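(* Let $d\ge2$ and let $\psi:\mathbb{R}^{d-1}\to\mathbb{R}$ satisfy, for some constants $\ell>0$ and $L$, $\psi(x')>\ell>0$ and $|\psi(x')-\psi(y')|\le L|x'-y'|$ for all $x',y'\in\mathbb{R}^{d-1}$. Let $w$ be an $M$-confined weight function on $\mathbb{R}^d$ with confinement region $S\subset\mathbb{R}^{d-1}$ and let $\sigma>\frac12$. Assume that $\mathbb{R}^{d-1}\setminus S$ has positive measure. Then there exists $\delta>0$ such that the self-adjoint operator $H_w=-i\frac{\psi}{w}\frac{\partial}{\partial x_1}:D_w^{\mathrm{symm}}\subset L^2_w(\mathbb{R}^d)\to L^2_w(\mathbb{R}^d)$ has an absolutely continuous spectrum in $(-\delta,\delta)\setminus\{0\}$ (with no embedded eigenvalues). Moreover, the density of states satisfies, for $f,g\in\mathcal{Y}^\sigma$, $$\left|\frac{d}{d\lambda}\Big|_{\lambda=\lambda_0}\left(E_w(\lambda)f,g\right)_{L^2_w(\mathbb{R}^d)}\right|\le C(\sigma,\ell,L,\lambda_0)\,\|f\|_{\mathcal{Y}^\sigma}\|g\|_{\mathcal{Y}^\sigma},\qquad 0<|\lambda_0|<\delta,$$ where $C(\sigma,\ell,L,\lambda_0)$ is a constant depending only on its arguments but not on $f$ or $g$.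
   Context: Points of $\mathbb{R}^d$ are written $x=(x_1,x')$, $x'=(x_2,\dots,x_d)\in\mathbb{R}^{d-1}$. A positive bounded weight $0<w\in L^\infty(\mathbb{R}^d)$ is $M$-confined ($M>0$) with confinement region $S\subset\mathbb{R}^{d-1}$ if $w(x_1,x')=1$ for all $x'\in\mathbb{R}^{d-1}\setminus S$ and $\|w(\cdot,x')\|_{L^1(\mathbb{R})}<M$ for all $x'\in S$. $L^2_w(\mathbb{R}^d)$ is the Hilbert space with inner product $(f,g)_{L^2_w}=\int_{\mathbb{R}^d}f\overline g\,w\,dx$; $L^2_{w(\cdot,x')}(\mathbb{R})$ is the one with inner product $\int_{\mathbb{R}}f\overline g\,w(\cdot,x')\,ds$. For $x'\in\mathbb{R}^{d-1}$ let $H_w^{x'}=-i\frac{\psi(x')}{w(\cdot,x')}\frac{d}{dx}$ (distributional derivative) on $$D^{x'}=\left\{g\in L^2_{w(\cdot,x')}(\mathbb{R})\ \Big|\ H_w^{x'}g\in L^2_{w(\cdot,x')}(\mathbb{R}),\ \lim_{x\to\infty}g(x)=\lim_{x\to-\infty}g(x)\right\}.$$ The symmetric domain is $$D_w^{\mathrm{symm}}=\left\{f\in L^2_w(\mathbb{R}^d)\ \Big|\ f(\cdot,x')\in D^{x'}\text{ a.e. }x',\ \int_{\mathbb{R}^{d-1}}\|H_w^{x'}f(\cdot,x')\|^2_{L^2_{w(\cdot,x')}(\mathbb{R})}\,dx'<\infty\right\},$$ on which $(H_wf)(\cdot,x')=H_w^{x'}f(\cdot,x')$ is self-adjoint. $\{E_w(\lambda)\}_{\lambda\in\mathbb{R}}$,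 $E_w(\lambda)=\mathbf{1}_{(-\infty,\lambda]}(H_w)$, is its spectral family. The density of states at $\lambda_0$ is the form $(f,g)\mapsto\frac{d}{d\lambda}\big|_{\lambda=\lambda_0}(E_w(\lambda)f,g)_{L^2_w}$. Absolutely continuous spectrum in an open set $U$ means that the spectral measures $d(E_w(\lambda)f,g)_{L^2_w}$ restricted to $U$ are absolutely continuous with respect to Lebesgue measure for all $f,g\in L^2_w(\mathbb{R}^d)$. $\mathcal{Y}^\sigma$ is the space of $r:\mathbb{R}^d\to\mathbb{C}$ with $r(\cdot,x')\in L^{2,\sigma}(\mathbb{R})$ for $x'\notin S$ and $r(\cdot,x')\in L^2_{w(\cdot,x')}(\mathbb{R})$ for $x'\in S$, with finite norm $$\|r\|_{\mathcal{Y}^\sigma}^2=\int_S\|r(\cdot,x')\|^2_{L^2_{w(\cdot,x')}(\mathbb{R})}\,dx'+\int_{\mathbb{R}^{d-1}\setminus S}\|r(\cdot,x')\|^2_{L^{2,\sigma}(\mathbb{R})}\,dx',$$ where $\|g\|_{L^{2,\sigma}(\mathbb{R})}^2=\int_{\mathbb{R}}(1+s^2)^\sigma|g(s)|^2\,ds$. *)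

theory Defs
  imports "HOL-Analysis.Analysis"
begin

section \<open>Coordinates\<close>

text \<open>
  A point of $\mathbb{R}^d$ is a pair $(x_1, x')$. The transversal variable $x' = (x_2,\dots,x_d)$
  is an extensional function on the index set $\{2,\dots,d\}$ rather than a vector of a
  type-indexed space, so that the dimension d can be quantified inside a formula (the constant in
  the bound on the density of states must not depend on d). All measures are completed, that is,
  they are Lebesgue measures.
\<close>

type_synonym perp = "nat \<Rightarrow> real"
type_synonym point = "real \<times> perp"

definition Rperp :: "nat \<Rightarrow> perp set" where
  "Rperp d = ({2..d} \<rightarrow>\<^sub>E (UNIV :: real set))"

definition dist_perp :: "nat \<Rightarrow> perp \<Rightarrow> perp \<Rightarrow> real" where
  "dist_perp d x y = L2_set (\<lambda>i. x i - y i) {2..d}"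

definition leb_perp :: "nat \<Rightarrow> perp measure" where
  "leb_perp d = completion (\<Pi>\<^sub>M i\<in>{2..d}. (lborel :: real measure))"

definition leb_full :: "nat \<Rightarrow> point measure" where
  "leb_full d = completion ((lborel :: real measure) \<Otimes>\<^sub>M (\<Pi>\<^sub>M i\<in>{2..d}. (lborel :: real measure)))"


section \<open>The Hilbert space of square integrable functions\<close>

text \<open>
  Elements are represented by functions; equality in the Hilbert space is equality almost
  everywhere.
\<close>

definition L2 :: "'a measure \<Rightarrow> ('a \<Rightarrow> complex) set" where
  "L2 N = {f. f \<in> borel_measurable N \<and> integrable N (\<lambda>x. (cmod (f x))\<^sup>2)}"

definition L2_inner :: "'a measure \<Rightarrow> ('a \<Rightarrow> complex) \<Rightarrow> ('a \<Rightarrow> complex) \<Rightarrow> complex" where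
  "L2_inner N f g = (\<integral>x. f x * cnj (g x) \<partial>N)"

definition L2_norm :: "'a measure \<Rightarrow> ('a \<Rightarrow> complex) \<Rightarrow> real" where
  "L2_norm N f = sqrt (\<integral>x. (cmod (f x))\<^sup>2 \<partial>N)"


section \<open>Unbounded self-adjoint operators and their spectral families\<close>

text \<open>An operator is given by its domain D and a map A on D.\<close>

definition adjoint_rel ::
  "'a measure \<Rightarrow> ('a \<Rightarrow> complex) set \<Rightarrow> (('a \<Rightarrow> complex) \<Rightarrow> ('a \<Rightarrow> complex)) \<Rightarrow>
   ('a \<Rightarrow> complex) \<Rightarrow> ('a \<Rightarrow> complex) \<Rightarrow> bool" where
  "adjoint_rel N D A g h \<longleftrightarrow>
     g \<in> L2 N \<and> h \<in> L2 N \<and> (\<forall>f\<in>D. L2_inner N (A f) g = L2_inner N f h)"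

definition self_adjoint ::
  "'a measure \<Rightarrow> ('a \<Rightarrow> complex) set \<Rightarrow> (('a \<Rightarrow> complex) \<Rightarrow> ('a \<Rightarrow> complex)) \<Rightarrow> bool" where
  "self_adjoint N D A \<longleftrightarrow>
     D \<subseteq> L2 N \<and> (\<forall>f\<in>D. A f \<in> L2 N) \<and>
     (\<forall>f\<in>L2 N. \<forall>\<epsilon>>0. \<exists>g\<in>D. L2_norm N (\<lambda>x. f x - g x) < \<epsilon>) \<and>
     (\<forall>g h. adjoint_rel N D A g h \<longleftrightarrow> g \<in> D \<and> h \<in> L2 N \<and> (AE x in N. h x = A g x))"

definition eigenvalue ::
  "'a measure \<Rightarrow> ('a \<Rightarrow> complex) set \<Rightarrow> (('a \<Rightarrow> complex) \<Rightarrow> ('a \<Rightarrow> complex)) \<Rightarrow> complex \<Rightarrow> bool" where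
  "eigenvalue N D A \<mu> \<longleftrightarrow>
     (\<exists>f\<in>D. \<not> (AE x in N. f x = 0) \<and> (AE x in N. A f x = \<mu> * f x))"

definition orth_proj :: "'a measure \<Rightarrow> (('a \<Rightarrow> complex) \<Rightarrow> ('a \<Rightarrow> complex)) \<Rightarrow> bool" where
  "orth_proj N P \<longleftrightarrow>
     (\<forall>f\<in>L2 N. P f \<in> L2 N) \<and>
     (\<forall>f\<in>L2 N. \<forall>g\<in>L2 N. \<forall>a. AE x in N. P (\<lambda>y. a * f y + g y) x = a * P f x + P g x) \<and>
     (\<forall>f\<in>L2 N. AE x in N. P (P f) x = P f x) \<and>
     (\<forall>f\<in>L2 N. \<forall>g\<in>L2 N. L2_inner N (P f) g = L2_inner N f (P g))"

definition resolution_of_identity ::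
  "'a measure \<Rightarrow> (real \<Rightarrow> ('a \<Rightarrow> complex) \<Rightarrow> ('a \<Rightarrow> complex)) \<Rightarrow> bool" where
  "resolution_of_identity N E \<longleftrightarrow>
     (\<forall>t. orth_proj N (E t)) \<and>
     (\<forall>s t. s \<le> t \<longrightarrow> (\<forall>f\<in>L2 N. AE x in N. E s (E t f) x = E s f x)) \<and>
     (\<forall>f\<in>L2 N. \<forall>t. ((\<lambda>s. L2_norm N (\<lambda>x. E s f x - E t f x)) \<longlongrightarrow> 0) (at_right t)) \<and>
     (\<forall>f\<in>L2 N. ((\<lambda>s. L2_norm N (E s f)) \<longlongrightarrow> 0) at_bot) \<and>
     (\<forall>f\<in>L2 N. ((\<lambda>s. L2_norm N (\<lambda>x. E s f x - f x)) \<longlongrightarrow> 0) at_top)"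

text \<open>The finite Borel measure $d(E(\lambda) f, f)$.\<close>

definition spectral_measure ::
  "'a measure \<Rightarrow> (real \<Rightarrow> ('a \<Rightarrow> complex) \<Rightarrow> ('a \<Rightarrow> complex)) \<Rightarrow> ('a \<Rightarrow> complex) \<Rightarrow> real measure" where
  "spectral_measure N E f = interval_measure (\<lambda>t. Re (L2_inner N (E t f) f))"

text \<open>The complex measure $d(E(\lambda) f, g)$, by polarization.\<close>

definition spectral_cmeasure ::
  "'a measure \<Rightarrow> (real \<Rightarrow> ('a \<Rightarrow> complex) \<Rightarrow> ('a \<Rightarrow> complex)) \<Rightarrow>
   ('a \<Rightarrow> complex) \<Rightarrow> ('a \<Rightarrow> complex) \<Rightarrow> real set \<Rightarrow> complex" where
  "spectral_cmeasure N E f g B =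
     (\<Sum>k<(4::nat). \<i> ^ k * of_real (measure (spectral_measure N E (\<lambda>x. f x + \<i> ^ k * g x)) B)) / 4"

text \<open>
  E is the family $E(\lambda) = \mathbf{1}_{(-\infty,\lambda]}(A)$, that is
  $A = \int \lambda \, dE(\lambda)$ in the sense of the spectral theorem: the domain of A consists
  of the f for which $\int \lambda^2 \, d(E(\lambda) f, f)$ is finite, and on it
  $(A f, f) = \int \lambda \, d(E(\lambda) f, f)$. These conditions determine E up to null sets.
\<close>

definition spectral_family ::
  "'a measure \<Rightarrow> ('a \<Rightarrow> complex) set \<Rightarrow> (('a \<Rightarrow> complex) \<Rightarrow> ('a \<Rightarrow> complex)) \<Rightarrow>
   (real \<Rightarrow> ('a \<Rightarrow> complex) \<Rightarrow> ('a \<Rightarrow> complex)) \<Rightarrow> bool" where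
  "spectral_family N D A E \<longleftrightarrow>
     resolution_of_identity N E \<and>
     D = {f \<in> L2 N. integrable (spectral_measure N E f) (\<lambda>t. t\<^sup>2)} \<and>
     (\<forall>f\<in>D. L2_inner N (A f) f = of_real (\<integral>t. t \<partial>spectral_measure N E f))"

definition ac_spectrum_in ::
  "'a measure \<Rightarrow> (real \<Rightarrow> ('a \<Rightarrow> complex) \<Rightarrow> ('a \<Rightarrow> complex)) \<Rightarrow> real set \<Rightarrow> bool" where
  "ac_spectrum_in N E U \<longleftrightarrow>
     (\<forall>f\<in>L2 N. \<forall>g\<in>L2 N. \<forall>B\<in>null_sets lborel. B \<subseteq> U \<longrightarrow> spectral_cmeasure N E f g B = 0)"


section \<open>Distributional derivatives on the line\<close>

definition test_function :: "(real \<Rightarrow> real) \<Rightarrow> bool" where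
  "test_function \<phi> \<longleftrightarrow>
     (\<forall>n x. (deriv ^^ n) \<phi> differentiable (at x)) \<and> (\<exists>a b. \<forall>x. x \<notin> {a..b} \<longrightarrow> \<phi> x = 0)"

definition locally_integrable :: "(real \<Rightarrow> complex) \<Rightarrow> bool" where
  "locally_integrable g \<longleftrightarrow> (\<forall>a b. set_integrable lebesgue {a..b} g)"

definition has_weak_deriv :: "(real \<Rightarrow> complex) \<Rightarrow> (real \<Rightarrow> complex) \<Rightarrow> bool" where
  "has_weak_deriv g h \<longleftrightarrow>
     locally_integrable g \<and> locally_integrable h \<and>
     (\<forall>\<phi>. test_function \<phi> \<longrightarrow>
        (\<integral>s. g s * of_real (deriv \<phi> s) \<partial>lebesgue) = - (\<integral>s. h s * of_real (\<phi> s) \<partial>lebesgue))"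

text \<open>Unique up to null sets if it exists.\<close>

definition weak_deriv :: "(real \<Rightarrow> complex) \<Rightarrow> (real \<Rightarrow> complex)" where
  "weak_deriv g = (SOME h. has_weak_deriv g h)"


section \<open>Confined weights and the operator\<close>

definition confined_weight :: "nat \<Rightarrow> real \<Rightarrow> perp set \<Rightarrow> (point \<Rightarrow> real) \<Rightarrow> bool" where
  "confined_weight d M S w \<longleftrightarrow>
     0 < M \<and> S \<subseteq> Rperp d \<and>
     w \<in> borel_measurable (leb_full d) \<and>
     (AE x in leb_full d. 0 < w x) \<and> (\<exists>B. AE x in leb_full d. w x \<le> B) \<and>
     (\<forall>x'\<in>Rperp d - S. \<forall>s. w (s, x') = 1) \<and>
     (\<forall>x'\<in>S. integrable lebesgue (\<lambda>s. w (s, x')) \<and> (\<integral>s. \<bar>w (s, x')\<bar> \<partial>lebesgue) < M)"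

definition wmeas :: "nat \<Rightarrow> (point \<Rightarrow> real) \<Rightarrow> point measure" where
  "wmeas d w = density (leb_full d) (\<lambda>x. ennreal (w x))"

definition wfib :: "(point \<Rightarrow> real) \<Rightarrow> perp \<Rightarrow> real measure" where
  "wfib w x' = density lebesgue (\<lambda>s. ennreal (w (s, x')))"

definition H_fib ::
  "(perp \<Rightarrow> real) \<Rightarrow> (point \<Rightarrow> real) \<Rightarrow> perp \<Rightarrow> (real \<Rightarrow> complex) \<Rightarrow> (real \<Rightarrow> complex)" where
  "H_fib \<psi> w x' g = (\<lambda>s. - \<i> * of_real (\<psi> x' / w (s, x')) * weak_deriv g s)"

text \<open>
  Membership of $H g$ in the weighted space includes that the distributional derivative of g is a
  locally integrable function; this is automatic for a distribution of the form $w h$ with h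
  in the weighted space, since w is bounded. The limits at infinity are those of the continuous
  representative of g.
\<close>

definition D_fib :: "(perp \<Rightarrow> real) \<Rightarrow> (point \<Rightarrow> real) \<Rightarrow> perp \<Rightarrow> (real \<Rightarrow> complex) set" where
  "D_fib \<psi> w x' =
     {g \<in> L2 (wfib w x').
        (\<exists>h. has_weak_deriv g h) \<and> H_fib \<psi> w x' g \<in> L2 (wfib w x') \<and>
        (\<exists>g0 c. (AE s in lebesgue. g s = g0 s) \<and> continuous_on UNIV g0 \<and>
           (g0 \<longlongrightarrow> c) at_top \<and> (g0 \<longlongrightarrow> c) at_bot)}"

definition D_symm :: "nat \<Rightarrow> (perp \<Rightarrow> real) \<Rightarrow> (point \<Rightarrow> real) \<Rightarrow> (point \<Rightarrow> complex) set" where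
  "D_symm d \<psi> w =
     {f \<in> L2 (wmeas d w).
        (AE x' in leb_perp d. (\<lambda>s. f (s, x')) \<in> D_fib \<psi> w x') \<and>
        (\<integral>\<^sup>+x'. ennreal ((L2_norm (wfib w x') (H_fib \<psi> w x' (\<lambda>s. f (s, x'))))\<^sup>2) \<partial>leb_perp d) < \<infinity>}"

text \<open>
  The fibrewise derivatives are each chosen only up to a null set of the line, so the function
  assembled from them need not be jointly measurable; the operator picks a square integrable
  function which agrees with it on almost every fibre.
\<close>

definition H_op ::
  "nat \<Rightarrow> (perp \<Rightarrow> real) \<Rightarrow> (point \<Rightarrow> real) \<Rightarrow> (point \<Rightarrow> complex) \<Rightarrow> (point \<Rightarrow> complex)" where
  "H_op d \<psi> w f =
     (SOME h. h \<in> L2 (wmeas d w) \<and>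
        (AE x' in leb_perp d. AE s in lebesgue. h (s, x') = H_fib \<psi> w x' (\<lambda>s. f (s, x')) s))"


section \<open>The spaces $\mathcal{Y}^\sigma$\<close>

definition sfib :: "real \<Rightarrow> real measure" where
  "sfib \<sigma> = density lebesgue (\<lambda>s. ennreal ((1 + s\<^sup>2) powr \<sigma>))"

definition Y_sqnorm :: "nat \<Rightarrow> perp set \<Rightarrow> (point \<Rightarrow> real) \<Rightarrow> real \<Rightarrow> (point \<Rightarrow> complex) \<Rightarrow> ennreal" where
  "Y_sqnorm d S w \<sigma> r =
     (\<integral>\<^sup>+x'\<in>S. ennreal ((L2_norm (wfib w x') (\<lambda>s. r (s, x')))\<^sup>2) \<partial>leb_perp d) +
     (\<integral>\<^sup>+x'\<in>Rperp d - S. ennreal ((L2_norm (sfib \<sigma>) (\<lambda>s. r (s, x')))\<^sup>2) \<partial>leb_perp d)"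

definition Y_space :: "nat \<Rightarrow> perp set \<Rightarrow> (point \<Rightarrow> real) \<Rightarrow> real \<Rightarrow> (point \<Rightarrow> complex) set" where
  "Y_space d S w \<sigma> =
     {r \<in> borel_measurable (leb_full d).
        (AE x' in leb_perp d. (\<lambda>s. r (s, x')) \<in> (if x' \<in> S then L2 (wfib w x') else L2 (sfib \<sigma>))) \<and>
        Y_sqnorm d S w \<sigma> r < \<infinity>}"

definition Y_norm :: "nat \<Rightarrow> perp set \<Rightarrow> (point \<Rightarrow> real) \<Rightarrow> real \<Rightarrow> (point \<Rightarrow> complex) \<Rightarrow> real" where
  "Y_norm d S w \<sigma> r = sqrt (enn2real (Y_sqnorm d S w \<sigma> r))"

end

theory Submission
  imports Defs "HOL-Probability.Distribution_Functions" "HOL-Computational_Algebra.Polynomial"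
begin

text \<open>
  On a fibre over S the operator has a spectral gap at 0: its range consists of functions of mean
  zero, and a function differs from a constant by at most $M/l$ times its image. Hence, for small
  $t \neq 0$, a fibrewise resolvent estimate $\|v\| \le (3/|t|) \|(H - t) v\|$ holds over S.
  Iterating it shows that vectors in a short spectral interval around t vanish over S. On the other
  fibres $H = -i \psi\, d/dx_1$, and integrating the derivative of $|v|^2$ gives
  $\sup |v|^2 \le (2/l) \int |(H - t) v| |v|$. For $v = (E(b) - E(a)) f$ the right-hand side is of
  order $(b - a) \|v\|^2$, and pairing v with f yields
  $((E(b) - E(a)) f, f) \le C (b - a) \|f\|^2$ with the norm of $\mathcal{Y}^\sigma$ on the right.
  So $(E(\cdot) f, f)$ is locally Lipschitz, which implies absolute continuity. Off S,
  multiplication by $e^{ihx_1/\psi}$ translates the spectral parameter by h; since it moves f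
  little in $\mathcal{Y}^\sigma$, the increments of $(E(\cdot) f, f)$ are almost translation
  invariant, which upgrades the Lipschitz bound to differentiability at every point.

  Self-adjointness reduces to solving $(H \pm iB) u = f$ fibrewise, where B averages over the fibres
  over S and is the identity elsewhere: over S one integrates $f - Bf$, elsewhere one convolves with
  an exponential.
\<close>

section \<open>Square integrable functions\<close>

text \<open>Nothing says in advance that the projections of the spectral family act fibre by fibre,
  so they cannot be restricted to a fibre and computed there. They are reached through growth
  instead: on the range of an increment over (m - r, m + r] the operator A - m has norm at most r,
  and conversely a vector whose iterates under A - m stay below C * rho^n with rho < r lies in that
  range. Growth bounds pass through operations that are local in the fibres, namely cutting to S and
  multiplying by a phase. Since the family is tied to A only through the scalar measures d(E f, f),
  these norm bounds are themselves extracted from the quadratic form. The point 0 is excluded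
  because constants on a fibre over S lie in the kernel. The radius l/(4M) leaves room to absorb
  half of the norm of v in the fibre estimate over S. The final constant is the integral of (1 +
  s^2)^(-sigma) divided by l: the integral is the price of turning a sup bound on a fibre into a
  weighted norm. A Lipschitz distribution function has a derivative almost everywhere only, with an
  exceptional set depending on f; this is the obstacle that the translation argument
  removes.\<close>

lemma borel_measurable_cnj [measurable (raw)]:
  "f \<in> borel_measurable M \<Longrightarrow> (\<lambda>x. cnj (f x)) \<in> borel_measurable M"
  by (rule borel_measurable_continuous_on[where f=cnj]) (auto intro: continuous_intros)

lemma L2_measurable: "f \<in> L2 N \<Longrightarrow> f \<in> borel_measurable N"
  and L2_integrable: "f \<in> L2 N \<Longrightarrow> integrable N (\<lambda>x. (cmod (f x))\<^sup>2)"
  by (auto simp: L2_def)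

lemma L2I: "f \<in> borel_measurable N \<Longrightarrow> integrable N (\<lambda>x. (cmod (f x))\<^sup>2) \<Longrightarrow> f \<in> L2 N"
  by (simp add: L2_def)

lemma L2_iff_nn_integral:
  "f \<in> L2 N \<longleftrightarrow> f \<in> borel_measurable N \<and> (\<integral>\<^sup>+x. ennreal ((cmod (f x))\<^sup>2) \<partial>N) < \<infinity>"
proof -
  have "integrable N (\<lambda>x. (cmod (f x))\<^sup>2) \<longleftrightarrow> (\<integral>\<^sup>+x. ennreal ((cmod (f x))\<^sup>2) \<partial>N) < \<infinity>"
    if "f \<in> borel_measurable N"
    using that by (subst integrable_iff_bounded) auto
  then show ?thesis by (auto simp: L2_def)
qed

lemma L2_norm_nonneg [simp]: "0 \<le> L2_norm N f"
  by (simp add: L2_norm_def)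

lemma L2_norm_sq: "(L2_norm N f)\<^sup>2 = (\<integral>x. (cmod (f x))\<^sup>2 \<partial>N)"
  by (simp add: L2_norm_def)

lemma L2_norm_sq_nn:
  assumes "f \<in> L2 N"
  shows "ennreal ((L2_norm N f)\<^sup>2) = (\<integral>\<^sup>+x. ennreal ((cmod (f x))\<^sup>2) \<partial>N)"
  unfolding L2_norm_sq using assms by (subst nn_integral_eq_integral) (auto simp: L2_def)

lemma cmod_sq_lin_le: "(cmod (a * x + y))\<^sup>2 \<le> 2 * (cmod a)\<^sup>2 * (cmod x)\<^sup>2 + 2 * (cmod y)\<^sup>2"
proof -
  have "cmod (a * x + y) \<le> cmod a * cmod x + cmod y"
    by (metis norm_mult norm_triangle_ineq)
  then have "(cmod (a * x + y))\<^sup>2 \<le> (cmod a * cmod x + cmod y)\<^sup>2"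
    by (simp add: power_mono)
  also have "\<dots> \<le> 2 * (cmod a * cmod x)\<^sup>2 + 2 * (cmod y)\<^sup>2"
    using sum_squares_bound[of "cmod a * cmod x" "cmod y"] by (simp add: power2_sum)
  finally show ?thesis by (simp add: power_mult_distrib)
qed

lemma L2_lin:
  assumes f: "f \<in> L2 N" and g: "g \<in> L2 N"
  shows "(\<lambda>x. a * f x + g x) \<in> L2 N"
proof (rule L2I)
  note [measurable] = L2_measurable[OF f] L2_measurable[OF g]
  show "(\<lambda>x. a * f x + g x) \<in> borel_measurable N" by simp
  have "integrable N (\<lambda>x. 2 * (cmod a)\<^sup>2 * (cmod (f x))\<^sup>2 + 2 * (cmod (g x))\<^sup>2)"
    using L2_integrable[OF f] L2_integrable[OF g] by auto
  then show "integrable N (\<lambda>x. (cmod (a * f x + g x))\<^sup>2)"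
    by (rule Bochner_Integration.integrable_bound) (auto simp: cmod_sq_lin_le)
qed

lemma L2_zero [simp]: "(\<lambda>x. 0) \<in> L2 N"
  by (auto intro!: L2I)

lemma L2_scale: "f \<in> L2 N \<Longrightarrow> (\<lambda>x. a * f x) \<in> L2 N"
  using L2_lin[of f N "\<lambda>_. 0" a] by simp

lemma L2_add: "f \<in> L2 N \<Longrightarrow> g \<in> L2 N \<Longrightarrow> (\<lambda>x. f x + g x) \<in> L2 N"
  using L2_lin[of f N g 1] by simp

lemma L2_diff: "f \<in> L2 N \<Longrightarrow> g \<in> L2 N \<Longrightarrow> (\<lambda>x. f x - g x) \<in> L2 N"
  using L2_lin[of g N f "-1"] by simp

lemma L2_cong_AE:
  assumes "f \<in> L2 N" "g \<in> borel_measurable N" "AE x in N. f x = g x"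
  shows "g \<in> L2 N"
proof (rule L2I)
  have [measurable]: "f \<in> borel_measurable N" "g \<in> borel_measurable N" using assms by (auto simp: L2_def)
  show "integrable N (\<lambda>x. (cmod (g x))\<^sup>2)"
    using L2_integrable[OF assms(1)]
    by (rule integrable_cong_AE_imp) (use assms(3) in auto)
qed fact

lemma L2_mult_bounded:
  assumes f: "f \<in> L2 N" and [measurable]: "c \<in> borel_measurable N" and K: "AE x in N. cmod (c x) \<le> K"
  shows "(\<lambda>x. c x * f x) \<in> L2 N"
proof (rule L2I)
  note [measurable] = L2_measurable[OF f]
  show "(\<lambda>x. c x * f x) \<in> borel_measurable N" by simp
  have "integrable N (\<lambda>x. K\<^sup>2 * (cmod (f x))\<^sup>2)"
    using L2_integrable[OF f] by auto
  moreover have "AE x in N. norm ((cmod (c x * f x))\<^sup>2) \<le> norm (K\<^sup>2 * (cmod (f x))\<^sup>2)"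
    using K by eventually_elim (auto simp: norm_mult power_mult_distrib intro!: mult_right_mono power_mono)
  ultimately show "integrable N (\<lambda>x. (cmod (c x * f x))\<^sup>2)"
    using Bochner_Integration.integrable_bound[of N "\<lambda>x. K\<^sup>2 * (cmod (f x))\<^sup>2" "\<lambda>x. (cmod (c x * f x))\<^sup>2"]
    by simp
qed

lemma integrable_L2_inner:
  assumes f: "f \<in> L2 N" and g: "g \<in> L2 N"
  shows "integrable N (\<lambda>x. f x * cnj (g x))"
proof -
  note [measurable] = L2_measurable[OF f] L2_measurable[OF g]
  have "integrable N (\<lambda>x. (cmod (f x))\<^sup>2 + (cmod (g x))\<^sup>2)"
    using L2_integrable[OF f] L2_integrable[OF g] by auto
  then show ?thesis
  proof (rule Bochner_Integration.integrable_bound)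
    have "norm (f x * cnj (g x)) \<le> norm ((cmod (f x))\<^sup>2 + (cmod (g x))\<^sup>2)" for x
    proof -
      have "0 \<le> cmod (f x) * cmod (g x)" by simp
      with sum_squares_bound[of "cmod (f x)" "cmod (g x)"]
      have "cmod (f x) * cmod (g x) \<le> (cmod (f x))\<^sup>2 + (cmod (g x))\<^sup>2" by linarith
      then show ?thesis by (simp add: norm_mult)
    qed
    then show "AE x in N. norm (f x * cnj (g x)) \<le> norm ((cmod (f x))\<^sup>2 + (cmod (g x))\<^sup>2)" by simp
  qed simp
qed

lemma L2_inner_lin_left:
  assumes "f \<in> L2 N" "g \<in> L2 N" "k \<in> L2 N"
  shows "L2_inner N (\<lambda>x. a * f x + g x) k = a * L2_inner N f k + L2_inner N g k"
proof -
  have "L2_inner N (\<lambda>x. a * f x + g x) k = (\<integral>x. a * (f x * cnj (k x)) + g x * cnj (k x) \<partial>N)"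
    unfolding L2_inner_def by (simp add: algebra_simps)
  also have "\<dots> = a * L2_inner N f k + L2_inner N g k"
    unfolding L2_inner_def
    using integrable_L2_inner[OF assms(1,3)] integrable_L2_inner[OF assms(2,3)]
    by (subst Bochner_Integration.integral_add) auto
  finally show ?thesis .
qed

lemma L2_inner_commute: "L2_inner N g f = cnj (L2_inner N f g)"
proof -
  have "cnj (L2_inner N f g) = (\<integral>x. cnj (f x * cnj (g x)) \<partial>N)"
    unfolding L2_inner_def by (simp only: Bochner_Integration.integral_cnj)
  then show ?thesis unfolding L2_inner_def by (simp add: mult.commute)
qed

lemma L2_inner_lin_right:
  assumes "f \<in> L2 N" "g \<in> L2 N" "k \<in> L2 N"
  shows "L2_inner N k (\<lambda>x. a * f x + g x) = cnj a * L2_inner N k f + L2_inner N k g"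
  using L2_inner_lin_left[OF assms] by (metis L2_inner_commute complex_cnj_add complex_cnj_mult)

lemma L2_inner_zero [simp]: "L2_inner N (\<lambda>x. 0) k = 0" "L2_inner N k (\<lambda>x. 0) = 0"
  by (auto simp: L2_inner_def)

lemma L2_inner_scale_left: "L2_inner N (\<lambda>x. a * f x) k = a * L2_inner N f k"
  unfolding L2_inner_def by (simp add: mult.assoc)

lemma L2_inner_scale_right: "L2_inner N k (\<lambda>x. a * f x) = cnj a * L2_inner N k f"
  by (metis L2_inner_commute L2_inner_scale_left complex_cnj_mult)

lemma L2_inner_add_left:
  "f \<in> L2 N \<Longrightarrow> g \<in> L2 N \<Longrightarrow> k \<in> L2 N \<Longrightarrow> L2_inner N (\<lambda>x. f x + g x) k = L2_inner N f k + L2_inner N g k"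
  using L2_inner_lin_left[of f N g k 1] by simp

lemma L2_inner_add_right:
  "f \<in> L2 N \<Longrightarrow> g \<in> L2 N \<Longrightarrow> k \<in> L2 N \<Longrightarrow> L2_inner N k (\<lambda>x. f x + g x) = L2_inner N k f + L2_inner N k g"
  using L2_inner_lin_right[of f N g k 1] by simp

lemma L2_inner_diff_left:
  "f \<in> L2 N \<Longrightarrow> g \<in> L2 N \<Longrightarrow> k \<in> L2 N \<Longrightarrow> L2_inner N (\<lambda>x. f x - g x) k = L2_inner N f k - L2_inner N g k"
  using L2_inner_lin_left[of g N f k "-1"] by simp

lemma L2_inner_diff_right:
  "f \<in> L2 N \<Longrightarrow> g \<in> L2 N \<Longrightarrow> k \<in> L2 N \<Longrightarrow> L2_inner N k (\<lambda>x. f x - g x) = L2_inner N k f - L2_inner N k g"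
  using L2_inner_lin_right[of g N f k "-1"] by simp

lemmas L2_inner_simps = L2_inner_scale_left L2_inner_scale_right L2_inner_add_left L2_inner_add_right
  L2_inner_diff_left L2_inner_diff_right L2_scale L2_add L2_diff

lemma L2_inner_cong_AE:
  assumes "f \<in> L2 N" "f' \<in> L2 N" "g \<in> L2 N" "g' \<in> L2 N" "AE x in N. f x = f' x" "AE x in N. g x = g' x"
  shows "L2_inner N f g = L2_inner N f' g'"
proof -
  note [measurable] = assms(1-4)[THEN L2_measurable]
  show ?thesis unfolding L2_inner_def
    by (rule integral_cong_AE) (use assms(5,6) in auto)
qed

lemma L2_norm_cong_AE:
  assumes "f \<in> L2 N" "f' \<in> L2 N" "AE x in N. f x = f' x"
  shows "L2_norm N f = L2_norm N f'"
proof -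
  note [measurable] = assms(1,2)[THEN L2_measurable]
  have "(\<integral>x. (cmod (f x))\<^sup>2 \<partial>N) = (\<integral>x. (cmod (f' x))\<^sup>2 \<partial>N)"
    by (rule integral_cong_AE) (use assms(3) in auto)
  then show ?thesis unfolding L2_norm_def by simp
qed

lemma L2_inner_self: "L2_inner N f f = of_real ((L2_norm N f)\<^sup>2)"
  unfolding L2_inner_def L2_norm_sq complex_norm_square[symmetric] by (rule integral_complex_of_real)

lemma Re_L2_inner_self: "Re (L2_inner N f f) = (L2_norm N f)\<^sup>2"
  by (simp add: L2_inner_self)

lemma L2_norm_scale: "L2_norm N (\<lambda>x. a * f x) = cmod a * L2_norm N f"
  by (simp add: L2_norm_def norm_mult power_mult_distrib real_sqrt_mult)

lemma L2_norm_zero [simp]: "L2_norm N (\<lambda>x. 0) = 0"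
  by (simp add: L2_norm_def)

lemma L2_norm_eq_0_iff:
  assumes "f \<in> L2 N"
  shows "L2_norm N f = 0 \<longleftrightarrow> (AE x in N. f x = 0)"
  using integral_nonneg_eq_0_iff_AE[OF L2_integrable[OF assms]]
  by (simp add: L2_norm_def)

lemma L2_norm_add_sq:
  assumes "f \<in> L2 N" "g \<in> L2 N"
  shows "(L2_norm N (\<lambda>x. f x + g x))\<^sup>2 = (L2_norm N f)\<^sup>2 + (L2_norm N g)\<^sup>2 + 2 * Re (L2_inner N f g)"
proof -
  have "Re (L2_inner N g f) = Re (L2_inner N f g)" by (subst L2_inner_commute) simp
  then show ?thesis
    unfolding Re_L2_inner_self[symmetric] using assms by (simp add: L2_inner_simps)
qed

lemma L2_norm_diff_sq:
  assumes "f \<in> L2 N" "g \<in> L2 N"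
  shows "(L2_norm N (\<lambda>x. f x - g x))\<^sup>2 = (L2_norm N f)\<^sup>2 + (L2_norm N g)\<^sup>2 - 2 * Re (L2_inner N f g)"
proof -
  have "Re (L2_inner N g f) = Re (L2_inner N f g)" by (subst L2_inner_commute) simp
  then show ?thesis
    unfolding Re_L2_inner_self[symmetric] using assms by (simp add: L2_inner_simps)
qed

text \<open>Expand the squared norm of b f - c g with b = ||g||^2 and c = (f, g); this choice avoids
  dividing by the norm of g inside the vector.\<close>

lemma L2_Cauchy_Schwarz:
  assumes f: "f \<in> L2 N" and g: "g \<in> L2 N"
  shows "cmod (L2_inner N f g) \<le> L2_norm N f * L2_norm N g"
proof (cases "L2_norm N g = 0")
  case True
  then have "L2_inner N f g = L2_inner N f (\<lambda>x. 0)"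
    using L2_norm_eq_0_iff[OF g] f g by (intro L2_inner_cong_AE) auto
  then show ?thesis by simp
next
  case False
  define b where "b = (L2_norm N g)\<^sup>2"
  define c where "c = L2_inner N f g"
  have b: "b > 0" using False by (simp add: b_def)
  have "0 \<le> (L2_norm N (\<lambda>x. of_real b * f x - c * g x))\<^sup>2" by simp
  also have "\<dots> = (b * L2_norm N f)\<^sup>2 + (cmod c * L2_norm N g)\<^sup>2 - 2 * Re (of_real b * (cnj c * c))"
    using f g by (subst L2_norm_diff_sq) (use b in \<open>simp_all add: L2_inner_simps L2_norm_scale c_def\<close>)
  also have "Re (of_real b * (cnj c * c)) = b * (cmod c)\<^sup>2"
    using cmod_power2[of c] by (simp add: power2_eq_square)
  also have "(b * L2_norm N f)\<^sup>2 + (cmod c * L2_norm N g)\<^sup>2 - 2 * (b * (cmod c)\<^sup>2) = b * (b * (L2_norm N f)\<^sup>2 - (cmod c)\<^sup>2)"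
    by (simp add: b_def power_mult_distrib algebra_simps power2_eq_square)
  finally have "(cmod c)\<^sup>2 \<le> b * (L2_norm N f)\<^sup>2" using b by (simp add: zero_le_mult_iff)
  then have "(cmod c)\<^sup>2 \<le> (L2_norm N f * L2_norm N g)\<^sup>2" by (simp add: b_def power_mult_distrib mult.commute)
  then show ?thesis unfolding c_def by (rule power2_le_imp_le) simp
qed

lemma L2_norm_triangle:
  assumes "f \<in> L2 N" "g \<in> L2 N"
  shows "L2_norm N (\<lambda>x. f x + g x) \<le> L2_norm N f + L2_norm N g"
proof (rule power2_le_imp_le)
  have "Re (L2_inner N f g) \<le> L2_norm N f * L2_norm N g"
    using L2_Cauchy_Schwarz[OF assms] complex_Re_le_cmod order_trans by blast
  then show "(L2_norm N (\<lambda>x. f x + g x))\<^sup>2 \<le> (L2_norm N f + L2_norm N g)\<^sup>2"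
    using assms by (simp add: L2_norm_add_sq power2_sum)
qed simp

lemma L2_norm_diff_commute: "L2_norm N (\<lambda>x. f x - g x) = L2_norm N (\<lambda>x. g x - f x)"
  by (simp add: L2_norm_def norm_minus_commute)

lemma L2_norm_parallelogram:
  assumes "f \<in> L2 N" "g \<in> L2 N"
  shows "(L2_norm N (\<lambda>x. f x + g x))\<^sup>2 + (L2_norm N (\<lambda>x. f x - g x))\<^sup>2 = 2 * (L2_norm N f)\<^sup>2 + 2 * (L2_norm N g)\<^sup>2"
  using assms by (simp add: L2_norm_add_sq L2_norm_diff_sq)

lemma L2_norm_mult_bounded:
  assumes f: "f \<in> L2 N" and [measurable]: "c \<in> borel_measurable N" and K: "AE x in N. cmod (c x) \<le> K" "0 \<le> K"
  shows "L2_norm N (\<lambda>x. c x * f x) \<le> K * L2_norm N f"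
proof -
  have "(L2_norm N (\<lambda>x. c x * f x))\<^sup>2 \<le> (\<integral>x. K\<^sup>2 * (cmod (f x))\<^sup>2 \<partial>N)"
    unfolding L2_norm_sq
    using L2_integrable[OF f] L2_integrable[OF L2_mult_bounded[OF assms(1-3)]] K(1)
    by (intro integral_mono_AE) (auto simp: norm_mult power_mult_distrib intro!: mult_right_mono power_mono)
  also have "\<dots> = (K * L2_norm N f)\<^sup>2" by (simp add: power_mult_distrib L2_norm_sq)
  finally show ?thesis by (rule power2_le_imp_le) (use K in simp)
qed

section \<open>Completeness and a density criterion in L2\<close>

text \<open>Riesz-Fischer for a geometrically fast Cauchy sequence, which is what a well chosen
  minimising sequence provides: the differences are summable at almost every point, and Fatou turns
  the pointwise limit into a norm limit.\<close>

lemma L2_complete: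
  assumes f: "\<And>n. f n \<in> L2 N" and C: "\<And>n::nat. L2_norm N (\<lambda>x. f (Suc n) x - f n x) \<le> (1/2)^n"
  obtains g where "g \<in> L2 N" "(\<lambda>n. L2_norm N (\<lambda>x. f n x - g x)) \<longlonglongrightarrow> 0"
proof -
  note [measurable] = f[THEN L2_measurable]
  define d where "d = (\<lambda>n x. f (Suc n) x - f n x)"
  have dL: "d n \<in> L2 N" for n unfolding d_def using f by (intro L2_diff)
  note [measurable] = dL[THEN L2_measurable]
  have tele: "L2_norm N (\<lambda>x. f (n + k) x - f n x) \<le> 2 * (1/2)^n" for n k
  proof -
    have "L2_norm N (\<lambda>x. f (n + k) x - f n x) \<le> 2 * (1/2)^n - 2 * (1/2)^(n+k)"
    proof (induction k)
      case 0 then show ?case by simp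
    next
      case (Suc k)
      have "L2_norm N (\<lambda>x. f (n + Suc k) x - f n x) = L2_norm N (\<lambda>x. (f (n + k) x - f n x) + d (n+k) x)"
        by (simp add: d_def)
      also have "\<dots> \<le> L2_norm N (\<lambda>x. f (n + k) x - f n x) + L2_norm N (d (n+k))"
        using f dL by (intro L2_norm_triangle L2_diff)
      also have "\<dots> \<le> 2 * (1/2)^n - 2 * (1/2)^(n+k) + (1/2)^(n+k)"
        using Suc C[of "n+k"] unfolding d_def by linarith
      finally show ?case by simp
    qed
    moreover have "(0::real) \<le> 2 * (1/2)^(n+k)" by simp
    ultimately show ?thesis by linarith
  qed
  \<comment> \<open>The squared norms of the differences are at most 4^-n, so the factor 2^n is
    affordable. Finiteness of the weighted sum at a point then forces geometric decay of the
    differences there.\<close>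
  have "(\<integral>\<^sup>+x. (\<Sum>n. ennreal (2^n * (cmod (d n x))\<^sup>2)) \<partial>N) = (\<Sum>n. (\<integral>\<^sup>+x. ennreal (2^n * (cmod (d n x))\<^sup>2) \<partial>N))"
    by (rule nn_integral_suminf) simp
  also have "\<dots> = (\<Sum>n. ennreal (2^n * (L2_norm N (d n))\<^sup>2))"
    using L2_integrable[OF dL] by (intro suminf_cong) (subst nn_integral_eq_integral, auto simp: L2_norm_sq)
  also have "\<dots> \<le> (\<Sum>n. ennreal ((1/2)^n))"
  proof (intro suminf_le ennreal_leI)
    fix n
    have "(L2_norm N (d n))\<^sup>2 \<le> ((1/2)^n)\<^sup>2" using C[of n] by (intro power_mono) (auto simp: d_def)
    then have "2^n * (L2_norm N (d n))\<^sup>2 \<le> 2^n * ((1/2)^n)\<^sup>2" by simp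
    also have "\<dots> = (1/2)^n" by (simp add: power2_eq_square power_divide)
    finally show "2^n * (L2_norm N (d n))\<^sup>2 \<le> (1/2)^n" .
  qed auto
  also have "\<dots> = ennreal (\<Sum>n. (1/2)^n)"
    by (rule suminf_ennreal2) auto
  also have "\<dots> < \<infinity>" by simp
  finally have "AE x in N. (\<Sum>n. ennreal (2^n * (cmod (d n x))\<^sup>2)) \<noteq> \<infinity>"
    by (intro nn_integral_PInf_AE) auto
  then have conv: "AE x in N. convergent (\<lambda>n. f n x)"
  proof (rule eventually_mono)
    fix x assume elim: "(\<Sum>n. ennreal (2^n * (cmod (d n x))\<^sup>2)) \<noteq> \<infinity>"
    define S where "S = (\<lambda>n. ennreal (2^n * (cmod (d n x))\<^sup>2))"
    define B where "B = enn2real (\<Sum>n. ennreal (2^n * (cmod (d n x))\<^sup>2))"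
    have le: "2^n * (cmod (d n x))\<^sup>2 \<le> B" for n
    proof -
      have "sum S {n} \<le> suminf S" by (rule sum_le_suminf) auto
      then have "ennreal (2^n * (cmod (d n x))\<^sup>2) \<le> (\<Sum>n. ennreal (2^n * (cmod (d n x))\<^sup>2))"
        by (simp add: S_def)
      also have "\<dots> = ennreal B" unfolding B_def
        by (rule ennreal_enn2real[symmetric]) (use elim in \<open>simp only: less_top infinity_ennreal_def\<close>)
      finally show ?thesis by (rule ennreal_le_iff[THEN iffD1, rotated]) (simp only: B_def enn2real_nonneg)
    qed
    have dB: "cmod (d n x) \<le> sqrt B * (sqrt (1/2))^n" for n
    proof -
      have "(cmod (d n x))\<^sup>2 \<le> B * (1/2)^n" using le[of n] by (simp add: field_simps)
      then have "sqrt ((cmod (d n x))\<^sup>2) \<le> sqrt (B * (1/2)^n)" by (rule real_sqrt_le_mono)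
      then show ?thesis by (simp add: real_sqrt_mult real_sqrt_power)
    qed
    have "summable (\<lambda>n. sqrt B * (sqrt (1/2))^n)"
      by (intro summable_mult summable_geometric) simp
    from summable_comparison_test'[OF this, of 0 "\<lambda>n. d n x"] dB have "summable (\<lambda>n. d n x)"
      by blast
    then have "convergent (\<lambda>n. \<Sum>i<n. d i x)" by (simp add: summable_iff_convergent)
    moreover have "(\<Sum>i<n. d i x) = f n x - f 0 x" for n
      unfolding d_def by (rule sum_lessThan_telescope)
    ultimately have "convergent (\<lambda>n. (f n x - f 0 x) + f 0 x)"
      by (intro convergent_add) (auto simp: convergent_const)
    then show "convergent (\<lambda>n. f n x)" by simp
  qed
  define g where "g x = lim (\<lambda>n. f n x)" for x
  have [measurable]: "g \<in> borel_measurable N" unfolding g_def by simp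
  have lim: "AE x in N. (\<lambda>n. f n x) \<longlonglongrightarrow> g x"
    using conv by eventually_elim (auto simp: g_def convergent_LIMSEQ_iff)
  \<comment> \<open>Fatou along k: the limit inherits the bound on f (n+k) - f n that is uniform in
    k.\<close>
  have bd: "(\<integral>\<^sup>+x. ennreal ((cmod (g x - f n x))\<^sup>2) \<partial>N) \<le> ennreal ((2 * (1/2)^n)\<^sup>2)" for n
  proof -
    have "(\<integral>\<^sup>+x. ennreal ((cmod (g x - f n x))\<^sup>2) \<partial>N)
        = (\<integral>\<^sup>+x. liminf (\<lambda>k. ennreal ((cmod (f (n+k) x - f n x))\<^sup>2)) \<partial>N)"
    proof (rule nn_integral_cong_AE, use lim in eventually_elim)
      case (elim x)
      have "(\<lambda>k. f (n + k) x) \<longlonglongrightarrow> g x"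
        using LIMSEQ_ignore_initial_segment[OF elim, of n] by (simp add: add.commute)
      then have "(\<lambda>k. ennreal ((cmod (f (n + k) x - f n x))\<^sup>2)) \<longlonglongrightarrow> ennreal ((cmod (g x - f n x))\<^sup>2)"
        by (intro tendsto_intros)
      from lim_imp_Liminf[OF _ this] show ?case by simp
    qed
    also have "\<dots> \<le> liminf (\<lambda>k. \<integral>\<^sup>+x. ennreal ((cmod (f (n+k) x - f n x))\<^sup>2) \<partial>N)"
      by (rule nn_integral_liminf) simp
    also have "\<dots> \<le> limsup (\<lambda>k. \<integral>\<^sup>+x. ennreal ((cmod (f (n+k) x - f n x))\<^sup>2) \<partial>N)"
      by (rule Liminf_le_Limsup) simp
    also have "\<dots> \<le> ennreal ((2 * (1/2)^n)\<^sup>2)"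
    proof (rule Limsup_bounded, rule always_eventually, rule allI)
      fix k
      have "(\<integral>\<^sup>+x. ennreal ((cmod (f (n+k) x - f n x))\<^sup>2) \<partial>N) = ennreal ((L2_norm N (\<lambda>x. f (n+k) x - f n x))\<^sup>2)"
        using f by (intro L2_norm_sq_nn[symmetric] L2_diff)
      also have "\<dots> \<le> ennreal ((2 * (1/2)^n)\<^sup>2)"
        using tele[of n k] by (intro ennreal_leI power_mono) auto
      finally show "(\<integral>\<^sup>+x. ennreal ((cmod (f (n+k) x - f n x))\<^sup>2) \<partial>N) \<le> ennreal ((2 * (1/2)^n)\<^sup>2)" .
    qed
    finally show ?thesis .
  qed
  have dg: "(\<lambda>x. g x - f n x) \<in> L2 N" for n
    using bd[of n] by (auto simp: L2_iff_nn_integral intro: le_less_trans)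
  have gL: "g \<in> L2 N" using L2_add[OF dg[of 0] f[of 0]] by simp
  have nb: "L2_norm N (\<lambda>x. f n x - g x) \<le> 2 * (1/2)^n" for n
  proof (rule power2_le_imp_le)
    have "ennreal ((L2_norm N (\<lambda>x. g x - f n x))\<^sup>2) \<le> ennreal ((2 * (1/2)^n)\<^sup>2)"
      using bd[of n] L2_norm_sq_nn[OF dg] by simp
    then show "(L2_norm N (\<lambda>x. f n x - g x))\<^sup>2 \<le> (2 * (1/2)^n)\<^sup>2"
      by (subst L2_norm_diff_commute) simp
  qed simp
  have "(\<lambda>n. L2_norm N (\<lambda>x. f n x - g x)) \<longlonglongrightarrow> 0"
  proof (rule tendsto_sandwich[OF _ _ tendsto_const])
    show "(\<lambda>n. 2 * (1/2)^n :: real) \<longlonglongrightarrow> 0"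
      using tendsto_mult_right_zero[OF LIMSEQ_power_zero[of "1/2::real"], of 2] by simp
  qed (use nb in auto)
  with gL show ?thesis by (rule that)
qed

text \<open>The projection theorem for the closure of D. A minimising sequence for the distance from
  f to D is Cauchy by the parallelogram law, and its limit h, which need not lie in D, makes f - h
  orthogonal to D.\<close>

lemma L2_dense_if_orthogonal_trivial:
  assumes D: "D \<subseteq> L2 N" and lin: "\<And>f g a. f \<in> D \<Longrightarrow> g \<in> D \<Longrightarrow> (\<lambda>x. a * f x + g x) \<in> D"
    and ne: "(\<lambda>x. 0) \<in> D"
    and orth: "\<And>f. f \<in> L2 N \<Longrightarrow> (\<And>g. g \<in> D \<Longrightarrow> L2_inner N f g = 0) \<Longrightarrow> AE x in N. f x = 0"
    and f: "f \<in> L2 N" and e: "e > 0"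
  shows "\<exists>g\<in>D. L2_norm N (\<lambda>x. f x - g x) < e"
proof -
  define m where "m = Inf ((\<lambda>g. (L2_norm N (\<lambda>x. f x - g x))\<^sup>2) ` D)"
  have m_le: "m \<le> (L2_norm N (\<lambda>x. f x - g x))\<^sup>2" if "g \<in> D" for g
    unfolding m_def using that by (intro cInf_lower) (auto intro!: bdd_belowI[of _ 0])
  \<comment> \<open>The parallelogram law turns the defects 16^-n / 8 into squared steps of at most
    4^-n, the rate that completeness asks for.\<close>
  have "\<exists>g\<in>D. (L2_norm N (\<lambda>x. f x - g x))\<^sup>2 < m + (1/16)^n / 8" for n
  proof -
    have "m < m + (1/16)^n / 8" by simp
    then show ?thesis unfolding m_def using ne by (subst (asm) cInf_less_iff) (auto intro!: bdd_belowI[of _ 0])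
  qed
  then obtain g where gD: "\<And>n. g n \<in> D" and gm: "\<And>n. (L2_norm N (\<lambda>x. f x - g n x))\<^sup>2 < m + (1/16)^n / 8"
    by metis
  have gL: "g n \<in> L2 N" for n using gD D by auto
  have "L2_norm N (\<lambda>x. g (Suc n) x - g n x) \<le> (1/2)^n" for n
  proof (rule power2_le_imp_le)
    let ?a = "\<lambda>x. f x - g n x" and ?b = "\<lambda>x. f x - g (Suc n) x"
    have aL: "?a \<in> L2 N" "?b \<in> L2 N" using f gL by (auto intro: L2_diff)
    have "(\<lambda>x. (1/2) * g n x + (1/2) * g (Suc n) x) \<in> D"
      using lin[OF gD[of n], of "\<lambda>x. (1/2) * g (Suc n) x" "1/2"] lin[OF gD[of "Suc n"] ne, of "1/2"] by simp
    from m_le[OF this] have "4 * m \<le> (L2_norm N (\<lambda>x. 2 * (f x - ((1/2) * g n x + (1/2) * g (Suc n) x))))\<^sup>2"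
      unfolding L2_norm_scale by (simp add: power_mult_distrib)
    also have "(\<lambda>x. 2 * (f x - ((1/2) * g n x + (1/2) * g (Suc n) x))) = (\<lambda>x. ?a x + ?b x)"
      by (simp add: algebra_simps)
    finally have "4 * m \<le> (L2_norm N (\<lambda>x. ?a x + ?b x))\<^sup>2" .
    then have "(L2_norm N (\<lambda>x. ?a x - ?b x))\<^sup>2 \<le> 2 * (L2_norm N ?a)\<^sup>2 + 2 * (L2_norm N ?b)\<^sup>2 - 4 * m"
      using L2_norm_parallelogram[OF aL] by linarith
    also have "\<dots> \<le> (1/16)^n / 4 + (1/16)^Suc n / 4" using gm[of n] gm[of "Suc n"] by linarith
    also have "\<dots> \<le> (1/16)^n" by simp
    also have "\<dots> \<le> ((1/2)^n)\<^sup>2"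
    proof -
      have "((1/2)^n)\<^sup>2 = (1/4::real)^n" by (simp add: power2_eq_square flip: power_mult_distrib)
      then show ?thesis by (simp add: power_mono)
    qed
    finally show "(L2_norm N (\<lambda>x. g (Suc n) x - g n x))\<^sup>2 \<le> ((1/2)^n)\<^sup>2" by simp
  qed simp
  from L2_complete[OF gL this] obtain h where h: "h \<in> L2 N" and lim: "(\<lambda>n. L2_norm N (\<lambda>x. g n x - h x)) \<longlonglongrightarrow> 0"
    by blast
  have fh: "(\<lambda>x. f x - h x) \<in> L2 N" using f h by (rule L2_diff)
  have hm: "(L2_norm N (\<lambda>x. f x - h x))\<^sup>2 \<le> m"
  proof -
    have "L2_norm N (\<lambda>x. f x - h x) \<le> sqrt (m + (1/16)^n/8) + L2_norm N (\<lambda>x. g n x - h x)" for n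
    proof -
      have "L2_norm N (\<lambda>x. (f x - g n x) + (g n x - h x)) \<le> L2_norm N (\<lambda>x. f x - g n x) + L2_norm N (\<lambda>x. g n x - h x)"
        using f gL h by (intro L2_norm_triangle L2_diff)
      moreover have "L2_norm N (\<lambda>x. f x - g n x) \<le> sqrt (m + (1/16)^n/8)"
        using gm[of n] by (intro real_le_rsqrt) simp
      ultimately show ?thesis by simp
    qed
    moreover have "(\<lambda>n. sqrt (m + (1/16)^n/8) + L2_norm N (\<lambda>x. g n x - h x)) \<longlonglongrightarrow> sqrt (m + 0/8) + 0"
      by (intro tendsto_intros lim) auto
    ultimately have "L2_norm N (\<lambda>x. f x - h x) \<le> sqrt m" by (intro LIMSEQ_le_const[where a="L2_norm N (\<lambda>x. f x - h x)"]) auto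
    moreover have "m \<ge> 0" unfolding m_def using ne by (intro cInf_greatest) auto
    ultimately show ?thesis
      using power_mono[of "L2_norm N (\<lambda>x. f x - h x)" "sqrt m" 2] by simp
  qed
  have "L2_inner N (\<lambda>x. f x - h x) k = 0" if k: "k \<in> D" for k
  proof -
    have kL: "k \<in> L2 N" using k D by auto
    define c where "c = L2_inner N (\<lambda>x. f x - h x) k"
    \<comment> \<open>Since h is only a limit of elements of D, the competitor h + a k is replaced
      by g n + a k, which does belong to D, at a cost tending to 0.\<close>
    have ge: "m \<le> (L2_norm N (\<lambda>x. (f x - h x) - a * k x))\<^sup>2" for a
    proof -
      have "sqrt m \<le> L2_norm N (\<lambda>x. (f x - h x) - a * k x) + L2_norm N (\<lambda>x. g n x - h x)" for n
      proof -
        have *: "(\<lambda>x. a * k x + g n x) \<in> D" using lin k gD by auto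
        have "sqrt m \<le> L2_norm N (\<lambda>x. f x - (a * k x + g n x))"
          using m_le[OF *] by (intro real_le_lsqrt) auto
        also have "(\<lambda>x. f x - (a * k x + g n x)) = (\<lambda>x. ((f x - h x) - a * k x) + (h x - g n x))"
          by (simp add: algebra_simps)
        also have "L2_norm N \<dots> \<le> L2_norm N (\<lambda>x. (f x - h x) - a * k x) + L2_norm N (\<lambda>x. h x - g n x)"
          using f gL h kL by (intro L2_norm_triangle L2_diff L2_scale)
        finally show ?thesis by (subst (asm) (2) L2_norm_diff_commute)
      qed
      moreover have "(\<lambda>n. L2_norm N (\<lambda>x. (f x - h x) - a * k x) + L2_norm N (\<lambda>x. g n x - h x)) \<longlonglongrightarrow>
          L2_norm N (\<lambda>x. (f x - h x) - a * k x) + 0"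
        by (intro tendsto_intros lim)
      ultimately have "sqrt m \<le> L2_norm N (\<lambda>x. (f x - h x) - a * k x)"
        by (intro LIMSEQ_le_const) auto
      then show ?thesis by (simp add: sqrt_le_D)
    qed
    have "2 * t * (cmod c)\<^sup>2 \<le> t\<^sup>2 * ((cmod c)\<^sup>2 * (L2_norm N k)\<^sup>2)" for t :: real
    proof -
      have "m \<le> (L2_norm N (\<lambda>x. (f x - h x) - (of_real t * c) * k x))\<^sup>2" by (rule ge)
      also have "\<dots> = (L2_norm N (\<lambda>x. f x - h x))\<^sup>2 + (t * cmod c)\<^sup>2 * (L2_norm N k)\<^sup>2 - 2 * Re (cnj (of_real t * c) * c)"
        using fh kL by (subst L2_norm_diff_sq)
          (auto intro: L2_scale simp: L2_norm_scale norm_mult power_mult_distrib L2_inner_scale_right c_def)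
      also have "Re (cnj (of_real t * c) * c) = t * (cmod c)\<^sup>2"
        by (simp add: cmod_power2) (simp add: algebra_simps power2_eq_square)
      finally show ?thesis using hm by (simp add: power_mult_distrib)
    qed
    note q = this
    have "(cmod c)\<^sup>2 \<le> 0"
    proof (rule ccontr)
      assume "\<not> (cmod c)\<^sup>2 \<le> 0"
      then have cp: "(cmod c)\<^sup>2 > 0" by simp
      \<comment> \<open>At t = 1/K the linear term of the variation beats the quadratic one; adding
        1 keeps K positive when k vanishes.\<close>
      define K where "K = (L2_norm N k)\<^sup>2 + 1"
      have K: "K > 0" by (simp add: K_def add_nonneg_pos)
      have "2 * (1/K) * (cmod c)\<^sup>2 \<le> (1/K)\<^sup>2 * ((cmod c)\<^sup>2 * (L2_norm N k)\<^sup>2)" by (rule q)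
      also have "\<dots> \<le> (1/K)\<^sup>2 * ((cmod c)\<^sup>2 * K)"
        by (intro mult_left_mono) (auto simp: K_def)
      also have "\<dots> = (1/K) * (cmod c)\<^sup>2" using K by (simp add: power2_eq_square)
      finally have "(1/K) * (cmod c)\<^sup>2 \<le> 0" by simp
      then show False using K cp by (simp add: mult_le_0_iff divide_le_0_iff)
    qed
    then show ?thesis by (simp add: c_def)
  qed
  from orth[OF fh this] have ae: "AE x in N. f x - h x = 0" by simp
  from order_tendstoD(2)[OF lim e] obtain n where n: "L2_norm N (\<lambda>x. g n x - h x) < e"
    by (auto simp: eventually_sequentially)
  have "L2_norm N (\<lambda>x. f x - g n x) = L2_norm N (\<lambda>x. h x - g n x)"
    using f gL h ae by (intro L2_norm_cong_AE) (auto intro: L2_diff)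
  with n gD show ?thesis by (metis L2_norm_diff_commute)
qed

section \<open>A criterion for self-adjointness\<close>

lemma L2_inner_cong_left:
  "f \<in> L2 N \<Longrightarrow> f' \<in> L2 N \<Longrightarrow> g \<in> L2 N \<Longrightarrow> AE x in N. f x = f' x \<Longrightarrow> L2_inner N f g = L2_inner N f' g"
  using L2_inner_cong_AE[of f N f' g g] by simp

lemma L2_inner_cong_right:
  "f \<in> L2 N \<Longrightarrow> g \<in> L2 N \<Longrightarrow> g' \<in> L2 N \<Longrightarrow> AE x in N. g x = g' x \<Longrightarrow> L2_inner N f g = L2_inner N f g'"
  using L2_inner_cong_AE[of f N f g g'] by simp

lemma AE_eq_sym: "AE x in N. f x = g x \<Longrightarrow> AE x in N. g x = f x"
  by (simp add: eq_commute)

text \<open>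
  For B the identity this is the usual criterion that the ranges of $A \pm i$ are everything. The
  operator is given by its graph, because functions are only determined up to null sets.
\<close>

lemma self_adjoint_criterion:
  fixes Gr :: "('a \<Rightarrow> complex) \<Rightarrow> ('a \<Rightarrow> complex) \<Rightarrow> bool"
  assumes GrL: "\<And>f h. Gr f h \<Longrightarrow> f \<in> L2 N \<and> h \<in> L2 N"
    and lin: "\<And>f h g k a. Gr f h \<Longrightarrow> Gr g k \<Longrightarrow> Gr (\<lambda>x. a * f x + g x) (\<lambda>x. a * h x + k x)"
    and cong: "\<And>f h f' h'. Gr f h \<Longrightarrow> f' \<in> L2 N \<Longrightarrow> h' \<in> L2 N \<Longrightarrow> AE x in N. f x = f' x \<Longrightarrow>
      AE x in N. h x = h' x \<Longrightarrow> Gr f' h'"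
    and symm: "\<And>f h g k. Gr f h \<Longrightarrow> Gr g k \<Longrightarrow> L2_inner N h g = L2_inner N f k"
    and BL: "\<And>f. f \<in> L2 N \<Longrightarrow> B f \<in> L2 N"
    and Bsymm: "\<And>f g. f \<in> L2 N \<Longrightarrow> g \<in> L2 N \<Longrightarrow> L2_inner N (B f) g = L2_inner N f (B g)"
    and Bidem: "\<And>f. f \<in> L2 N \<Longrightarrow> L2_inner N (B f) (B f) = L2_inner N (B f) f"
    and surj: "\<And>f e. f \<in> L2 N \<Longrightarrow> e \<in> {\<i>, -\<i>} \<Longrightarrow> \<exists>u h. Gr u h \<and> (AE x in N. h x + e * B u x = f x)"
    and DA: "\<And>f. f \<in> D \<Longrightarrow> Gr f (A f)" and DI: "\<And>f h. Gr f h \<Longrightarrow> f \<in> D \<and> (AE x in N. h x = A f x)"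
  shows "self_adjoint N D A"
proof -
  have DL: "D \<subseteq> L2 N" using DA GrL by blast
  have ALn: "A f \<in> L2 N" if "f \<in> D" for f using DA[OF that] GrL by blast
  have Deq: "g \<in> D" if "f \<in> D" "g \<in> L2 N" "AE x in N. f x = g x" for f g
    using DI[OF cong[OF DA[OF that(1)] that(2) ALn[OF that(1)] that(3)]] by simp
  have inner_eq: "L2_inner N f (\<lambda>x. h x + e * k x) = L2_inner N f h + cnj e * L2_inner N f k"
    if "f \<in> L2 N" "h \<in> L2 N" "k \<in> L2 N" for f h k e using that by (simp add: L2_inner_simps)
  have zero_if: "AE x in N. f x = 0" if "f \<in> L2 N" "L2_inner N f f = 0" for f
    using that L2_norm_eq_0_iff[OF that(1)] by (simp add: L2_inner_self)
  have surjD: "\<exists>u\<in>D. AE x in N. A u x + e * B u x = f x" if f: "f \<in> L2 N" "e \<in> {\<i>, -\<i>}" for f e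
  proof -
    from surj[OF f] obtain u h where u: "Gr u h" "AE x in N. h x + e * B u x = f x" by blast
    from DI[OF u(1)] have uD: "u \<in> D" and hA: "AE x in N. h x = A u x" by auto
    have "AE x in N. A u x + e * B u x = f x" using u(2) hA by eventually_elim simp
    with uD show ?thesis by blast
  qed
  have symmD: "L2_inner N (A f) g = L2_inner N f (A g)" if "f \<in> D" "g \<in> D" for f g
    using symm[OF DA DA] that by blast
  have adj: "g \<in> D \<and> (AE x in N. h x = A g x)" if "adjoint_rel N D A g h" for g h
  proof -
    have g: "g \<in> L2 N" and h: "h \<in> L2 N" and ad: "\<And>f. f \<in> D \<Longrightarrow> L2_inner N (A f) g = L2_inner N f h"
      using that by (auto simp: adjoint_rel_def)
    \<comment> \<open>Solving (A - iB) u = h - iB g produces a candidate u in D; then g - u is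
      orthogonal to the range of A + iB, which is everything.\<close>
    have "(\<lambda>x. h x + (-\<i>) * B g x) \<in> L2 N" using h g BL by (intro L2_add L2_scale)
    from surjD[OF this, of "-\<i>"] obtain u where u: "u \<in> D"
      and ueq: "AE x in N. A u x + (-\<i>) * B u x = h x + (-\<i>) * B g x" by auto
    have uL: "u \<in> L2 N" using u DL by auto
    have gu: "(\<lambda>x. g x - u x) \<in> L2 N" using g uL by (rule L2_diff)
    have key: "L2_inner N (\<lambda>x. A f x + \<i> * B f x) (\<lambda>x. g x - u x) = 0" if f: "f \<in> D" for f
    proof -
      have fL: "f \<in> L2 N" using f DL by auto
      have "L2_inner N (\<lambda>x. A f x + \<i> * B f x) g = L2_inner N f (\<lambda>x. h x + (-\<i>) * B g x)"
        using fL g h BL ALn[OF f] ad[OF f] Bsymm[OF fL g] by (simp add: L2_inner_simps)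
      also have "\<dots> = L2_inner N f (\<lambda>x. A u x + (-\<i>) * B u x)"
        by (rule L2_inner_cong_right[OF fL _ _ AE_eq_sym[OF ueq]])
          (intro L2_add L2_scale BL h g uL ALn[OF u])+
      also have "\<dots> = L2_inner N (\<lambda>x. A f x + \<i> * B f x) u"
        using fL uL BL ALn[OF f] ALn[OF u] symmD[OF f u] Bsymm[OF fL uL] by (simp add: L2_inner_simps)
      finally show ?thesis using fL g uL BL ALn[OF f] by (simp add: L2_inner_diff_right L2_add L2_scale)
    qed
    from surjD[OF gu, of "\<i>"] obtain f where f: "f \<in> D" "AE x in N. A f x + \<i> * B f x = g x - u x" by auto
    have "L2_inner N (\<lambda>x. g x - u x) (\<lambda>x. g x - u x) = L2_inner N (\<lambda>x. A f x + \<i> * B f x) (\<lambda>x. g x - u x)"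
      by (rule L2_inner_cong_left[OF gu _ gu AE_eq_sym[OF f(2)]])
        (use f(1) DL in \<open>intro L2_add L2_scale BL ALn; blast\<close>)
    with key[OF f(1)] have "L2_inner N (\<lambda>x. g x - u x) (\<lambda>x. g x - u x) = 0" by simp
    from zero_if[OF gu this] have gu0: "AE x in N. g x - u x = 0" .
    \<comment> \<open>B acts on functions and is not assumed to respect null sets, so B g = B u has
      to be derived from g = u; the symmetry of B supplies it.\<close>
    have Bgu: "(\<lambda>x. B g x - B u x) \<in> L2 N" using g uL BL by (intro L2_diff)
    have "L2_inner N (\<lambda>x. B g x - B u x) (\<lambda>x. B g x - B u x) = L2_inner N (\<lambda>x. g x - u x) (B (\<lambda>x. B g x - B u x))"
      using Bsymm[OF g Bgu] Bsymm[OF uL Bgu] Bgu g uL BL[OF g] BL[OF uL] BL[OF Bgu] by (simp add: L2_inner_simps)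
    also have "\<dots> = L2_inner N (\<lambda>x. 0) (B (\<lambda>x. B g x - B u x))"
      by (rule L2_inner_cong_left[OF gu L2_zero BL[OF Bgu] gu0])
    finally have "AE x in N. B g x - B u x = 0" using zero_if[OF Bgu] by simp
    with ueq have hA: "AE x in N. A u x = h x" by eventually_elim simp
    have "AE x in N. u x = g x" using gu0 by eventually_elim simp
    from DI[OF cong[OF DA[OF u] g h this hA]] show ?thesis by auto
  qed
  have "\<exists>g\<in>D. L2_norm N (\<lambda>x. f x - g x) < \<epsilon>" if f: "f \<in> L2 N" "\<epsilon> > 0" for f \<epsilon>
  proof (rule L2_dense_if_orthogonal_trivial[OF DL _ _ _ f])
    show "(\<lambda>x. a * f x + g x) \<in> D" if "f \<in> D" "g \<in> D" for f g a
      using DI[OF lin[OF DA[OF that(1)] DA[OF that(2)]]] by blast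
    from surjD[OF L2_zero, of "\<i>"] obtain u where u: "u \<in> D" by auto
    show "(\<lambda>x. 0) \<in> D" using DI[OF lin[OF DA[OF u] DA[OF u], of "-1"]] by simp
    \<comment> \<open>Write f = A u + iB u and pair with u: the first term is real and the second
      purely imaginary, so B u = 0. Then u is orthogonal to the range of A + iB, hence u =
      0.\<close>
    show "AE x in N. f x = 0" if f: "f \<in> L2 N" and orth: "\<And>g. g \<in> D \<Longrightarrow> L2_inner N f g = 0" for f
    proof -
      from surjD[OF f, of "\<i>"] obtain u where u: "u \<in> D" and ueq: "AE x in N. A u x + \<i> * B u x = f x" by auto
      have uL: "u \<in> L2 N" using u DL by auto
      have fin: "L2_inner N f g = L2_inner N (A u) g + \<i> * L2_inner N (B u) g" if "g \<in> L2 N" for g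
      proof -
        have "L2_inner N f g = L2_inner N (\<lambda>x. A u x + \<i> * B u x) g"
          by (rule L2_inner_cong_left[OF f _ that AE_eq_sym[OF ueq]]) (intro L2_add L2_scale BL uL ALn[OF u])
        then show ?thesis using that uL BL ALn[OF u] by (simp add: L2_inner_simps)
      qed
      have real: "cnj (L2_inner N (A u) u) = L2_inner N (A u) u"
        using symmD[OF u u] L2_inner_commute[of N "A u" u] by simp
      have "L2_inner N (A u) u + \<i> * of_real ((L2_norm N (B u))\<^sup>2) = 0"
        using fin[OF uL] orth[OF u] Bidem[OF uL] by (simp add: L2_inner_self)
      with real have "L2_norm N (B u) = 0"
        by (simp add: complex_eq_iff)
      then have Bu: "AE x in N. B u x = 0" using L2_norm_eq_0_iff[OF BL[OF uL]] by simp
      then have Bu0: "L2_inner N (B u) g = 0" if "g \<in> L2 N" for g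
        using L2_inner_cong_left[OF BL[OF uL] L2_zero that Bu] by simp
      have "L2_inner N u (\<lambda>x. A v x + \<i> * B v x) = 0" if v: "v \<in> D" for v
      proof -
        have vL: "v \<in> L2 N" using v DL by auto
        have "L2_inner N u (A v) = 0"
          using symmD[OF u v] fin[OF vL] orth[OF v] Bu0[OF vL] by simp
        moreover have "L2_inner N u (B v) = 0" using Bsymm[OF uL vL] Bu0[OF vL] by simp
        ultimately show ?thesis using uL vL BL ALn[OF v] by (simp add: L2_inner_simps)
      qed
      moreover from surjD[OF uL, of "\<i>"] obtain v where v: "v \<in> D" "AE x in N. A v x + \<i> * B v x = u x" by auto
      moreover have "L2_inner N u u = L2_inner N u (\<lambda>x. A v x + \<i> * B v x)"
        by (rule L2_inner_cong_right[OF uL uL _ AE_eq_sym[OF v(2)]])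
          (use v(1) DL in \<open>intro L2_add L2_scale BL ALn; blast\<close>)
      ultimately have u0: "AE x in N. u x = 0" using zero_if[OF uL] by simp
      have "L2_inner N f f = L2_inner N (A u) f + \<i> * L2_inner N (B u) f" by (rule fin[OF f])
      also have "\<dots> = L2_inner N (A u) f" using Bu0[OF f] by simp
      finally have ff: "L2_inner N f f = L2_inner N (A u) f" .
      \<comment> \<open>From u = 0 it still has to follow that A u = 0. Subtracting the pair (0, A
        u) from (u, A u) shows that 0 is also an image of u, and images are unique up to null
        sets.\<close>
      have "Gr (\<lambda>x. 0) (A u)" by (rule cong[OF DA[OF u] L2_zero ALn[OF u] u0]) simp
      from lin[OF this DA[OF u], of "-1"] have "Gr u (\<lambda>x. 0)" by simp
      from DI[OF this] have "AE x in N. 0 = A u x" by blast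
      from AE_eq_sym[OF this] have "AE x in N. A u x = 0" .
      then have "L2_inner N (A u) f = 0"
        using L2_inner_cong_left[OF ALn[OF u] L2_zero f] by simp
      with ff show ?thesis using zero_if[OF f] by argo
    qed
  qed
  moreover have "adjoint_rel N D A g h" if "g \<in> D" "h \<in> L2 N" "AE x in N. h x = A g x" for g h
    unfolding adjoint_rel_def
  proof (intro conjI ballI)
    fix f assume f: "f \<in> D"
    have "L2_inner N f h = L2_inner N f (A g)"
      by (rule L2_inner_cong_right[OF _ that(2) ALn[OF that(1)] that(3)]) (use f DL in blast)
    then show "L2_inner N (A f) g = L2_inner N f h" using symmD[OF f that(1)] by simp
  qed (use that DL in blast)+
  moreover have "h \<in> L2 N" if "adjoint_rel N D A g h" for g h using that by (simp add: adjoint_rel_def)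
  ultimately show ?thesis
    unfolding self_adjoint_def using DL ALn adj by blast
qed

section \<open>Spectral families\<close>

text \<open>A Dynkin argument for sums of measures, which avoids subtraction. It serves orthogonal
  sums, the parallelogram identity, and the comparison of a measure with a multiple of Lebesgue
  measure; a null measure fills an empty slot.\<close>

lemma emeasure_add_eqI_Ioc:
  fixes M1 M2 M3 M4 :: "real measure"
  assumes fin: "finite_measure M1" "finite_measure M2" "finite_measure M3" "finite_measure M4"
    and sets: "sets M1 = sets borel" "sets M2 = sets borel" "sets M3 = sets borel" "sets M4 = sets borel"
    and eq: "\<And>a b. a \<le> b \<Longrightarrow> measure M1 {a<..b} + measure M2 {a<..b} = measure M3 {a<..b} + measure M4 {a<..b}"
    and B: "B \<in> sets borel"
  shows "emeasure M1 B + emeasure M2 B = emeasure M3 B + emeasure M4 B"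
proof -
  interpret M1: finite_measure M1 by fact
  interpret M2: finite_measure M2 by fact
  interpret M3: finite_measure M3 by fact
  interpret M4: finite_measure M4 by fact
  let ?G = "range (\<lambda>(a::real, b). {a<..b})"
  let ?P = "\<lambda>X. measure M1 X + measure M2 X = measure M3 X + measure M4 X"
  have sp: "space M1 = UNIV" "space M2 = UNIV" "space M3 = UNIV" "space M4 = UNIV"
    using sets[THEN sets_eq_imp_space_eq] by auto
  have gen: "sets borel = sigma_sets UNIV ?G" by (subst borel_sigma_sets_Ioc) simp
  \<comment> \<open>The complement clause below needs the total masses, and the whole line is not
    among the generating intervals, so it is exhausted by them.\<close>
  have UN: "?P UNIV"
  proof -
    have U: "(\<Union>n::nat. {- real n<..real n}) = UNIV"
    proof -
      have "\<exists>n::nat. - real n < x \<and> x \<le> real n" for x :: real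
      proof -
        obtain n :: nat where "\<bar>x\<bar> < real n" using reals_Archimedean2 by blast
        then have "- real n < x \<and> x \<le> real n" by linarith
        then show ?thesis by blast
      qed
      then show ?thesis by auto
    qed
    have inc: "incseq (\<lambda>n::nat. {- real n<..real n})" by (auto simp: incseq_def)
    have l: "(\<lambda>n. measure M {- real n<..real n}) \<longlonglongrightarrow> measure M UNIV"
      if "finite_measure M" "sets M = sets borel" for M :: "real measure"
    proof -
      interpret finite_measure M by fact
      have "range (\<lambda>n::nat. {- real n<..real n}) \<subseteq> sets M" unfolding that(2) by auto
      from finite_Lim_measure_incseq[OF this inc] show ?thesis unfolding U .
    qed
    have l12: "(\<lambda>n. measure M1 {- real n<..real n} + measure M2 {- real n<..real n}) \<longlonglongrightarrow> measure M1 UNIV + measure M2 UNIV"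
      by (intro tendsto_add l fin sets)
    have l34: "(\<lambda>n. measure M3 {- real n<..real n} + measure M4 {- real n<..real n}) \<longlonglongrightarrow> measure M3 UNIV + measure M4 UNIV"
      by (intro tendsto_add l fin sets)
    have l: "measure M1 {- real n<..real n} + measure M2 {- real n<..real n} = measure M3 {- real n<..real n} + measure M4 {- real n<..real n}" for n :: nat
      by (rule eq) simp
    show ?thesis by (rule LIMSEQ_unique[OF l12 l34[folded l]])
  qed
  have "?P B"
  proof (rule sigma_sets_induct_disjoint[of ?G UNIV B ?P])
    show "Int_stable ?G"
      by (auto simp: Int_stable_def)
    show "?G \<subseteq> Pow UNIV" by simp
    show "B \<in> sigma_sets UNIV ?G" using B gen by simp
    show "?P X" if "X \<in> ?G" for X
    proof -
      from that obtain a b where X: "X = {a<..b}" by auto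
      show ?thesis
      proof (cases "a \<le> b")
        case True then show ?thesis unfolding X by (rule eq)
      next
        case False then show ?thesis unfolding X by simp
      qed
    qed
    show "?P {}" by simp
    show "?P (UNIV - X)" if "X \<in> sigma_sets UNIV ?G" "?P X" for X
    proof -
      have "X \<in> sets borel" using that gen by simp
      then have "measure M (UNIV - X) = measure M UNIV - measure M X" if "finite_measure M" "sets M = sets borel" for M
        using finite_measure.finite_measure_compl[OF that(1), of X] that sets_eq_imp_space_eq[OF that(2)] by simp
      then show ?thesis using fin sets that UN by simp
    qed
    show "?P (\<Union>i. X i)" if "disjoint_family X" "range X \<subseteq> sigma_sets UNIV ?G" "\<And>i. ?P (X i)" for X :: "nat \<Rightarrow> real set"
    proof -
      have r: "range X \<subseteq> sets borel" using that gen by simp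
      have s: "(\<lambda>i. measure M (X i)) sums measure M (\<Union>i. X i)" if "finite_measure M" "sets M = sets borel" for M
      proof -
        interpret finite_measure M by fact
        show ?thesis using r \<open>disjoint_family X\<close> that(2) by (intro finite_measure_UNION) auto
      qed
      from sums_add[OF s[OF fin(1) sets(1)] s[OF fin(2) sets(2)]] sums_add[OF s[OF fin(3) sets(3)] s[OF fin(4) sets(4)]]
      show ?thesis using that(3) sums_unique2 by simp
    qed
  qed
  then show ?thesis
    by (simp add: M1.emeasure_eq_measure M2.emeasure_eq_measure M3.emeasure_eq_measure M4.emeasure_eq_measure
        flip: ennreal_plus)
qed

lemma nn_integral_add_measure:
  assumes sets: "sets M1 = sets M" "sets M2 = sets M"
    and eq: "\<And>B. B \<in> sets M \<Longrightarrow> emeasure M B = emeasure M1 B + emeasure M2 B"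
    and f: "f \<in> borel_measurable M"
  shows "integral\<^sup>N M f = integral\<^sup>N M1 f + integral\<^sup>N M2 f"
  using f
proof (induction rule: borel_measurable_induct)
  case (cong f g)
  have "space M1 = space M" "space M2 = space M" using sets[THEN sets_eq_imp_space_eq] by auto
  then have "integral\<^sup>N M' f = integral\<^sup>N M' g" if "M' \<in> {M, M1, M2}" for M'
    using cong(3) that by (intro nn_integral_cong) auto
  then show ?case using cong(4) by simp
next
  case (set B) then show ?case using sets eq by simp
next
  case (mult u c)
  then have "u \<in> borel_measurable M1" "u \<in> borel_measurable M2"
    by (auto simp: measurable_cong_sets[OF sets(1) refl] measurable_cong_sets[OF sets(2) refl])
  with mult show ?case by (simp add: nn_integral_cmult distrib_left)
next
  case (add u v)
  then have "u \<in> borel_measurable M1" "u \<in> borel_measurable M2" "v \<in> borel_measurable M1" "v \<in> borel_measurable M2"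
    by (auto simp: measurable_cong_sets[OF sets(1) refl] measurable_cong_sets[OF sets(2) refl])
  with add show ?case by (simp add: nn_integral_add ac_simps)
next
  case (seq U)
  have U: "U i \<in> borel_measurable M1" "U i \<in> borel_measurable M2" for i
    using seq(1) by (auto simp: measurable_cong_sets[OF sets(1) refl] measurable_cong_sets[OF sets(2) refl])
  have [simp]: "(\<lambda>x. (SUP i. U i) x) = (\<lambda>x. SUP i. U i x)" by (simp add: fun_eq_iff image_comp)
  have inc: "incseq (\<lambda>i. integral\<^sup>N M' (U i))" for M'
    unfolding incseq_def by (intro allI impI nn_integral_mono) (use incseqD[OF \<open>incseq U\<close>] in \<open>simp add: le_fun_def\<close>)
  have s: "integral\<^sup>N M' (Sup (range U)) = (SUP i. integral\<^sup>N M' (U i))" if "\<And>i. U i \<in> borel_measurable M'" for M'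
    using nn_integral_monotone_convergence_SUP[OF \<open>incseq U\<close> that] by (simp add: image_comp)
  have "integral\<^sup>N M (Sup (range U)) = (SUP i. integral\<^sup>N M1 (U i) + integral\<^sup>N M2 (U i))"
    using s[of M] seq by simp
  also have "\<dots> = (SUP i. integral\<^sup>N M1 (U i)) + (SUP i. integral\<^sup>N M2 (U i))"
    by (rule ennreal_SUP_add[OF inc inc])
  finally show ?case using s[OF U(1)] s[OF U(2)] by simp
qed

lemma integral_add_measure:
  fixes f :: "'a \<Rightarrow> real"
  assumes sets: "sets M1 = sets M" "sets M2 = sets M"
    and eq: "\<And>B. B \<in> sets M \<Longrightarrow> emeasure M B = emeasure M1 B + emeasure M2 B"
    and f: "f \<in> borel_measurable M"
  shows "integrable M f \<longleftrightarrow> integrable M1 f \<and> integrable M2 f"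
    and "integrable M1 f \<Longrightarrow> integrable M2 f \<Longrightarrow> integral\<^sup>L M f = integral\<^sup>L M1 f + integral\<^sup>L M2 f"
proof -
  have m: "f \<in> borel_measurable M1" "f \<in> borel_measurable M2"
    using f by (auto simp: measurable_cong_sets[OF sets(1) refl] measurable_cong_sets[OF sets(2) refl])
  have n: "integral\<^sup>N M (\<lambda>x. ennreal (g (f x))) = integral\<^sup>N M1 (\<lambda>x. ennreal (g (f x))) + integral\<^sup>N M2 (\<lambda>x. ennreal (g (f x)))"
    if [measurable]: "g \<in> borel_measurable borel" for g
  proof (rule nn_integral_add_measure[OF sets eq])
    note [measurable] = f
    show "(\<lambda>x. ennreal (g (f x))) \<in> borel_measurable M" by simp
  qed
  show "integrable M f \<longleftrightarrow> integrable M1 f \<and> integrable M2 f"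
    unfolding integrable_iff_bounded using f m n[of norm] by (auto simp: ennreal_add_less_top)
  assume i: "integrable M1 f" "integrable M2 f"
  then have iM: "integrable M f" using \<open>integrable M f \<longleftrightarrow> _\<close> by simp
  have fin: "integral\<^sup>N M' (\<lambda>x. ennreal (f x)) < top" "integral\<^sup>N M' (\<lambda>x. ennreal (- f x)) < top" if "integrable M' f" for M'
    using that unfolding real_integrable_def by (auto simp: less_top)
  show "integral\<^sup>L M f = integral\<^sup>L M1 f + integral\<^sup>L M2 f"
    unfolding real_lebesgue_integral_def[OF iM] real_lebesgue_integral_def[OF i(1)] real_lebesgue_integral_def[OF i(2)]
    using n[of "\<lambda>x. x"] n[of uminus] fin[OF i(1)] fin[OF i(2)] by (simp add: enn2real_plus)
qed

lemma L2_eqI: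
  assumes f: "f \<in> L2 N" and g: "g \<in> L2 N" and eq: "\<And>k. k \<in> L2 N \<Longrightarrow> L2_inner N f k = L2_inner N g k"
  shows "AE x in N. f x = g x"
proof -
  have d: "(\<lambda>x. f x - g x) \<in> L2 N" using f g by (rule L2_diff)
  have "L2_inner N (\<lambda>x. f x - g x) (\<lambda>x. f x - g x) = 0"
    using eq[OF d] f g d by (simp add: L2_inner_diff_left)
  then have "AE x in N. f x - g x = 0"
    using L2_norm_eq_0_iff[OF d] by (simp add: L2_inner_self)
  then show ?thesis by eventually_elim simp
qed

section \<open>The operator and the projections of its spectral family\<close>

locale spectral_resolution =
  fixes N :: "'a measure" and D :: "('a \<Rightarrow> complex) set" and A :: "('a \<Rightarrow> complex) \<Rightarrow> ('a \<Rightarrow> complex)"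
    and E :: "real \<Rightarrow> ('a \<Rightarrow> complex) \<Rightarrow> ('a \<Rightarrow> complex)"
  assumes sa: "self_adjoint N D A" and sf: "spectral_family N D A E"
begin

abbreviation "ip \<equiv> L2_inner N"
abbreviation "nrm \<equiv> L2_norm N"

definition Gr :: "('a \<Rightarrow> complex) \<Rightarrow> ('a \<Rightarrow> complex) \<Rightarrow> bool" where
  "Gr f h \<longleftrightarrow> f \<in> D \<and> h \<in> L2 N \<and> (AE x in N. h x = A f x)"

lemma D_L2: "f \<in> D \<Longrightarrow> f \<in> L2 N" and A_L2: "f \<in> D \<Longrightarrow> A f \<in> L2 N"
  using sa by (auto simp: self_adjoint_def)

text \<open>\<open>A\<close> is an arbitrary map on functions, with no linearity or compatibility
  with null sets built in. Self-adjointness identifies its graph with the adjoint relation, and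
  there both properties are immediate.\<close>

lemma Gr_adjoint_rel: "Gr f h \<longleftrightarrow> adjoint_rel N D A f h"
  using sa by (simp add: self_adjoint_def Gr_def)

lemma Gr_A: "f \<in> D \<Longrightarrow> Gr f (A f)"
  using A_L2 by (simp add: Gr_def)

lemma Gr_L2: "Gr f h \<Longrightarrow> f \<in> L2 N" "Gr f h \<Longrightarrow> h \<in> L2 N" "Gr f h \<Longrightarrow> f \<in> D" "Gr f h \<Longrightarrow> AE x in N. A f x = h x"
  unfolding Gr_def using D_L2 AE_eq_sym[of h "A f" N] by blast+

lemma Gr_lin: assumes "Gr f h" "Gr g k" shows "Gr (\<lambda>x. a * f x + g x) (\<lambda>x. a * h x + k x)"
proof -
  have fh: "f \<in> L2 N" "h \<in> L2 N" "\<And>u. u \<in> D \<Longrightarrow> ip (A u) f = ip u h"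
    and gk: "g \<in> L2 N" "k \<in> L2 N" "\<And>u. u \<in> D \<Longrightarrow> ip (A u) g = ip u k"
    using assms unfolding Gr_adjoint_rel adjoint_rel_def by blast+
  have "ip (A u) (\<lambda>x. a * f x + g x) = ip u (\<lambda>x. a * h x + k x)" if u: "u \<in> D" for u
    using L2_inner_lin_right[OF fh(1) gk(1) A_L2[OF u], of a] L2_inner_lin_right[OF fh(2) gk(2) D_L2[OF u], of a]
      fh(3)[OF u] gk(3)[OF u] by argo
  then show ?thesis
    unfolding Gr_adjoint_rel adjoint_rel_def using L2_lin[OF fh(1) gk(1)] L2_lin[OF fh(2) gk(2)] by blast
qed

lemma Gr_cong:
  assumes "Gr f h" and f': "f' \<in> L2 N" and h': "h' \<in> L2 N" and ff: "AE x in N. f x = f' x" and hh: "AE x in N. h x = h' x"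
  shows "Gr f' h'"
proof -
  have fh: "f \<in> L2 N" "h \<in> L2 N" "\<And>u. u \<in> D \<Longrightarrow> ip (A u) f = ip u h"
    using assms(1) unfolding Gr_adjoint_rel adjoint_rel_def by blast+
  have "ip (A u) f' = ip u h'" if u: "u \<in> D" for u
    using L2_inner_cong_right[OF A_L2[OF u] fh(1) f' ff] L2_inner_cong_right[OF D_L2[OF u] fh(2) h' hh]
      fh(3)[OF u] by argo
  then show ?thesis
    unfolding Gr_adjoint_rel adjoint_rel_def using f' h' by blast
qed

lemma Gr_diff: "Gr f h \<Longrightarrow> Gr g k \<Longrightarrow> Gr (\<lambda>x. f x - g x) (\<lambda>x. h x - k x)"
  using Gr_lin[of g k f h "-1"] by simp

lemma Gr_symm: assumes fh: "Gr f h" and gk: "Gr g k" shows "ip h g = ip f k"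
proof -
  have "ip h g = ip (A f) g"
    by (rule L2_inner_cong_left[OF Gr_L2(2)[OF fh] A_L2 Gr_L2(1)[OF gk] AE_eq_sym[OF Gr_L2(4)[OF fh]]]) (rule Gr_L2(3)[OF fh])
  also have "\<dots> = ip f k" using gk Gr_L2(3)[OF fh] unfolding Gr_adjoint_rel adjoint_rel_def by blast
  finally show ?thesis .
qed

lemma orth_D: "h \<in> L2 N \<Longrightarrow> (\<And>g. g \<in> D \<Longrightarrow> ip h g = 0) \<Longrightarrow> AE x in N. h x = 0"
proof -
  assume h: "h \<in> L2 N" and o: "\<And>g. g \<in> D \<Longrightarrow> ip h g = 0"
  have "(nrm h)\<^sup>2 \<le> nrm h * e" if e: "e > 0" for e
  proof -
    have "\<forall>f\<in>L2 N. \<forall>\<epsilon>>0. \<exists>g\<in>D. nrm (\<lambda>x. f x - g x) < \<epsilon>"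
      using sa by (simp add: self_adjoint_def)
    then obtain g where g: "g \<in> D" "nrm (\<lambda>x. h x - g x) < e"
      using h e by blast
    have "(nrm h)\<^sup>2 = Re (ip h (\<lambda>x. h x - g x))"
      using o[OF g(1)] h D_L2[OF g(1)] by (simp add: L2_inner_diff_right Re_L2_inner_self)
    also have "\<dots> \<le> cmod (ip h (\<lambda>x. h x - g x))" by (rule complex_Re_le_cmod)
    also have "\<dots> \<le> nrm h * nrm (\<lambda>x. h x - g x)"
      using h D_L2[OF g(1)] by (intro L2_Cauchy_Schwarz L2_diff)
    also have "\<dots> \<le> nrm h * e" using g(2) by (intro mult_left_mono) auto
    finally show ?thesis .
  qed
  note * = this
  have "nrm h = 0"
  proof (rule ccontr)
    assume "nrm h \<noteq> 0"
    then have p: "nrm h > 0" using L2_norm_nonneg[of N h] by linarith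
    from *[of "nrm h / 2"] p show False by (simp add: power2_eq_square)
  qed
  then show ?thesis using L2_norm_eq_0_iff[OF h] by simp
qed

lemma orthE: "orth_proj N (E t)"
  using sf by (simp add: spectral_family_def resolution_of_identity_def)

lemma E_L2: "f \<in> L2 N \<Longrightarrow> E t f \<in> L2 N"
  using orthE by (auto simp: orth_proj_def)

lemma E_symm: "f \<in> L2 N \<Longrightarrow> g \<in> L2 N \<Longrightarrow> ip (E t f) g = ip f (E t g)"
  using orthE by (auto simp: orth_proj_def)

lemma E_lin: "f \<in> L2 N \<Longrightarrow> g \<in> L2 N \<Longrightarrow> k \<in> L2 N \<Longrightarrow> ip (E t (\<lambda>x. a * f x + g x)) k = a * ip (E t f) k + ip (E t g) k"
  by (simp add: E_symm L2_lin L2_inner_lin_left E_L2)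

lemma E_add: "f \<in> L2 N \<Longrightarrow> g \<in> L2 N \<Longrightarrow> k \<in> L2 N \<Longrightarrow> ip (E t (\<lambda>x. f x + g x)) k = ip (E t f) k + ip (E t g) k"
  using E_lin[of f g k t 1] by simp

lemma E_diff: "f \<in> L2 N \<Longrightarrow> g \<in> L2 N \<Longrightarrow> k \<in> L2 N \<Longrightarrow> ip (E t (\<lambda>x. f x - g x)) k = ip (E t f) k - ip (E t g) k"
  using E_lin[of g f k t "-1"] by simp

lemma E_scale: "f \<in> L2 N \<Longrightarrow> k \<in> L2 N \<Longrightarrow> ip (E t (\<lambda>x. a * f x)) k = a * ip (E t f) k"
  by (simp add: E_symm L2_scale L2_inner_scale_left)

text \<open>Only the order s \<le> t is part of the definition of a resolution of the identity; the
  other order follows by taking adjoints.\<close>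

lemma E_E:
  assumes f: "f \<in> L2 N" and g: "g \<in> L2 N"
  shows "ip (E s (E t f)) g = ip (E (min s t) f) g"
proof -
  have *: "ip (E s (E t f)) g = ip (E s f) g" if "s \<le> t" "f \<in> L2 N" "g \<in> L2 N" for s t f g
    using that sf by (intro L2_inner_cong_left E_L2) (auto simp: spectral_family_def resolution_of_identity_def)
  show ?thesis
  proof (cases "s \<le> t")
    case True then show ?thesis using *[OF True f g] by simp
  next
    case False
    then have "t \<le> s" by simp
    have "ip (E s (E t f)) g = ip f (E t (E s g))" using f g by (simp add: E_symm E_L2)
    also have "\<dots> = cnj (ip (E t (E s g)) f)" by (rule L2_inner_commute)
    also have "\<dots> = cnj (ip (E t g) f)" using *[OF \<open>t \<le> s\<close> g f] by simp
    also have "\<dots> = ip f (E t g)" by (rule L2_inner_commute[symmetric])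
    also have "\<dots> = ip (E t f) g" using f g by (simp add: E_symm)
    finally show ?thesis using \<open>t \<le> s\<close> by simp
  qed
qed

lemma E_inner: "f \<in> L2 N \<Longrightarrow> g \<in> L2 N \<Longrightarrow> ip (E s f) (E t g) = ip (E (min s t) f) g"
  using E_E[of f g t s] E_symm[of "E s f" g t] by (simp add: E_L2 min.commute)

text \<open>The distribution function of the scalar spectral measure of f.\<close>

definition F :: "('a \<Rightarrow> complex) \<Rightarrow> real \<Rightarrow> real" where "F f t = Re (ip (E t f) f)"

lemma F_eq: "f \<in> L2 N \<Longrightarrow> F f t = (nrm (E t f))\<^sup>2"
  using E_inner[of f f t t] by (simp add: F_def flip: Re_L2_inner_self)

text \<open>For a \<le> b, the spectral projection of the half-open interval (a, b].\<close>

definition P :: "real \<Rightarrow> real \<Rightarrow> ('a \<Rightarrow> complex) \<Rightarrow> ('a \<Rightarrow> complex)" where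
  "P a b f = (\<lambda>x. E b f x - E a f x)"

lemma P_L2: "f \<in> L2 N \<Longrightarrow> P a b f \<in> L2 N"
  unfolding P_def by (intro L2_diff E_L2)

lemma P_inner: "f \<in> L2 N \<Longrightarrow> g \<in> L2 N \<Longrightarrow> ip (P a b f) g = ip (E b f) g - ip (E a f) g"
  unfolding P_def by (intro L2_inner_diff_left E_L2)

lemma P_symm: "f \<in> L2 N \<Longrightarrow> g \<in> L2 N \<Longrightarrow> ip (P a b f) g = ip f (P a b g)"
  unfolding P_def by (simp add: L2_inner_diff_left L2_inner_diff_right E_L2 E_symm)

lemma E_P: "a \<le> b \<Longrightarrow> f \<in> L2 N \<Longrightarrow> g \<in> L2 N \<Longrightarrow> ip (E t (P a b f)) g = ip (E (min t b) f) g - ip (E (min t a) f) g"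
  unfolding P_def by (simp add: E_diff E_L2 E_E)

lemma P_P: "a \<le> b \<Longrightarrow> f \<in> L2 N \<Longrightarrow> g \<in> L2 N \<Longrightarrow> ip (P a b (P a b f)) g = ip (P a b f) g"
  by (simp add: P_inner P_L2 E_P min_def)

lemma P_idem_inner: "a \<le> b \<Longrightarrow> f \<in> L2 N \<Longrightarrow> g \<in> L2 N \<Longrightarrow> ip (P a b f) (P a b g) = ip (P a b f) g"
  using P_P[of a b f g] P_symm[of "P a b f" g a b] by (simp add: P_L2)

lemma P_norm_sq: "a \<le> b \<Longrightarrow> f \<in> L2 N \<Longrightarrow> (nrm (P a b f))\<^sup>2 = F f b - F f a"
  using P_idem_inner[of a b f f] P_inner[of f f a b] by (simp add: F_def flip: Re_L2_inner_self)

lemma P_norm_sq_inner: "a \<le> b \<Longrightarrow> f \<in> L2 N \<Longrightarrow> of_real ((nrm (P a b f))\<^sup>2) = ip (P a b f) f"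
  using P_idem_inner[of a b f f] L2_inner_self[of N "P a b f"] by simp

lemma F_mono: "f \<in> L2 N \<Longrightarrow> s \<le> t \<Longrightarrow> F f s \<le> F f t"
  using P_norm_sq[of s t f] zero_le_power2[of "nrm (P s t f)"] by linarith

lemma F_right_cont: assumes f: "f \<in> L2 N" shows "continuous (at_right a) (F f)"
proof -
  have "((\<lambda>s. nrm (\<lambda>x. E s f x - E a f x)) \<longlongrightarrow> 0) (at_right a)"
    using sf f by (simp add: spectral_family_def resolution_of_identity_def)
  then have "((\<lambda>s. F f a + (nrm (P a s f))\<^sup>2) \<longlongrightarrow> F f a + 0\<^sup>2) (at_right a)"
    unfolding P_def by (intro tendsto_intros)
  moreover have "\<forall>\<^sub>F s in at_right a. F f a + (nrm (P a s f))\<^sup>2 = F f s"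
    using P_norm_sq[OF _ f] by (auto simp: eventually_at_right_field intro!: exI[of _ "a+1"])
  ultimately show ?thesis
    unfolding continuous_within by (simp cong: filterlim_cong)
qed

lemma F_at_bot: assumes f: "f \<in> L2 N" shows "(F f \<longlongrightarrow> 0) at_bot"
proof -
  have "((\<lambda>s. nrm (E s f)) \<longlongrightarrow> 0) at_bot"
    using sf f by (simp add: spectral_family_def resolution_of_identity_def)
  then have "((\<lambda>s. (nrm (E s f))\<^sup>2) \<longlongrightarrow> 0\<^sup>2) at_bot" by (intro tendsto_intros)
  moreover have "F f = (\<lambda>s. (nrm (E s f))\<^sup>2)" using F_eq[OF f] by auto
  ultimately show ?thesis by simp
qed

lemma F_at_top: assumes f: "f \<in> L2 N" shows "(F f \<longlongrightarrow> (nrm f)\<^sup>2) at_top"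
proof -
  have "((\<lambda>s. nrm (\<lambda>x. E s f x - f x)) \<longlongrightarrow> 0) at_top"
    using sf f by (simp add: spectral_family_def resolution_of_identity_def)
  then have "((\<lambda>s. (nrm f)\<^sup>2 - (nrm (\<lambda>x. E s f x - f x))\<^sup>2) \<longlongrightarrow> (nrm f)\<^sup>2 - 0\<^sup>2) at_top" by (intro tendsto_intros)
  moreover have "(nrm f)\<^sup>2 - (nrm (\<lambda>x. E s f x - f x))\<^sup>2 = F f s" for s
    using L2_norm_diff_sq[OF E_L2[OF f] f, of s] F_eq[OF f, of s] by (simp add: F_def)
  ultimately show ?thesis by simp
qed

abbreviation "mu f \<equiv> spectral_measure N E f"

lemma mu_eq: "mu f = interval_measure (F f)"
  by (simp add: spectral_measure_def F_def[abs_def])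

lemma sets_mu [simp, measurable_cong]: "sets (mu f) = sets borel" and space_mu [simp]: "space (mu f) = UNIV"
  by (simp_all add: mu_eq)

lemma mu_Ioc: "f \<in> L2 N \<Longrightarrow> a \<le> b \<Longrightarrow> measure (mu f) {a<..b} = F f b - F f a"
  unfolding mu_eq by (intro measure_interval_measure_Ioc F_mono F_right_cont)

lemma mu_Iic: "f \<in> L2 N \<Longrightarrow> emeasure (mu f) {..a} = ennreal (F f a)"
  unfolding mu_eq by (intro emeasure_interval_measure_Iic F_mono F_right_cont F_at_bot)

lemma emeasure_mu_UNIV: assumes f: "f \<in> L2 N" shows "emeasure (mu f) UNIV = ennreal ((nrm f)\<^sup>2)"
proof -
  have "(\<lambda>n. emeasure (mu f) {..real n}) \<longlonglongrightarrow> emeasure (mu f) (\<Union>n. {..real n})"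
    by (intro Lim_emeasure_incseq) (auto simp: incseq_def)
  moreover have "(\<Union>n. {..real n}) = UNIV" using real_arch_simple by auto
  moreover have "(\<lambda>n. F f (real n)) \<longlonglongrightarrow> (nrm f)\<^sup>2"
    by (rule filterlim_compose[OF F_at_top[OF f] filterlim_real_sequentially])
  then have "(\<lambda>n. emeasure (mu f) {..real n}) \<longlonglongrightarrow> ennreal ((nrm f)\<^sup>2)"
    unfolding mu_Iic[OF f] by (rule tendsto_ennrealI)
  ultimately show ?thesis using LIMSEQ_unique by auto
qed

lemma finite_mu: "f \<in> L2 N \<Longrightarrow> finite_measure (mu f)"
  by (intro finite_measureI) (simp add: emeasure_mu_UNIV)

lemma measure_mu_le: "f \<in> L2 N \<Longrightarrow> measure (mu f) B \<le> (nrm f)\<^sup>2"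
  using finite_measure.bounded_measure[OF finite_mu, of f B] emeasure_mu_UNIV[of f] by (simp add: measure_def)

end

section \<open>Support and additivity of the scalar spectral measures\<close>

context spectral_resolution
begin

lemma mu_lower: assumes v: "v \<in> L2 N" and a: "AE x in N. E a v x = 0" shows "AE t in mu v. a < t"
proof -
  have "F v a = 0" using a F_eq[OF v] L2_norm_eq_0_iff[OF E_L2[OF v]] by simp
  then have "{..a} \<in> null_sets (mu v)" using mu_Iic[OF v] by (auto intro: null_setsI)
  then show ?thesis by (rule AE_I') auto
qed

lemma mu_upper: assumes v: "v \<in> L2 N" and b: "AE x in N. E b v x = v x" shows "AE t in mu v. t \<le> b"
proof -
  interpret finite_measure "mu v" using finite_mu[OF v] .
  have "F v b = (nrm v)\<^sup>2" using F_eq[OF v] L2_norm_cong_AE[OF E_L2[OF v] v b] by simp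
  then have "emeasure (mu v) (UNIV - {..b}) = 0"
    using emeasure_compl[of "{..b}" "mu v"] mu_Iic[OF v] emeasure_mu_UNIV[OF v] by simp
  then have "UNIV - {..b} \<in> null_sets (mu v)" by (auto intro: null_setsI)
  then show ?thesis by (rule AE_I') auto
qed

lemma F_add:
  "f \<in> L2 N \<Longrightarrow> g \<in> L2 N \<Longrightarrow> F (\<lambda>x. f x + g x) t = F f t + F g t + 2 * Re (ip (E t f) g)"
proof -
  assume f: "f \<in> L2 N" and g: "g \<in> L2 N"
  have "ip (E t g) f = cnj (ip (E t f) g)"
    using E_symm[OF g f, of t] L2_inner_commute[of N g "E t f"] by simp
  then show ?thesis using f g by (simp add: F_def E_add L2_add L2_inner_add_right E_L2)
qed

lemma F_scale: "f \<in> L2 N \<Longrightarrow> F (\<lambda>x. c * f x) t = (cmod c)\<^sup>2 * F f t"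
proof -
  assume f: "f \<in> L2 N"
  have "ip (E t (\<lambda>x. c * f x)) (\<lambda>x. c * f x) = (c * cnj c) * ip (E t f) f"
    using f by (simp add: E_scale L2_scale L2_inner_scale_right mult_ac)
  also have "c * cnj c = of_real ((cmod c)\<^sup>2)" by (simp only: complex_norm_square)
  finally show ?thesis by (simp only: F_def Re_complex_of_real times_complex.sel Im_complex_of_real mult_zero_left diff_zero)
qed

text \<open>The cross term in the distribution function of f + g is 2 Re (E t f, g), which the
  hypothesis kills for every t.\<close>

lemma mu_add:
  assumes f: "f \<in> L2 N" and g: "g \<in> L2 N" and o: "\<And>t. ip (E t f) g = 0" and B: "B \<in> sets borel"
  shows "emeasure (mu (\<lambda>x. f x + g x)) B = emeasure (mu f) B + emeasure (mu g) B"
proof -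
  have fn: "finite_measure (null_measure (borel :: real measure))" by (intro finite_measureI) simp
  have "emeasure (mu (\<lambda>x. f x + g x)) B + emeasure (null_measure borel) B = emeasure (mu f) B + emeasure (mu g) B"
  proof (rule emeasure_add_eqI_Ioc)
    fix a b :: real assume ab: "a \<le> b"
    show "measure (mu (\<lambda>x. f x + g x)) {a<..b} + measure (null_measure borel) {a<..b} =
         measure (mu f) {a<..b} + measure (mu g) {a<..b}"
      using f g ab o by (simp add: mu_Ioc L2_add F_add measure_def[of "null_measure borel"])
  qed (intro finite_mu L2_add f g sets_mu B fn sets_null_measure)+
  then show ?thesis by simp
qed

text \<open>The scalar measures are quadratic in the vector, so the factor 2 of the parallelogram
  law is carried by the vectors as sqrt 2. Its use is to bound the mass that f + g gives to a set by
  the masses of the two summands.\<close>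

lemma mu_parallelogram:
  assumes f: "f \<in> L2 N" and g: "g \<in> L2 N" and B: "B \<in> sets borel"
  defines "c \<equiv> complex_of_real (sqrt 2)"
  shows "emeasure (mu (\<lambda>x. f x + g x)) B \<le> emeasure (mu (\<lambda>x. c * f x)) B + emeasure (mu (\<lambda>x. c * g x)) B"
proof -
  have "F (\<lambda>x. f x - g x) t = F f t + F g t - 2 * Re (ip (E t f) g)" for t
    using F_add[OF f L2_scale[OF g, of "-1"]] F_scale[OF g, of "-1"] L2_inner_scale_right[of N "E t f" "-1" g] by simp
  note F_diff = this
  have "emeasure (mu (\<lambda>x. f x + g x)) B + emeasure (mu (\<lambda>x. f x - g x)) B = emeasure (mu (\<lambda>x. c * f x)) B + emeasure (mu (\<lambda>x. c * g x)) B"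
  proof (rule emeasure_add_eqI_Ioc)
    fix a b :: real assume ab: "a \<le> b"
    have "(cmod c)\<^sup>2 = 2" by (simp add: c_def)
    then show "measure (mu (\<lambda>x. f x + g x)) {a<..b} + measure (mu (\<lambda>x. f x - g x)) {a<..b} =
         measure (mu (\<lambda>x. c * f x)) {a<..b} + measure (mu (\<lambda>x. c * g x)) {a<..b}"
      using f g ab by (simp add: mu_Ioc L2_add L2_diff L2_scale F_add F_diff F_scale)
  qed (intro finite_mu L2_add L2_diff L2_scale f g sets_mu B)+
  moreover have "emeasure (mu (\<lambda>x. f x + g x)) B \<le> emeasure (mu (\<lambda>x. f x + g x)) B + emeasure (mu (\<lambda>x. f x - g x)) B"
    by simp
  ultimately show ?thesis by simp
qed

end

section \<open>Spectral subspaces of bounded intervals\<close>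

context spectral_resolution
begin

lemma P_idem: "a \<le> b \<Longrightarrow> f \<in> L2 N \<Longrightarrow> AE x in N. P a b (P a b f) x = P a b f x"
  by (rule L2_eqI) (simp_all add: P_L2 P_P)

lemma E_P_upper: "a \<le> b \<Longrightarrow> f \<in> L2 N \<Longrightarrow> AE x in N. E b (P a b f) x = P a b f x"
  by (rule L2_eqI) (simp_all add: P_L2 E_L2 E_P P_inner min_def)

lemma E_P_lower: "a \<le> b \<Longrightarrow> f \<in> L2 N \<Longrightarrow> AE x in N. E a (P a b f) x = 0"
proof -
  assume ab: "a \<le> b" and f: "f \<in> L2 N"
  have "AE x in N. E a (P a b f) x = (\<lambda>x. 0) x"
    by (rule L2_eqI) (use ab f in \<open>simp_all add: P_L2 E_L2 E_P min_def\<close>)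
  then show ?thesis by simp
qed

definition inran :: "real \<Rightarrow> real \<Rightarrow> ('a \<Rightarrow> complex) \<Rightarrow> bool" where
  "inran a b v \<longleftrightarrow> v \<in> L2 N \<and> (AE x in N. P a b v x = v x)"

lemma inran_L2: "inran a b v \<Longrightarrow> v \<in> L2 N" and inran_AE: "inran a b v \<Longrightarrow> AE x in N. P a b v x = v x"
  by (auto simp: inran_def)

lemma inran_P: "a \<le> b \<Longrightarrow> f \<in> L2 N \<Longrightarrow> inran a b (P a b f)"
  using P_idem P_L2 by (simp add: inran_def)

lemma inran_inner: "inran a b v \<Longrightarrow> k \<in> L2 N \<Longrightarrow> ip v k = ip (P a b v) k"
  by (rule L2_inner_cong_left[OF inran_L2 P_L2[OF inran_L2] _ AE_eq_sym[OF inran_AE]])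

lemma inran_inner_P: "inran a b v \<Longrightarrow> k \<in> L2 N \<Longrightarrow> ip v (P a b k) = ip v k"
  using inran_inner[of a b v k] P_symm[of v k a b] inran_L2 by simp

lemma P_lin:
  assumes f: "f \<in> L2 N" and g: "g \<in> L2 N"
  shows "AE x in N. P a b (\<lambda>x. c * f x + g x) x = c * P a b f x + P a b g x"
proof (rule L2_eqI)
  fix k assume k: "k \<in> L2 N"
  have "ip (P a b (\<lambda>x. c * f x + g x)) k = ip (\<lambda>x. c * f x + g x) (P a b k)"
    by (rule P_symm[OF L2_lin[OF f g] k])
  also have "\<dots> = c * ip f (P a b k) + ip g (P a b k)" by (rule L2_inner_lin_left[OF f g P_L2[OF k]])
  also have "\<dots> = c * ip (P a b f) k + ip (P a b g) k" using P_symm[OF f k] P_symm[OF g k] by simp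
  also have "\<dots> = ip (\<lambda>x. c * P a b f x + P a b g x) k"
    by (rule L2_inner_lin_left[OF P_L2[OF f] P_L2[OF g] k, symmetric])
  finally show "ip (P a b (\<lambda>x. c * f x + g x)) k = ip (\<lambda>x. c * P a b f x + P a b g x) k" .
qed (intro P_L2 L2_lin f g)+

lemma inran_lin:
  assumes f: "inran a b f" and g: "inran a b g"
  shows "inran a b (\<lambda>x. c * f x + g x)"
proof -
  have "AE x in N. P a b (\<lambda>x. c * f x + g x) x = c * f x + g x"
    using P_lin[OF inran_L2[OF f] inran_L2[OF g], of a b c] inran_AE[OF f] inran_AE[OF g]
    by eventually_elim simp
  then show ?thesis using inran_L2[OF f] inran_L2[OF g] by (simp add: inran_def L2_lin)
qed

lemma inran_E_upper: assumes ab: "a \<le> b" and v: "inran a b v" shows "AE x in N. E b v x = v x"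
proof (rule L2_eqI)
  fix k assume k: "k \<in> L2 N"
  have "ip (E b v) k = ip v (E b k)" using inran_L2[OF v] k by (rule E_symm)
  also have "\<dots> = ip (P a b v) (E b k)" using v k by (intro inran_inner E_L2)
  also have "\<dots> = ip (E b (P a b v)) k" using E_symm[of "P a b v" k b] P_L2[OF inran_L2[OF v]] k by simp
  also have "\<dots> = ip (P a b v) k"
    by (rule L2_inner_cong_left[OF E_L2[OF P_L2[OF inran_L2[OF v]]] P_L2[OF inran_L2[OF v]] k E_P_upper[OF ab inran_L2[OF v]]])
  also have "\<dots> = ip v k" using inran_inner[OF v k] by simp
  finally show "ip (E b v) k = ip v k" .
qed (use inran_L2[OF v] E_L2 in auto)

lemma inran_E_lower: assumes ab: "a \<le> b" and v: "inran a b v" shows "AE x in N. E a v x = 0"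
proof -
  have "AE x in N. E a v x = (\<lambda>x. 0) x"
  proof (rule L2_eqI)
    fix k assume k: "k \<in> L2 N"
    have "ip (E a v) k = ip v (E a k)" using inran_L2[OF v] k by (rule E_symm)
    also have "\<dots> = ip (P a b v) (E a k)" using v k by (intro inran_inner E_L2)
    also have "\<dots> = ip (E a (P a b v)) k" using E_symm[of "P a b v" k a] P_L2[OF inran_L2[OF v]] k by simp
    also have "\<dots> = ip (\<lambda>x. 0) k"
      by (rule L2_inner_cong_left[OF E_L2[OF P_L2[OF inran_L2[OF v]]] L2_zero k E_P_lower[OF ab inran_L2[OF v]]])
    finally show "ip (E a v) k = ip (\<lambda>x. 0) k" .
  qed (use inran_L2[OF v] E_L2 in auto)
  then show ?thesis by simp
qed

lemma D_iff: "f \<in> D \<longleftrightarrow> f \<in> L2 N \<and> integrable (mu f) (\<lambda>t. t\<^sup>2)"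
  using sf by (auto simp: spectral_family_def)

lemma A_quadratic: "f \<in> D \<Longrightarrow> ip (A f) f = of_real (\<integral>t. t \<partial>mu f)"
  using sf by (simp add: spectral_family_def)

lemma D_integrable: assumes "f \<in> D" shows "integrable (mu f) (\<lambda>t. t)"
proof -
  interpret finite_measure "mu f" using finite_mu[OF D_L2[OF assms]] .
  have "integrable (mu f) (\<lambda>t. 1 + t\<^sup>2)" using assms D_iff by simp
  then show ?thesis
  proof (rule Bochner_Integration.integrable_bound)
    have "\<bar>t\<bar> \<le> \<bar>1 + t\<^sup>2\<bar>" for t :: real
    proof -
      have "2 * \<bar>t\<bar> \<le> 1 + \<bar>t\<bar>\<^sup>2" using sum_squares_bound[of 1 "\<bar>t\<bar>"] by simp
      then show ?thesis by auto
    qed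
    then show "AE t in mu f. norm t \<le> norm (1 + t\<^sup>2)" by simp
  qed simp
qed

lemma inran_D:
  assumes ab: "a \<le> b" and v: "inran a b v" shows "v \<in> D"
proof -
  interpret finite_measure "mu v" using finite_mu[OF inran_L2[OF v]] .
  have "AE t in mu v. norm (t\<^sup>2) \<le> (max \<bar>a\<bar> \<bar>b\<bar>)\<^sup>2"
    using mu_lower[OF inran_L2[OF v] inran_E_lower[OF ab v]] mu_upper[OF inran_L2[OF v] inran_E_upper[OF ab v]]
  proof eventually_elim
    case (elim t)
    then have "\<bar>t\<bar> \<le> max \<bar>a\<bar> \<bar>b\<bar>" by auto
    then have "\<bar>t\<bar>\<^sup>2 \<le> (max \<bar>a\<bar> \<bar>b\<bar>)\<^sup>2" by (rule power_mono) simp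
    then show ?case by simp
  qed
  then have "integrable (mu v) (\<lambda>t. t\<^sup>2)" by (rule integrable_const_bound) simp
  then show ?thesis using D_iff inran_L2[OF v] by simp
qed

lemma quadratic_eq:
  assumes "f \<in> D"
  shows "Re (ip (A f) f) - m * (nrm f)\<^sup>2 = (\<integral>t. t - m \<partial>mu f)"
proof -
  interpret finite_measure "mu f" using finite_mu[OF D_L2[OF assms]] .
  have "measure (mu f) UNIV = (nrm f)\<^sup>2"
    using emeasure_mu_UNIV[OF D_L2[OF assms]] by (simp add: measure_def)
  then show ?thesis using A_quadratic[OF assms] D_integrable[OF assms] by (simp add: mult.commute)
qed

lemma quadratic_ge:
  assumes f: "f \<in> D" and "AE x in N. E a f x = 0"
  shows "Re (ip (A f) f) - m * (nrm f)\<^sup>2 \<ge> (a - m) * (nrm f)\<^sup>2"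
proof -
  interpret finite_measure "mu f" using finite_mu[OF D_L2[OF f]] .
  have "(\<integral>t. a - m \<partial>mu f) \<le> (\<integral>t. t - m \<partial>mu f)"
    using mu_lower[OF D_L2[OF f] assms(2)] D_integrable[OF f] by (intro integral_mono_AE) auto
  moreover have "measure (mu f) UNIV = (nrm f)\<^sup>2"
    using emeasure_mu_UNIV[OF D_L2[OF f]] by (simp add: measure_def)
  ultimately show ?thesis unfolding quadratic_eq[OF f] by (simp add: mult.commute)
qed

lemma quadratic_le:
  assumes f: "f \<in> D" and "AE x in N. E b f x = f x"
  shows "Re (ip (A f) f) - m * (nrm f)\<^sup>2 \<le> (b - m) * (nrm f)\<^sup>2"
proof -
  interpret finite_measure "mu f" using finite_mu[OF D_L2[OF f]] .
  have "(\<integral>t. t - m \<partial>mu f) \<le> (\<integral>t. b - m \<partial>mu f)"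
    using mu_upper[OF D_L2[OF f] assms(2)] D_integrable[OF f] by (intro integral_mono_AE) auto
  moreover have "measure (mu f) UNIV = (nrm f)\<^sup>2"
    using emeasure_mu_UNIV[OF D_L2[OF f]] by (simp add: measure_def)
  ultimately show ?thesis unfolding quadratic_eq[OF f] by (simp add: mult.commute)
qed

text \<open>The family determines A only through (A f, f), so the mixed term must be recovered by
  polarization. The orthogonality hypothesis makes the measures of f and c g additive for every
  scalar c, hence cnj c (A f, g) + c (A g, f) = 0; the values 1 and i of c suffice.\<close>

lemma A_cross:
  assumes f: "f \<in> D" and g: "g \<in> D" and o: "\<And>t. ip (E t f) g = 0"
  shows "ip (A f) g = 0"
proof -
  note L = D_L2[OF f] D_L2[OF g] A_L2[OF f] A_L2[OF g]
  have key: "cnj c * ip (A f) g + c * ip (A g) f = 0" for c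
  proof -
    let ?g = "\<lambda>x. c * g x"
    have Gg: "Gr ?g (\<lambda>x. c * A g x)"
      using Gr_lin[OF Gr_A[OF g] Gr_lin[OF Gr_A[OF g] Gr_A[OF g], of "-1"], of c] by simp
    have Gfg: "Gr (\<lambda>x. f x + ?g x) (\<lambda>x. A f x + c * A g x)"
      using Gr_lin[OF Gr_A[OF f] Gg, of 1] by simp
    have o': "ip (E t f) ?g = 0" for t using o[of t] by (simp add: L2_inner_scale_right)
    have L': "?g \<in> L2 N" "(\<lambda>x. f x + ?g x) \<in> L2 N" using L by (auto intro: L2_scale L2_add)
    have "(\<integral>t. t \<partial>mu (\<lambda>x. f x + ?g x)) = (\<integral>t. t \<partial>mu f) + (\<integral>t. t \<partial>mu ?g)"
    proof (rule integral_add_measure(2))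
      fix B assume "B \<in> sets (mu (\<lambda>x. f x + ?g x))"
      then have "B \<in> sets borel" by simp
      then show "emeasure (mu (\<lambda>x. f x + ?g x)) B = emeasure (mu f) B + emeasure (mu ?g) B"
        by (rule mu_add[OF L(1) L'(1) o'])
    qed (intro D_integrable f Gr_L2(3)[OF Gg] | simp)+
    then have "ip (A (\<lambda>x. f x + ?g x)) (\<lambda>x. f x + ?g x) = ip (A f) f + ip (A ?g) ?g"
      using A_quadratic[OF f] A_quadratic[OF Gr_L2(3)[OF Gg]] A_quadratic[OF Gr_L2(3)[OF Gfg]] by simp
    moreover have "ip (A (\<lambda>x. f x + ?g x)) (\<lambda>x. f x + ?g x) = ip (\<lambda>x. A f x + c * A g x) (\<lambda>x. f x + ?g x)"
      by (rule L2_inner_cong_left[OF A_L2[OF Gr_L2(3)[OF Gfg]] Gr_L2(2)[OF Gfg] L'(2) Gr_L2(4)[OF Gfg]])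
    moreover have "ip (A ?g) ?g = ip (\<lambda>x. c * A g x) ?g"
      by (rule L2_inner_cong_left[OF A_L2[OF Gr_L2(3)[OF Gg]] Gr_L2(2)[OF Gg] L'(1) Gr_L2(4)[OF Gg]])
    moreover have "ip (\<lambda>x. A f x + c * A g x) (\<lambda>x. f x + ?g x)
        = ip (A f) f + cnj c * ip (A f) g + c * ip (A g) f + c * cnj c * ip (A g) g"
      using L by (simp add: L2_inner_simps ring_distribs)
    moreover have "ip (\<lambda>x. c * A g x) ?g = c * cnj c * ip (A g) g"
      by (simp add: L2_inner_scale_left L2_inner_scale_right)
    ultimately have "ip (A f) f + cnj c * ip (A f) g + c * ip (A g) f + c * cnj c * ip (A g) g
        = ip (A f) f + c * cnj c * ip (A g) g"
      by metis
    then show ?thesis by (simp add: add.assoc)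
  qed
  have "ip (A g) f = ip g (A f)" by (rule Gr_symm[OF Gr_A[OF g] Gr_A[OF f]])
  then have *: "ip (A g) f = cnj (ip (A f) g)" using L2_inner_commute[of N g "A f"] by simp
  define z where "z = ip (A f) g"
  have "z + cnj z = 0" "- \<i> * z + \<i> * cnj z = 0"
    using key[of 1] key[of \<i>] unfolding * by (simp_all add: z_def)
  then have "z = 0" by (simp add: complex_eq_iff)
  then show ?thesis by (simp add: z_def)
qed

lemma E_split_orth: "u \<in> L2 N \<Longrightarrow> ip (E t (E c u)) (\<lambda>x. u x - E c u x) = 0"
proof -
  assume u: "u \<in> L2 N"
  have "ip (E t (E c u)) (\<lambda>x. u x - E c u x) = ip (E (min t c) u) u - ip (E c (E t (E c u))) u"
    using u E_symm[of "E t (E c u)" u c] by (simp add: L2_inner_diff_right E_L2 E_E)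
  also have "ip (E c (E t (E c u))) u = ip (E (min t c) u) u"
    using u E_E[of "E c u" u c t] E_E[of u u "min c t" c] by (simp add: E_L2 min.commute)
  finally show ?thesis by simp
qed

lemma E_D: assumes u: "u \<in> D" shows "E c u \<in> D" "(\<lambda>x. u x - E c u x) \<in> D"
proof -
  note uL = D_L2[OF u]
  note L = E_L2[OF uL, of c] L2_diff[OF uL E_L2[OF uL, of c]]
  have "integrable (mu (\<lambda>x. E c u x + (u x - E c u x))) (\<lambda>t. t\<^sup>2) \<longleftrightarrow>
      integrable (mu (E c u)) (\<lambda>t. t\<^sup>2) \<and> integrable (mu (\<lambda>x. u x - E c u x)) (\<lambda>t. t\<^sup>2)"
    by (rule integral_add_measure(1)) (use mu_add[OF L E_split_orth[OF uL]] in auto)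
  then have "integrable (mu (E c u)) (\<lambda>t. t\<^sup>2) \<and> integrable (mu (\<lambda>x. u x - E c u x)) (\<lambda>t. t\<^sup>2)"
    using u D_iff by simp
  then show "E c u \<in> D" "(\<lambda>x. u x - E c u x) \<in> D" using L D_iff by auto
qed

lemma inran_orth: assumes "inran a b v" "g \<in> L2 N" "a \<le> b" shows "ip (E t v) (\<lambda>x. g x - P a b g x) = 0"
proof -
  note vL = inran_L2[OF assms(1)]
  have "ip (E t v) (P a b g) = ip v (E t (P a b g))" using vL assms by (intro E_symm P_L2)
  also have "\<dots> = cnj (ip (E t (P a b g)) v)" by (rule L2_inner_commute)
  also have "\<dots> = cnj (ip (E (min t b) g) v - ip (E (min t a) g) v)" using assms vL by (simp add: E_P)
  also have "ip (E (min t b) g) v = ip (E t g) (E b v)"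
    using assms vL E_E[of g v b t] E_symm[of "E t g" v b] by (simp add: min.commute E_L2)
  also have "\<dots> = ip (E t g) v"
    using inran_E_upper[OF assms(3,1)] assms(2) vL by (intro L2_inner_cong_right E_L2)
  also have "ip (E (min t a) g) v = ip (E t g) (E a v)"
    using assms vL E_E[of g v a t] E_symm[of "E t g" v a] by (simp add: min.commute E_L2)
  also have "\<dots> = ip (E t g) (\<lambda>x. 0)"
    using inran_E_lower[OF assms(3,1)] assms(2) vL by (intro L2_inner_cong_right E_L2 L2_zero)
  finally have "ip (E t v) (P a b g) = cnj (ip (E t g) v)" by simp
  also have "\<dots> = ip v (E t g)" by (rule L2_inner_commute[symmetric])
  also have "\<dots> = ip (E t v) g" using E_symm[OF vL assms(2)] by simp
  finally show ?thesis using assms vL by (simp add: L2_inner_diff_right E_L2 P_L2)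
qed

lemma P_D: assumes "u \<in> D" "a \<le> b" shows "P a b u \<in> D" "(\<lambda>x. u x - P a b u x) \<in> D"
proof -
  show *: "P a b u \<in> D" using inran_D[OF assms(2) inran_P[OF assms(2) D_L2[OF assms(1)]]] .
  show "(\<lambda>x. u x - P a b u x) \<in> D"
    using Gr_diff[OF Gr_A[OF assms(1)] Gr_A[OF *]] Gr_L2(3) by blast
qed

text \<open>Tested against g in D, the component of A v outside the subspace becomes (A v, g - P g),
  and g - P g shares no spectral mass with v, so \<open>A_cross\<close> applies.\<close>

lemma A_inran: assumes ab: "a \<le> b" and v: "inran a b v" shows "inran a b (A v)"
proof -
  note vD = inran_D[OF ab v]
  note AvL = A_L2[OF vD]
  have "AE x in N. A v x - P a b (A v) x = 0"
  proof (rule orth_D)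
    fix g assume g: "g \<in> D"
    have "ip (A v) (\<lambda>x. g x - P a b g x) = 0"
      by (rule A_cross[OF vD P_D(2)[OF g ab]]) (rule inran_orth[OF v D_L2[OF g] ab])
    then show "ip (\<lambda>x. A v x - P a b (A v) x) g = 0"
      using AvL D_L2[OF g] P_symm[OF AvL D_L2[OF g], of a b]
      by (simp add: L2_inner_diff_right L2_inner_diff_left P_L2)
  qed (intro L2_diff P_L2 AvL)
  then have "AE x in N. P a b (A v) x = A v x" by eventually_elim simp
  then show ?thesis using AvL by (simp add: inran_def)
qed

lemma inran_shift: assumes ab: "a \<le> b" and v: "inran a b v" shows "inran a b (\<lambda>x. A v x - m * v x)"
  using inran_lin[OF v A_inran[OF ab v], of "- m"] by simp

text \<open>On the subspace the quadratic form q of A - m satisfies |q(u)| \<le> r ||u||^2. For a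
  symmetric operator this bounds the norm: with y = (A - m) v, polarization gives 4 s ||y||^2 = q(v
  + s y) - q(v - s y), where y lies in the subspace again.\<close>

lemma inran_norm_le:
  assumes r: "r > 0" and v: "inran (m - r) (m + r) v"
  shows "nrm (\<lambda>x. A v x - of_real m * v x) \<le> r * nrm v"
proof -
  have ab: "m - r \<le> m + r" using r by simp
  define y where "y = (\<lambda>x. A v x - of_real m * v x)"
  have y: "inran (m - r) (m + r) y" unfolding y_def by (rule inran_shift[OF ab v])
  note vD = inran_D[OF ab v] and yD = inran_D[OF ab y]
  note L = D_L2[OF vD] D_L2[OF yD] A_L2[OF vD] A_L2[OF yD]
  let ?q = "\<lambda>u. Re (ip (A u) u) - m * (nrm u)\<^sup>2"
  have q: "\<bar>?q u\<bar> \<le> r * (nrm u)\<^sup>2" if "inran (m - r) (m + r) u" for u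
    using quadratic_le[OF inran_D[OF ab that] inran_E_upper[OF ab that], of m]
      quadratic_ge[OF inran_D[OF ab that] inran_E_lower[OF ab that], of m] by (simp add: abs_le_iff)
  \<comment> \<open>With this s the form bound returns 2 ||y||^2 on the right after multiplication
    by r, half of the 4 ||y||^2 on the left.\<close>
  define s where "s = 1 / r"
  have s: "s > 0" using r by (simp add: s_def)
  have nq: "(nrm (\<lambda>x. of_real c * y x + v x))\<^sup>2 = c\<^sup>2 * (nrm y)\<^sup>2 + (nrm v)\<^sup>2 + 2 * c * Re (ip y v)" for c :: real
    using L by (simp add: L2_norm_add_sq L2_scale L2_norm_scale L2_inner_scale_left power_mult_distrib)
  have qs: "?q (\<lambda>x. of_real c * y x + v x) = ?q v + c\<^sup>2 * ?q y + 2 * c * (nrm y)\<^sup>2" for c :: real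
  proof -
    let ?u = "\<lambda>x. of_real c * y x + v x"
    have G: "Gr ?u (\<lambda>x. of_real c * A y x + A v x)" by (rule Gr_lin[OF Gr_A[OF yD] Gr_A[OF vD]])
    have "ip (A ?u) ?u = ip (\<lambda>x. of_real c * A y x + A v x) ?u"
      by (rule L2_inner_cong_left[OF A_L2[OF Gr_L2(3)[OF G]] Gr_L2(2)[OF G] Gr_L2(1)[OF G] Gr_L2(4)[OF G]])
    also have "\<dots> = of_real (c\<^sup>2) * ip (A y) y + of_real c * ip (A y) v + of_real c * ip (A v) y + ip (A v) v"
      using L by (simp add: L2_inner_simps power2_eq_square algebra_simps)
    finally have 1: "Re (ip (A ?u) ?u) = c\<^sup>2 * Re (ip (A y) y) + c * Re (ip (A y) v) + c * Re (ip (A v) y) + Re (ip (A v) v)"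
      by simp
    note 2 = nq[of c]
    have 3: "(nrm y)\<^sup>2 = Re (ip (A v) y) - m * Re (ip v y)"
      using L unfolding Re_L2_inner_self[symmetric]
      by (subst y_def) (simp add: L2_inner_diff_left L2_inner_scale_left L2_scale)
    have 4: "Re (ip (A y) v) = Re (ip (A v) y)"
      using Gr_symm[OF Gr_A[OF yD] Gr_A[OF vD]] arg_cong[OF L2_inner_commute[of N y "A v"], of Re] by simp
    have 5: "Re (ip y v) = Re (ip v y)" using arg_cong[OF L2_inner_commute[of N v y], of Re] by simp
    have "?q ?u = ?q v + c\<^sup>2 * ?q y + 2 * c * (Re (ip (A v) y) - m * Re (ip v y))"
      unfolding 1 2 4 5 by (simp add: algebra_simps)
    then show ?thesis unfolding 3[symmetric] .
  qed
  have "4 * s * (nrm y)\<^sup>2 = ?q (\<lambda>x. of_real s * y x + v x) - ?q (\<lambda>x. of_real (- s) * y x + v x)"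
    unfolding qs by simp
  also have "\<dots> \<le> r * (nrm (\<lambda>x. of_real s * y x + v x))\<^sup>2 + r * (nrm (\<lambda>x. of_real (- s) * y x + v x))\<^sup>2"
    using q[OF inran_lin[OF y v, of "of_real s"]] q[OF inran_lin[OF y v, of "of_real (-s)"]] by linarith
  also have "\<dots> = 2 * r * ((nrm v)\<^sup>2 + s\<^sup>2 * (nrm y)\<^sup>2)"
    unfolding nq by (simp add: algebra_simps)
  finally have "4 * s * (nrm y)\<^sup>2 \<le> 2 * r * ((nrm v)\<^sup>2 + s\<^sup>2 * (nrm y)\<^sup>2)" .
  then have "r * (4 * s * (nrm y)\<^sup>2) \<le> r * (2 * r * ((nrm v)\<^sup>2 + s\<^sup>2 * (nrm y)\<^sup>2))"
    using r by (intro mult_left_mono) auto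
  moreover have "r * (4 * s * (nrm y)\<^sup>2) = 4 * (nrm y)\<^sup>2" using r by (simp add: s_def)
  moreover have "r * (2 * r * ((nrm v)\<^sup>2 + s\<^sup>2 * (nrm y)\<^sup>2)) = 2 * r\<^sup>2 * (nrm v)\<^sup>2 + 2 * (nrm y)\<^sup>2"
    using r by (simp add: s_def power2_eq_square algebra_simps)
  ultimately have "(nrm y)\<^sup>2 \<le> (r * nrm v)\<^sup>2" by (simp add: power_mult_distrib)
  then show ?thesis unfolding y_def by (rule power2_le_imp_le) (use r in simp)
qed

text \<open>The hypothesis says that u has no spectral mass in (m - r, m + r], so u splits into a
  lower and an upper part. Pairing (A - m) u with the upper part minus the lower part makes both
  contributions positive, and this reflected vector has the same norm as u.\<close>

lemma outside_norm_ge: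
  assumes u: "u \<in> D" and eq: "AE x in N. E (m + r) u x = E (m - r) u x"
  shows "r * nrm u \<le> nrm (\<lambda>x. A u x - of_real m * u x)"
proof -
  note uL = D_L2[OF u]
  define um where "um = E (m - r) u"
  define up where "up = (\<lambda>x. u x - E (m + r) u x)"
  have D: "um \<in> D" "up \<in> D" unfolding um_def up_def by (rule E_D[OF u])+
  note L = D_L2[OF D(1)] D_L2[OF D(2)] A_L2[OF D(1)] A_L2[OF D(2)]
  have umE: "AE x in N. E (m - r) um x = um x"
    by (rule L2_eqI) (use uL in \<open>simp_all add: um_def E_L2 E_E\<close>)
  have "AE x in N. E (m + r) up x = (\<lambda>x. 0) x"
    by (rule L2_eqI) (use uL in \<open>simp_all add: up_def E_L2 E_E E_diff L2_diff\<close>)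
  then have upE: "AE x in N. E (m + r) up x = 0" by simp
  have sum: "AE x in N. um x + up x = u x" using eq by eventually_elim (simp add: um_def up_def)
  have o: "ip (E t um) up = 0" for t
  proof -
    have "ip (E t um) up = ip (E t (E (m - r) u)) (\<lambda>x. u x - E (m - r) u x)"
      unfolding um_def
    proof (rule L2_inner_cong_right)
      show "AE x in N. up x = u x - E (m - r) u x" using eq by eventually_elim (simp add: up_def)
    qed (use L uL in \<open>auto intro: E_L2 L2_diff\<close>)
    then show ?thesis using E_split_orth[OF uL] by simp
  qed
  have o1: "ip um up = 0"
  proof -
    have "ip um up = ip (E (m - r) um) up" by (rule L2_inner_cong_left[OF L(1) E_L2[OF L(1)] L(2) AE_eq_sym[OF umE]])
    then show ?thesis using o by simp
  qed
  have c1: "ip (A um) up = 0" by (rule A_cross[OF D o])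
  have "ip (A up) um = ip up (A um)" by (rule Gr_symm[OF Gr_A[OF D(2)] Gr_A[OF D(1)]])
  also have "\<dots> = cnj (ip (A um) up)" by (rule L2_inner_commute)
  finally have c2: "ip (A up) um = 0" using c1 by simp
  have o2: "ip up um = 0" using L2_inner_commute[of N up um] o1 by simp
  define y where "y = (\<lambda>x. A u x - of_real m * u x)"
  define z where "z = (\<lambda>x. (A um x + A up x) - of_real m * (um x + up x))"
  have G: "Gr (\<lambda>x. um x + up x) (\<lambda>x. A um x + A up x)" using Gr_lin[OF Gr_A[OF D(1)] Gr_A[OF D(2)], of 1] by simp
  have G': "Gr u (\<lambda>x. A um x + A up x)"
    using Gr_cong[OF G uL Gr_L2(2)[OF G] sum] by simp
  have yL: "y \<in> L2 N" and zL: "z \<in> L2 N"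
    unfolding y_def z_def using uL A_L2[OF u] L by (auto intro!: L2_diff L2_scale L2_add)
  have "AE x in N. y x = z x" using Gr_L2(4)[OF G'] sum by eventually_elim (simp add: y_def z_def)
  then have ny: "nrm y = nrm z" by (rule L2_norm_cong_AE[OF yL zL])
  have nu: "(nrm u)\<^sup>2 = (nrm up)\<^sup>2 + (nrm um)\<^sup>2"
    using L2_norm_cong_AE[OF L2_add[OF L(1,2)] uL sum] L2_norm_add_sq[OF L(1,2)] o1 by simp
  have nd: "(nrm (\<lambda>x. up x - um x))\<^sup>2 = (nrm up)\<^sup>2 + (nrm um)\<^sup>2"
    using L2_norm_diff_sq[OF L(2,1)] o2 by simp
  then have nd': "nrm (\<lambda>x. up x - um x) = nrm u" using nu by (metis L2_norm_nonneg power2_eq_iff_nonneg)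
  have "r * (nrm u)\<^sup>2 \<le> (Re (ip (A up) up) - m * (nrm up)\<^sup>2) - (Re (ip (A um) um) - m * (nrm um)\<^sup>2)"
    using quadratic_ge[OF D(2) upE, of m] quadratic_le[OF D(1) umE, of m] unfolding nu by (simp add: algebra_simps)
  also have "\<dots> = Re (ip z (\<lambda>x. up x - um x))"
    unfolding z_def using L c1 c2 o1 o2 by (simp add: L2_inner_simps Re_L2_inner_self right_diff_distrib)
  also have "\<dots> \<le> cmod (ip z (\<lambda>x. up x - um x))" by (rule complex_Re_le_cmod)
  also have "\<dots> \<le> nrm z * nrm (\<lambda>x. up x - um x)" using zL L by (intro L2_Cauchy_Schwarz L2_diff)
  finally have "r * nrm u * nrm u \<le> nrm z * nrm u" unfolding nd' by (simp add: power2_eq_square)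
  then show ?thesis
    using L2_norm_nonneg[of N u] ny unfolding y_def
    by (cases "nrm u = 0") auto
qed

text \<open>The converse of \<open>inran_norm_le\<close>. The component of \<open>w 0\<close>
  outside the interval grows at least like r^n under A - m, yet it is dominated by the iterates,
  which grow at most like rho^n.\<close>

lemma inran_if_powers_bounded:
  assumes r: "0 \<le> \<rho>" "\<rho> < r"
    and G: "\<And>n. Gr (w n) (\<lambda>x. w (Suc n) x + of_real m * w n x)"
    and bd: "\<And>n. nrm (w n) \<le> C * \<rho> ^ n"
  shows "inran (m - r) (m + r) (w 0)"
proof -
  have ab: "m - r \<le> m + r" using r by simp
  let ?P = "P (m - r) (m + r)"
  define q where "q n = (\<lambda>x. w n x - ?P (w n) x)" for n
  have wL: "w n \<in> L2 N" and wD: "w n \<in> D" for n using Gr_L2[OF G[of n]] by auto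
  have qD: "q n \<in> D" for n unfolding q_def by (rule P_D(2)[OF wD ab])
  have step: "r * nrm (q n) \<le> nrm (q (Suc n))" for n
  proof -
    have "AE x in N. E (m + r) (q n) x = E (m - r) (q n) x"
      unfolding q_def by (rule L2_eqI) (use wL ab r in \<open>simp_all add: E_L2 E_diff L2_diff P_L2 E_P\<close>)
    from outside_norm_ge[OF qD this]
    have "r * nrm (q n) \<le> nrm (\<lambda>x. A (q n) x - of_real m * q n x)" .
    also have "\<dots> = nrm (q (Suc n))"
    proof (rule L2_norm_cong_AE)
      have PwD: "?P (w n) \<in> D" by (rule P_D(1)[OF wD ab])
      \<comment> \<open>The projection commutes with A. This is shown weakly, by moving A and the
        projection across the inner product onto k, whose projection lies in the domain.\<close>
      have A1: "AE x in N. ?P (A (w n)) x = A (?P (w n)) x"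
      proof (rule L2_eqI)
        fix k assume k: "k \<in> L2 N"
        have Pk: "inran (m - r) (m + r) (?P k)" by (rule inran_P[OF ab k])
        have "ip (?P (A (w n))) k = ip (A (w n)) (?P k)" using A_L2[OF wD] k by (rule P_symm)
        also have "\<dots> = ip (w n) (A (?P k))" by (rule Gr_symm[OF Gr_A[OF wD] Gr_A[OF inran_D[OF ab Pk]]])
        also have "\<dots> = cnj (ip (A (?P k)) (w n))" by (rule L2_inner_commute)
        also have "\<dots> = cnj (ip (A (?P k)) (?P (w n)))" using inran_inner_P[OF A_inran[OF ab Pk] wL] by simp
        also have "\<dots> = ip (?P (w n)) (A (?P k))" by (rule L2_inner_commute[symmetric])
        also have "\<dots> = ip (A (?P (w n))) (?P k)" by (rule Gr_symm[OF Gr_A[OF PwD] Gr_A[OF inran_D[OF ab Pk]], symmetric])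
        also have "\<dots> = ip (A (?P (w n))) k" by (rule inran_inner_P[OF A_inran[OF ab inran_P[OF ab wL]] k])
        finally show "ip (?P (A (w n))) k = ip (A (?P (w n))) k" .
      qed (use A_L2 wD PwD P_L2 in auto)
      have A2: "AE x in N. A (q n) x = A (w n) x - A (?P (w n)) x"
        unfolding q_def by (rule Gr_L2(4)[OF Gr_diff[OF Gr_A[OF wD] Gr_A[OF PwD]]])
      have A3: "AE x in N. A (w n) x = w (Suc n) x + of_real m * w n x" by (rule Gr_L2(4)[OF G])
      have A4: "AE x in N. ?P (A (w n)) x = of_real m * ?P (w n) x + ?P (w (Suc n)) x"
      proof -
        have "AE x in N. ?P (A (w n)) x = ?P (\<lambda>x. of_real m * w n x + w (Suc n) x) x"
        proof (rule L2_eqI)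
          fix k assume k: "k \<in> L2 N"
          have L': "(\<lambda>x. of_real m * w n x + w (Suc n) x) \<in> L2 N" using wL by (intro L2_lin)
          have "AE x in N. A (w n) x = of_real m * w n x + w (Suc n) x" using A3 by eventually_elim simp
          from L2_inner_cong_left[OF A_L2[OF wD] L' P_L2[OF k] this]
          show "ip (?P (A (w n))) k = ip (?P (\<lambda>x. of_real m * w n x + w (Suc n) x)) k"
            using P_symm[OF A_L2[OF wD] k] P_symm[OF L' k] by simp
        qed (use A_L2 wD wL in \<open>auto intro!: P_L2 L2_lin\<close>)
        with P_lin[OF wL wL, of "m - r" "m + r" "of_real m" n "Suc n"] show ?thesis by eventually_elim simp
      qed
      show "AE x in N. A (q n) x - of_real m * q n x = q (Suc n) x"
        using A1 A2 A3 A4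
      proof eventually_elim
        case (elim x)
        have "A (q n) x = (w (Suc n) x + of_real m * w n x) - (of_real m * ?P (w n) x + ?P (w (Suc n)) x)"
          using elim by simp
        then show ?case by (simp add: q_def algebra_simps)
      qed
    qed (use qD A_L2 D_L2 in \<open>auto intro!: L2_diff L2_scale\<close>)
    finally show ?thesis .
  qed
  have qC: "nrm (q n) \<le> C * \<rho> ^ n" for n
  proof -
    have "(nrm (q n))\<^sup>2 = (nrm (w n))\<^sup>2 + (nrm (?P (w n)))\<^sup>2 - 2 * Re (ip (?P (w n)) (w n))"
      using L2_norm_diff_sq[OF wL P_L2[OF wL], of n] arg_cong[OF L2_inner_commute[of N "w n" "?P (w n)"], of Re]
      by (simp add: q_def)
    also have "Re (ip (?P (w n)) (w n)) = (nrm (?P (w n)))\<^sup>2"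
      using arg_cong[OF P_norm_sq_inner[OF ab wL[of n]], of Re] by simp
    finally have "(nrm (q n))\<^sup>2 \<le> (nrm (w n))\<^sup>2" by simp
    then have "nrm (q n) \<le> nrm (w n)" by (rule power2_le_imp_le) simp
    with bd[of n] show ?thesis by simp
  qed
  have "r ^ n * nrm (q 0) \<le> nrm (q n)" for n
  proof (induction n)
    case 0 then show ?case by simp
  next
    case (Suc n)
    have "r ^ Suc n * nrm (q 0) = r * (r ^ n * nrm (q 0))" by simp
    also have "\<dots> \<le> r * nrm (q n)" using Suc r by (intro mult_left_mono) auto
    also have "\<dots> \<le> nrm (q (Suc n))" by (rule step)
    finally show ?case .
  qed
  then have "r ^ n * nrm (q 0) \<le> C * \<rho> ^ n" for n using qC order_trans by blast
  then have le: "nrm (q 0) \<le> C * (\<rho> / r) ^ n" for n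
    using r by (simp add: power_divide field_simps)
  have "(\<lambda>n. C * (\<rho> / r) ^ n) \<longlonglongrightarrow> C * 0"
    using r by (intro tendsto_mult tendsto_const LIMSEQ_power_zero) auto
  then have "nrm (q 0) \<le> 0" using le by (intro LIMSEQ_le_const) auto
  then have "nrm (q 0) = 0" using L2_norm_nonneg[of N "q 0"] by linarith
  then have "AE x in N. q 0 x = 0" using L2_norm_eq_0_iff[OF D_L2[OF qD]] by simp
  then have "AE x in N. ?P (w 0) x = w 0 x" by eventually_elim (simp add: q_def)
  then show ?thesis using wL by (simp add: inran_def)
qed

end

section \<open>Absolutely continuous functions on the line\<close>

text \<open>Needed to apply Fubini to the product of two completed Lebesgue measures in the
  integration by parts and in the convolution estimate.\<close>

lemma sigma_finite_completion:
  assumes "sigma_finite_measure M" shows "sigma_finite_measure (completion M)"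
proof -
  interpret sigma_finite_measure M by fact
  from sigma_finite obtain A :: "nat \<Rightarrow> 'a set"
    where A: "range A \<subseteq> sets M" "(\<Union>i. A i) = space M" "\<And>i. emeasure M (A i) \<noteq> \<infinity>" by metis
  show ?thesis
  proof
    show "\<exists>B. countable B \<and> B \<subseteq> sets (completion M) \<and> \<Union> B = space (completion M) \<and> (\<forall>a\<in>B. emeasure (completion M) a \<noteq> \<infinity>)"
    proof (intro exI[of _ "range A"] conjI ballI)
      fix a assume "a \<in> range A"
      then obtain i where a: "a = A i" by auto
      have "A i \<in> sets M" using A(1) by auto
      then show "emeasure (completion M) a \<noteq> \<infinity>" using A(3)[of i] a by simp
    qed (use A in auto)
  qed
qed

interpretation lebesgue_pair: pair_sigma_finite "lebesgue :: real measure" "lebesgue :: real measure"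
  unfolding pair_sigma_finite_def using sigma_finite_completion[OF sigma_finite_lborel] by blast

section \<open>Indefinite integrals and integration by parts\<close>

text \<open>Absolute continuity of F with density h, stated through integrals rather than
  derivatives: every rule for F and h then reduces to an identity between integrals, and h may be
  altered on a null set.\<close>

definition ac_prim :: "(real \<Rightarrow> complex) \<Rightarrow> (real \<Rightarrow> complex) \<Rightarrow> bool" where
  "ac_prim F h \<longleftrightarrow> locally_integrable h \<and> (\<forall>a b. a \<le> b \<longrightarrow> F b - F a = (LINT s:{a..b}|lebesgue. h s))"

lemma ac_prim_integrable: "ac_prim F h \<Longrightarrow> set_integrable lebesgue {a..b} h"
  and ac_prim_eq: "ac_prim F h \<Longrightarrow> a \<le> b \<Longrightarrow> F b - F a = (LINT s:{a..b}|lebesgue. h s)"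
  by (auto simp: ac_prim_def locally_integrable_def)

lemma locally_integrable_measurable: assumes "locally_integrable h" shows "h \<in> borel_measurable lebesgue"
proof -
  have "(\<lambda>x. indicator {-real n..real n} x *\<^sub>R h x) \<in> borel_measurable lebesgue" for n :: nat
    using assms borel_measurable_integrable unfolding locally_integrable_def set_integrable_def by blast
  then show ?thesis
  proof (rule borel_measurable_LIMSEQ_metric)
    fix x :: real
    obtain m :: nat where m: "\<bar>x\<bar> \<le> real m" using real_arch_simple by blast
    have "\<forall>\<^sub>F n in sequentially. indicator {-real n..real n} x *\<^sub>R h x = h x"
      using eventually_ge_at_top[of m]
    proof eventually_elim
      case (elim n)
      then have "\<bar>x\<bar> \<le> real n" using m by linarith
      then have "x \<in> {-real n..real n}" by (auto simp: abs_le_iff)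
      then show ?case by simp
    qed
    then show "(\<lambda>n. indicator {-real n..real n} x *\<^sub>R h x) \<longlonglongrightarrow> h x"
      by (rule tendsto_eventually)
  qed
qed

lemma ac_prim_locally_integrable: "ac_prim F h \<Longrightarrow> locally_integrable h"
  by (simp add: ac_prim_def)

lemma ac_prim_measurable: "ac_prim F h \<Longrightarrow> h \<in> borel_measurable lebesgue"
  by (simp add: ac_prim_def locally_integrable_measurable)

lemma ac_prim_lin:
  assumes "ac_prim F h" "ac_prim G k"
  shows "ac_prim (\<lambda>s. c * F s + G s) (\<lambda>s. c * h s + k s)"
proof -
  have i: "set_integrable lebesgue {a..b} (\<lambda>s. c * h s)" "set_integrable lebesgue {a..b} k" for a b
    using assms by (auto intro: ac_prim_integrable)
  have "c * F b + G b - (c * F a + G a) = (LINT s:{a..b}|lebesgue. c * h s + k s)" if "a \<le> b" for a b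
  proof -
    have "(LINT s:{a..b}|lebesgue. c * h s + k s) = c * (LINT s:{a..b}|lebesgue. h s) + (LINT s:{a..b}|lebesgue. k s)"
      by (simp add: set_integral_add(2)[OF i])
    then show ?thesis using ac_prim_eq[OF assms(1) that] ac_prim_eq[OF assms(2) that] by (simp add: algebra_simps)
  qed
  then show ?thesis
    unfolding ac_prim_def locally_integrable_def using set_integral_add(1)[OF i] by blast
qed

lemma ac_prim_const: "ac_prim (\<lambda>s. c) (\<lambda>s. 0)"
  by (simp add: ac_prim_def locally_integrable_def set_integrable_def set_lebesgue_integral_def)

lemma ac_prim_scale: "ac_prim F h \<Longrightarrow> ac_prim (\<lambda>s. c * F s) (\<lambda>s. c * h s)"
  using ac_prim_lin[OF _ ac_prim_const[of 0], of F h c] by simp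

lemma ac_prim_cnj: assumes "ac_prim F h" shows "ac_prim (\<lambda>s. cnj (F s)) (\<lambda>s. cnj (h s))"
proof -
  have e: "indicator A s *\<^sub>R cnj (h s) = cnj (indicator A s *\<^sub>R h s)" for A and s :: real by simp
  have i: "set_integrable lebesgue {a..b} (\<lambda>s. cnj (h s))" for a b
    using ac_prim_integrable[OF assms, of a b] unfolding set_integrable_def e by (rule integrable_cnj)
  have "cnj (F b) - cnj (F a) = (LINT s:{a..b}|lebesgue. cnj (h s))" if "a \<le> b" for a b
    unfolding set_lebesgue_integral_def e Bochner_Integration.integral_cnj
    using ac_prim_eq[OF assms that] by (simp add: set_lebesgue_integral_def flip: complex_cnj_diff)
  then show ?thesis using i by (simp add: ac_prim_def locally_integrable_def)
qed

lemma borel_measurable_completion_cong_AE: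
  assumes f: "f \<in> borel_measurable (completion M)" and fg: "AE x in completion M. f x = g x"
  shows "g \<in> borel_measurable (completion M)"
proof (rule measurableI)
  fix A :: "'b set" assume "A \<in> sets borel"
  then have s: "f -` A \<inter> space (completion M) \<in> sets (completion M)" using f by (rule measurable_sets[rotated])
  have e: "AE x in completion M. (x \<in> f -` A \<inter> space (completion M)) = (x \<in> g -` A \<inter> space (completion M))"
    using fg by (rule eventually_mono) simp
  show "g -` A \<inter> space (completion M) \<in> sets (completion M)"
    by (rule completion.in_sets_AE[OF e s]) simp
qed simp

lemma ac_prim_cong_AE:
  assumes F: "ac_prim F h" and hk: "AE s in lebesgue. h s = k s"
  shows "ac_prim F k"
proof -
  have [measurable]: "h \<in> borel_measurable lebesgue" by (rule ac_prim_measurable[OF F])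
  have [measurable]: "k \<in> borel_measurable lebesgue"
    by (rule borel_measurable_completion_cong_AE[OF \<open>h \<in> borel_measurable lebesgue\<close> hk])
  have [measurable]: "{a..b} \<in> sets lebesgue" for a b :: real by simp
  have "set_integrable lebesgue {a..b} k" for a b
    using ac_prim_integrable[OF F, of a b] unfolding set_integrable_def
    by (rule integrable_cong_AE_imp) (use hk in auto)
  moreover have "(LINT s:{a..b}|lebesgue. h s) = (LINT s:{a..b}|lebesgue. k s)" for a b
    unfolding set_lebesgue_integral_def by (rule integral_cong_AE) (use hk in auto)
  ultimately show ?thesis using F by (simp add: ac_prim_def locally_integrable_def)
qed

lemma ac_prim_exists: assumes h: "locally_integrable h" shows "\<exists>F. ac_prim F h"
proof -
  define F where "F x = (if 0 \<le> x then LINT s:{0..x}|lebesgue. h s else - (LINT s:{x..0}|lebesgue. h s))" for x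
  have i: "set_integrable lebesgue {a..b} h" for a b using h by (simp add: locally_integrable_def)
  have add: "(LINT s:{a..c}|lebesgue. h s) = (LINT s:{a..b}|lebesgue. h s) + (LINT s:{b..c}|lebesgue. h s)"
    if "a \<le> b" "b \<le> c" for a b c
  proof -
    have "integral {a..b} h + integral {b..c} h = integral {a..c} h"
      using that set_lebesgue_integral_eq_integral(1)[OF i] by (intro Henstock_Kurzweil_Integration.integral_combine)
    then show ?thesis unfolding set_lebesgue_integral_eq_integral(2)[OF i] by (rule sym)
  qed
  have "F b - F a = (LINT s:{a..b}|lebesgue. h s)" if "a \<le> b" for a b
    using add[of 0 a b] add[of a 0 b] add[of a b 0] that unfolding F_def by (auto simp: algebra_simps)
  then show ?thesis using h by (auto simp: ac_prim_def)
qed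

lemma ac_prim_continuous: assumes F: "ac_prim F h" shows "continuous_on UNIV F"
proof -
  have "isCont F x" for x
  proof -
    have e: "F (x - 1) + integral {x-1..y} h = F y" if "y \<in> {x-1..x+1}" for y
      using ac_prim_eq[OF F, of "x-1" y] that
      unfolding set_lebesgue_integral_eq_integral(2)[OF ac_prim_integrable[OF F]] by (simp add: algebra_simps)
    have "continuous_on {x-1..x+1} (\<lambda>y. F (x - 1) + integral {x-1..y} h)"
      by (intro continuous_intros indefinite_integral_continuous_1 set_lebesgue_integral_eq_integral(1)[OF ac_prim_integrable[OF F]])
    from continuous_on_eq[OF this e] have "continuous_on {x-1..x+1} F" .
    then show ?thesis by (rule continuous_on_interior) simp
  qed
  then show ?thesis by (simp add: continuous_on_eq_continuous_at)
qed

lemma ac_prim_fun_measurable: "ac_prim F h \<Longrightarrow> F \<in> borel_measurable lebesgue"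
  using borel_measurable_continuous_onI[OF ac_prim_continuous] by (intro measurable_completion) simp

text \<open>Lebesgue differentiation along the fixed sequence 1/(n+1). A countable sequence is what
  later lets fibrewise derivatives be assembled into a jointly measurable function.\<close>

lemma ac_prim_AE_derivative:
  assumes F: "ac_prim F h"
  shows "AE s in lebesgue. (\<lambda>n. of_nat (Suc n) * (F (s + 1 / of_nat (Suc n)) - F s)) \<longlonglongrightarrow> h s"
proof -
  have "\<And>a b. h integrable_on cbox a b"
    using set_lebesgue_integral_eq_integral(1)[OF ac_prim_integrable[OF F]] by simp
  from integrable_ccontinuous_explicit[OF this] obtain N where N: "negligible N"
    and lim: "\<And>x e. \<lbrakk>x \<notin> N; 0 < e\<rbrakk> \<Longrightarrow> \<exists>d>0. \<forall>k. 0 < k \<and> k < d \<longrightarrow>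
      norm (integral (cbox x (x + k *\<^sub>R One)) h /\<^sub>R k ^ DIM(real) - h x) < e" by blast
  have "(\<lambda>n. of_nat (Suc n) * (F (x + 1 / of_nat (Suc n)) - F x)) \<longlonglongrightarrow> h x" if "x \<notin> N" for x
  proof (rule LIMSEQ_I)
    fix e :: real assume "0 < e"
    from lim[OF that this] obtain d where d: "d > 0" and
      l: "\<And>k. 0 < k \<Longrightarrow> k < d \<Longrightarrow> norm (integral (cbox x (x + k *\<^sub>R One)) h /\<^sub>R k ^ DIM(real) - h x) < e" by blast
    from real_arch_inverse[of d] d obtain n0 :: nat where n0: "n0 \<noteq> 0" "inverse (real n0) < d" by auto
    show "\<exists>no. \<forall>n\<ge>no. norm (of_nat (Suc n) * (F (x + 1 / of_nat (Suc n)) - F x) - h x) < e"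
    proof (intro exI[of _ n0] allI impI)
      fix n assume n: "n0 \<le> n"
      let ?k = "1 / real (Suc n)"
      have "?k \<le> inverse (real n0)" using n n0 by (simp add: field_simps)
      then have k: "0 < ?k" "?k < d" using n0 by auto
      have "integral (cbox x (x + ?k *\<^sub>R One)) h = F (x + ?k) - F x"
        using ac_prim_eq[OF F, of x "x + ?k"] set_lebesgue_integral_eq_integral(2)[OF ac_prim_integrable[OF F]] k
        by simp
      then show "norm (of_nat (Suc n) * (F (x + 1 / of_nat (Suc n)) - F x) - h x) < e"
        using l[OF k] by (simp add: scaleR_conv_of_real)
    qed
  qed
  moreover have "AE s in lebesgue. s \<notin> N"
    using N by (intro AE_not_in) (simp add: negligible_iff_null_sets)
  ultimately show ?thesis by (auto elim: eventually_mono)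
qed

lemma ac_prim_unique: "ac_prim F h \<Longrightarrow> ac_prim F k \<Longrightarrow> AE s in lebesgue. h s = k s"
  using ac_prim_AE_derivative[of F h] ac_prim_AE_derivative[of F k]
  by (force intro: LIMSEQ_unique elim: eventually_elim2)

lemma ac_prim_smooth:
  assumes d: "\<And>x. (F has_vector_derivative h x) (at x)" and c: "continuous_on UNIV h"
  shows "ac_prim F h"
proof -
  have i: "set_integrable lebesgue {a..b} h" for a b
    using absolutely_integrable_continuous_real[OF continuous_on_subset[OF c], of a b] by simp
  have "F b - F a = (LINT s:{a..b}|lebesgue. h s)" if "a \<le> b" for a b
  proof -
    have "(h has_integral (F b - F a)) {a..b}"
      using that d by (intro fundamental_theorem_of_calculus) (auto intro: has_vector_derivative_at_within)
    then show ?thesis using set_lebesgue_integral_eq_integral(2)[OF i] by (simp add: integral_unique)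
  qed
  then show ?thesis using i by (simp add: ac_prim_def locally_integrable_def)
qed

lemma set_integrable_mult_continuous:
  fixes h G :: "real \<Rightarrow> complex"
  assumes h: "set_integrable lebesgue {a..b} h" and G: "continuous_on {a..b} G"
  shows "set_integrable lebesgue {a..b} (\<lambda>s. h s * G s)"
proof -
  have "bounded (G ` {a..b})" using compact_continuous_image[OF G] compact_imp_bounded by blast
  then obtain B where "\<forall>x\<in>{a..b}. norm (G x) \<le> B" by (auto simp: bounded_iff)
  then have B: "\<And>s. s \<in> {a..b} \<Longrightarrow> norm (G s) \<le> B" by blast
  have hm [measurable]: "(\<lambda>s. indicator {a..b} s *\<^sub>R h s) \<in> borel_measurable lebesgue"
    using h by (simp add: set_integrable_def)
  have "(\<lambda>s. indicator {a..b} s *\<^sub>R G s) \<in> borel_measurable borel"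
    using borel_measurable_continuous_on_indicator[OF _ G] by simp
  then have Gm: "(\<lambda>s. indicator {a..b} s *\<^sub>R G s) \<in> borel_measurable lebesgue"
    by (intro measurable_completion) simp
  have "integrable lebesgue (\<lambda>s. B *\<^sub>R (indicator {a..b} s *\<^sub>R h s))"
    by (rule integrable_scaleR_right) (use h in \<open>simp add: set_integrable_def\<close>)
  then show ?thesis unfolding set_integrable_def
  proof (rule Bochner_Integration.integrable_bound)
    have "(\<lambda>s. indicator {a..b} s *\<^sub>R (h s * G s)) = (\<lambda>s. (indicator {a..b} s *\<^sub>R h s) * (indicator {a..b} s *\<^sub>R G s))"
      by (auto simp: fun_eq_iff indicator_def)
    then show "(\<lambda>s. indicator {a..b} s *\<^sub>R (h s * G s)) \<in> borel_measurable lebesgue"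
      using borel_measurable_times[OF hm Gm] by (simp only:)
    have "norm (indicator {a..b} s *\<^sub>R (h s * G s)) \<le> norm (B *\<^sub>R (indicator {a..b} s *\<^sub>R h s))" for s
    proof (cases "s \<in> {a..b}")
      case True
      then have "norm (G s) \<le> \<bar>B\<bar>" using B[OF True] by linarith
      then show ?thesis using True by (simp add: norm_mult mult.commute mult_right_mono)
    qed simp
    then show "AE s in lebesgue. norm (indicator {a..b} s *\<^sub>R (h s * G s)) \<le> norm (B *\<^sub>R (indicator {a..b} s *\<^sub>R h s))"
      by simp
  qed
qed

text \<open>
  Both sides are integrals of $h(s) k(t)$, over the two triangles and over the
  square.
\<close>

lemma ac_prim_mult:
  assumes F: "ac_prim F h" and G: "ac_prim G k"
  shows "ac_prim (\<lambda>s. F s * G s) (\<lambda>s. h s * G s + F s * k s)"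
proof -
  have hG: "set_integrable lebesgue {a..b} (\<lambda>s. h s * G s)" for a b
    using ac_prim_integrable[OF F] continuous_on_subset[OF ac_prim_continuous[OF G]]
    by (intro set_integrable_mult_continuous) auto
  have kF: "set_integrable lebesgue {a..b} (\<lambda>s. F s * k s)" for a b
    using set_integrable_mult_continuous[OF ac_prim_integrable[OF G] continuous_on_subset[OF ac_prim_continuous[OF F]], of a b]
    by (simp add: mult.commute)
  have "F b * G b - F a * G a = (LINT s:{a..b}|lebesgue. h s * G s + F s * k s)" if ab: "a \<le> b" for a b
  proof -
    define u where "u s = indicator {a..b} s *\<^sub>R h s" for s
    define v where "v s = indicator {a..b} s *\<^sub>R k s" for s
    have iu: "integrable lebesgue u" and iv: "integrable lebesgue v"
      using ac_prim_integrable[OF F, of a b] ac_prim_integrable[OF G, of a b]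
      by (simp_all add: u_def[abs_def] v_def[abs_def] set_integrable_def)
    have [measurable]: "u \<in> borel_measurable lebesgue" "v \<in> borel_measurable lebesgue" using iu iv by auto
    have [measurable]: "(\<lambda>p. fst p) \<in> lebesgue \<Otimes>\<^sub>M lebesgue \<rightarrow>\<^sub>M (borel :: real measure)"
       "(\<lambda>p. snd p) \<in> lebesgue \<Otimes>\<^sub>M lebesgue \<rightarrow>\<^sub>M (borel :: real measure)"
      by (rule measurable_compose[OF measurable_fst measurable_completion], simp,
          rule measurable_compose[OF measurable_snd measurable_completion], simp)
    have uF: "(\<integral>s. u s \<partial>lebesgue) = F b - F a" and vG: "(\<integral>s. v s \<partial>lebesgue) = G b - G a"
      using ac_prim_eq[OF F ab] ac_prim_eq[OF G ab] by (simp_all add: u_def v_def set_lebesgue_integral_def)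
    have prod: "integrable (lebesgue \<Otimes>\<^sub>M lebesgue) (\<lambda>p. u (fst p) * v (snd p))"
    proof (rule lebesgue_pair.Fubini_integrable)
      show "AE x in lebesgue. integrable lebesgue (\<lambda>y. u (fst (x, y)) * v (snd (x, y)))" using iv by simp
      show "integrable lebesgue (\<lambda>x. \<integral>y. norm (u (fst (x, y)) * v (snd (x, y))) \<partial>lebesgue)"
        using iu iv by (simp add: norm_mult)
    qed simp
    have tri: "integrable (lebesgue \<Otimes>\<^sub>M lebesgue) (\<lambda>(s, t). indicator {t. t \<le> s} t *\<^sub>R (u s * v t))"
    proof (rule Bochner_Integration.integrable_bound[OF prod])
      have "(\<lambda>(s, t). indicator {t. t \<le> s} t *\<^sub>R (u s * v t))
          = (\<lambda>p. indicator {p. snd p \<le> fst p} p *\<^sub>R (u (fst p) * v (snd p)))"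
        by (auto simp: fun_eq_iff indicator_def)
      moreover have "(\<lambda>p. indicator {p. snd p \<le> fst p} p *\<^sub>R (u (fst p) * v (snd p))) \<in> borel_measurable (lebesgue \<Otimes>\<^sub>M lebesgue)"
      proof -
        have "(\<lambda>p. if snd p \<le> fst p then u (fst p) * v (snd p) else 0) \<in> borel_measurable (lebesgue \<Otimes>\<^sub>M lebesgue)"
          by measurable
        moreover have "(\<lambda>p. if snd p \<le> fst p then u (fst p) * v (snd p) else 0)
            = (\<lambda>p. indicator {p. snd p \<le> fst p} p *\<^sub>R (u (fst p) * v (snd p)))"
          by (auto simp: fun_eq_iff indicator_def)
        ultimately show ?thesis by simp
      qed
      ultimately show "(\<lambda>(s, t). indicator {t. t \<le> s} t *\<^sub>R (u s * v t)) \<in> borel_measurable (lebesgue \<Otimes>\<^sub>M lebesgue)"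
        by simp
    qed (auto simp: indicator_def)
    have Fs: "(\<integral>s. indicator {..t} s *\<^sub>R u s \<partial>lebesgue) = F t - F a" if "t \<in> {a..b}" for t
    proof -
      have "(\<lambda>s. indicator {..t} s *\<^sub>R u s) = (\<lambda>s. indicator {a..t} s *\<^sub>R h s)"
        using that by (auto simp: u_def indicator_def fun_eq_iff)
      then show ?thesis using ac_prim_eq[OF F, of a t] that by (simp add: set_lebesgue_integral_def)
    qed
    have Gs: "(\<integral>s. indicator {..t} s *\<^sub>R v s \<partial>lebesgue) = G t - G a" if "t \<in> {a..b}" for t
    proof -
      have "(\<lambda>s. indicator {..t} s *\<^sub>R v s) = (\<lambda>s. indicator {a..t} s *\<^sub>R k s)"
        using that by (auto simp: v_def indicator_def fun_eq_iff)
      then show ?thesis using ac_prim_eq[OF G, of a t] that by (simp add: set_lebesgue_integral_def)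
    qed
    have 1: "(\<integral>s. u s * (G s - G a) \<partial>lebesgue) = (\<integral>s. (\<integral>t. indicator {t. t \<le> s} t *\<^sub>R (u s * v t) \<partial>lebesgue) \<partial>lebesgue)"
    proof (rule Bochner_Integration.integral_cong[OF refl])
      fix s :: real
      have "(\<integral>t. indicator {t. t \<le> s} t *\<^sub>R (u s * v t) \<partial>lebesgue) = (\<integral>t. u s * (indicator {..s} t *\<^sub>R v t) \<partial>lebesgue)"
        by (rule Bochner_Integration.integral_cong) (auto simp: indicator_def)
      also have "\<dots> = u s * (\<integral>t. indicator {..s} t *\<^sub>R v t \<partial>lebesgue)" by (rule integral_mult_right_zero)
      also have "\<dots> = u s * (G s - G a)"
        by (cases "s \<in> {a..b}") (simp_all only: Gs, simp add: u_def)
      finally show "u s * (G s - G a) = (\<integral>t. indicator {t. t \<le> s} t *\<^sub>R (u s * v t) \<partial>lebesgue)" by simp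
    qed
    have 2: "(\<integral>t. v t * (F b - F t) \<partial>lebesgue) = (\<integral>t. (\<integral>s. indicator {t. t \<le> s} t *\<^sub>R (u s * v t) \<partial>lebesgue) \<partial>lebesgue)"
    proof (rule Bochner_Integration.integral_cong[OF refl])
      fix t :: real
      have i1: "integrable lebesgue (\<lambda>s. indicator {..t} s *\<^sub>R u s)"
        by (rule integrable_mult_indicator[OF _ iu]) simp
      \<comment> \<open>The half-line from t on and the complement of the half-line up to t differ
        only in the point t, that is, by a slice of the diagonal of measure 0.\<close>
      have t: "AE s in lebesgue. s \<notin> {t}" by (intro AE_not_in) simp
      have [measurable]: "{t..} \<in> sets lebesgue" "{..t} \<in> sets lebesgue" by simp_all
      have "(\<integral>s. indicator {t. t \<le> s} t *\<^sub>R (u s * v t) \<partial>lebesgue) = (\<integral>s. indicator {t..} s *\<^sub>R (u s * v t) \<partial>lebesgue)"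
        by (rule Bochner_Integration.integral_cong) (auto simp: indicator_def)
      also have "\<dots> = (\<integral>s. (u s - indicator {..t} s *\<^sub>R u s) * v t \<partial>lebesgue)"
      proof (rule integral_cong_AE)
        show "AE s in lebesgue. indicator {t..} s *\<^sub>R (u s * v t) = (u s - indicator {..t} s *\<^sub>R u s) * v t"
          using t by eventually_elim (auto simp: indicator_def)
      qed simp_all
      also have "\<dots> = ((\<integral>s. u s \<partial>lebesgue) - (\<integral>s. indicator {..t} s *\<^sub>R u s \<partial>lebesgue)) * v t"
        using iu i1 by (simp add: Bochner_Integration.integral_diff)
      also have "\<dots> = v t * (F b - F t)"
        by (cases "t \<in> {a..b}") (simp_all only: Fs uF, simp_all add: v_def)
      finally show "v t * (F b - F t) = (\<integral>s. indicator {t. t \<le> s} t *\<^sub>R (u s * v t) \<partial>lebesgue)" by simp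
    qed
    have uG: "integrable lebesgue (\<lambda>s. u s * G s)" "integrable lebesgue (\<lambda>s. v s * F s)"
      using hG[of a b] kF[of a b] by (simp_all add: set_integrable_def u_def v_def mult.commute mult.left_commute)
    have e1: "(\<integral>s. u s * (G s - G a) \<partial>lebesgue) = (\<integral>t. v t * (F b - F t) \<partial>lebesgue)"
      unfolding 1 2 by (rule lebesgue_pair.Fubini_integral[OF tri, symmetric])
    have e2: "(\<integral>s. u s * (G s - G a) \<partial>lebesgue) = (\<integral>s. u s * G s \<partial>lebesgue) - (F b - F a) * G a"
      using iu uG uF by (simp add: right_diff_distrib)
    have e3: "(\<integral>t. v t * (F b - F t) \<partial>lebesgue) = (G b - G a) * F b - (\<integral>s. v s * F s \<partial>lebesgue)"
      using iv uG vG by (simp add: right_diff_distrib)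
    have e4: "(LINT s:{a..b}|lebesgue. h s * G s + F s * k s) = (\<integral>s. u s * G s \<partial>lebesgue) + (\<integral>s. v s * F s \<partial>lebesgue)"
      unfolding set_integral_add(2)[OF hG kF] by (simp add: set_lebesgue_integral_def u_def v_def mult.commute mult.left_commute)
    have "(\<integral>s. u s * G s \<partial>lebesgue) = (\<integral>t. v t * (F b - F t) \<partial>lebesgue) + (F b - F a) * G a"
      by (simp only: e1[symmetric] e2 diff_add_cancel)
    moreover have "(\<integral>s. v s * F s \<partial>lebesgue) = (G b - G a) * F b - (\<integral>t. v t * (F b - F t) \<partial>lebesgue)"
      unfolding e3 by simp
    ultimately show ?thesis unfolding e4 by (simp only:) (simp add: algebra_simps)
  qed
  then show ?thesis
    unfolding ac_prim_def locally_integrable_def using set_integral_add(1)[OF hG kF] by blast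
qed

lemma ac_prim_limits:
  assumes F: "ac_prim F h" and h: "integrable lebesgue h"
  obtains c d where "(F \<longlongrightarrow> c) at_bot" "(F \<longlongrightarrow> d) at_top" "(\<integral>s. h s \<partial>lebesgue) = d - c"
proof -
  have si: "set_integrable lebesgue A h" if "A \<in> sets lebesgue" for A
    using integrable_mult_indicator[OF that h] by (simp add: set_integrable_def)
  have "((\<lambda>b. F 0 + (LINT s:{0..b}|lebesgue. h s)) \<longlongrightarrow> F 0 + (LINT s:{0..}|lebesgue. h s)) at_top"
  proof (rule tendsto_add[OF tendsto_const])
    show "((\<lambda>b. LINT s:{0..b}|lebesgue. h s) \<longlongrightarrow> (LINT s:{0..}|lebesgue. h s)) at_top"
      by (rule tendsto_set_lebesgue_integral_at_top[of 0 lebesgue h, OF _ si[of "{0..}"]]) simp_all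
  qed
  moreover have "\<forall>\<^sub>F b in at_top. F 0 + (LINT s:{0..b}|lebesgue. h s) = F b"
    using eventually_ge_at_top[of 0]
  proof (rule eventually_mono)
    fix b :: real assume "0 \<le> b"
    from ac_prim_eq[OF F this, symmetric] show "F 0 + (LINT s:{0..b}|lebesgue. h s) = F b" by simp
  qed
  ultimately have top: "(F \<longlongrightarrow> F 0 + (LINT s:{0..}|lebesgue. h s)) at_top" (is "(F \<longlongrightarrow> ?d) at_top")
    by (rule Lim_transform_eventually)
  have "((\<lambda>a. F 0 - (LINT s:{a..0}|lebesgue. h s)) \<longlongrightarrow> F 0 - (LINT s:{..0}|lebesgue. h s)) at_bot"
  proof (rule tendsto_diff[OF tendsto_const])
    show "((\<lambda>a. LINT s:{a..0}|lebesgue. h s) \<longlongrightarrow> (LINT s:{..0}|lebesgue. h s)) at_bot"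
      by (rule tendsto_set_lebesgue_integral_at_bot[of 0 lebesgue h, OF _ si[of "{..0}"]]) simp_all
  qed
  moreover have "\<forall>\<^sub>F a in at_bot. F 0 - (LINT s:{a..0}|lebesgue. h s) = F a"
    using eventually_le_at_bot[of 0]
  proof (rule eventually_mono)
    fix a :: real assume "a \<le> 0"
    from ac_prim_eq[OF F this, symmetric] show "F 0 - (LINT s:{a..0}|lebesgue. h s) = F a" by simp
  qed
  ultimately have bot: "(F \<longlongrightarrow> F 0 - (LINT s:{..0}|lebesgue. h s)) at_bot" (is "(F \<longlongrightarrow> ?c) at_bot")
    by (rule Lim_transform_eventually)
  have "(\<lambda>n. \<integral>s. indicator {- real n..real n} s *\<^sub>R h s \<partial>lebesgue) \<longlonglongrightarrow> (\<integral>s. h s \<partial>lebesgue)"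
  proof (rule integral_dominated_convergence[where w="\<lambda>s. norm (h s)"])
    show "AE x in lebesgue. (\<lambda>n. indicator {- real n..real n} x *\<^sub>R h x) \<longlonglongrightarrow> h x"
    proof (rule AE_I2)
      fix x :: real
      obtain m :: nat where m: "\<bar>x\<bar> \<le> real m" using real_arch_simple by blast
      have "\<forall>\<^sub>F n in sequentially. indicator {-real n..real n} x *\<^sub>R h x = h x"
        using eventually_ge_at_top[of m]
      proof eventually_elim
        case (elim n)
        then have "\<bar>x\<bar> \<le> real n" using m by linarith
        then have "x \<in> {-real n..real n}" by (auto simp: abs_le_iff)
        then show ?case by simp
      qed
      then show "(\<lambda>n. indicator {-real n..real n} x *\<^sub>R h x) \<longlonglongrightarrow> h x"
        by (rule tendsto_eventually)
    qed
    show "h \<in> borel_measurable lebesgue" "integrable lebesgue (\<lambda>s. norm (h s))" using h by auto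
    show "(\<lambda>s. indicator {- real n..real n} s *\<^sub>R h s) \<in> borel_measurable lebesgue" for n
      using si[of "{-real n..real n}"] by (simp add: set_integrable_def)
  qed (auto simp: indicator_def)
  moreover have "(\<integral>s. indicator {- real n..real n} s *\<^sub>R h s \<partial>lebesgue) = F (real n) - F (- real n)" for n
    using ac_prim_eq[OF F, of "- real n" "real n"] by (simp add: set_lebesgue_integral_def)
  moreover have "(\<lambda>n. F (real n) - F (- real n)) \<longlonglongrightarrow> ?d - ?c"
    by (intro tendsto_intros filterlim_compose[OF top filterlim_real_sequentially]
        filterlim_compose[OF bot] filterlim_compose[OF filterlim_uminus_at_bot_at_top filterlim_real_sequentially])
  ultimately have "(\<integral>s. h s \<partial>lebesgue) = ?d - ?c" using LIMSEQ_unique by auto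
  with bot top show ?thesis by (rule that)
qed

section \<open>Distributional derivatives\<close>

text \<open>The classical function exp(-1/x) that is flat at the origin, with a polynomial factor in
  1/x. The polynomial parameter makes the family closed under differentiation.\<close>

definition flat :: "real poly \<Rightarrow> real \<Rightarrow> real" where
  "flat p x = (if 0 < x then poly p (inverse x) * exp (- inverse x) else 0)"

lemma poly_times_exp_minus_tendsto_0: "((\<lambda>y. poly p y * exp (- y)) \<longlongrightarrow> (0::real)) at_top"
proof -
  have "((\<lambda>y. \<Sum>i\<le>degree p. coeff p i * (y ^ i / exp y)) \<longlongrightarrow> (\<Sum>i\<le>degree p. coeff p i * 0)) at_top"
    by (intro tendsto_sum tendsto_mult tendsto_const tendsto_power_div_exp_0)
  moreover have "(\<Sum>i\<le>degree p. coeff p i * (y ^ i / exp y)) = poly p y * exp (- y)" for y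
    by (simp add: poly_altdef sum_distrib_right exp_minus field_simps sum_divide_distrib)
  ultimately show ?thesis by simp
qed

text \<open>Since the derivative of 1/x is -(1/x)^2, differentiation replaces the polynomial p in
  1/x by X^2 (p - p').\<close>

lemma flat_has_derivative: "(flat p has_real_derivative flat ([:0, 0, 1:] * (p - pderiv p)) x) (at x)"
proof -
  consider "x > 0" | "x < 0" | "x = 0" by linarith
  then show ?thesis
  proof cases
    case 1
    have "((\<lambda>x. poly p (inverse x) * exp (- inverse x)) has_real_derivative
        flat ([:0, 0, 1:] * (p - pderiv p)) x) (at x)"
      using 1 by (auto intro!: derivative_eq_intros simp: flat_def power2_eq_square algebra_simps)
    then show ?thesis
      by (rule has_field_derivative_transform_within_open[of _ _ _ "{0<..}"]) (use 1 in \<open>auto simp: flat_def\<close>)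
  next
    case 2
    have "((\<lambda>x. 0) has_real_derivative flat ([:0, 0, 1:] * (p - pderiv p)) x) (at x)"
      using 2 by (simp add: flat_def)
    then show ?thesis
      by (rule has_field_derivative_transform_within_open[of _ _ _ "{..<0}"]) (use 2 in \<open>auto simp: flat_def\<close>)
  next
    \<comment> \<open>At the origin the difference quotient from the right is y p(y) exp(-y) at y =
      1/x, that is, the same expression with p multiplied by X; it tends to 0.\<close>
    case 3
    have "((\<lambda>y. poly (pCons 0 p) (inverse y) * exp (- inverse y)) \<longlongrightarrow> 0) (at_right 0)"
      by (rule filterlim_compose[OF poly_times_exp_minus_tendsto_0 filterlim_inverse_at_top_right])
    then have r: "((\<lambda>y. (flat p y - flat p 0) / (y - 0)) \<longlongrightarrow> 0) (at_right 0)"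
      by (rule Lim_transform_eventually)
        (auto simp: flat_def eventually_at_filter field_simps intro!: always_eventually)
    have "((\<lambda>y::real. 0::real) \<longlongrightarrow> 0) (at_left 0)" by simp
    then have l: "((\<lambda>y. (flat p y - flat p 0) / (y - 0)) \<longlongrightarrow> 0) (at_left 0)"
      by (rule Lim_transform_eventually) (auto simp: flat_def eventually_at_filter intro!: always_eventually)
    from filterlim_split_at[OF l r] show ?thesis
      unfolding 3 has_field_derivative_iff by (simp add: flat_def)
  qed
qed

text \<open>
  A class of smooth functions that is visibly closed under differentiation and large enough to
  contain the cut-off functions below.
\<close>

inductive smooth :: "(real \<Rightarrow> real) \<Rightarrow> bool" where
  smooth_const: "smooth (\<lambda>x. c)"
| smooth_flat: "smooth (flat p)"
| smooth_add: "smooth f \<Longrightarrow> smooth g \<Longrightarrow> smooth (\<lambda>x. f x + g x)"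
| smooth_mult: "smooth f \<Longrightarrow> smooth g \<Longrightarrow> smooth (\<lambda>x. f x * g x)"
| smooth_affine: "smooth f \<Longrightarrow> smooth (\<lambda>x. f (a * x + b))"
| smooth_antiderivative: "(\<And>x. (f has_real_derivative g x) (at x)) \<Longrightarrow> smooth g \<Longrightarrow> smooth f"

lemma smooth_has_derivative: "smooth f \<Longrightarrow> \<exists>g. smooth g \<and> (\<forall>x. (f has_real_derivative g x) (at x))"
proof (induction rule: smooth.induct)
  case (smooth_const c)
  show ?case by (rule exI[of _ "\<lambda>x. 0"]) (auto intro: smooth.smooth_const)
next
  case (smooth_flat p)
  show ?case using flat_has_derivative smooth.smooth_flat by blast
next
  case (smooth_add f g)
  then obtain f' g' where "smooth f'" "smooth g'" "\<And>x. (f has_real_derivative f' x) (at x)" "\<And>x. (g has_real_derivative g' x) (at x)" by blast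
  then show ?case
    by (intro exI[of _ "\<lambda>x. f' x + g' x"]) (auto intro: smooth.smooth_add DERIV_add)
next
  case (smooth_mult f g)
  then obtain f' g' where fg: "smooth f'" "smooth g'" "\<And>x. (f has_real_derivative f' x) (at x)" "\<And>x. (g has_real_derivative g' x) (at x)" by blast
  have "smooth (\<lambda>x. f' x * g x + g' x * f x)"
    using smooth.smooth_add smooth.smooth_mult fg smooth_mult by blast
  moreover have "((\<lambda>x. f x * g x) has_real_derivative f' x * g x + g' x * f x) (at x)" for x
    by (rule DERIV_mult[OF fg(3,4)])
  ultimately show ?case by blast
next
  case (smooth_affine f a b)
  then obtain f' where f': "smooth f'" "\<And>x. (f has_real_derivative f' x) (at x)" by blast
  have "((\<lambda>x. f (a * x + b)) has_real_derivative f' (a * x + b) * a) (at x)" for x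
    by (rule DERIV_chain2[OF f'(2)]) (auto intro!: derivative_eq_intros)
  moreover have "smooth (\<lambda>x. f' (a * x + b) * a)"
    by (rule smooth.smooth_mult[OF smooth.smooth_affine[OF f'(1)] smooth.smooth_const])
  ultimately show ?case by blast
next
  case (smooth_antiderivative f g)
  then show ?case by blast
qed

lemma smooth_deriv: assumes "smooth f" shows "smooth (deriv f)" "f differentiable (at x)" "(f has_real_derivative deriv f x) (at x)"
proof -
  from smooth_has_derivative[OF assms] obtain g where g: "smooth g" "\<And>x. (f has_real_derivative g x) (at x)" by blast
  then have "deriv f = g" using DERIV_imp_deriv by blast
  then show "smooth (deriv f)" "(f has_real_derivative deriv f x) (at x)" using g by auto
  show "f differentiable (at x)" using g(2) real_differentiable_def by blast
qed

lemma smooth_continuous: "smooth f \<Longrightarrow> continuous_on UNIV f"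
  using smooth_deriv(3) DERIV_isCont by (simp add: continuous_on_eq_continuous_at) blast

lemma test_function_if_smooth: assumes f: "smooth f" and z: "\<And>x. x \<notin> {a..b} \<Longrightarrow> f x = 0" shows "test_function f"
proof -
  have "smooth ((deriv ^^ n) f)" for n
    by (induction n) (auto intro: f smooth_deriv(1))
  then show ?thesis unfolding test_function_def using smooth_deriv(2) z by blast
qed

lemma smooth_antiderivative_exists: assumes "smooth g" shows "\<exists>f. smooth f \<and> f 0 = 0 \<and> (\<forall>x. (f has_real_derivative g x) (at x))"
proof -
  have "\<exists>F. \<forall>x::real. -\<infinity> < ereal x \<longrightarrow> ereal x < \<infinity> \<longrightarrow> (F has_vector_derivative g x) (at x)"
    by (rule einterval_antiderivative) (use smooth_continuous[OF assms] in \<open>auto simp: continuous_on_eq_continuous_at\<close>)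
  then obtain F where "\<And>x. (F has_real_derivative g x) (at x)"
    by (auto simp: has_real_derivative_iff_has_vector_derivative)
  then have F: "((\<lambda>x. F x - F 0) has_real_derivative g x) (at x)" for x
    by (auto intro!: derivative_eq_intros)
  show ?thesis using F smooth_antiderivative[OF F assms] by (intro exI[of _ "\<lambda>x. F x - F 0"]) auto
qed

text \<open>The step is the normalized antiderivative of a bump supported in [0, 1], the product of
  the flat function with its reflection about 1/2.\<close>

lemma smooth_step_exists:
  "\<exists>\<theta>. smooth \<theta> \<and> (\<forall>x\<le>0. \<theta> x = 0) \<and> (\<forall>x\<ge>1. \<theta> x = 1) \<and> (\<forall>x. 0 \<le> \<theta> x \<and> \<theta> x \<le> 1)"
proof -
  define \<beta> where "\<beta> = (\<lambda>x. flat 1 x * flat 1 ((-1) * x + 1))"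
  have \<beta>: "smooth \<beta>" unfolding \<beta>_def by (rule smooth_mult[OF smooth_flat smooth_affine[OF smooth_flat]])
  have \<beta>0: "\<beta> x = 0" if "x \<le> 0 \<or> 1 \<le> x" for x using that by (auto simp: \<beta>_def flat_def)
  have \<beta>p: "\<beta> x > 0" if "0 < x" "x < 1" for x using that by (auto simp: \<beta>_def flat_def)
  have \<beta>n: "\<beta> x \<ge> 0" for x by (auto simp: \<beta>_def flat_def)
  from smooth_antiderivative_exists[OF \<beta>] obtain F where F: "smooth F" "F 0 = 0" and
    dF: "\<And>x. (F has_real_derivative \<beta> x) (at x)" by blast
  have mono: "F x \<le> F y" if "x \<le> y" for x y
    using that by (rule DERIV_nonneg_imp_nondecreasing) (use dF \<beta>n in blast)
  have "0 < F 1"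
  proof -
    obtain z where z: "z > 0" "z < 1" "F 1 - F 0 = (1 - 0) * \<beta> z" using MVT2[of 0 1 F \<beta>] dF by auto
    then show ?thesis using \<beta>p[of z] F(2) by simp
  qed
  have const0: "F x = 0" if x: "x \<le> 0" for x
  proof (cases "x = 0")
    case False
    then obtain z where z: "z > x" "z < 0" "F 0 - F x = (0 - x) * \<beta> z" using MVT2[of x 0 F \<beta>] dF x by auto
    then show ?thesis using \<beta>0[of z] F(2) by simp
  qed (use F in simp)
  have const1: "F x = F 1" if x: "x \<ge> 1" for x
  proof (cases "x = 1")
    case False
    then obtain z where z: "z > 1" "z < x" "F x - F 1 = (x - 1) * \<beta> z" using MVT2[of 1 x F \<beta>] dF x by auto
    then show ?thesis using \<beta>0[of z] by simp
  qed simp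
  have bd: "0 \<le> F x \<and> F x \<le> F 1" for x
  proof -
    consider "x \<le> 0" | "0 \<le> x" "x \<le> 1" | "1 \<le> x" by linarith
    then show ?thesis
      using mono[of 0 x] mono[of x 1] const0[of x] const1[of x] F(2) \<open>0 < F 1\<close> by cases linarith+
  qed
  have "smooth (\<lambda>x. (1 / F 1) * F x)" by (rule smooth_mult[OF smooth_const F(1)])
  moreover have "(1 / F 1) * F x = 0" if "x \<le> 0" for x using const0[OF that] by simp
  moreover have "(1 / F 1) * F x = 1" if "1 \<le> x" for x using const1[OF that] \<open>0 < F 1\<close> by simp
  moreover have "0 \<le> (1 / F 1) * F x \<and> (1 / F 1) * F x \<le> 1" for x using bd[of x] \<open>0 < F 1\<close> by simp
  ultimately show ?thesis by blast
qed

definition smooth_step :: "real \<Rightarrow> real" where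
  "smooth_step = (SOME \<theta>. smooth \<theta> \<and> (\<forall>x\<le>0. \<theta> x = 0) \<and> (\<forall>x\<ge>1. \<theta> x = 1) \<and> (\<forall>x. 0 \<le> \<theta> x \<and> \<theta> x \<le> 1))"

lemma smooth_step: "smooth smooth_step" "x \<le> 0 \<Longrightarrow> smooth_step x = 0" "1 \<le> x \<Longrightarrow> smooth_step x = 1"
    "0 \<le> smooth_step x" "smooth_step x \<le> 1"
proof -
  have *: "smooth smooth_step \<and> (\<forall>x\<le>0. smooth_step x = 0) \<and> (\<forall>x\<ge>1. smooth_step x = 1) \<and>
      (\<forall>x. 0 \<le> smooth_step x \<and> smooth_step x \<le> 1)"
    unfolding smooth_step_def by (rule someI_ex[OF smooth_step_exists])
  then show "smooth smooth_step" by blast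
  show "x \<le> 0 \<Longrightarrow> smooth_step x = 0" using * by simp
  show "1 \<le> x \<Longrightarrow> smooth_step x = 1" using * by simp
  show "0 \<le> smooth_step x" "smooth_step x \<le> 1" using * by simp_all
qed

section \<open>Smooth cut-offs and weak derivatives\<close>

text \<open>A smooth approximation of the indicator of (a, b]. Both ramps have width 1/(i+1) and
  extend to the right of their starting points; hence the half-open limit, and support in [a, b+1]
  for every i.\<close>

definition cutoff :: "nat \<Rightarrow> real \<Rightarrow> real \<Rightarrow> real \<Rightarrow> real" where
  "cutoff i a b s = smooth_step (real (Suc i) * (s - a)) - smooth_step (real (Suc i) * (s - b))"

lemma smooth_scaled: "smooth f \<Longrightarrow> smooth (\<lambda>s. f (n * (s - a)))"
proof -
  assume "smooth f"
  from smooth_affine[OF this, of n "- (n * a)"] have "smooth (\<lambda>s. f (n * s + - (n * a)))" .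
  moreover have "n * s + - (n * a) = n * (s - a)" for s by (simp add: right_diff_distrib)
  ultimately show ?thesis by (simp only:)
qed

lemma smooth_minus: "smooth f \<Longrightarrow> smooth g \<Longrightarrow> smooth (\<lambda>s. f s - g s)"
proof -
  assume f: "smooth f" and g: "smooth g"
  have "smooth (\<lambda>s. f s + (-1) * g s)" by (rule smooth_add[OF f smooth_mult[OF smooth_const g]])
  then show ?thesis by simp
qed

lemma smooth_cutoff: "smooth (cutoff i a b)"
  unfolding cutoff_def[abs_def]
  by (rule smooth_minus[OF smooth_scaled[OF smooth_step(1)] smooth_scaled[OF smooth_step(1)]])

lemma cutoff_eq_0: assumes "a \<le> b" "s \<notin> {a..b+1}" shows "cutoff i a b s = 0"
proof -
  let ?n = "real (Suc i)"
  have "s < a \<or> s > b + 1" using assms(2) by (simp add: not_le)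
  then consider "s < a" | "s > b + 1" by blast
  then show ?thesis
  proof cases
    case 1
    then have "?n * (s - a) \<le> 0" "?n * (s - b) \<le> 0"
      using assms by (auto intro!: mult_nonneg_nonpos)
    then show ?thesis by (simp only: cutoff_def smooth_step(2) diff_self)
  next
    case 2
    then have "1 \<le> s - a" "1 \<le> s - b" using assms by auto
    moreover have n: "1 * 1 \<le> ?n * t" if "1 \<le> t" for t :: real using that by (intro mult_mono) auto
    ultimately have "1 \<le> ?n * (s - a)" "1 \<le> ?n * (s - b)"
      using n[of "s - a"] n[of "s - b"] by (simp_all only: mult_1)
    then show ?thesis by (simp only: cutoff_def smooth_step(3) diff_self)
  qed
qed

lemma abs_cutoff_le: "\<bar>cutoff i a b s\<bar> \<le> 1"
  using smooth_step(4,5)[of "real (Suc i) * (s - a)"] smooth_step(4,5)[of "real (Suc i) * (s - b)"]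
  unfolding cutoff_def by linarith

lemma test_function_cutoff: "a \<le> b \<Longrightarrow> test_function (cutoff i a b)"
  by (rule test_function_if_smooth[OF smooth_cutoff cutoff_eq_0])

lemma smooth_step_tendsto: "(\<lambda>i. smooth_step (real (Suc i) * x)) \<longlonglongrightarrow> (if 0 < x then 1 else 0)"
proof (cases "0 < x")
  case True
  obtain m :: nat where m: "1 / x \<le> real m" using real_arch_simple by blast
  have "\<forall>\<^sub>F i in sequentially. smooth_step (real (Suc i) * x) = 1"
    using eventually_ge_at_top[of m]
  proof (rule eventually_mono)
    fix i assume "m \<le> i"
    then have "1 / x \<le> real (Suc i)" using m by linarith
    then show "smooth_step (real (Suc i) * x) = 1" using True by (intro smooth_step(3)) (simp add: field_simps)
  qed
  then show ?thesis using True by (simp add: tendsto_eventually)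
next
  case False
  then have "smooth_step (real (Suc i) * x) = 0" for i by (intro smooth_step(2) mult_nonneg_nonpos) auto
  then show ?thesis using False by simp
qed

lemma cutoff_tendsto: "a \<le> b \<Longrightarrow> (\<lambda>i. cutoff i a b s) \<longlonglongrightarrow> indicator {a<..b} s"
  using tendsto_diff[OF smooth_step_tendsto[of "s - a"] smooth_step_tendsto[of "s - b"]]
  unfolding cutoff_def by (rule back_subst[of "\<lambda>l. _ \<longlonglongrightarrow> l"]) (auto simp: indicator_def)

lemma integrable_times_compact_support:
  assumes g: "locally_integrable g" and c: "continuous_on UNIV \<phi>" and z: "\<And>s. s \<notin> {a..b} \<Longrightarrow> \<phi> s = 0"
  shows "integrable lebesgue (\<lambda>s. g s * of_real (\<phi> s))"
proof -
  have "set_integrable lebesgue {a..b} (\<lambda>s. g s * of_real (\<phi> s))"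
  proof (rule set_integrable_mult_continuous)
    show "set_integrable lebesgue {a..b} g" using g by (simp add: locally_integrable_def)
    show "continuous_on {a..b} (\<lambda>s. complex_of_real (\<phi> s))"
      by (intro continuous_on_of_real continuous_on_subset[OF c]) simp
  qed
  moreover have "indicator {a..b} s *\<^sub>R (g s * of_real (\<phi> s)) = g s * of_real (\<phi> s)" for s
    using z[of s] by (auto simp: indicator_def)
  ultimately show ?thesis by (simp add: set_integrable_def)
qed

lemma integral_cutoff_tendsto:
  assumes k: "locally_integrable k" and ab: "a \<le> b"
  shows "(\<lambda>i. \<integral>s. k s * of_real (cutoff i a b s) \<partial>lebesgue) \<longlonglongrightarrow> (LINT s:{a..b}|lebesgue. k s)"
proof -
  note km [measurable] = locally_integrable_measurable[OF k]
  have 1: "integrable lebesgue (\<lambda>s. k s * of_real (cutoff i a b s))" for i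
    by (rule integrable_times_compact_support[OF k smooth_continuous[OF smooth_cutoff] cutoff_eq_0[OF ab]])
  have [measurable]: "{a<..b} \<in> sets lebesgue" "{a..b} \<in> sets lebesgue" by simp_all
  have "(\<lambda>i. \<integral>s. k s * of_real (cutoff i a b s) \<partial>lebesgue) \<longlonglongrightarrow> (\<integral>s. k s * of_real (indicator {a<..b} s) \<partial>lebesgue)"
  proof (rule integral_dominated_convergence[where w="\<lambda>s. norm (indicator {a..b+1} s *\<^sub>R k s)"])
    show "integrable lebesgue (\<lambda>s. norm (indicator {a..b+1} s *\<^sub>R k s))"
      using k by (intro integrable_norm) (simp add: locally_integrable_def set_integrable_def)
    show "AE s in lebesgue. (\<lambda>i. k s * of_real (cutoff i a b s)) \<longlonglongrightarrow> k s * of_real (indicator {a<..b} s)"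
      by (intro AE_I2 tendsto_intros cutoff_tendsto ab)
    show "AE s in lebesgue. norm (k s * of_real (cutoff i a b s)) \<le> norm (indicator {a..b+1} s *\<^sub>R k s)" for i
    proof (rule AE_I2)
      fix s
      show "norm (k s * of_real (cutoff i a b s)) \<le> norm (indicator {a..b+1} s *\<^sub>R k s)"
      proof (cases "s \<in> {a..b+1}")
        case True
        then show ?thesis using mult_left_mono[OF abs_cutoff_le[of i a b s], of "norm (k s)"] by (simp add: norm_mult)
      next
        case False
        then show ?thesis using cutoff_eq_0[OF ab False, of i] by simp
      qed
    qed
    show "(\<lambda>s. k s * of_real (cutoff i a b s)) \<in> borel_measurable lebesgue" for i using 1 by (rule borel_measurable_integrable)
  qed simp
  also have "(\<integral>s. k s * of_real (indicator {a<..b} s) \<partial>lebesgue) = (LINT s:{a..b}|lebesgue. k s)"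
    unfolding set_lebesgue_integral_def
  proof (rule integral_cong_AE)
    have "AE s in lebesgue. s \<notin> {a}" by (intro AE_not_in) simp
    then show "AE s in lebesgue. k s * of_real (indicator {a<..b} s) = indicator {a..b} s *\<^sub>R k s"
      by (rule eventually_mono) (auto simp: indicator_def)
  qed simp_all
  finally show ?thesis .
qed

lemma weak_zero_imp_ac_prim:
  assumes k: "locally_integrable k" and z: "\<And>\<phi>. test_function \<phi> \<Longrightarrow> (\<integral>s. k s * of_real (\<phi> s) \<partial>lebesgue) = 0"
  shows "ac_prim (\<lambda>s. 0) k"
proof -
  have "0 = (LINT s:{a..b}|lebesgue. k s)" if "a \<le> b" for a b
    using integral_cutoff_tendsto[OF k that] z[OF test_function_cutoff[OF that]] by (simp add: LIMSEQ_const_iff)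
  then show ?thesis using k by (simp add: ac_prim_def)
qed

text \<open>The difference of two cut-offs of equal length has integral 0, so it is the derivative
  of a test function. Hence the integral of k over an interval depends only on the length, and the
  difference quotients of a primitive of k are the same at every point; their limit is the
  constant.\<close>

lemma weak_constant_imp_AE_constant:
  assumes k: "locally_integrable k"
    and z: "\<And>\<phi>. test_function \<phi> \<Longrightarrow> (\<integral>s. k s * of_real (deriv \<phi> s) \<partial>lebesgue) = 0"
  shows "\<exists>c. AE s in lebesgue. k s = c"
proof -
  from smooth_antiderivative_exists[OF smooth_step(1)] obtain \<Theta> where T: "smooth \<Theta>" "\<Theta> 0 = 0"
    and dT: "\<And>x. (\<Theta> has_real_derivative smooth_step x) (at x)" by blast
  have T0: "\<Theta> x = 0" if x: "x \<le> 0" for x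
  proof (cases "x = 0")
    case False
    then obtain z where z: "z > x" "z < 0" "\<Theta> 0 - \<Theta> x = (0 - x) * smooth_step z" using MVT2[of x 0 \<Theta> smooth_step] dT x by auto
    then show ?thesis using smooth_step(2)[of z] T(2) by simp
  qed (use T in simp)
  have T1: "\<Theta> x = x - 1 + \<Theta> 1" if x: "x \<ge> 1" for x
  proof (cases "x = 1")
    case False
    then obtain z where z: "z > 1" "z < x" "\<Theta> x - \<Theta> 1 = (x - 1) * smooth_step z" using MVT2[of 1 x \<Theta> smooth_step] dT x by auto
    then show ?thesis using smooth_step(3)[of z] by simp
  qed simp
  have eq: "(LINT s:{a..a+e}|lebesgue. k s) = (LINT s:{b..b+e}|lebesgue. k s)" if e: "0 \<le> e" for a b e
  proof -
    have "(\<integral>s. k s * of_real (cutoff i a (a+e) s) \<partial>lebesgue) = (\<integral>s. k s * of_real (cutoff i b (b+e) s) \<partial>lebesgue)" for i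
    proof -
      let ?n = "real (Suc i)"
      \<comment> \<open>The antiderivative of the difference of the two cut-offs.
        \<open>\<Theta>\<close> is affine with slope 1 beyond 1, so to the right each bracket equals
        n e and the two cancel; this is what gives compact support.\<close>
      define \<phi> where "\<phi> s = (1 / ?n) * ((\<Theta> (?n * (s - a)) - \<Theta> (?n * (s - (a+e)))) - (\<Theta> (?n * (s - b)) - \<Theta> (?n * (s - (b+e)))))" for s
      have "smooth \<phi>" unfolding \<phi>_def[abs_def]
        by (rule smooth_mult[OF smooth_const smooth_minus[OF
              smooth_minus[OF smooth_scaled[OF T(1)] smooth_scaled[OF T(1)]]
              smooth_minus[OF smooth_scaled[OF T(1)] smooth_scaled[OF T(1)]]]])
      have d: "(\<phi> has_real_derivative cutoff i a (a+e) s - cutoff i b (b+e) s) (at s)" for s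
      proof -
        have D: "((\<lambda>s. \<Theta> (?n * (s - c))) has_real_derivative ?n * smooth_step (?n * (s - c))) (at s)" for c
        proof -
          have g: "((\<lambda>s. ?n * (s - c)) has_real_derivative ?n) (at s)"
            by (auto intro!: derivative_eq_intros)
          show ?thesis
            by (subst mult.commute[of ?n "smooth_step (?n * (s - c))"]) (rule DERIV_chain2[OF dT g])
        qed
        have "(\<phi> has_real_derivative (1 / ?n) * ((?n * smooth_step (?n * (s - a)) - ?n * smooth_step (?n * (s - (a+e))))
            - (?n * smooth_step (?n * (s - b)) - ?n * smooth_step (?n * (s - (b+e)))))) (at s)"
          unfolding \<phi>_def[abs_def] by (intro DERIV_cmult DERIV_diff D)
        also have "(1 / ?n) * ((?n * smooth_step (?n * (s - a)) - ?n * smooth_step (?n * (s - (a+e))))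
            - (?n * smooth_step (?n * (s - b)) - ?n * smooth_step (?n * (s - (b+e))))) = cutoff i a (a+e) s - cutoff i b (b+e) s"
          unfolding cutoff_def by (simp only: right_diff_distrib[symmetric]) simp
        finally show ?thesis .
      qed
      have "\<phi> s = 0" if s: "s \<notin> {min a b..max a b + e + 1}" for s
      proof -
        have "s < min a b \<or> s > max a b + e + 1" using s unfolding atLeastAtMost_iff by linarith
        then consider "s < min a b" | "s > max a b + e + 1" by blast
        then show ?thesis
        proof cases
          case 1
          have "?n * (s - c) \<le> 0" if "c \<in> {a, a+e, b, b+e}" for c
          proof (rule mult_nonneg_nonpos)
            show "s - c \<le> 0" using that e 1 by auto
          qed simp
          from T0[OF this] have t: "\<Theta> (?n * (s - c)) = 0" if "c \<in> {a, a+e, b, b+e}" for c using that by blast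
          have "\<Theta> (?n * (s - a)) = 0" "\<Theta> (?n * (s - (a+e))) = 0" "\<Theta> (?n * (s - b)) = 0" "\<Theta> (?n * (s - (b+e))) = 0"
            by (rule t, simp)+
          then show ?thesis unfolding \<phi>_def by (simp only: diff_self mult_zero_right)
        next
          case 2
          have l: "1 \<le> ?n * (s - c)" if "c \<in> {a, a+e, b, b+e}" for c
          proof -
            have "1 \<le> s - c" using that e 2 by auto
            then have "1 * 1 \<le> ?n * (s - c)" by (intro mult_mono) auto
            then show ?thesis by simp
          qed
          have t: "\<Theta> (?n * (s - c)) - \<Theta> (?n * (s - (c + e))) = ?n * e" if "c \<in> {a, b}" for c
          proof -
            have "c \<in> {a, a+e, b, b+e}" "c + e \<in> {a, a+e, b, b+e}" using that by auto
            from T1[OF l[OF this(1)]] T1[OF l[OF this(2)]]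
            have "\<Theta> (?n * (s - c)) - \<Theta> (?n * (s - (c + e))) = ?n * (s - c) - ?n * (s - (c + e))" by linarith
            also have "\<dots> = ?n * e" by (simp only: right_diff_distrib[symmetric]) simp
            finally show ?thesis .
          qed
          have "\<Theta> (?n * (s - a)) - \<Theta> (?n * (s - (a + e))) = ?n * e" "\<Theta> (?n * (s - b)) - \<Theta> (?n * (s - (b + e))) = ?n * e"
            by (rule t, simp)+
          then show ?thesis unfolding \<phi>_def by (simp only: diff_self mult_zero_right)
        qed
      qed
      from test_function_if_smooth[OF \<open>smooth \<phi>\<close> this] have "test_function \<phi>" .
      from z[OF this] have z0: "(\<integral>s. k s * of_real (deriv \<phi> s) \<partial>lebesgue) = 0" .
      have dd: "deriv \<phi> = (\<lambda>s. cutoff i a (a+e) s - cutoff i b (b+e) s)" using DERIV_imp_deriv[OF d] by blast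
      have I: "integrable lebesgue (\<lambda>s. k s * of_real (cutoff i c (c+e) s))" for c
        by (rule integrable_times_compact_support[OF k smooth_continuous[OF smooth_cutoff] cutoff_eq_0]) (use e in simp_all)
      show ?thesis using z0 I[of a] I[of b] unfolding dd by (simp add: right_diff_distrib)
    qed
    then show ?thesis
      using LIMSEQ_unique[OF integral_cutoff_tendsto[OF k, of a "a+e"], of "LINT s:{b..b+e}|lebesgue. k s"]
        integral_cutoff_tendsto[OF k, of b "b+e"] e by simp
  qed
  from ac_prim_exists[OF k] obtain K where K: "ac_prim K k" by blast
  from ac_prim_AE_derivative[OF K]
  have AE: "AE s in lebesgue. (\<lambda>n. of_nat (Suc n) * (K (s + 1 / of_nat (Suc n)) - K s)) \<longlonglongrightarrow> k s" .
  have same: "K (s + 1 / of_nat (Suc n)) - K s = K (0 + 1 / of_nat (Suc n)) - K 0" for s n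
    using ac_prim_eq[OF K, of s "s + 1 / of_nat (Suc n)"] ac_prim_eq[OF K, of 0 "0 + 1 / of_nat (Suc n)"]
      eq[of "1 / of_nat (Suc n)" s 0] by simp
  have "AE s in lebesgue. k s = lim (\<lambda>n. of_nat (Suc n) * (K (0 + 1 / of_nat (Suc n)) - K 0))"
    using AE
  proof (rule eventually_mono)
    fix s assume l: "(\<lambda>n. of_nat (Suc n) * (K (s + 1 / of_nat (Suc n)) - K s)) \<longlonglongrightarrow> k s"
    have "(\<lambda>n. of_nat (Suc n) * (K (s + 1 / of_nat (Suc n)) - K s)) = (\<lambda>n. of_nat (Suc n) * (K (0 + 1 / of_nat (Suc n)) - K 0))"
      by (rule ext) (rule arg_cong[OF same])
    from limI[OF l, unfolded this] show "k s = lim (\<lambda>n. of_nat (Suc n) * (K (0 + 1 / of_nat (Suc n)) - K 0))" by (rule sym)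
  qed
  then show ?thesis by blast
qed

lemma test_functionD:
  assumes "test_function \<phi>"
  obtains a b where "\<And>x. (\<phi> has_real_derivative deriv \<phi> x) (at x)" "continuous_on UNIV (deriv \<phi>)"
    "a \<le> b" "\<And>x. x \<notin> {a<..<b} \<Longrightarrow> \<phi> x = 0" "\<And>x. x \<notin> {a<..<b} \<Longrightarrow> deriv \<phi> x = 0"
proof -
  have df: "((deriv ^^ n) \<phi>) differentiable (at x)" for n x using assms by (simp add: test_function_def)
  have d: "(\<phi> has_real_derivative deriv \<phi> x) (at x)" for x
    using df[of 0 x] DERIV_deriv_iff_real_differentiable[of \<phi> x] by simp
  have "continuous_on UNIV (deriv \<phi>)"
  proof (unfold continuous_on_eq_continuous_at[OF open_UNIV], rule ballI)
    fix x
    show "isCont (deriv \<phi>) x" using df[of 1 x] by (intro differentiable_imp_continuous_within) simp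
  qed
  from assms obtain a b where z: "\<And>x. x \<notin> {a..b} \<Longrightarrow> \<phi> x = 0" by (auto simp: test_function_def)
  have dz: "deriv \<phi> x = 0" if "x \<notin> {a..b}" for x
  proof -
    have "((\<lambda>x. 0) has_real_derivative 0) (at x)" by simp
    then have "(\<phi> has_real_derivative 0) (at x)"
      by (rule has_field_derivative_transform_within_open[of _ _ _ "- {a..b}"]) (use that z in auto)
    then show ?thesis by (rule DERIV_imp_deriv)
  qed
  \<comment> \<open>Enlarging by 1 on each side makes the function vanish at the endpoints
    themselves; the minimum and maximum cover the case a > b.\<close>
  have out: "x \<notin> {a..b}" if "x \<notin> {min a b - 1<..<max a b + 1}" for x using that by auto
  show ?thesis
    by (rule that[of "min a b - 1" "max a b + 1", OF d \<open>continuous_on UNIV (deriv \<phi>)\<close>])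
      (simp, erule z[OF out], erule dz[OF out])
qed

lemma integrable_times_test_function:
  assumes g: "locally_integrable g" and t: "test_function \<phi>"
  shows "integrable lebesgue (\<lambda>s. g s * of_real (\<phi> s))" "integrable lebesgue (\<lambda>s. g s * of_real (deriv \<phi> s))"
proof -
  obtain a b where d: "\<And>x. (\<phi> has_real_derivative deriv \<phi> x) (at x)"
    and c: "continuous_on UNIV (deriv \<phi>)" and ab: "a \<le> b" and z: "\<And>x. x \<notin> {a<..<b} \<Longrightarrow> \<phi> x = 0"
    and dz: "\<And>x. x \<notin> {a<..<b} \<Longrightarrow> deriv \<phi> x = 0" by (rule test_functionD[OF t]) blast
  have c\<phi>: "continuous_on UNIV \<phi>"
    unfolding continuous_on_eq_continuous_at[OF open_UNIV] using DERIV_isCont[OF d] by blast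
  have out: "x \<notin> {a<..<b}" if "x \<notin> {a..b}" for x using that by auto
  show "integrable lebesgue (\<lambda>s. g s * of_real (\<phi> s))"
    by (rule integrable_times_compact_support[OF g c\<phi> z[OF out]])
  show "integrable lebesgue (\<lambda>s. g s * of_real (deriv \<phi> s))"
    by (rule integrable_times_compact_support[OF g c dz[OF out]])
qed

lemma locally_integrable_diff:
  assumes "locally_integrable g" "locally_integrable h" shows "locally_integrable (\<lambda>s. g s - h s)"
  unfolding locally_integrable_def
proof (intro allI)
  fix a b :: real
  show "set_integrable lebesgue {a..b} (\<lambda>s. g s - h s)"
    by (rule set_integral_diff(1)) (use assms in \<open>simp_all add: locally_integrable_def\<close>)
qed

lemma ac_prim_imp_has_weak_deriv: assumes F: "ac_prim F h" shows "has_weak_deriv F h"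
proof -
  have li: "locally_integrable F"
    unfolding locally_integrable_def
    by (intro allI absolutely_integrable_continuous_real continuous_on_subset[OF ac_prim_continuous[OF F]]) simp
  have "(\<integral>s. F s * of_real (deriv \<phi> s) \<partial>lebesgue) = - (\<integral>s. h s * of_real (\<phi> s) \<partial>lebesgue)"
    if test: "test_function \<phi>" for \<phi>
  proof -
    obtain a b where d: "\<And>x. (\<phi> has_real_derivative deriv \<phi> x) (at x)"
      and c: "continuous_on UNIV (deriv \<phi>)" and ab: "a \<le> b" and z: "\<And>x. x \<notin> {a<..<b} \<Longrightarrow> \<phi> x = 0"
      and dz: "\<And>x. x \<notin> {a<..<b} \<Longrightarrow> deriv \<phi> x = 0"
      by (rule test_functionD[OF test]) blast
    have c\<phi>: "continuous_on UNIV \<phi>"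
    unfolding continuous_on_eq_continuous_at[OF open_UNIV] using DERIV_isCont[OF d] by blast
    note I = integrable_times_test_function(1)[OF ac_prim_locally_integrable[OF F] that]
      integrable_times_test_function(2)[OF li that]
    have "ac_prim (\<lambda>s. complex_of_real (\<phi> s)) (\<lambda>s. of_real (deriv \<phi> s))"
    proof (rule ac_prim_smooth)
      show "((\<lambda>s. complex_of_real (\<phi> s)) has_vector_derivative of_real (deriv \<phi> x)) (at x)" for x
        using d[of x] unfolding has_real_derivative_iff_has_vector_derivative
        by (rule bounded_linear.has_vector_derivative[OF bounded_linear_of_real])
      show "continuous_on UNIV (\<lambda>s. complex_of_real (deriv \<phi> s))" by (rule continuous_on_of_real[OF c])
    qed
    from ac_prim_eq[OF ac_prim_mult[OF F this] ab]
    have "(LINT s:{a..b}|lebesgue. h s * of_real (\<phi> s) + F s * of_real (deriv \<phi> s)) = 0"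
      using z[of a] z[of b] by simp
    moreover have "indicator {a..b} s *\<^sub>R (h s * of_real (\<phi> s) + F s * of_real (deriv \<phi> s)) = h s * of_real (\<phi> s) + F s * of_real (deriv \<phi> s)" for s
      using z[of s] dz[of s] by (auto simp: indicator_def)
    ultimately have "(\<integral>s. h s * of_real (\<phi> s) \<partial>lebesgue) + (\<integral>s. F s * of_real (deriv \<phi> s) \<partial>lebesgue) = 0"
      using I by (simp add: set_lebesgue_integral_def)
    then show ?thesis by (simp only: add_eq_0_iff)
  qed
  then show ?thesis using li ac_prim_locally_integrable[OF F] by (simp add: has_weak_deriv_def)
qed

lemma locally_integrable_cong_AE:
  assumes g: "locally_integrable g" and gk: "AE s in lebesgue. g s = k s"
  shows "locally_integrable k"
  using ac_prim_exists[OF g] ac_prim_cong_AE[OF _ gk] ac_prim_locally_integrable by blast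

text \<open>The passage from distributions to continuous representatives. It lets all later calculus
  on the fibres be done with an absolutely continuous G instead of test functions.\<close>

lemma has_weak_deriv_iff_ac_prim: "has_weak_deriv g h \<longleftrightarrow> (\<exists>G. ac_prim G h \<and> (AE s in lebesgue. g s = G s))"
proof
  assume w: "has_weak_deriv g h"
  then have lg: "locally_integrable g" and lh: "locally_integrable h"
    and wd: "\<And>\<phi>. test_function \<phi> \<Longrightarrow> (\<integral>s. g s * of_real (deriv \<phi> s) \<partial>lebesgue) = - (\<integral>s. h s * of_real (\<phi> s) \<partial>lebesgue)"
    by (auto simp: has_weak_deriv_def)
  from ac_prim_exists[OF lh] obtain H where H: "ac_prim H h" by blast
  from ac_prim_imp_has_weak_deriv[OF H] have lH: "locally_integrable H"
    and wH: "\<And>\<phi>. test_function \<phi> \<Longrightarrow> (\<integral>s. H s * of_real (deriv \<phi> s) \<partial>lebesgue) = - (\<integral>s. h s * of_real (\<phi> s) \<partial>lebesgue)"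
    by (auto simp: has_weak_deriv_def)
  have "\<exists>c. AE s in lebesgue. g s - H s = c"
  proof (rule weak_constant_imp_AE_constant)
    show "locally_integrable (\<lambda>s. g s - H s)" by (rule locally_integrable_diff[OF lg lH])
    fix \<phi> assume t: "test_function \<phi>"
    note I = integrable_times_test_function(2)[OF lg t] integrable_times_test_function(2)[OF lH t]
    show "(\<integral>s. (g s - H s) * of_real (deriv \<phi> s) \<partial>lebesgue) = 0"
      using I wd[OF t] wH[OF t] by (simp add: left_diff_distrib)
  qed
  then obtain c where "AE s in lebesgue. g s - H s = c" by blast
  then have "AE s in lebesgue. g s = H s + c" by (rule eventually_mono) (simp add: diff_eq_eq)
  moreover have "ac_prim (\<lambda>s. H s + c) h" using ac_prim_lin[OF H ac_prim_const[of c], of 1] by simp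
  ultimately show "\<exists>G. ac_prim G h \<and> (AE s in lebesgue. g s = G s)" by (intro exI[of _ "\<lambda>s. H s + c"]) simp
next
  assume "\<exists>G. ac_prim G h \<and> (AE s in lebesgue. g s = G s)"
  then obtain G where G: "ac_prim G h" and e: "AE s in lebesgue. g s = G s" by blast
  from ac_prim_imp_has_weak_deriv[OF G] have wG: "has_weak_deriv G h" .
  then have lG: "locally_integrable G" by (simp add: has_weak_deriv_def)
  have lg: "locally_integrable g" by (rule locally_integrable_cong_AE[OF lG AE_eq_sym[OF e]])
  have "(\<integral>s. g s * of_real (deriv \<phi> s) \<partial>lebesgue) = (\<integral>s. G s * of_real (deriv \<phi> s) \<partial>lebesgue)"
    if t: "test_function \<phi>" for \<phi>
  proof (rule integral_cong_AE)
    show "(\<lambda>s. g s * of_real (deriv \<phi> s)) \<in> borel_measurable lebesgue"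
      by (rule borel_measurable_integrable[OF integrable_times_test_function(2)[OF lg t]])
    show "(\<lambda>s. G s * of_real (deriv \<phi> s)) \<in> borel_measurable lebesgue"
      by (rule borel_measurable_integrable[OF integrable_times_test_function(2)[OF lG t]])
    show "AE s in lebesgue. g s * of_real (deriv \<phi> s) = G s * of_real (deriv \<phi> s)"
      using e by (rule eventually_mono) simp
  qed
  then show "has_weak_deriv g h" using wG lg by (simp add: has_weak_deriv_def)
qed

lemma has_weak_deriv_unique: "has_weak_deriv g h \<Longrightarrow> has_weak_deriv g k \<Longrightarrow> AE s in lebesgue. h s = k s"
proof -
  assume h: "has_weak_deriv g h" and k: "has_weak_deriv g k"
  have l: "locally_integrable (\<lambda>s. h s - k s)"
    using h k by (intro locally_integrable_diff) (simp_all add: has_weak_deriv_def)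
  have "ac_prim (\<lambda>s. 0) (\<lambda>s. h s - k s)"
  proof (rule weak_zero_imp_ac_prim[OF l])
    fix \<phi> assume t: "test_function \<phi>"
    have "locally_integrable h" "locally_integrable k" using h k by (simp_all add: has_weak_deriv_def)
    note I = this[THEN integrable_times_test_function(1), OF t]
    have "(\<integral>s. h s * of_real (\<phi> s) \<partial>lebesgue) = (\<integral>s. k s * of_real (\<phi> s) \<partial>lebesgue)"
      using h k t by (auto simp: has_weak_deriv_def)
    then show "(\<integral>s. (h s - k s) * of_real (\<phi> s) \<partial>lebesgue) = 0" using I by (simp add: left_diff_distrib)
  qed
  from ac_prim_unique[OF this ac_prim_const] have "AE s in lebesgue. h s - k s = 0" .
  then show ?thesis by (rule eventually_mono) simp
qed

lemma has_weak_deriv_weak_deriv: "has_weak_deriv g h \<Longrightarrow> has_weak_deriv g (weak_deriv g)"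
  unfolding weak_deriv_def by (rule someI[of "has_weak_deriv g"])

section \<open>Fibres of a product with the line\<close>

lemma completion_ex_borel_measurable_complex:
  fixes f :: "'a \<Rightarrow> complex"
  assumes f: "f \<in> borel_measurable (completion M)"
  shows "\<exists>g\<in>borel_measurable M. AE x in M. f x = g x"
proof -
  have "(\<lambda>x. Re (f x)) \<in> borel_measurable (completion M)" "(\<lambda>x. Im (f x)) \<in> borel_measurable (completion M)"
    using f by simp_all
  from this[THEN completion_ex_borel_measurable_real]
  obtain u v where uv: "u \<in> borel_measurable M" "AE x in M. Re (f x) = u x" "v \<in> borel_measurable M" "AE x in M. Im (f x) = v x"
    by blast
  have "(\<lambda>x. Complex (u x) (v x)) \<in> borel_measurable M"
    using uv(1,3) by (subst borel_measurable_complex_iff) simp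
  moreover have "AE x in M. f x = Complex (u x) (v x)"
    using uv(2,4) by eventually_elim (simp add: complex_eq_iff)
  ultimately show ?thesis by (intro bexI[where x="\<lambda>x. Complex (u x) (v x)"])
qed

lemma AE_lebesgue_translate:
  fixes t :: real
  assumes "AE s in lebesgue. P s" shows "AE s in lebesgue. P (s + t)"
proof -
  have "AE s in distr lborel borel ((+) t). P s"
    using assms by (subst lborel_distr_plus) (simp add: AE_completion_iff)
  then have "AE s in lborel. P (t + s)" by (rule AE_distrD[rotated]) simp
  then show ?thesis by (simp add: AE_completion_iff add.commute)
qed

lemma continuous_AE_eq_imp_eq:
  fixes f g :: "real \<Rightarrow> complex"
  assumes f: "continuous_on UNIV f" and g: "continuous_on UNIV g" and e: "AE s in lebesgue. f s = g s"
  shows "f s = g s"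
proof (rule ccontr)
  assume ne: "f s \<noteq> g s"
  have o: "open {s. f s \<noteq> g s}" by (rule open_Collect_neq[OF f g])
  have "{s. f s \<noteq> g s} \<in> sets lebesgue" using o by (intro sets_completionI_sets) simp
  with e have "{s. f s \<noteq> g s} \<in> null_sets lebesgue" by (simp add: AE_iff_null)
  then have "negligible {s. f s \<noteq> g s}" by (simp add: negligible_iff_null_sets)
  with open_not_negligible[OF o] ne show False by blast
qed

text \<open>The full measure is the completion of a product, not the product of completions. Fubini
  is therefore applied to a Borel representative, and the result is transferred to the given
  function along equality almost everywhere on almost every fibre.\<close>

locale completed_product = sigma_finite_measure Q for Q :: "'b measure"
begin

sublocale pair: pair_sigma_finite "lborel :: real measure" Q ..

abbreviation "Z \<equiv> completion ((lborel :: real measure) \<Otimes>\<^sub>M Q)"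

lemma AE_fibres:
  assumes "AE p in Z. R p"
  shows "AE y in completion Q. AE s in lebesgue. R (s, y)"
proof -
  interpret QP: pair_sigma_finite Q "lborel :: real measure" ..
  have "AE p in distr (Q \<Otimes>\<^sub>M lborel) (lborel \<Otimes>\<^sub>M Q) (\<lambda>(x, y). (y, x)). R p"
    using assms by (subst pair.distr_pair_swap[symmetric]) (simp add: AE_completion_iff)
  then have "AE p in Q \<Otimes>\<^sub>M lborel. R ((\<lambda>(x, y). (y, x)) p)"
    by (rule AE_distrD[rotated]) (rule measurable_pair_swap')
  from QP.AE_pair[OF this] show ?thesis by (simp add: AE_completion_iff)
qed

lemma ex_borel_fibres:
  fixes f :: "real \<times> 'b \<Rightarrow> complex"
  assumes f: "f \<in> borel_measurable Z"
  obtains g where "g \<in> borel_measurable (lborel \<Otimes>\<^sub>M Q)" "AE p in Z. f p = g p"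
    "AE y in completion Q. AE s in lebesgue. f (s, y) = g (s, y)"
proof -
  from completion_ex_borel_measurable_complex[OF f] obtain g
    where g: "g \<in> borel_measurable (lborel \<Otimes>\<^sub>M Q)" "AE p in lborel \<Otimes>\<^sub>M Q. f p = g p" by blast
  from AE_completion[OF g(2)] have "AE p in Z. f p = g p" .
  from that[OF g(1) this AE_fibres[OF this]] show ?thesis .
qed

lemma AE_completion_space: "AE y in completion Q. y \<in> space Q"
  using AE_space[of "completion Q"] by simp

lemma measurable_fibres:
  fixes f :: "real \<times> 'b \<Rightarrow> complex"
  assumes f: "f \<in> borel_measurable Z"
  shows "AE y in completion Q. (\<lambda>s. f (s, y)) \<in> borel_measurable lebesgue"
proof -
  obtain g where g: "g \<in> borel_measurable (lborel \<Otimes>\<^sub>M Q)" and e: "AE y in completion Q. AE s in lebesgue. f (s, y) = g (s, y)"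
    by (rule ex_borel_fibres[OF f])
  show ?thesis using e AE_completion_space
  proof eventually_elim
    case (elim y)
    have "(\<lambda>s. g (s, y)) \<in> borel_measurable lborel"
      by (rule measurable_compose[OF measurable_Pair2'[OF elim(2)] g])
    then have "(\<lambda>s. g (s, y)) \<in> borel_measurable lebesgue" by (rule measurable_completion)
    then show ?case by (rule borel_measurable_completion_cong_AE) (rule AE_eq_sym[OF elim(1)])
  qed
qed

lemma nn_integral_fibres:
  assumes f: "f \<in> borel_measurable Z"
  shows "(\<integral>\<^sup>+p. f p \<partial>Z) = (\<integral>\<^sup>+y. (\<integral>\<^sup>+s. f (s, y) \<partial>lebesgue) \<partial>completion Q)"
proof -
  from completion_ex_borel_measurable[OF f] obtain g
    where g: "g \<in> borel_measurable (lborel \<Otimes>\<^sub>M Q)" "AE p in lborel \<Otimes>\<^sub>M Q. f p = g p" by blast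
  from AE_fibres[OF AE_completion[OF g(2)]]
  have e: "AE y in completion Q. (\<integral>\<^sup>+s. g (s, y) \<partial>lebesgue) = (\<integral>\<^sup>+s. f (s, y) \<partial>lebesgue)"
    by (rule eventually_mono) (rule nn_integral_cong_AE, rule AE_eq_sym)
  have "(\<integral>\<^sup>+p. f p \<partial>Z) = (\<integral>\<^sup>+p. g p \<partial>(lborel \<Otimes>\<^sub>M Q))"
    unfolding nn_integral_completion by (rule nn_integral_cong_AE[OF g(2)])
  also have "\<dots> = (\<integral>\<^sup>+y. (\<integral>\<^sup>+s. g (s, y) \<partial>lborel) \<partial>Q)"
    by (rule pair.nn_integral_snd[OF g(1), symmetric])
  also have "\<dots> = (\<integral>\<^sup>+y. (\<integral>\<^sup>+s. g (s, y) \<partial>lebesgue) \<partial>completion Q)"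
    by (simp add: nn_integral_completion)
  also have "\<dots> = (\<integral>\<^sup>+y. (\<integral>\<^sup>+s. f (s, y) \<partial>lebesgue) \<partial>completion Q)"
    by (rule nn_integral_cong_AE[OF e])
  finally show ?thesis .
qed

text \<open>The converse of \<open>AE_fibres\<close> needs a measurable exceptional set: only then
  is its measure the integral of the measures of its fibres.\<close>

lemma AE_Z_if_fibres:
  assumes R: "{p \<in> space Z. R p} \<in> sets Z" and e: "AE y in completion Q. AE s in lebesgue. R (s, y)"
  shows "AE p in Z. R p"
proof -
  let ?B = "space Z - {p \<in> space Z. R p}"
  have B: "?B \<in> sets Z" using R by (rule sets.compl_sets)
  have "emeasure Z ?B = (\<integral>\<^sup>+p. indicator ?B p \<partial>Z)" using B by simp
  also have "\<dots> = (\<integral>\<^sup>+y. (\<integral>\<^sup>+s. indicator ?B (s, y) \<partial>lebesgue) \<partial>completion Q)"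
    using B by (intro nn_integral_fibres) simp
  also have "\<dots> = (\<integral>\<^sup>+y. 0 \<partial>completion Q)"
  proof (rule nn_integral_cong_AE, use e in eventually_elim)
    case (elim y)
    have "AE s in lebesgue. indicator ?B (s, y) = (0::ennreal)"
      using elim by (rule eventually_mono) (simp add: indicator_def)
    from nn_integral_cong_AE[OF this] show ?case by simp
  qed
  finally have "?B \<in> null_sets Z" using B by (intro null_setsI) simp_all
  then show ?thesis by (rule AE_I') auto
qed

lemma AE_Z_eq_if_fibres:
  fixes f g :: "real \<times> 'b \<Rightarrow> complex"
  assumes "f \<in> borel_measurable Z" "g \<in> borel_measurable Z" "AE y in completion Q. AE s in lebesgue. f (s, y) = g (s, y)"
  shows "AE p in Z. f p = g p"
proof (rule AE_Z_if_fibres[OF _ assms(3)])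
  have "(\<lambda>p. f p - g p) -` {0} \<inter> space Z \<in> sets Z"
    by (rule measurable_sets[OF borel_measurable_diff[OF assms(1,2)]]) simp
  moreover have "(\<lambda>p. f p - g p) -` {0} \<inter> space Z = {p \<in> space Z. f p = g p}" by auto
  ultimately show "{p \<in> space Z. f p = g p} \<in> sets Z" by (simp only:)
qed

lemma measurable_fibre_integral:
  fixes f :: "real \<times> 'b \<Rightarrow> complex"
  assumes f: "f \<in> borel_measurable Z"
  shows "(\<lambda>y. \<integral>s. f (s, y) \<partial>lebesgue) \<in> borel_measurable (completion Q)"
proof -
  obtain g where g: "g \<in> borel_measurable (lborel \<Otimes>\<^sub>M Q)" and e: "AE y in completion Q. AE s in lebesgue. f (s, y) = g (s, y)"
    by (rule ex_borel_fibres[OF f])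
  have "(\<lambda>(y, s). g (s, y)) \<in> borel_measurable (Q \<Otimes>\<^sub>M lborel)"
    using measurable_compose[OF measurable_pair_swap' g] by (simp add: case_prod_unfold)
  from lborel.borel_measurable_lebesgue_integral[OF this]
  have "(\<lambda>y. \<integral>s. g (s, y) \<partial>lborel) \<in> borel_measurable (completion Q)" by (intro measurable_completion)
  then show ?thesis
  proof (rule borel_measurable_completion_cong_AE)
    show "AE y in completion Q. (\<integral>s. g (s, y) \<partial>lborel) = (\<integral>s. f (s, y) \<partial>lebesgue)"
      using e AE_completion_space measurable_fibres[OF f]
    proof eventually_elim
      case (elim y)
      have gy: "(\<lambda>s. g (s, y)) \<in> borel_measurable lborel"
        by (rule measurable_compose[OF measurable_Pair2'[OF elim(2)] g])
      have "(\<integral>s. g (s, y) \<partial>lborel) = (\<integral>s. g (s, y) \<partial>lebesgue)" by (rule integral_completion[OF gy, symmetric])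
      also have "\<dots> = (\<integral>s. f (s, y) \<partial>lebesgue)"
        by (rule integral_cong_AE[OF measurable_completion[OF gy] elim(3) AE_eq_sym[OF elim(1)]])
      finally show ?case .
    qed
  qed
qed

lemma integral_fibres:
  fixes f :: "real \<times> 'b \<Rightarrow> complex"
  assumes f: "integrable Z f"
  shows "(\<integral>p. f p \<partial>Z) = (\<integral>y. (\<integral>s. f (s, y) \<partial>lebesgue) \<partial>completion Q)"
proof -
  have fm: "f \<in> borel_measurable Z" using f by simp
  obtain g where g: "g \<in> borel_measurable (lborel \<Otimes>\<^sub>M Q)" and eZ: "AE p in Z. f p = g p"
      and e: "AE y in completion Q. AE s in lebesgue. f (s, y) = g (s, y)"
    by (rule ex_borel_fibres[OF fm])
  have gZ: "g \<in> borel_measurable Z" by (rule measurable_completion[OF g])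
  have "integrable Z g" by (rule integrable_cong_AE_imp[OF f gZ eZ])
  then have gi: "integrable (lborel \<Otimes>\<^sub>M Q) g" using integrable_completion[OF g] by simp
  have sm: "(\<lambda>(y, s). g (s, y)) \<in> borel_measurable (Q \<Otimes>\<^sub>M lborel)"
    using measurable_compose[OF measurable_pair_swap' g] by (simp add: case_prod_unfold)
  have gm: "(\<lambda>y. \<integral>s. g (s, y) \<partial>lborel) \<in> borel_measurable Q"
    by (rule lborel.borel_measurable_lebesgue_integral[OF sm])
  have "(\<integral>p. f p \<partial>Z) = (\<integral>p. g p \<partial>Z)" by (rule integral_cong_AE[OF fm gZ eZ])
  also have "\<dots> = (\<integral>p. g p \<partial>(lborel \<Otimes>\<^sub>M Q))" by (rule integral_completion[OF g])
  also have "\<dots> = (\<integral>y. (\<integral>s. g (s, y) \<partial>lborel) \<partial>Q)"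
    using pair.integral_snd[of "\<lambda>s y. g (s, y)"] gi by simp
  also have "\<dots> = (\<integral>y. (\<integral>s. g (s, y) \<partial>lborel) \<partial>completion Q)" by (rule integral_completion[OF gm, symmetric])
  also have "\<dots> = (\<integral>y. (\<integral>s. f (s, y) \<partial>lebesgue) \<partial>completion Q)"
  proof (rule integral_cong_AE[OF measurable_completion[OF gm] measurable_fibre_integral[OF fm]])
    show "AE y in completion Q. (\<integral>s. g (s, y) \<partial>lborel) = (\<integral>s. f (s, y) \<partial>lebesgue)"
      using e AE_completion_space measurable_fibres[OF fm]
    proof eventually_elim
      case (elim y)
      have gy: "(\<lambda>s. g (s, y)) \<in> borel_measurable lborel"
        by (rule measurable_compose[OF measurable_Pair2'[OF elim(2)] g])
      have "(\<integral>s. g (s, y) \<partial>lborel) = (\<integral>s. g (s, y) \<partial>lebesgue)" by (rule integral_completion[OF gy, symmetric])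
      also have "\<dots> = (\<integral>s. f (s, y) \<partial>lebesgue)"
        by (rule integral_cong_AE[OF measurable_completion[OF gy] elim(3) AE_eq_sym[OF elim(1)]])
      finally show ?case .
    qed
  qed
  finally show ?thesis .
qed

lemma measurable_snd_Z: "snd \<in> Z \<rightarrow>\<^sub>M completion Q"
proof (rule completion.measurable_completion2)
  show m: "snd \<in> Z \<rightarrow>\<^sub>M Q" by (rule measurable_completion[OF measurable_snd])
  show "null_sets Q \<subseteq> null_sets (distr Z Q snd)"
  proof
    fix A assume A: "A \<in> null_sets Q"
    then have AQ: "A \<in> sets Q" by auto
    have "emeasure (distr Z Q snd) A = emeasure Z (snd -` A \<inter> space Z)" by (rule emeasure_distr[OF m AQ])
    also have "snd -` A \<inter> space Z = UNIV \<times> A"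
      using sets.sets_into_space[OF AQ] by (auto simp: space_pair_measure)
    also have "emeasure Z (UNIV \<times> A) = emeasure ((lborel :: real measure) \<Otimes>\<^sub>M Q) (UNIV \<times> A)"
    proof -
      have "UNIV \<times> A \<in> sets ((lborel :: real measure) \<Otimes>\<^sub>M Q)" using AQ by (intro pair_measureI) simp_all
      then show ?thesis by simp
    qed
    also have "\<dots> = emeasure lborel (UNIV :: real set) * emeasure Q A"
      using AQ by (intro emeasure_pair_measure_Times) auto
    \<comment> \<open>The cylinder over a null set has measure infinity times 0, which is 0 in the
      extended nonnegative reals.\<close>
    also have "\<dots> = 0" using A by auto
    finally show "A \<in> null_sets (distr Z Q snd)" using AQ by (intro null_setsI) simp_all
  qed
qed

lemma measurable_fst_Z: "fst \<in> Z \<rightarrow>\<^sub>M (borel :: real measure)"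
proof -
  have "fst \<in> (lborel :: real measure) \<Otimes>\<^sub>M Q \<rightarrow>\<^sub>M borel"
    using measurable_fst[of "lborel :: real measure" Q] by (simp cong: measurable_cong_sets)
  then show ?thesis by (rule measurable_completion)
qed

end

section \<open>A differentiability criterion and the weight integral\<close>

text \<open>Almost translation invariant increments make G nearly additive at small scales: the
  increment over a length eta is about n times the increment over k when n k is close to eta. So
  difference quotients of different scales agree up to e, and they form a Cauchy family.\<close>

lemma differentiable_if_increments_almost_translation_invariant:
  fixes G :: "real \<Rightarrow> real"
  assumes \<rho>: "\<rho> > 0"
    and lip: "\<And>a b. t0 - \<rho> < a \<Longrightarrow> a \<le> b \<Longrightarrow> b < t0 + \<rho> \<Longrightarrow> \<bar>G b - G a\<bar> \<le> K * (b - a)"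
    and inv: "\<And>e. e > 0 \<Longrightarrow> \<exists>h0>0. \<forall>h a b. \<bar>h\<bar> < h0 \<longrightarrow> t0 - \<rho> < a \<longrightarrow> a \<le> b \<longrightarrow> b < t0 + \<rho> \<longrightarrow>
      t0 - \<rho> < a + h \<longrightarrow> b + h < t0 + \<rho> \<longrightarrow> \<bar>(G (b + h) - G (a + h)) - (G b - G a)\<bar> \<le> e * (b - a)"
  shows "\<exists>D. (G has_real_derivative D) (at t0)"
proof -
  have K: "K \<ge> 0"
  proof -
    have "0 \<le> \<bar>G (t0 + \<rho>/2) - G t0\<bar>" by simp
    also have "\<dots> \<le> K * (\<rho>/2)" using lip[of t0 "t0 + \<rho>/2"] \<rho> by simp
    finally show ?thesis using \<rho> by (simp add: zero_le_mult_iff)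
  qed
  define q where "q k = (G (t0 + k) - G t0) / k" for k
  have step: "\<bar>q \<eta> - q k\<bar> \<le> e + 2 * K * k / \<eta>"
    if h0: "\<And>h a b. \<bar>h\<bar> < h0 \<Longrightarrow> t0 - \<rho> < a \<Longrightarrow> a \<le> b \<Longrightarrow> b < t0 + \<rho> \<Longrightarrow>
      t0 - \<rho> < a + h \<Longrightarrow> b + h < t0 + \<rho> \<Longrightarrow> \<bar>(G (b + h) - G (a + h)) - (G b - G a)\<bar> \<le> e * (b - a)"
      and \<eta>: "0 < \<eta>" "\<eta> < h0" "\<eta> < \<rho>" and k: "0 < k" "k \<le> \<eta>" and e: "e > 0" for \<eta> k e h0
  proof -
    \<comment> \<open>The remainder eta - n k is shorter than k. It costs K k once in the increment
      of G and once more when n k is replaced by eta, which explains the error term 2 K k /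
      eta.\<close>
    define n where "n = nat \<lfloor>\<eta> / k\<rfloor>"
    have nk: "real n * k \<le> \<eta>" "\<eta> < (real n + 1) * k"
    proof -
      have "real n \<le> \<eta> / k" unfolding n_def using \<eta> k by simp
      then show "real n * k \<le> \<eta>" using k by (simp add: field_simps)
      have "\<eta> / k < real n + 1" unfolding n_def using \<eta> k by (simp add: of_nat_nat floor_less_iff)
      then show "\<eta> < (real n + 1) * k" using k by (simp add: field_simps)
    qed
    have s: "\<bar>(G (t0 + real j * k) - G t0) - real j * (G (t0 + k) - G t0)\<bar> \<le> real j * (e * k)" if "j \<le> n" for j
      using that
    proof (induction j)
      case (Suc j)
      have jk: "real (Suc j) * k \<le> \<eta>" using Suc(2) nk k by (meson mult_right_mono of_nat_mono order_trans less_imp_le)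
      then have jk': "real j * k + k \<le> \<eta>" by (simp add: algebra_simps)
      have j0: "0 \<le> real j * k" using k by simp
      have "\<bar>(G (t0 + k + real j * k) - G (t0 + real j * k)) - (G (t0 + k) - G t0)\<bar> \<le> e * (t0 + k - t0)"
        by (rule h0) (use jk' j0 k \<eta> \<rho> in linarith)+
      moreover have "t0 + k + real j * k = t0 + real (Suc j) * k" by (simp add: algebra_simps)
      ultimately have "\<bar>(G (t0 + real (Suc j) * k) - G (t0 + real j * k)) - (G (t0 + k) - G t0)\<bar> \<le> e * k" by simp
      moreover have "\<bar>(G (t0 + real j * k) - G t0) - real j * (G (t0 + k) - G t0)\<bar> \<le> real j * (e * k)" using Suc by simp
      moreover have "real (Suc j) * (G (t0 + k) - G t0) = real j * (G (t0 + k) - G t0) + (G (t0 + k) - G t0)"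
          "real (Suc j) * (e * k) = real j * (e * k) + e * k" by (simp_all add: algebra_simps)
      ultimately show ?case by linarith
    qed simp
    have l1: "\<bar>G (t0 + \<eta>) - G (t0 + real n * k)\<bar> \<le> K * k"
    proof -
      have n0: "0 \<le> real n * k" using k by simp
      have "\<bar>G (t0 + \<eta>) - G (t0 + real n * k)\<bar> \<le> K * ((t0 + \<eta>) - (t0 + real n * k))"
        by (rule lip) (use nk n0 \<eta> \<rho> in linarith)+
      also have "\<dots> \<le> K * k" using nk K by (intro mult_left_mono) (auto simp: algebra_simps)
      finally show ?thesis .
    qed
    have "\<bar>G (t0 + k) - G t0\<bar> \<le> K * (t0 + k - t0)" by (rule lip) (use k \<eta> \<rho> in linarith)+
    then have qk: "\<bar>q k\<bar> \<le> K" using k by (simp add: q_def abs_mult field_simps)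
    have e1: "real n * (G (t0 + k) - G t0) = (real n * k) * q k" using k by (simp add: q_def)
    have e2: "\<bar>(real n * k) * q k - \<eta> * q k\<bar> \<le> K * k"
    proof -
      have "\<bar>(real n * k) * q k - \<eta> * q k\<bar> = (\<eta> - real n * k) * \<bar>q k\<bar>"
        using nk by (simp add: abs_mult flip: left_diff_distrib)
      also have "\<dots> \<le> k * K" using nk qk k by (intro mult_mono) (auto simp: algebra_simps)
      finally show ?thesis by (simp add: mult.commute)
    qed
    have e3: "real n * (e * k) \<le> e * \<eta>" using mult_left_mono[OF nk(1), of e] e by (simp add: mult_ac)
    have "\<bar>(G (t0 + \<eta>) - G t0) - \<eta> * q k\<bar> \<le> e * \<eta> + 2 * (K * k)"
      using s[of n] l1 e1 e2 e3 by linarith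
    moreover have "q \<eta> - q k = ((G (t0 + \<eta>) - G t0) - \<eta> * q k) / \<eta>" using \<eta> by (simp add: q_def field_simps)
    ultimately have "\<bar>q \<eta> - q k\<bar> \<le> (e * \<eta> + 2 * (K * k)) / \<eta>"
      using \<eta> by (simp add: divide_right_mono)
    also have "\<dots> = e + 2 * K * k / \<eta>" using \<eta> by (simp add: add_divide_distrib)
    finally show ?thesis .
  qed
  have cau: "\<exists>h1>0. \<forall>\<eta> k. 0 < \<eta> \<longrightarrow> \<eta> < h1 \<longrightarrow> 0 < k \<longrightarrow> k < h1 \<longrightarrow> \<bar>q \<eta> - q k\<bar> \<le> 4 * e" if e: "e > 0" for e
  proof -
    from inv[OF e] obtain h0 where h0: "h0 > 0" and h: "\<And>h a b. \<bar>h\<bar> < h0 \<Longrightarrow> t0 - \<rho> < a \<Longrightarrow> a \<le> b \<Longrightarrow> b < t0 + \<rho> \<Longrightarrow>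
      t0 - \<rho> < a + h \<Longrightarrow> b + h < t0 + \<rho> \<Longrightarrow> \<bar>(G (b + h) - G (a + h)) - (G b - G a)\<bar> \<le> e * (b - a)" by blast
    have "\<bar>q \<eta> - q k\<bar> \<le> 4 * e" if "0 < \<eta>" "\<eta> < min h0 \<rho>" "0 < k" "k < min h0 \<rho>" for \<eta> k
    proof -
      \<comment> \<open>A common scale finer than both, so small that the rounding error 2 K m / x
        is at most e for x equal to either of them. The 1 added to 2 K keeps the quotient defined
        when K = 0.\<close>
      define m where "m = min (min \<eta> k) (e * min \<eta> k / (2 * K + 1))"
      have m: "0 < m" "m \<le> \<eta>" "m \<le> k" using that e K by (auto simp: m_def)
      have mm: "2 * K * m \<le> e * min \<eta> k"
      proof -
        have "2 * K * m \<le> (2 * K + 1) * m" using m by (simp add: algebra_simps)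
        also have "\<dots> \<le> (2 * K + 1) * (e * min \<eta> k / (2 * K + 1))" using K by (intro mult_left_mono) (auto simp: m_def)
        also have "\<dots> = e * min \<eta> k" using K by simp
        finally show ?thesis .
      qed
      have b: "2 * K * m / x \<le> e" if "0 < x" "min \<eta> k \<le> x" for x
      proof -
        have "2 * K * m \<le> e * x" using mm mult_left_mono[OF that(2), of e] e by linarith
        then show ?thesis using that by (simp add: field_simps)
      qed
      have "\<bar>q \<eta> - q m\<bar> \<le> e + 2 * K * m / \<eta>" by (rule step[of h0, OF h]) (use that m e in auto)
      moreover have "\<bar>q k - q m\<bar> \<le> e + 2 * K * m / k" by (rule step[of h0, OF h]) (use that m e in auto)
      ultimately show ?thesis using b[of \<eta>] b[of k] that by simp
    qed
    then show ?thesis using h0 \<rho> by (intro exI[of _ "min h0 \<rho>"]) auto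
  qed
  have "Cauchy (\<lambda>n. q (1 / real (Suc n)))"
  proof (rule CauchyI)
    fix e :: real assume "0 < e"
    then obtain h1 where h1: "h1 > 0" "\<And>\<eta> k. 0 < \<eta> \<Longrightarrow> \<eta> < h1 \<Longrightarrow> 0 < k \<Longrightarrow> k < h1 \<Longrightarrow> \<bar>q \<eta> - q k\<bar> \<le> 4 * (e/8)"
      using cau[of "e/8"] by (auto simp del: mult_divide_mult_cancel_left_if)
    from reals_Archimedean[OF h1(1)] obtain n0 where n0: "inverse (real (Suc n0)) < h1" by blast
    have "1 / real (Suc n) < h1" if "n \<ge> n0" for n
    proof -
      have "1 / real (Suc n) \<le> inverse (real (Suc n0))" using that by (simp add: field_simps)
      then show ?thesis using n0 by linarith
    qed
    then have "\<bar>q (1 / real (Suc m)) - q (1 / real (Suc n))\<bar> < e" if "m \<ge> n0" "n \<ge> n0" for m n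
      using h1(2)[of "1 / real (Suc m)" "1 / real (Suc n)"] that \<open>0 < e\<close> by simp
    then show "\<exists>M. \<forall>m\<ge>M. \<forall>n\<ge>M. norm (q (1 / real (Suc m)) - q (1 / real (Suc n))) < e" by auto
  qed
  then obtain D where D: "(\<lambda>n. q (1 / real (Suc n))) \<longlonglongrightarrow> D"
    using Cauchy_convergent convergent_def by blast
  have "(G has_real_derivative D) (at t0)"
    unfolding DERIV_def LIM_def
  proof (intro allI impI)
    fix r :: real assume r: "0 < r"
    define e where "e = r / 8"
    have e: "e > 0" using r by (simp add: e_def)
    from cau[OF e] obtain h1 where h1: "h1 > 0" "\<And>\<eta> k. 0 < \<eta> \<Longrightarrow> \<eta> < h1 \<Longrightarrow> 0 < k \<Longrightarrow> k < h1 \<Longrightarrow> \<bar>q \<eta> - q k\<bar> \<le> 4 * e"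
      by blast
    from inv[OF e] obtain h0 where h0: "h0 > 0" and h: "\<And>h a b. \<bar>h\<bar> < h0 \<Longrightarrow> t0 - \<rho> < a \<Longrightarrow> a \<le> b \<Longrightarrow> b < t0 + \<rho> \<Longrightarrow>
      t0 - \<rho> < a + h \<Longrightarrow> b + h < t0 + \<rho> \<Longrightarrow> \<bar>(G (b + h) - G (a + h)) - (G b - G a)\<bar> \<le> e * (b - a)" by blast
    have qD: "\<bar>q \<eta> - D\<bar> \<le> 4 * e" if "0 < \<eta>" "\<eta> < h1" for \<eta>
    proof -
      have "(\<lambda>n. \<bar>q \<eta> - q (1 / real (Suc n))\<bar>) \<longlonglongrightarrow> \<bar>q \<eta> - D\<bar>" by (intro tendsto_intros D)
      moreover have "\<forall>\<^sub>F n in sequentially. \<bar>q \<eta> - q (1 / real (Suc n))\<bar> \<le> 4 * e"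
      proof -
        from reals_Archimedean[OF h1(1)] obtain n0 where n0: "inverse (real (Suc n0)) < h1" by blast
        show ?thesis using eventually_ge_at_top[of n0]
        proof (rule eventually_mono)
          fix n assume "n0 \<le> n"
          then have "1 / real (Suc n) \<le> inverse (real (Suc n0))" by (simp add: field_simps)
          then have "1 / real (Suc n) < h1" using n0 by linarith
          then show "\<bar>q \<eta> - q (1 / real (Suc n))\<bar> \<le> 4 * e" using h1(2)[OF that, of "1 / real (Suc n)"] by simp
        qed
      qed
      ultimately show ?thesis by (intro tendsto_upperbound[where F=sequentially]) auto
    qed
    have "\<bar>(G (t0 + k) - G t0) / k - D\<bar> < r" if k: "k \<noteq> 0" "\<bar>k\<bar> < min h1 (min h0 \<rho>)" for k
    proof (cases "k > 0")
      case True
      then show ?thesis using qD[of k] k e by (simp add: q_def e_def)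
    next
      case False
      \<comment> \<open>Quotients to the left are compared with those to the right: translating the
        increment over [t0, t0 + m] by -m gives the one over [t0 - m, t0].\<close>
      define m where "m = - k"
      have m: "0 < m" "m < h1" "m < h0" "m < \<rho>" using False k by (auto simp: m_def)
      have "\<bar>(G (t0 + m + (- m)) - G (t0 + (- m))) - (G (t0 + m) - G t0)\<bar> \<le> e * (t0 + m - t0)"
        by (rule h) (use m \<rho> in auto)
      then have "\<bar>(G t0 - G (t0 - m)) - (G (t0 + m) - G t0)\<bar> \<le> e * m" by simp
      then have "\<bar>((G t0 - G (t0 - m)) - (G (t0 + m) - G t0)) / m\<bar> \<le> e" using m by (simp add: field_simps)
      moreover have "((G t0 - G (t0 - m)) - (G (t0 + m) - G t0)) / m = (G (t0 + k) - G t0) / k - q m"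
        using m by (simp add: q_def m_def field_simps)
      ultimately have "\<bar>(G (t0 + k) - G t0) / k - q m\<bar> \<le> e" by (simp only:)
      then show ?thesis using qD[OF m(1,2)] e r unfolding e_def by linarith
    qed
    then have "\<forall>x. x \<noteq> 0 \<and> dist x 0 < min h1 (min h0 \<rho>) \<longrightarrow> dist ((G (t0 + x) - G t0) / x) D < r"
      unfolding dist_real_def by simp
    moreover have "0 < min h1 (min h0 \<rho>)" using h1(1) h0 \<rho> by simp
    ultimately show "\<exists>s>0. \<forall>x. x \<noteq> 0 \<and> dist x 0 < s \<longrightarrow> dist ((G (t0 + x) - G t0) / x) D < r"
      by (intro exI[of _ "min h1 (min h0 \<rho>)"] conjI)
  qed
  then show ?thesis ..
qed

text \<open>Outside [-1, 1] the integrand is dominated by |s|^(-2 sigma), which is integrable there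
  because 2 sigma > 1; inside it is at most 1.\<close>

lemma nn_integral_one_plus_square_powr:
  assumes "\<sigma> > 1/2"
  shows "(\<integral>\<^sup>+s. ennreal ((1 + s\<^sup>2) powr (- \<sigma>)) \<partial>lebesgue) < \<infinity>"
proof -
  have "((\<lambda>x. x powr (- 2 * \<sigma>)) has_integral - (1 powr (- 2 * \<sigma> + 1)) / (- 2 * \<sigma> + 1)) {1..}"
    using assms by (intro has_integral_powr_to_inf) auto
  then have i: "(\<lambda>x. x powr (- 2 * \<sigma>)) absolutely_integrable_on {1..}"
    by (intro nonnegative_absolutely_integrable_1) (auto simp: has_integral_integrable)
  let ?f = "\<lambda>s::real. (1 + s\<^sup>2) powr (- \<sigma>)"
  have bd: "?f s \<le> \<bar>s\<bar> powr (- 2 * \<sigma>)" if "\<bar>s\<bar> \<ge> 1" for s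
  proof -
    have "?f s \<le> (\<bar>s\<bar>\<^sup>2) powr (- \<sigma>)" using assms that by (intro powr_mono2') auto
    also have "\<dots> = \<bar>s\<bar> powr (- 2 * \<sigma>)"
    proof -
      have "\<bar>s\<bar>\<^sup>2 = \<bar>s\<bar> powr 2" using that by (subst powr_numeral) auto
      then have "(\<bar>s\<bar>\<^sup>2) powr (- \<sigma>) = \<bar>s\<bar> powr (2 * - \<sigma>)" by (simp only: powr_powr)
      then show ?thesis by simp
    qed
    finally show ?thesis .
  qed
  have i1: "(\<integral>\<^sup>+s. ennreal (indicator {1..} s * s powr (- 2 * \<sigma>)) \<partial>lebesgue) < \<infinity>"
  proof -
    have "integrable lebesgue (\<lambda>s. indicator {1..} s * s powr (- 2 * \<sigma>))"
      using i by (simp add: set_integrable_def)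
    from integrableD(2)[OF this] show ?thesis
      by (auto simp: less_top abs_mult indicator_def intro: le_less_trans[OF nn_integral_mono])
  qed
  have refl: "(\<integral>\<^sup>+s. ennreal (indicator {1..} (-s) * (-s) powr (- 2 * \<sigma>)) \<partial>lebesgue) = (\<integral>\<^sup>+s. ennreal (indicator {1..} s * s powr (- 2 * \<sigma>)) \<partial>lebesgue)"
    unfolding nn_integral_completion
    using nn_integral_real_affine[of "\<lambda>s. ennreal (indicator {1..} s * s powr (- 2 * \<sigma>))" "-1" 0] by simp
  have "(\<integral>\<^sup>+s. ennreal (?f s) \<partial>lebesgue) \<le> (\<integral>\<^sup>+s. (indicator {-1..1} s + ennreal (indicator {1..} s * s powr (- 2 * \<sigma>))) + ennreal (indicator {1..} (-s) * (-s) powr (- 2 * \<sigma>)) \<partial>lebesgue)"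
  proof (rule nn_integral_mono)
    fix s :: real
    consider "\<bar>s\<bar> \<le> 1" | "s > 1" | "s < -1" by linarith
    then show "ennreal (?f s) \<le> (indicator {-1..1} s + ennreal (indicator {1..} s * s powr (- 2 * \<sigma>))) + ennreal (indicator {1..} (-s) * (-s) powr (- 2 * \<sigma>))"
    proof cases
      case 1
      have "?f s \<le> 1 powr (- \<sigma>)" using assms by (intro powr_mono2') auto
      then have "ennreal (?f s) \<le> indicator {-1..1} s" using 1 by (auto simp: indicator_def abs_le_iff intro: ennreal_leI)
      then show ?thesis by (simp add: add_increasing2)
    next
      case 2
      then have "ennreal (?f s) \<le> ennreal (indicator {1..} s * s powr (- 2 * \<sigma>))" using bd[of s] by (auto intro: ennreal_leI)
      then show ?thesis by (simp add: add_increasing add_increasing2)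
    next
      case 3
      then have "ennreal (?f s) \<le> ennreal (indicator {1..} (-s) * (-s) powr (- 2 * \<sigma>))" using bd[of s] by (auto intro: ennreal_leI)
      then show ?thesis by (simp add: add_increasing)
    qed
  qed
  also have "\<dots> = 2 + 2 * (\<integral>\<^sup>+s. ennreal (indicator {1..} s * s powr (- 2 * \<sigma>)) \<partial>lebesgue)"
    unfolding nn_integral_completion
    by (simp add: nn_integral_add refl[unfolded nn_integral_completion, simplified] flip: mult_2)
  also have "\<dots> < \<infinity>" using i1 by (simp add: ennreal_mult_less_top)
  finally show ?thesis .
qed

section \<open>The operator as a relation between functions\<close>

locale confined_operator =
  fixes d :: nat and \<psi> :: "perp \<Rightarrow> real" and l L M :: real and S :: "perp set" and w :: "point \<Rightarrow> real"
  assumes l_pos: "0 < l"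
    and psi_gt: "\<And>x. x \<in> Rperp d \<Longrightarrow> l < \<psi> x"
    and psi_lipschitz: "\<And>x y. x \<in> Rperp d \<Longrightarrow> y \<in> Rperp d \<Longrightarrow> \<bar>\<psi> x - \<psi> y\<bar> \<le> L * dist_perp d x y"
    and confined: "confined_weight d M S w"
    and outside: "0 < emeasure (leb_perp d) (Rperp d - S)"
begin

sublocale completed_product "\<Pi>\<^sub>M i\<in>{2..d}. (lborel :: real measure)"
proof -
  interpret product_sigma_finite "\<lambda>_::nat. lborel :: real measure" ..
  interpret sigma_finite_measure "\<Pi>\<^sub>M i\<in>{2..d}. (lborel :: real measure)" by (rule sigma_finite) simp
  show "completed_product (\<Pi>\<^sub>M i\<in>{2..d}. (lborel :: real measure))" ..
qed

abbreviation "X \<equiv> leb_perp d"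
abbreviation "ZZ \<equiv> leb_full d"
abbreviation "N \<equiv> wmeas d w"

lemmas fold_measures = leb_full_def[symmetric] leb_perp_def[symmetric]
lemmas AE_fib = AE_fibres[unfolded fold_measures]
lemmas ex_borel_fib = ex_borel_fibres[unfolded fold_measures]
lemmas measurable_fib = measurable_fibres[unfolded fold_measures]
lemmas nn_integral_fib = nn_integral_fibres[unfolded fold_measures]
lemmas AE_eq_if_fib = AE_Z_eq_if_fibres[unfolded fold_measures]
lemmas measurable_fib_integral = measurable_fibre_integral[unfolded fold_measures]
lemmas integral_fib = integral_fibres[unfolded fold_measures]
lemmas measurable_snd_full = measurable_snd_Z[unfolded fold_measures]
lemmas measurable_fst_full = measurable_fst_Z[unfolded fold_measures]

section \<open>Measurability of the data and Fubini for the weighted space\<close>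

lemma space_X: "space X = Rperp d"
  by (simp add: leb_perp_def Rperp_def space_PiM)

lemma AE_Rperp: "AE y in X. y \<in> Rperp d"
  using AE_space[of X] by (simp add: space_X)

text \<open>Measurability of S is read off from the positive measure of its complement, because a
  set that is not measurable is assigned measure 0.\<close>

lemma S_sets: "S \<in> sets X"
proof -
  have "Rperp d - S \<in> sets X" using outside by (metis emeasure_notin_sets less_irrefl)
  then have "space X - (Rperp d - S) \<in> sets X" by (rule sets.compl_sets)
  moreover have "space X - (Rperp d - S) = S" using confined by (auto simp: space_X confined_weight_def)
  ultimately show ?thesis by simp
qed

lemma psi_pos: "y \<in> Rperp d \<Longrightarrow> 0 < \<psi> y" and psi_ge: "y \<in> Rperp d \<Longrightarrow> l \<le> \<psi> y"
  using psi_gt[of y] l_pos by auto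

text \<open>The Lipschitz bound makes \<open>\<psi>\<close> continuous, and for countably many
  factors the Borel sets of the product topology are those of the product sigma-algebra.\<close>

lemma psi_measurable_Q: "\<psi> \<in> borel_measurable (\<Pi>\<^sub>M i\<in>{2..d}. (lborel :: real measure))"
proof -
  \<comment> \<open>The hypotheses on \<open>\<psi>\<close> concern extensional functions only.
    Composing with restriction extends it to all functions, where the product topology is
    available.\<close>
  define \<psi>' where "\<psi>' = (\<lambda>x :: nat \<Rightarrow> real. \<psi> (restrict x {2..d}))"
  have r: "restrict x {2..d} \<in> Rperp d" for x by (auto simp: Rperp_def)
  have "isCont \<psi>' x" for x
  proof -
    define g where "g y = \<bar>L\<bar> * sqrt (\<Sum>i\<in>{2..d}. (y i - x i)\<^sup>2)" for y :: "nat \<Rightarrow> real"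
    have "continuous_on UNIV g" unfolding g_def
      by (intro continuous_intros continuous_on_product_coordinates)
    then have "isCont g x" by (simp add: continuous_on_eq_continuous_at)
    then have g0: "(g \<longlongrightarrow> 0) (at x)" by (simp add: isCont_def g_def)
    have le: "norm (\<psi>' y - \<psi>' x) \<le> g y" for y
    proof -
      have "\<bar>\<psi>' y - \<psi>' x\<bar> \<le> L * dist_perp d (restrict y {2..d}) (restrict x {2..d})"
        unfolding \<psi>'_def by (rule psi_lipschitz[OF r r])
      also have "dist_perp d (restrict y {2..d}) (restrict x {2..d}) = sqrt (\<Sum>i\<in>{2..d}. (y i - x i)\<^sup>2)"
        unfolding dist_perp_def L2_set_def by simp
      also have "L * sqrt (\<Sum>i\<in>{2..d}. (y i - x i)\<^sup>2) \<le> g y"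
        unfolding g_def by (intro mult_right_mono) (auto intro: sum_nonneg)
      finally show ?thesis by simp
    qed
    have "((\<lambda>y. \<psi>' y - \<psi>' x) \<longlongrightarrow> 0) (at x)"
      by (rule Lim_null_comparison[OF always_eventually g0]) (use le in blast)
    then show ?thesis unfolding isCont_def by (rule LIM_zero_cancel)
  qed
  then have "continuous_on UNIV \<psi>'" by (simp add: continuous_on_eq_continuous_at)
  then have m1: "\<psi>' \<in> borel_measurable borel" by (rule borel_measurable_continuous_onI)
  have "(\<lambda>x i. x i) \<in> (\<Pi>\<^sub>M i\<in>{2..d}. (lborel :: real measure)) \<rightarrow>\<^sub>M (\<Pi>\<^sub>M i\<in>(UNIV :: nat set). (borel :: real measure))"
  proof (rule measurable_PiM_single')
    fix i :: nat
    show "(\<lambda>x. x i) \<in> (\<Pi>\<^sub>M i\<in>{2..d}. (lborel :: real measure)) \<rightarrow>\<^sub>M (borel :: real measure)"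
    proof (cases "i \<in> {2..d}")
      case True
      from measurable_component_singleton[OF this, of "\<lambda>_. lborel :: real measure"] show ?thesis by simp
    next
      case False
      \<comment> \<open>Coordinates outside {2..d} are constant on the space, hence
        measurable.\<close>
      have "x i = undefined" if "x \<in> space (\<Pi>\<^sub>M i\<in>{2..d}. (lborel :: real measure))" for x
        using that False by (simp add: space_PiM PiE_def extensional_def)
      then show ?thesis by (subst measurable_cong[where g="\<lambda>_. undefined"]) simp_all
    qed
  qed auto
  then have m2: "(\<lambda>x. x) \<in> (\<Pi>\<^sub>M i\<in>{2..d}. (lborel :: real measure)) \<rightarrow>\<^sub>M (borel :: (nat \<Rightarrow> real) measure)"
    using measurable_cong_sets[OF refl sets_PiM_equal_borel] by blast
  have "(\<lambda>x. \<psi>' x) \<in> borel_measurable (\<Pi>\<^sub>M i\<in>{2..d}. (lborel :: real measure))"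
    using measurable_compose[OF m2 m1] by simp
  moreover have "\<psi>' x = \<psi> x" if "x \<in> space (\<Pi>\<^sub>M i\<in>{2..d}. (lborel :: real measure))" for x
    using that by (simp add: \<psi>'_def space_PiM PiE_def extensional_restrict)
  ultimately show ?thesis using measurable_cong[of _ \<psi>' \<psi>] by blast
qed

lemma psi_measurable: "\<psi> \<in> borel_measurable X"
  unfolding leb_perp_def by (rule measurable_completion[OF psi_measurable_Q])

lemma psi_measurable_full: "(\<lambda>p. \<psi> (snd p)) \<in> borel_measurable ZZ"
  by (rule measurable_compose[OF measurable_snd_full psi_measurable])

lemma w_measurable: "w \<in> borel_measurable ZZ"
  and w_pos: "AE p in ZZ. 0 < w p"
  and w_one: "y \<in> Rperp d - S \<Longrightarrow> w (s, y) = 1"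
  and w_S: "y \<in> S \<Longrightarrow> integrable lebesgue (\<lambda>s. w (s, y))" "y \<in> S \<Longrightarrow> (\<integral>s. \<bar>w (s, y)\<bar> \<partial>lebesgue) < M"
  and M_pos: "0 < M"
  using confined by (simp_all add: confined_weight_def)

definition wbound :: real where "wbound = (SOME B. AE p in ZZ. w p \<le> B)"

lemma w_le: "AE p in ZZ. w p \<le> wbound"
proof -
  have "\<exists>B. AE p in ZZ. w p \<le> B" using confined by (simp add: confined_weight_def)
  then show ?thesis unfolding wbound_def by (rule someI_ex)
qed

lemma w_fib_measurable: "y \<in> Rperp d \<Longrightarrow> (\<lambda>s. w (s, y)) \<in> borel_measurable lebesgue"
proof (cases "y \<in> S")
  case True then show ?thesis using w_S(1) by (intro borel_measurable_integrable)
next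
  case False
  assume "y \<in> Rperp d"
  with False have "(\<lambda>s. w (s, y)) = (\<lambda>s. 1)" using w_one by auto
  then show ?thesis by simp
qed

text \<open>Positivity and boundedness of the weight hold only almost everywhere on the full space.
  These are the fibres on which they survive, and they are almost all of them.\<close>

definition good :: "perp \<Rightarrow> bool" where
  "good y \<longleftrightarrow> y \<in> Rperp d \<and> (AE s in lebesgue. 0 < w (s, y) \<and> w (s, y) \<le> wbound)"

lemma AE_good: "AE y in X. good y"
proof -
  have "AE p in ZZ. 0 < w p \<and> w p \<le> wbound" using w_pos w_le by eventually_elim simp
  from AE_fib[OF this] AE_Rperp show ?thesis by eventually_elim (simp add: good_def)
qed

lemma good_Rperp: "good y \<Longrightarrow> y \<in> Rperp d" and good_pos: "good y \<Longrightarrow> AE s in lebesgue. 0 < w (s, y)"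
  unfolding good_def by (auto elim: eventually_mono)

lemma sets_N [simp]: "sets N = sets ZZ" and space_N: "space N = space ZZ"
  by (simp_all add: wmeas_def)

lemma measurable_N: "borel_measurable N = borel_measurable ZZ"
  by (rule measurable_cong_sets) simp_all

lemma AE_N: "(AE p in N. R p) \<longleftrightarrow> (AE p in ZZ. R p)"
proof -
  have "(\<lambda>p. ennreal (w p)) \<in> borel_measurable ZZ" using w_measurable by simp
  then have "(AE p in N. R p) \<longleftrightarrow> (AE p in ZZ. 0 < ennreal (w p) \<longrightarrow> R p)"
    unfolding wmeas_def by (rule AE_density)
  also have "\<dots> \<longleftrightarrow> (AE p in ZZ. R p)"
  proof
    assume "AE p in ZZ. 0 < ennreal (w p) \<longrightarrow> R p"
    then show "AE p in ZZ. R p" using w_pos by eventually_elim simp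
  next
    assume "AE p in ZZ. R p"
    then show "AE p in ZZ. 0 < ennreal (w p) \<longrightarrow> R p" by (rule eventually_mono) simp
  qed
  finally show ?thesis .
qed

lemma sets_wfib [simp]: "sets (wfib w y) = sets lebesgue"
  by (simp add: wfib_def)

lemma measurable_wfib: "borel_measurable (wfib w y) = borel_measurable lebesgue"
  by (rule measurable_cong_sets) simp_all

lemma AE_wfib: assumes y: "good y" shows "(AE s in wfib w y. R s) \<longleftrightarrow> (AE s in lebesgue. R s)"
proof -
  have "(\<lambda>s. ennreal (w (s, y))) \<in> borel_measurable lebesgue" using w_fib_measurable[OF good_Rperp[OF y]] by simp
  then have "(AE s in wfib w y. R s) \<longleftrightarrow> (AE s in lebesgue. 0 < ennreal (w (s, y)) \<longrightarrow> R s)"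
    unfolding wfib_def by (rule AE_density)
  also have "\<dots> \<longleftrightarrow> (AE s in lebesgue. R s)"
  proof
    assume "AE s in lebesgue. 0 < ennreal (w (s, y)) \<longrightarrow> R s"
    then show "AE s in lebesgue. R s" using good_pos[OF y] by eventually_elim simp
  next
    assume "AE s in lebesgue. R s"
    then show "AE s in lebesgue. 0 < ennreal (w (s, y)) \<longrightarrow> R s" by (rule eventually_mono) simp
  qed
  finally show ?thesis .
qed

lemma nn_integral_wfib:
  "y \<in> Rperp d \<Longrightarrow> f \<in> borel_measurable lebesgue \<Longrightarrow> (\<integral>\<^sup>+s. f s \<partial>wfib w y) = (\<integral>\<^sup>+s. ennreal (w (s, y)) * f s \<partial>lebesgue)"
  unfolding wfib_def using w_fib_measurable by (intro nn_integral_density) simp_all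

lemma nn_integral_N:
  "f \<in> borel_measurable ZZ \<Longrightarrow> (\<integral>\<^sup>+p. f p \<partial>N) = (\<integral>\<^sup>+p. ennreal (w p) * f p \<partial>ZZ)"
  unfolding wmeas_def using w_measurable by (intro nn_integral_density) simp_all

lemma nn_integral_N_fib:
  assumes f: "f \<in> borel_measurable ZZ" and fy: "AE y in X. (\<lambda>s. f (s, y)) \<in> borel_measurable lebesgue"
  shows "(\<integral>\<^sup>+p. f p \<partial>N) = (\<integral>\<^sup>+y. (\<integral>\<^sup>+s. f (s, y) \<partial>wfib w y) \<partial>X)"
proof -
  have "(\<integral>\<^sup>+p. f p \<partial>N) = (\<integral>\<^sup>+y. (\<integral>\<^sup>+s. ennreal (w (s, y)) * f (s, y) \<partial>lebesgue) \<partial>X)"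
    unfolding nn_integral_N[OF f] using f w_measurable by (intro nn_integral_fib) simp_all
  also have "\<dots> = (\<integral>\<^sup>+y. (\<integral>\<^sup>+s. f (s, y) \<partial>wfib w y) \<partial>X)"
    by (rule nn_integral_cong_AE, use fy AE_Rperp in eventually_elim) (rule nn_integral_wfib[symmetric])
  finally show ?thesis .
qed

lemma L2_N_measurable: "f \<in> L2 N \<Longrightarrow> f \<in> borel_measurable ZZ"
  using L2_measurable[of f N] by (simp add: measurable_N)

lemma nn_L2_fib:
  assumes f: "f \<in> borel_measurable ZZ"
  shows "(\<integral>\<^sup>+p. ennreal ((cmod (f p))\<^sup>2) \<partial>N) = (\<integral>\<^sup>+y. (\<integral>\<^sup>+s. ennreal ((cmod (f (s, y)))\<^sup>2) \<partial>wfib w y) \<partial>X)"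
proof (rule nn_integral_N_fib)
  show "(\<lambda>p. ennreal ((cmod (f p))\<^sup>2)) \<in> borel_measurable ZZ" using f by simp
  show "AE y in X. (\<lambda>s. ennreal ((cmod (f (s, y)))\<^sup>2)) \<in> borel_measurable lebesgue"
    using measurable_fib[OF f] by (rule eventually_mono) simp
qed

lemma nn_fib_measurable:
  assumes f: "f \<in> borel_measurable ZZ"
  shows "(\<lambda>y. \<integral>\<^sup>+s. ennreal ((cmod (f (s, y)))\<^sup>2) \<partial>wfib w y) \<in> borel_measurable X"
proof -
  let ?F = "\<lambda>p. ennreal (w p) * ennreal ((cmod (f p))\<^sup>2)"
  have Fm: "?F \<in> borel_measurable ZZ" using f w_measurable by simp
  from completion_ex_borel_measurable[OF Fm[unfolded leb_full_def]] obtain g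
    where g: "g \<in> borel_measurable ((lborel :: real measure) \<Otimes>\<^sub>M (\<Pi>\<^sub>M i\<in>{2..d}. (lborel :: real measure)))"
      and e: "AE p in (lborel :: real measure) \<Otimes>\<^sub>M (\<Pi>\<^sub>M i\<in>{2..d}. (lborel :: real measure)). ?F p = g p" by blast
  have eZ: "AE p in ZZ. ?F p = g p" unfolding leb_full_def by (rule AE_completion[OF e])
  have "(\<lambda>(y, s). g (s, y)) \<in> borel_measurable ((\<Pi>\<^sub>M i\<in>{2..d}. (lborel :: real measure)) \<Otimes>\<^sub>M lborel)"
    using measurable_compose[OF measurable_pair_swap' g] by (simp add: case_prod_unfold)
  from lborel.borel_measurable_nn_integral[OF this]
  have "(\<lambda>y. \<integral>\<^sup>+s. g (s, y) \<partial>lborel) \<in> borel_measurable X"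
    unfolding leb_perp_def by (intro measurable_completion)
  moreover have "AE y in X. (\<integral>\<^sup>+s. g (s, y) \<partial>lborel) = (\<integral>\<^sup>+s. ennreal ((cmod (f (s, y)))\<^sup>2) \<partial>wfib w y)"
    using AE_fib[OF eZ] AE_Rperp measurable_fib[OF f]
  proof eventually_elim
    case (elim y)
    have "(\<integral>\<^sup>+s. g (s, y) \<partial>lborel) = (\<integral>\<^sup>+s. g (s, y) \<partial>lebesgue)" by (simp add: nn_integral_completion)
    also have "\<dots> = (\<integral>\<^sup>+s. ?F (s, y) \<partial>lebesgue)"
      by (rule nn_integral_cong_AE[OF AE_eq_sym[OF elim(1)]])
    also have "\<dots> = (\<integral>\<^sup>+s. ennreal ((cmod (f (s, y)))\<^sup>2) \<partial>wfib w y)"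
      by (rule nn_integral_wfib[symmetric]) (use elim in simp_all)
    finally show ?case .
  qed
  ultimately show ?thesis
    unfolding leb_perp_def by (rule borel_measurable_completion_cong_AE)
qed

lemma L2_fib: assumes f: "f \<in> L2 N" shows "AE y in X. (\<lambda>s. f (s, y)) \<in> L2 (wfib w y)"
proof -
  note fm = L2_N_measurable[OF f]
  have "(\<integral>\<^sup>+y. (\<integral>\<^sup>+s. ennreal ((cmod (f (s, y)))\<^sup>2) \<partial>wfib w y) \<partial>X) \<noteq> \<infinity>"
    using f unfolding nn_L2_fib[OF fm, symmetric] L2_iff_nn_integral by (simp add: less_top)
  from nn_integral_PInf_AE[OF nn_fib_measurable[OF fm] this] measurable_fib[OF fm]
  show ?thesis
    by eventually_elim (simp add: L2_iff_nn_integral measurable_wfib less_top)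
qed

lemma L2_norm_fib:
  assumes f: "f \<in> L2 N"
  shows "ennreal ((L2_norm N f)\<^sup>2) = (\<integral>\<^sup>+y. ennreal ((L2_norm (wfib w y) (\<lambda>s. f (s, y)))\<^sup>2) \<partial>X)"
proof -
  have "ennreal ((L2_norm N f)\<^sup>2) = (\<integral>\<^sup>+y. (\<integral>\<^sup>+s. ennreal ((cmod (f (s, y)))\<^sup>2) \<partial>wfib w y) \<partial>X)"
    unfolding L2_norm_sq_nn[OF f] by (rule nn_L2_fib[OF L2_N_measurable[OF f]])
  also have "\<dots> = (\<integral>\<^sup>+y. ennreal ((L2_norm (wfib w y) (\<lambda>s. f (s, y)))\<^sup>2) \<partial>X)"
    by (rule nn_integral_cong_AE, use L2_fib[OF f] in eventually_elim) (rule L2_norm_sq_nn[symmetric])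
  finally show ?thesis .
qed

lemma L2I_fib:
  assumes f: "f \<in> borel_measurable ZZ" and fy: "AE y in X. (\<lambda>s. f (s, y)) \<in> L2 (wfib w y)"
    and fin: "(\<integral>\<^sup>+y. ennreal ((L2_norm (wfib w y) (\<lambda>s. f (s, y)))\<^sup>2) \<partial>X) < \<infinity>"
  shows "f \<in> L2 N"
proof -
  have "(\<integral>\<^sup>+y. (\<integral>\<^sup>+s. ennreal ((cmod (f (s, y)))\<^sup>2) \<partial>wfib w y) \<partial>X) = (\<integral>\<^sup>+y. ennreal ((L2_norm (wfib w y) (\<lambda>s. f (s, y)))\<^sup>2) \<partial>X)"
    by (rule nn_integral_cong_AE, use fy in eventually_elim) (rule L2_norm_sq_nn[symmetric])
  then show ?thesis unfolding L2_iff_nn_integral using f fin nn_L2_fib[OF f] by (simp add: measurable_N)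
qed

lemma L2_inner_fib:
  assumes f: "f \<in> L2 N" and g: "g \<in> L2 N"
  shows "L2_inner N f g = (\<integral>y. L2_inner (wfib w y) (\<lambda>s. f (s, y)) (\<lambda>s. g (s, y)) \<partial>X)"
proof -
  note m [measurable] = L2_N_measurable[OF f] L2_N_measurable[OF g] w_measurable
  have wn: "AE p in ZZ. 0 \<le> w p" using w_pos by (rule eventually_mono) simp
  have fgm: "(\<lambda>p. f p * cnj (g p)) \<in> borel_measurable ZZ" by measurable
  have "integrable N (\<lambda>p. f p * cnj (g p))" by (rule integrable_L2_inner[OF f g])
  then have i: "integrable ZZ (\<lambda>p. w p *\<^sub>R (f p * cnj (g p)))"
    unfolding wmeas_def using integrable_density[OF fgm w_measurable wn] by simp
  have "L2_inner N f g = (\<integral>p. w p *\<^sub>R (f p * cnj (g p)) \<partial>ZZ)"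
    unfolding L2_inner_def wmeas_def by (rule integral_density[OF fgm w_measurable wn])
  also have "\<dots> = (\<integral>y. (\<integral>s. w (s, y) *\<^sub>R (f (s, y) * cnj (g (s, y))) \<partial>lebesgue) \<partial>X)"
    by (rule integral_fib[OF i])
  also have "\<dots> = (\<integral>y. L2_inner (wfib w y) (\<lambda>s. f (s, y)) (\<lambda>s. g (s, y)) \<partial>X)"
  proof (rule integral_cong_AE)
    show m1: "(\<lambda>y. \<integral>s. w (s, y) *\<^sub>R (f (s, y) * cnj (g (s, y))) \<partial>lebesgue) \<in> borel_measurable X"
      by (rule measurable_fib_integral[OF borel_measurable_integrable[OF i]])
    show e: "AE y in X. (\<integral>s. w (s, y) *\<^sub>R (f (s, y) * cnj (g (s, y))) \<partial>lebesgue) = L2_inner (wfib w y) (\<lambda>s. f (s, y)) (\<lambda>s. g (s, y))"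
      using AE_good measurable_fib[OF fgm]
    proof eventually_elim
      case (elim y)
      have "AE s in lebesgue. 0 \<le> w (s, y)" using good_pos[OF elim(1)] by (rule eventually_mono) simp
      from integral_density[OF elim(2) w_fib_measurable[OF good_Rperp[OF elim(1)]] this]
      show ?case unfolding L2_inner_def wfib_def by simp
    qed
    show "(\<lambda>y. L2_inner (wfib w y) (\<lambda>s. f (s, y)) (\<lambda>s. g (s, y))) \<in> borel_measurable X"
      using m1 e unfolding leb_perp_def by (rule borel_measurable_completion_cong_AE)
  qed
  finally show ?thesis .
qed

text \<open>
  The fibre operator as a relation $g \mapsto k$: the equation $-i\psi G' = w k$ for an absolutely
  continuous representative G of g.
\<close>

definition fib_rel :: "perp \<Rightarrow> (real \<Rightarrow> complex) \<Rightarrow> (real \<Rightarrow> complex) \<Rightarrow> bool" where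
  "fib_rel y g k \<longleftrightarrow> (\<exists>G c. (AE s in lebesgue. g s = G s) \<and> ac_prim G (\<lambda>s. \<i> * of_real (w (s, y) / \<psi> y) * k s) \<and>
     (G \<longlongrightarrow> c) at_top \<and> (G \<longlongrightarrow> c) at_bot)"

definition graph :: "(point \<Rightarrow> complex) \<Rightarrow> (point \<Rightarrow> complex) \<Rightarrow> bool" where
  "graph f h \<longleftrightarrow> f \<in> L2 N \<and> h \<in> L2 N \<and> (AE y in X. fib_rel y (\<lambda>s. f (s, y)) (\<lambda>s. h (s, y)))"

lemma fib_rel_if_D_fib:
  assumes y: "good y" and g: "g \<in> D_fib \<psi> w y"
  obtains G c where "ac_prim G (weak_deriv g)" "AE s in lebesgue. g s = G s"
    "ac_prim G (\<lambda>s. \<i> * of_real (w (s, y) / \<psi> y) * H_fib \<psi> w y g s)" "(G \<longlongrightarrow> c) at_top" "(G \<longlongrightarrow> c) at_bot"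
proof -
  from g obtain h where "has_weak_deriv g h" by (auto simp: D_fib_def)
  from has_weak_deriv_weak_deriv[OF this] obtain G where G: "ac_prim G (weak_deriv g)" and gG: "AE s in lebesgue. g s = G s"
    by (auto simp: has_weak_deriv_iff_ac_prim)
  from g obtain g0 c where g0: "AE s in lebesgue. g s = g0 s" "continuous_on UNIV g0" and lim: "(g0 \<longlongrightarrow> c) at_top" "(g0 \<longlongrightarrow> c) at_bot"
    by (auto simp: D_fib_def)
  \<comment> \<open>The representative in the domain condition and the primitive of the weak
    derivative are both continuous, so equality almost everywhere makes them one function, and the
    common limit carries over to G.\<close>
  have "AE s in lebesgue. G s = g0 s" using gG g0(1) by eventually_elim simp
  from continuous_AE_eq_imp_eq[OF ac_prim_continuous[OF G] g0(2) this] have "G = g0" by (rule ext)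
  have "AE s in lebesgue. weak_deriv g s = \<i> * of_real (w (s, y) / \<psi> y) * H_fib \<psi> w y g s"
    using good_pos[OF y]
  proof (rule eventually_mono)
    fix s assume "0 < w (s, y)"
    then show "weak_deriv g s = \<i> * of_real (w (s, y) / \<psi> y) * H_fib \<psi> w y g s"
      using psi_pos[OF good_Rperp[OF y]] by (simp add: H_fib_def field_simps)
  qed
  from ac_prim_cong_AE[OF G this] have "ac_prim G (\<lambda>s. \<i> * of_real (w (s, y) / \<psi> y) * H_fib \<psi> w y g s)" .
  from that[OF G gG this] lim show ?thesis using \<open>G = g0\<close> by blast
qed

lemma D_fib_if_fib_rel:
  assumes y: "good y" and g: "g \<in> L2 (wfib w y)" and k: "k \<in> L2 (wfib w y)" and r: "fib_rel y g k"
  shows "g \<in> D_fib \<psi> w y" "AE s in lebesgue. H_fib \<psi> w y g s = k s"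
proof -
  from r obtain G c where gG: "AE s in lebesgue. g s = G s" and G: "ac_prim G (\<lambda>s. \<i> * of_real (w (s, y) / \<psi> y) * k s)"
    and lim: "(G \<longlongrightarrow> c) at_top" "(G \<longlongrightarrow> c) at_bot" by (auto simp: fib_rel_def)
  have wd: "has_weak_deriv g (\<lambda>s. \<i> * of_real (w (s, y) / \<psi> y) * k s)"
    using G gG by (auto simp: has_weak_deriv_iff_ac_prim)
  show e: "AE s in lebesgue. H_fib \<psi> w y g s = k s"
    using has_weak_deriv_unique[OF has_weak_deriv_weak_deriv[OF wd] wd] good_pos[OF y]
  proof eventually_elim
    case (elim s)
    then show ?case using psi_pos[OF good_Rperp[OF y]] by (simp add: H_fib_def field_simps)
  qed
  have "k \<in> borel_measurable lebesgue" using L2_measurable[OF k] by (simp add: measurable_wfib)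
  from borel_measurable_completion_cong_AE[OF this AE_eq_sym[OF e]]
  have Hm: "H_fib \<psi> w y g \<in> borel_measurable (wfib w y)" by (simp add: measurable_wfib)
  have "AE s in wfib w y. k s = H_fib \<psi> w y g s" using AE_eq_sym[OF e] by (simp add: AE_wfib[OF y])
  from L2_cong_AE[OF k Hm this] have "H_fib \<psi> w y g \<in> L2 (wfib w y)" .
  then show "g \<in> D_fib \<psi> w y"
    unfolding D_fib_def using g wd gG ac_prim_continuous[OF G] lim by blast
qed

lemma graph_imp_D_symm: assumes gr: "graph f h" shows "f \<in> D_symm d \<psi> w" "AE p in N. h p = H_op d \<psi> w f p"
proof -
  have f: "f \<in> L2 N" and h: "h \<in> L2 N" and r: "AE y in X. fib_rel y (\<lambda>s. f (s, y)) (\<lambda>s. h (s, y))"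
    using gr by (auto simp: graph_def)
  have D: "AE y in X. (\<lambda>s. f (s, y)) \<in> D_fib \<psi> w y"
    using AE_good L2_fib[OF f] L2_fib[OF h] r by eventually_elim (rule D_fib_if_fib_rel(1))
  have H: "AE y in X. AE s in lebesgue. H_fib \<psi> w y (\<lambda>s. f (s, y)) s = h (s, y)"
    using AE_good L2_fib[OF f] L2_fib[OF h] r by eventually_elim (rule D_fib_if_fib_rel(2))
  have "(\<integral>\<^sup>+y. ennreal ((L2_norm (wfib w y) (H_fib \<psi> w y (\<lambda>s. f (s, y))))\<^sup>2) \<partial>X)
      = (\<integral>\<^sup>+y. ennreal ((L2_norm (wfib w y) (\<lambda>s. h (s, y)))\<^sup>2) \<partial>X)"
  proof (rule nn_integral_cong_AE, use AE_good D L2_fib[OF h] H in eventually_elim)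
    case (elim y)
    have "H_fib \<psi> w y (\<lambda>s. f (s, y)) \<in> L2 (wfib w y)" using elim(2) by (simp add: D_fib_def)
    from L2_norm_cong_AE[OF this elim(3)] elim(4) show ?case by (simp add: AE_wfib[OF elim(1)])
  qed
  also have "\<dots> = ennreal ((L2_norm N h)\<^sup>2)" by (rule L2_norm_fib[OF h, symmetric])
  also have "\<dots> < \<infinity>" by simp
  finally show "f \<in> D_symm d \<psi> w" unfolding D_symm_def using f D by blast
  \<comment> \<open>The given h is itself a candidate in the choice that defines
    \<open>H_op\<close>, so the chosen function has the defining property.\<close>
  define P where "P k \<longleftrightarrow> k \<in> L2 N \<and> (AE y in X. AE s in lebesgue. k (s, y) = H_fib \<psi> w y (\<lambda>s. f (s, y)) s)" for k
  have "P h" unfolding P_def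
  proof (intro conjI h)
    show "AE y in X. AE s in lebesgue. h (s, y) = H_fib \<psi> w y (\<lambda>s. f (s, y)) s"
      using H by (rule eventually_mono) (rule AE_eq_sym)
  qed
  then have "P (H_op d \<psi> w f)" unfolding H_op_def P_def[symmetric] by (rule someI[of P])
  then have k: "H_op d \<psi> w f \<in> L2 N" "AE y in X. AE s in lebesgue. H_op d \<psi> w f (s, y) = H_fib \<psi> w y (\<lambda>s. f (s, y)) s"
    by (auto simp: P_def)
  have "AE y in X. AE s in lebesgue. h (s, y) = H_op d \<psi> w f (s, y)"
    using H k(2)
  proof eventually_elim
    case (elim y)
    then show ?case by eventually_elim simp
  qed
  from AE_eq_if_fib[OF L2_N_measurable[OF h] L2_N_measurable[OF k(1)] this]
  show "AE p in N. h p = H_op d \<psi> w f p" by (simp add: AE_N)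
qed

text \<open>The issue is that the choice in \<open>H_op\<close> has a candidate at all: the weak
  derivatives are picked on each fibre separately. A jointly measurable version is the limit of
  difference quotients in the first variable of a Borel representative of f.\<close>

lemma D_symm_imp_graph: assumes fD: "f \<in> D_symm d \<psi> w" shows "graph f (H_op d \<psi> w f)"
proof -
  have f: "f \<in> L2 N" and D: "AE y in X. (\<lambda>s. f (s, y)) \<in> D_fib \<psi> w y"
    and fin: "(\<integral>\<^sup>+y. ennreal ((L2_norm (wfib w y) (H_fib \<psi> w y (\<lambda>s. f (s, y))))\<^sup>2) \<partial>X) < \<infinity>"
    using fD by (auto simp: D_symm_def)
  let ?Q = "\<Pi>\<^sub>M i\<in>{2..d}. (lborel :: real measure)"
  obtain g where g: "g \<in> borel_measurable ((lborel :: real measure) \<Otimes>\<^sub>M ?Q)" and "AE p in ZZ. f p = g p"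
    and fg: "AE y in X. AE s in lebesgue. f (s, y) = g (s, y)"
    by (rule ex_borel_fib[OF L2_N_measurable[OF f]])
  define dq where "dq n p = of_nat (Suc n) * (g (fst p + 1 / real (Suc n), snd p) - g p)" for n p
  define dg where "dg p = lim (\<lambda>n. dq n p)" for p
  have "dq n \<in> borel_measurable ((lborel :: real measure) \<Otimes>\<^sub>M ?Q)" for n
  proof -
    have m: "(\<lambda>p. (fst p + 1 / real (Suc n), snd p)) \<in> (lborel :: real measure) \<Otimes>\<^sub>M ?Q \<rightarrow>\<^sub>M (lborel :: real measure) \<Otimes>\<^sub>M ?Q"
      by measurable
    show ?thesis unfolding dq_def[abs_def]
      by (intro borel_measurable_times borel_measurable_diff measurable_compose[OF m g] g borel_measurable_const)
  qed
  then have "dg \<in> borel_measurable ((lborel :: real measure) \<Otimes>\<^sub>M ?Q)" unfolding dg_def[abs_def]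
    by (intro borel_measurable_lim_metric)
  then have dgm: "dg \<in> borel_measurable ZZ" unfolding leb_full_def by (rule measurable_completion)
  define h where "h p = - \<i> * of_real (\<psi> (snd p) / w p) * dg p" for p
  have hm: "h \<in> borel_measurable ZZ" unfolding h_def[abs_def]
    by (intro borel_measurable_times borel_measurable_const dgm
        measurable_compose[OF borel_measurable_divide[OF psi_measurable_full w_measurable] borel_measurable_of_real])
  have key: "AE y in X. AE s in lebesgue. h (s, y) = H_fib \<psi> w y (\<lambda>s. f (s, y)) s"
    using AE_good D fg
  proof eventually_elim
    case (elim y)
    obtain G c where G: "ac_prim G (weak_deriv (\<lambda>s. f (s, y)))" and fG: "AE s in lebesgue. f (s, y) = G s"
      by (rule fib_rel_if_D_fib[OF elim(1,2)])
    have gG: "AE s in lebesgue. g (s, y) = G s" using fG elim(3) by eventually_elim simp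
    \<comment> \<open>The countably many translates of the exceptional null set are null together,
      so g agrees with G at s and at all the shifted points used by the quotients.\<close>
    have "AE s in lebesgue. \<forall>n. g (s + 1 / real (Suc n), y) = G (s + 1 / real (Suc n))"
      unfolding AE_all_countable by (rule allI) (rule AE_lebesgue_translate[OF gG])
    with gG ac_prim_AE_derivative[OF G] show ?case
    proof eventually_elim
      case (elim s)
      have "dq n (s, y) = of_nat (Suc n) * (G (s + 1 / of_nat (Suc n)) - G s)" for n
        using elim(1) elim(3)[rule_format, of n] by (simp only: dq_def fst_conv snd_conv)
      then have "dg (s, y) = weak_deriv (\<lambda>s. f (s, y)) s"
        unfolding dg_def using elim(2) by (simp only: limI)
      then show ?case by (simp add: h_def H_fib_def)
    qed
  qed
  have hL: "AE y in X. (\<lambda>s. h (s, y)) \<in> L2 (wfib w y) \<and> L2_norm (wfib w y) (\<lambda>s. h (s, y)) = L2_norm (wfib w y) (H_fib \<psi> w y (\<lambda>s. f (s, y)))"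
    using AE_good D key measurable_fib[OF hm]
  proof eventually_elim
    case (elim y)
    have H: "H_fib \<psi> w y (\<lambda>s. f (s, y)) \<in> L2 (wfib w y)" using elim(2) by (simp add: D_fib_def)
    have e: "AE s in wfib w y. h (s, y) = H_fib \<psi> w y (\<lambda>s. f (s, y)) s" using elim(3) by (simp add: AE_wfib[OF elim(1)])
    have m: "(\<lambda>s. h (s, y)) \<in> borel_measurable (wfib w y)" using elim(4) by (simp add: measurable_wfib)
    have hh: "(\<lambda>s. h (s, y)) \<in> L2 (wfib w y)" by (rule L2_cong_AE[OF H m AE_eq_sym[OF e]])
    show ?case using hh L2_norm_cong_AE[OF hh H e] by blast
  qed
  have "h \<in> L2 N"
  proof (rule L2I_fib[OF hm])
    show "AE y in X. (\<lambda>s. h (s, y)) \<in> L2 (wfib w y)" using hL by (rule eventually_mono) blast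
    have "(\<integral>\<^sup>+y. ennreal ((L2_norm (wfib w y) (\<lambda>s. h (s, y)))\<^sup>2) \<partial>X) = (\<integral>\<^sup>+y. ennreal ((L2_norm (wfib w y) (H_fib \<psi> w y (\<lambda>s. f (s, y))))\<^sup>2) \<partial>X)"
      by (rule nn_integral_cong_AE, use hL in eventually_elim) simp
    then show "(\<integral>\<^sup>+y. ennreal ((L2_norm (wfib w y) (\<lambda>s. h (s, y)))\<^sup>2) \<partial>X) < \<infinity>" using fin by simp
  qed
  define P where "P k \<longleftrightarrow> k \<in> L2 N \<and> (AE y in X. AE s in lebesgue. k (s, y) = H_fib \<psi> w y (\<lambda>s. f (s, y)) s)" for k
  have "P h" unfolding P_def using \<open>h \<in> L2 N\<close> key by blast
  then have "P (H_op d \<psi> w f)" unfolding H_op_def P_def[symmetric] by (rule someI[of P])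
  then have k: "H_op d \<psi> w f \<in> L2 N" "AE y in X. AE s in lebesgue. H_op d \<psi> w f (s, y) = H_fib \<psi> w y (\<lambda>s. f (s, y)) s"
    by (auto simp: P_def)
  have "AE y in X. fib_rel y (\<lambda>s. f (s, y)) (\<lambda>s. H_op d \<psi> w f (s, y))"
    using AE_good D k(2)
  proof eventually_elim
    case (elim y)
    obtain G c where fG: "AE s in lebesgue. f (s, y) = G s"
      and G: "ac_prim G (\<lambda>s. \<i> * of_real (w (s, y) / \<psi> y) * H_fib \<psi> w y (\<lambda>s. f (s, y)) s)"
      and lim: "(G \<longlongrightarrow> c) at_top" "(G \<longlongrightarrow> c) at_bot"
      by (rule fib_rel_if_D_fib[OF elim(1,2)])
    have "AE s in lebesgue. \<i> * of_real (w (s, y) / \<psi> y) * H_fib \<psi> w y (\<lambda>s. f (s, y)) s = \<i> * of_real (w (s, y) / \<psi> y) * H_op d \<psi> w f (s, y)"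
      using elim(3) by eventually_elim simp
    from ac_prim_cong_AE[OF G this] show ?case unfolding fib_rel_def using fG lim by blast
  qed
  then show ?thesis unfolding graph_def using f k(1) by blast
qed

end

section \<open>Exponential convolutions\<close>

lemma L2_cnj: "f \<in> L2 N \<Longrightarrow> (\<lambda>x. cnj (f x)) \<in> L2 N"
  unfolding L2_def mem_Collect_eq complex_mod_cnj using borel_measurable_cnj by blast

lemma integrable_limit_0_at_top:
  fixes f :: "real \<Rightarrow> real"
  assumes f: "integrable lebesgue f" and lim: "(f \<longlongrightarrow> c) at_top"
  shows "c = 0"
proof (rule ccontr)
  assume "c \<noteq> 0"
  then have "\<bar>c\<bar> / 2 < \<bar>c\<bar>" by simp
  from order_tendstoD(1)[OF tendsto_rabs[OF lim] this] obtain T where T: "\<And>x. x \<ge> T \<Longrightarrow> \<bar>c\<bar> / 2 < \<bar>f x\<bar>"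
    by (auto simp: eventually_at_top_linorder)
  have "\<infinity> = (\<integral>\<^sup>+x. ennreal (\<bar>c\<bar> / 2) * indicator {T..} x \<partial>lebesgue)"
  proof -
    have "emeasure lebesgue {T..} = \<infinity>"
    proof (rule ccontr)
      assume "emeasure lebesgue {T..} \<noteq> \<infinity>"
      then have "emeasure lebesgue {T..} < \<infinity>" by (simp add: less_top)
      from ennreal_Ex_less_of_nat[OF this[unfolded infinity_ennreal_def]] obtain n :: nat where n: "emeasure lebesgue {T..} < of_nat n" by auto
      have "ennreal n = emeasure lebesgue {T..T + real n}" by simp
      also have "\<dots> \<le> emeasure lebesgue {T..}" by (intro emeasure_mono) auto
      finally show False using n by (simp add: ennreal_of_nat_eq_real_of_nat)
    qed
    then show ?thesis using \<open>c \<noteq> 0\<close> by (simp add: nn_integral_cmult_indicator ennreal_mult_top)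
  qed
  also have "\<dots> \<le> (\<integral>\<^sup>+x. ennreal (norm (f x)) \<partial>lebesgue)"
    using T by (intro nn_integral_mono) (auto simp: indicator_def intro!: ennreal_leI less_imp_le)
  also have "\<dots> < \<infinity>" using f by (simp add: integrable_iff_bounded)
  finally show False by simp
qed

lemma uminus_lebesgue_measurable: "(\<lambda>x::real. - x) \<in> lebesgue \<rightarrow>\<^sub>M lebesgue"
proof -
  have "(*\<^sub>R) (-1) = (\<lambda>x::real. - x)" by auto
  then show ?thesis using lebesgue_measurable_scaling[of "-1", where 'a=real] by simp
qed

lemma lebesgue_distr_uminus: "distr lebesgue lebesgue (\<lambda>x::real. - x) = lebesgue"
  using lebesgue_real_affine[of "-1" 0] by (simp add: density_1 one_ennreal_def[symmetric])

lemma integrable_reflect_lebesgue: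
  fixes f :: "real \<Rightarrow> 'a::euclidean_space"
  shows "integrable lebesgue f \<Longrightarrow> integrable lebesgue (\<lambda>s. f (- s))"
  and "integral\<^sup>L lebesgue (\<lambda>s. f (- s)) = integral\<^sup>L lebesgue f"
proof -
  note d = lebesgue_distr_uminus[symmetric] and m = uminus_lebesgue_measurable
  show i: "integrable lebesgue f \<Longrightarrow> integrable lebesgue (\<lambda>s. f (- s))" for f :: "real \<Rightarrow> 'a"
  proof -
    assume f: "integrable lebesgue f"
    then have "integrable (distr lebesgue lebesgue (\<lambda>x. - x)) f" using d by simp
    then show ?thesis by (rule integrable_distr[OF m])
  qed
  show "integral\<^sup>L lebesgue (\<lambda>s. f (- s)) = integral\<^sup>L lebesgue f"
  proof (cases "f \<in> borel_measurable lebesgue")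
    case True
    have "integral\<^sup>L (distr lebesgue lebesgue (\<lambda>x. - x)) f = integral\<^sup>L lebesgue (\<lambda>s. f (- s))"
      by (rule integral_distr[OF m True])
    then show ?thesis using d by simp
  next
    case False
    then have "\<not> integrable lebesgue f" by auto
    moreover have "\<not> integrable lebesgue (\<lambda>s. f (- s))"
      using i[of "\<lambda>s. f (- s)"] \<open>\<not> integrable lebesgue f\<close> by auto
    ultimately show ?thesis by (simp add: not_integrable_integral_eq)
  qed
qed

lemma integrable_limit_0_at_bot:
  fixes f :: "real \<Rightarrow> real"
  assumes f: "integrable lebesgue f" and lim: "(f \<longlongrightarrow> c) at_bot"
  shows "c = 0"
  by (rule integrable_limit_0_at_top[OF integrable_reflect_lebesgue(1)[OF f]])
    (rule filterlim_compose[OF lim filterlim_uminus_at_bot_at_top])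

lemma ac_prim_reflect: assumes F: "ac_prim F h" shows "ac_prim (\<lambda>s. F (- s)) (\<lambda>s. - h (- s))"
proof -
  have e: "indicator {a..b} s *\<^sub>R h (- s) = indicator {- b..- a} (- s) *\<^sub>R h (- s)" for a b s :: real
    by (auto simp: indicator_def)
  have "integrable lebesgue (\<lambda>s. indicator {a..b} s *\<^sub>R h (- s))" for a b
    unfolding e by (rule integrable_reflect_lebesgue(1)[of "\<lambda>s. indicator {- b..- a} s *\<^sub>R h s"])
      (use ac_prim_integrable[OF F] in \<open>simp add: set_integrable_def\<close>)
  then have i: "set_integrable lebesgue {a..b} (\<lambda>s. h (- s))" for a b by (simp add: set_integrable_def)
  have "F (- b) - F (- a) = (LINT s:{a..b}|lebesgue. - h (- s))" if "a \<le> b" for a b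
  proof -
    have "(LINT s:{a..b}|lebesgue. - h (- s)) = - (\<integral>s. indicator {- b..- a} (- s) *\<^sub>R h (- s) \<partial>lebesgue)"
      unfolding set_lebesgue_integral_def e[symmetric] by simp
    also have "(\<integral>s. indicator {- b..- a} (- s) *\<^sub>R h (- s) \<partial>lebesgue) = (LINT s:{- b..- a}|lebesgue. h s)"
      unfolding set_lebesgue_integral_def by (rule integrable_reflect_lebesgue(2))
    also have "\<dots> = F (- a) - F (- b)" using ac_prim_eq[OF F, of "- b" "- a"] that by simp
    finally show ?thesis by simp
  qed
  moreover have "set_integrable lebesgue {a..b} (\<lambda>s. - h (- s))" for a b
    using i[of a b] by (simp add: set_integrable_def)
  ultimately show ?thesis by (simp add: ac_prim_def locally_integrable_def)
qed

text \<open>The derivative of |F|^2 is integrable, so |F|^2 has limits at both ends; being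
  integrable itself, it can only tend to 0.\<close>

lemma ac_prim_L2_limits:
  assumes F: "ac_prim F h" and FL: "F \<in> L2 lebesgue" and i: "integrable lebesgue (\<lambda>s. h s * cnj (F s) + F s * cnj (h s))"
  shows "(F \<longlongrightarrow> 0) at_top" "(F \<longlongrightarrow> 0) at_bot"
proof -
  have U: "ac_prim (\<lambda>s. F s * cnj (F s)) (\<lambda>s. h s * cnj (F s) + F s * cnj (h s))"
    by (rule ac_prim_mult[OF F ac_prim_cnj[OF F]])
  obtain c e where lim: "((\<lambda>s. F s * cnj (F s)) \<longlongrightarrow> c) at_bot" "((\<lambda>s. F s * cnj (F s)) \<longlongrightarrow> e) at_top"
    by (rule ac_prim_limits[OF U i])
  have n: "cmod (F s * cnj (F s)) = (cmod (F s))\<^sup>2" for s by (simp add: norm_mult power2_eq_square)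
  have l1: "((\<lambda>s. (cmod (F s))\<^sup>2) \<longlongrightarrow> cmod e) at_top" using tendsto_norm[OF lim(2)] unfolding n .
  have l2: "((\<lambda>s. (cmod (F s))\<^sup>2) \<longlongrightarrow> cmod c) at_bot" using tendsto_norm[OF lim(1)] unfolding n .
  have z: "cmod e = 0" "cmod c = 0"
    using integrable_limit_0_at_top[OF L2_integrable[OF FL] l1] integrable_limit_0_at_bot[OF L2_integrable[OF FL] l2] by auto
  have "((\<lambda>s. sqrt ((cmod (F s))\<^sup>2)) \<longlongrightarrow> sqrt 0) at_top" using l1 unfolding z by (rule tendsto_real_sqrt)
  then have "((\<lambda>s. cmod (F s)) \<longlongrightarrow> 0) at_top" by simp
  then show "(F \<longlongrightarrow> 0) at_top" by (rule tendsto_norm_zero_cancel)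
  have "((\<lambda>s. sqrt ((cmod (F s))\<^sup>2)) \<longlongrightarrow> sqrt 0) at_bot" using l2 unfolding z by (rule tendsto_real_sqrt)
  then have "((\<lambda>s. cmod (F s)) \<longlongrightarrow> 0) at_bot" by simp
  then show "(F \<longlongrightarrow> 0) at_bot" by (rule tendsto_norm_zero_cancel)
qed

lemma integrable_L2_deriv_sum:
  assumes "F \<in> L2 N" "h \<in> L2 N" shows "integrable N (\<lambda>s. h s * cnj (F s) + F s * cnj (h s))"
  using integrable_L2_inner[OF assms] integrable_L2_inner[OF assms(2,1)] by simp

lemma ac_prim_halfline:
  assumes q: "\<And>b. integrable lebesgue (\<lambda>t. indicator {..b} t *\<^sub>R q t)"
  shows "ac_prim (\<lambda>s. \<integral>t. indicator {..s} t *\<^sub>R q t \<partial>lebesgue) q"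
proof -
  have i: "set_integrable lebesgue {a..b} q" for a b
  proof -
    have "integrable lebesgue (\<lambda>t. indicator {a..b} t *\<^sub>R (indicator {..b} t *\<^sub>R q t))"
      by (rule integrable_mult_indicator[OF _ q]) simp
    moreover have "(\<lambda>t. indicator {a..b} t *\<^sub>R (indicator {..b} t *\<^sub>R q t)) = (\<lambda>t. indicator {a..b} t *\<^sub>R q t)"
      by (auto simp: fun_eq_iff indicator_def)
    ultimately show ?thesis by (simp only: set_integrable_def)
  qed
  have "(\<integral>t. indicator {..b} t *\<^sub>R q t \<partial>lebesgue) - (\<integral>t. indicator {..a} t *\<^sub>R q t \<partial>lebesgue) = (LINT s:{a..b}|lebesgue. q s)"
    if "a \<le> b" for a b
  proof -
    have m: "(\<lambda>t. indicator {..b} t *\<^sub>R q t - indicator {..a} t *\<^sub>R q t) \<in> borel_measurable lebesgue"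
      by (intro borel_measurable_diff borel_measurable_integrable q)
    have "(\<integral>t. indicator {..b} t *\<^sub>R q t \<partial>lebesgue) - (\<integral>t. indicator {..a} t *\<^sub>R q t \<partial>lebesgue)
      = (\<integral>t. indicator {..b} t *\<^sub>R q t - indicator {..a} t *\<^sub>R q t \<partial>lebesgue)"
      by (rule Bochner_Integration.integral_diff[OF q q, symmetric])
    also have "\<dots> = (\<integral>t. indicator {a..b} t *\<^sub>R q t \<partial>lebesgue)"
    proof (rule integral_cong_AE[OF m])
      show "(\<lambda>t. indicator {a..b} t *\<^sub>R q t) \<in> borel_measurable lebesgue" using i[of a b] by (simp add: set_integrable_def)
      have "AE t in lebesgue. t \<notin> {a}" by (intro AE_not_in) simp
      then show "AE t in lebesgue. indicator {..b} t *\<^sub>R q t - indicator {..a} t *\<^sub>R q t = indicator {a..b} t *\<^sub>R q t"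
        by (rule eventually_mono) (use that in \<open>auto simp: indicator_def\<close>)
    qed
    finally show ?thesis by (simp only: set_lebesgue_integral_def)
  qed
  then show ?thesis using i by (simp add: ac_prim_def locally_integrable_def)
qed

lemma halfline_limits:
  fixes q :: "real \<Rightarrow> complex"
  assumes q: "integrable lebesgue q"
  shows "((\<lambda>s. \<integral>t. indicator {..s} t *\<^sub>R q t \<partial>lebesgue) \<longlongrightarrow> 0) at_bot"
    "((\<lambda>s. \<integral>t. indicator {..s} t *\<^sub>R q t \<partial>lebesgue) \<longlongrightarrow> (\<integral>t. q t \<partial>lebesgue)) at_top"
proof -
  let ?J = "\<lambda>s. \<integral>t. indicator {..s} t *\<^sub>R q t \<partial>lebesgue"
  have im: "integrable lebesgue (\<lambda>t. indicator {..b} t *\<^sub>R q t)" for b :: real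
    by (rule integrable_mult_indicator[OF _ q]) simp
  have "(\<lambda>n. ?J (- real n)) \<longlonglongrightarrow> (\<integral>t. 0 \<partial>(lebesgue :: real measure))"
  proof (rule integral_dominated_convergence[where w="\<lambda>t. norm (q t)"])
    show "AE t in lebesgue. (\<lambda>n. indicator {..- real n} t *\<^sub>R q t) \<longlonglongrightarrow> 0"
    proof (rule AE_I2)
      fix t :: real
      obtain m :: nat where m: "- t < real m" using reals_Archimedean2 by blast
      have "\<forall>\<^sub>F n in sequentially. indicator {..- real n} t *\<^sub>R q t = 0"
        using eventually_ge_at_top[of m]
      proof (rule eventually_mono)
        fix n assume "m \<le> n"
        then have "- t < real n" using m by linarith
        then show "indicator {..- real n} t *\<^sub>R q t = 0" by (simp add: indicator_def)
      qed
      then show "(\<lambda>n. indicator {..- real n} t *\<^sub>R q t) \<longlonglongrightarrow> 0" by (rule tendsto_eventually)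
    qed
    show "(\<lambda>t. indicator {..- real n} t *\<^sub>R q t) \<in> borel_measurable lebesgue" for n
      by (rule borel_measurable_integrable[OF im])
    show "AE x in lebesgue. norm (indicator {..- real i} x *\<^sub>R q x) \<le> norm (q x)" for i
      by (rule AE_I2) (simp add: indicator_def)
  qed (use q in auto)
  then have s0: "(\<lambda>n. ?J (- real n)) \<longlonglongrightarrow> 0" by simp
  obtain c e where lim: "(?J \<longlongrightarrow> c) at_bot" "(?J \<longlongrightarrow> e) at_top" "(\<integral>t. q t \<partial>lebesgue) = e - c"
    by (rule ac_prim_limits[OF ac_prim_halfline[OF im] q])
  have "(\<lambda>n. ?J (- real n)) \<longlonglongrightarrow> c"
    by (rule filterlim_compose[OF lim(1) filterlim_compose[OF filterlim_uminus_at_bot_at_top filterlim_real_sequentially]])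
  from LIMSEQ_unique[OF this s0] have "c = 0" .
  then show "(?J \<longlongrightarrow> 0) at_bot" "(?J \<longlongrightarrow> (\<integral>t. q t \<partial>lebesgue)) at_top" using lim by simp_all
qed

lemma nn_integral_exp_halfline:
  fixes a s :: real assumes a: "a > 0"
  shows "(\<integral>\<^sup>+t. ennreal (indicator {..s} t * exp (- (a * (s - t)))) \<partial>lebesgue) = ennreal (1 / a)"
    and "(\<integral>\<^sup>+t. ennreal (indicator {..t} s * exp (- (a * (t - s)))) \<partial>lebesgue) = ennreal (1 / a)"
proof -
  have base: "(\<integral>\<^sup>+t. ennreal (indicator {0..} t * exp (- (a * t))) \<partial>lborel) = ennreal (1 / a)"
  proof -
    have "((\<lambda>x. exp (- a * x)) has_integral exp (- a * 0) / a) {0..}" by (rule has_integral_exp_minus_to_infinity[OF a])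
    then have "((\<lambda>x. if x \<in> {0..} then exp (- a * x) else 0) has_integral 1 / a) UNIV"
      by (subst has_integral_restrict_UNIV) simp
    moreover have "(\<lambda>x. if x \<in> {0..} then exp (- a * x) else 0) = (\<lambda>t. indicator {0..} t * exp (- (a * t)))"
      by (auto simp: indicator_def fun_eq_iff)
    ultimately have "((\<lambda>t. indicator {0..} t * exp (- (a * t))) has_integral 1 / a) UNIV" by simp
    from nn_integral_has_integral_lebesgue[OF _ this] show ?thesis by (simp add: nn_integral_completion)
  qed
  have "(\<integral>\<^sup>+t. ennreal (indicator {..s} t * exp (- (a * (s - t)))) \<partial>lborel) =
      (\<integral>\<^sup>+t. ennreal (indicator {..s} (s + -1 * t) * exp (- (a * (s - (s + -1 * t))))) \<partial>lborel)"
    using nn_integral_real_affine[of "\<lambda>t. ennreal (indicator {..s} t * exp (- (a * (s - t))))" "-1" s] by simp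
  also have "\<dots> = (\<integral>\<^sup>+t. ennreal (indicator {0..} t * exp (- (a * t))) \<partial>lborel)"
    by (rule nn_integral_cong) (auto simp: indicator_def)
  finally show "(\<integral>\<^sup>+t. ennreal (indicator {..s} t * exp (- (a * (s - t)))) \<partial>lebesgue) = ennreal (1 / a)"
    using base by (simp add: nn_integral_completion)
  have "(\<integral>\<^sup>+t. ennreal (indicator {..t} s * exp (- (a * (t - s)))) \<partial>lborel) =
      (\<integral>\<^sup>+t. ennreal (indicator {s..} t * exp (- (a * (t - s)))) \<partial>lborel)"
    by (rule nn_integral_cong) (auto simp: indicator_def)
  also have "\<dots> = (\<integral>\<^sup>+t. ennreal (indicator {s..} (s + 1 * t) * exp (- (a * ((s + 1 * t) - s)))) \<partial>lborel)"
    using nn_integral_real_affine[of "\<lambda>t. ennreal (indicator {s..} t * exp (- (a * (t - s))))" 1 s] by simp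
  also have "\<dots> = (\<integral>\<^sup>+t. ennreal (indicator {0..} t * exp (- (a * t))) \<partial>lborel)"
    by (rule nn_integral_cong) (auto simp: indicator_def)
  finally show "(\<integral>\<^sup>+t. ennreal (indicator {..t} s * exp (- (a * (t - s)))) \<partial>lebesgue) = ennreal (1 / a)"
    using base by (simp add: nn_integral_completion)
qed

lemma L2_exp_halfline:
  fixes a s :: real assumes a: "a > 0"
  shows "(\<lambda>t. complex_of_real (indicator {..s} t * exp (- (a * (s - t))))) \<in> L2 lebesgue"
    and "(L2_norm lebesgue (\<lambda>t. complex_of_real (indicator {..s} t * exp (- (a * (s - t))))))\<^sup>2 = 1 / (2 * a)"
proof -
  let ?e = "\<lambda>t. complex_of_real (indicator {..s} t * exp (- (a * (s - t))))"
  have m: "?e \<in> borel_measurable lebesgue" by (rule measurable_completion) measurable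
  have "(\<integral>\<^sup>+t. ennreal ((cmod (?e t))\<^sup>2) \<partial>lebesgue) = (\<integral>\<^sup>+t. ennreal (indicator {..s} t * exp (- ((2*a) * (s - t)))) \<partial>lebesgue)"
    by (rule nn_integral_cong) (auto simp: indicator_def power2_eq_square abs_mult simp flip: exp_add)
  also have "\<dots> = ennreal (1 / (2 * a))" using a by (intro nn_integral_exp_halfline) simp
  finally have n: "(\<integral>\<^sup>+t. ennreal ((cmod (?e t))\<^sup>2) \<partial>lebesgue) = ennreal (1 / (2 * a))" .
  then show L: "?e \<in> L2 lebesgue" unfolding L2_iff_nn_integral using m by simp
  show "(L2_norm lebesgue ?e)\<^sup>2 = 1 / (2 * a)" using L2_norm_sq_nn[OF L] n a by simp
qed

text \<open>The solution of u' + a u = f that integrates from minus infinity; at a = 0 it is the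
  plain indefinite integral, which is the case used over S.\<close>

definition exp_conv :: "real \<Rightarrow> (real \<Rightarrow> complex) \<Rightarrow> real \<Rightarrow> complex" where
  "exp_conv a f s = (\<integral>t. of_real (indicator {..s} t * exp (- (a * (s - t)))) * f t \<partial>lebesgue)"

text \<open>Variation of constants: the function is exp(-a s) times the primitive of exp(a t) f(t),
  and the product rule applies.\<close>

lemma exp_conv_ac_prim:
  assumes a: "a > 0" and f: "f \<in> L2 lebesgue"
  shows "ac_prim (exp_conv a f) (\<lambda>s. f s - of_real a * exp_conv a f s)"
proof -
  have i: "integrable lebesgue (\<lambda>t. of_real (indicator {..s} t * exp (- (a * (s - t)))) * f t)" for s
    using integrable_L2_inner[OF f L2_exp_halfline(1)[OF a, of s]] by (simp add: mult.commute)
  define q where "q t = of_real (exp (a * t)) * f t" for t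
  have e: "indicator {..s} t *\<^sub>R q t = of_real (exp (a * s)) * (of_real (indicator {..s} t * exp (- (a * (s - t)))) * f t)" for s t
  proof -
    have "exp (a * t) = exp (a * s) * exp (- (a * (s - t)))" by (simp add: algebra_simps flip: exp_add)
    then show ?thesis by (auto simp: q_def indicator_def)
  qed
  have "integrable lebesgue (\<lambda>t. indicator {..s} t *\<^sub>R q t)" for s
    unfolding e by (rule integrable_mult_right[OF i])
  from ac_prim_halfline[OF this] have V: "ac_prim (\<lambda>s. \<integral>t. indicator {..s} t *\<^sub>R q t \<partial>lebesgue) q" .
  have E: "ac_prim (\<lambda>s. of_real (exp (- (a * s)))) (\<lambda>s. of_real (- a * exp (- (a * s))))"
  proof (rule ac_prim_smooth)
    fix x
    have "((\<lambda>s. exp (- (a * s))) has_real_derivative - a * exp (- (a * x))) (at x)"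
      by (auto intro!: derivative_eq_intros)
    then show "((\<lambda>s. complex_of_real (exp (- (a * s)))) has_vector_derivative of_real (- a * exp (- (a * x)))) (at x)"
      unfolding has_real_derivative_iff_has_vector_derivative
      by (rule bounded_linear.has_vector_derivative[OF bounded_linear_of_real])
  qed (intro continuous_intros)
  have u: "exp_conv a f s = of_real (exp (- (a * s))) * (\<integral>t. indicator {..s} t *\<^sub>R q t \<partial>lebesgue)" for s
  proof -
    have "of_real (exp (- (a * s))) * (\<integral>t. indicator {..s} t *\<^sub>R q t \<partial>lebesgue) = of_real (exp (- (a * s)) * exp (a * s)) * exp_conv a f s"
      unfolding e exp_conv_def by (simp add: mult.assoc)
    also have "exp (- (a * s)) * exp (a * s) = 1" by (simp flip: exp_add)
    finally show ?thesis by simp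
  qed
  from ac_prim_mult[OF E V] have "ac_prim (exp_conv a f) (\<lambda>s. of_real (- a * exp (- (a * s))) * (\<integral>t. indicator {..s} t *\<^sub>R q t \<partial>lebesgue) + of_real (exp (- (a * s))) * q s)"
    unfolding u[symmetric] .
  moreover have "of_real (- a * exp (- (a * s))) * (\<integral>t. indicator {..s} t *\<^sub>R q t \<partial>lebesgue) + of_real (exp (- (a * s))) * q s = f s - of_real a * exp_conv a f s" for s
  proof -
    have "of_real (exp (- (a * s))) * q s = of_real (exp (- (a * s)) * exp (a * s)) * f s" by (simp add: q_def)
    also have "exp (- (a * s)) * exp (a * s) = 1" by (simp flip: exp_add)
    finally show ?thesis unfolding u[of s] by simp
  qed
  ultimately show ?thesis by simp
qed

text \<open>Schur's test. The kernel is written as a square, one factor is spent in the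
  Cauchy-Schwarz inequality, and both marginal integrals of the kernel equal 1/a.\<close>

lemma exp_conv_L2:
  assumes a: "a > 0" and f: "f \<in> L2 lebesgue"
  shows "exp_conv a f \<in> L2 lebesgue" "L2_norm lebesgue (exp_conv a f) \<le> (1 / a) * L2_norm lebesgue f"
proof -
  let ?u = "exp_conv a f"
  have fm [measurable]: "f \<in> borel_measurable lebesgue" using f by (rule L2_measurable)
  have um: "?u \<in> borel_measurable lebesgue"
    by (rule ac_prim_fun_measurable[OF exp_conv_ac_prim[OF a f]])
  have pw: "ennreal ((cmod (?u s))\<^sup>2) \<le> ennreal (1 / a) * (\<integral>\<^sup>+t. ennreal (indicator {..s} t * exp (- (a * (s - t)))) * ennreal ((cmod (f t))\<^sup>2) \<partial>lebesgue)" for s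
  proof -
    \<comment> \<open>The square root of the kernel, hence half the rate; its squared norm is
      1/a.\<close>
    let ?k = "\<lambda>t. complex_of_real (indicator {..s} t * exp (- ((a/2) * (s - t))))"
    have k: "?k \<in> L2 lebesgue" "(L2_norm lebesgue ?k)\<^sup>2 = 1 / a"
      using L2_exp_halfline[of "a/2" s] a by simp_all
    have km: "?k \<in> borel_measurable lebesgue" using k(1) by (rule L2_measurable)
    have kf: "(\<lambda>t. ?k t * f t) \<in> L2 lebesgue"
    proof (rule L2_mult_bounded[OF f km])
      show "AE t in lebesgue. cmod (?k t) \<le> 1"
        using a by (intro AE_I2) (auto simp: indicator_def)
    qed
    have kk: "?k t * cnj (cnj (?k t * f t)) = of_real (indicator {..s} t * exp (- (a * (s - t)))) * f t" for t
    proof (cases "t \<le> s")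
      case True
      have "exp (- ((a/2) * (s - t))) * exp (- ((a/2) * (s - t))) = exp (- (a * (s - t)))"
        by (simp flip: exp_add add: field_simps)
      then show ?thesis using True by (simp flip: of_real_mult mult.assoc add: indicator_def)
    qed (simp add: indicator_def)
    have kfc: "(\<lambda>t. cnj (?k t * f t)) \<in> L2 lebesgue"
      by (rule L2_cnj[OF kf])
    have "?u s = L2_inner lebesgue ?k (\<lambda>t. cnj (?k t * f t))"
      unfolding exp_conv_def L2_inner_def kk ..
    then have "cmod (?u s) \<le> L2_norm lebesgue ?k * L2_norm lebesgue (\<lambda>t. cnj (?k t * f t))"
      using L2_Cauchy_Schwarz[OF k(1) kfc] by simp
    then have "(cmod (?u s))\<^sup>2 \<le> (1 / a) * (L2_norm lebesgue (\<lambda>t. cnj (?k t * f t)))\<^sup>2"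
      unfolding k(2)[symmetric] power_mult_distrib[symmetric] by (intro power_mono) auto
    then have "ennreal ((cmod (?u s))\<^sup>2) \<le> ennreal (1 / a) * ennreal ((L2_norm lebesgue (\<lambda>t. cnj (?k t * f t)))\<^sup>2)"
      using a by (simp add: ennreal_leI flip: ennreal_mult)
    also have "ennreal ((L2_norm lebesgue (\<lambda>t. cnj (?k t * f t)))\<^sup>2) = (\<integral>\<^sup>+t. ennreal (indicator {..s} t * exp (- (a * (s - t)))) * ennreal ((cmod (f t))\<^sup>2) \<partial>lebesgue)"
      unfolding L2_norm_sq_nn[OF kfc]
    proof (rule nn_integral_cong)
      fix t
      have "(cmod (?k t))\<^sup>2 = indicator {..s} t * exp (- (a * (s - t)))"
        by (auto simp: indicator_def power2_eq_square field_simps simp flip: exp_add)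
      then show "ennreal ((cmod (cnj (?k t * f t)))\<^sup>2) = ennreal (indicator {..s} t * exp (- (a * (s - t)))) * ennreal ((cmod (f t))\<^sup>2)"
        by (simp add: norm_mult power_mult_distrib ennreal_mult[symmetric])
    qed
    finally show ?thesis .
  qed
  have mk: "(\<lambda>p. ennreal (indicator {..fst p} (snd p) * exp (- (a * (fst p - snd p)))) * ennreal ((cmod (f (snd p)))\<^sup>2)) \<in> borel_measurable (lebesgue \<Otimes>\<^sub>M lebesgue)"
  proof -
    have [measurable]: "(\<lambda>p. fst p) \<in> lebesgue \<Otimes>\<^sub>M lebesgue \<rightarrow>\<^sub>M (borel :: real measure)"
      by (rule measurable_compose[OF measurable_fst measurable_completion]) simp
    have [measurable]: "(\<lambda>p. snd p) \<in> lebesgue \<Otimes>\<^sub>M lebesgue \<rightarrow>\<^sub>M (borel :: real measure)"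
      by (rule measurable_compose[OF measurable_snd measurable_completion]) simp
    have "(\<lambda>p. if snd p \<le> fst p then exp (- (a * (fst p - snd p))) else 0) \<in> borel_measurable (lebesgue \<Otimes>\<^sub>M lebesgue)" by measurable
    moreover have "(\<lambda>p. if snd p \<le> fst p then exp (- (a * (fst p - snd p))) else 0) = (\<lambda>p. indicator {..fst p} (snd p) * exp (- (a * (fst p - snd p))))"
      by (auto simp: fun_eq_iff indicator_def)
    ultimately have [measurable]: "(\<lambda>p. indicator {..fst p} (snd p) * exp (- (a * (fst p - snd p)))) \<in> borel_measurable (lebesgue \<Otimes>\<^sub>M lebesgue)" by simp
    show ?thesis by measurable
  qed
  have "(\<integral>\<^sup>+s. ennreal ((cmod (?u s))\<^sup>2) \<partial>lebesgue) \<le> (\<integral>\<^sup>+s. ennreal (1 / a) * (\<integral>\<^sup>+t. ennreal (indicator {..s} t * exp (- (a * (s - t)))) * ennreal ((cmod (f t))\<^sup>2) \<partial>lebesgue) \<partial>lebesgue)"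
    by (rule nn_integral_mono) (rule pw)
  also have "\<dots> = ennreal (1 / a) * (\<integral>\<^sup>+s. (\<integral>\<^sup>+t. ennreal (indicator {..s} t * exp (- (a * (s - t)))) * ennreal ((cmod (f t))\<^sup>2) \<partial>lebesgue) \<partial>lebesgue)"
    by (rule nn_integral_cmult) (use sigma_finite_measure.borel_measurable_nn_integral_fst[OF sigma_finite_completion[OF lborel.sigma_finite_measure_axioms] mk] in simp)
  also have "(\<integral>\<^sup>+s. (\<integral>\<^sup>+t. ennreal (indicator {..s} t * exp (- (a * (s - t)))) * ennreal ((cmod (f t))\<^sup>2) \<partial>lebesgue) \<partial>lebesgue)
    = (\<integral>\<^sup>+t. (\<integral>\<^sup>+s. ennreal (indicator {..s} t * exp (- (a * (s - t)))) * ennreal ((cmod (f t))\<^sup>2) \<partial>lebesgue) \<partial>lebesgue)"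
    using lebesgue_pair.Fubini[OF mk] by simp
  also have "\<dots> = (\<integral>\<^sup>+t. ennreal (1 / a) * ennreal ((cmod (f t))\<^sup>2) \<partial>lebesgue)"
  proof (rule nn_integral_cong)
    fix t :: real
    have m: "(\<lambda>s. ennreal (indicator {..s} t * exp (- (a * (s - t))))) \<in> borel_measurable lebesgue"
    proof -
      have "(\<lambda>s. ennreal (indicator {t..} s * exp (- (a * (s - t))))) \<in> borel_measurable lebesgue"
        by (rule measurable_completion) measurable
      moreover have "(\<lambda>s. ennreal (indicator {t..} s * exp (- (a * (s - t))))) = (\<lambda>s. ennreal (indicator {..s} t * exp (- (a * (s - t)))))"
        by (auto simp: fun_eq_iff indicator_def)
      ultimately show ?thesis by simp
    qed
    show "(\<integral>\<^sup>+s. ennreal (indicator {..s} t * exp (- (a * (s - t)))) * ennreal ((cmod (f t))\<^sup>2) \<partial>lebesgue) = ennreal (1 / a) * ennreal ((cmod (f t))\<^sup>2)"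
      unfolding nn_integral_multc[OF m] nn_integral_exp_halfline(2)[OF a] ..
  qed
  also have "\<dots> = ennreal (1 / a) * ennreal ((L2_norm lebesgue f)\<^sup>2)"
    unfolding L2_norm_sq_nn[OF f] by (rule nn_integral_cmult) measurable
  finally have le: "(\<integral>\<^sup>+s. ennreal ((cmod (?u s))\<^sup>2) \<partial>lebesgue) \<le> ennreal ((1 / a * L2_norm lebesgue f)\<^sup>2)"
    using a by (simp add: ennreal_mult[symmetric] power2_eq_square mult_ac)
  show uL: "?u \<in> L2 lebesgue" unfolding L2_iff_nn_integral using um le le_less_trans by fastforce
  have "(L2_norm lebesgue ?u)\<^sup>2 \<le> (1 / a * L2_norm lebesgue f)\<^sup>2"
    using le unfolding L2_norm_sq_nn[OF uL, symmetric] by simp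
  then show "L2_norm lebesgue ?u \<le> (1 / a) * L2_norm lebesgue f" by (rule power2_le_imp_le) (use a in simp)
qed

lemma exp_conv_limits:
  assumes a: "a > 0" and f: "f \<in> L2 lebesgue"
  shows "(exp_conv a f \<longlongrightarrow> 0) at_top" "(exp_conv a f \<longlongrightarrow> 0) at_bot"
proof -
  have "(\<lambda>s. f s - of_real a * exp_conv a f s) \<in> L2 lebesgue"
    by (intro L2_diff L2_scale f exp_conv_L2(1)[OF a f])
  from ac_prim_L2_limits[OF exp_conv_ac_prim[OF a f] exp_conv_L2(1)[OF a f] integrable_L2_deriv_sum[OF exp_conv_L2(1)[OF a f] this]]
  show "(exp_conv a f \<longlongrightarrow> 0) at_top" "(exp_conv a f \<longlongrightarrow> 0) at_bot" .
qed

section \<open>Self-adjointness\<close>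

text \<open>The sign c lets one convolution solve both equations with +i and -i. Off S a square
  integrable solution comes from integrating from the left for one sign and from the right for the
  other, and the reflection s to -s exchanges the two.\<close>

lemma AE_lebesgue_sign:
  assumes c: "c = 1 \<or> c = (-1::real)" and R: "AE s in lebesgue. R s" shows "AE s in lebesgue. R (c * s)"
  using c
proof
  assume "c = -1"
  have "AE s in distr lebesgue lebesgue (\<lambda>x::real. - x). R s" using R unfolding lebesgue_distr_uminus .
  from AE_distrD[OF uminus_lebesgue_measurable this] show ?thesis using \<open>c = -1\<close> by simp
qed (use R in simp)

lemma ac_prim_sign:
  assumes c: "c = 1 \<or> c = (-1::real)" and F: "ac_prim F h"
  shows "ac_prim (\<lambda>s. F (c * s)) (\<lambda>s. of_real c * h (c * s))"
  using c ac_prim_reflect[OF F] F by auto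

lemma tendsto_sign:
  fixes F :: "real \<Rightarrow> complex"
  assumes c: "c = 1 \<or> c = (-1::real)" and F: "(F \<longlongrightarrow> x) at_top" "(F \<longlongrightarrow> x) at_bot"
  shows "((\<lambda>s. F (c * s)) \<longlongrightarrow> x) at_top" "((\<lambda>s. F (c * s)) \<longlongrightarrow> x) at_bot"
  using c filterlim_compose[OF F(2) filterlim_uminus_at_bot_at_top] filterlim_compose[OF F(1) filterlim_uminus_at_top_at_bot] F
  by auto

lemma L2_sign:
  assumes c: "c = 1 \<or> c = (-1::real)" and f: "f \<in> L2 lebesgue"
  shows "(\<lambda>s. f (c * s)) \<in> L2 lebesgue" "L2_norm lebesgue (\<lambda>s. f (c * s)) = L2_norm lebesgue f"
proof -
  have "(\<lambda>s. f (- s)) \<in> L2 lebesgue" unfolding L2_def mem_Collect_eq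
    using measurable_compose[OF uminus_lebesgue_measurable L2_measurable[OF f]] integrable_reflect_lebesgue(1)[OF L2_integrable[OF f]]
    by blast
  then show "(\<lambda>s. f (c * s)) \<in> L2 lebesgue" using c f by auto
  have "L2_norm lebesgue (\<lambda>s. f (- s)) = L2_norm lebesgue f"
    unfolding L2_norm_def using integrable_reflect_lebesgue(2)[of "\<lambda>s. (cmod (f s))\<^sup>2"] by simp
  then show "L2_norm lebesgue (\<lambda>s. f (c * s)) = L2_norm lebesgue f" using c by auto
qed

lemma L2_norm_of_real_cmod:
  assumes f: "f \<in> L2 N"
  shows "(\<lambda>x. of_real (cmod (f x))) \<in> L2 N" "L2_norm N (\<lambda>x. complex_of_real (cmod (f x))) = L2_norm N f"
proof -
  have "(\<lambda>x. complex_of_real (cmod (f x))) \<in> borel_measurable N" using L2_measurable[OF f] by measurable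
  then show "(\<lambda>x. of_real (cmod (f x))) \<in> L2 N" using L2_integrable[OF f] by (simp add: L2_def)
qed (simp add: L2_norm_def)

lemma norm_exp_conv_0_le: "cmod (exp_conv 0 F s) \<le> (\<integral>t. cmod (F t) \<partial>lebesgue)" if F: "integrable lebesgue F"
proof -
  have i: "integrable lebesgue (\<lambda>t. indicator {..s} t *\<^sub>R F t)" by (rule integrable_mult_indicator[OF _ F]) simp
  have "exp_conv 0 F s = (\<integral>t. indicator {..s} t *\<^sub>R F t \<partial>lebesgue)"
    unfolding exp_conv_def by (simp add: scaleR_conv_of_real)
  also have "cmod \<dots> \<le> (\<integral>t. cmod (indicator {..s} t *\<^sub>R F t) \<partial>lebesgue)" by (rule integral_norm_bound)
  also have "\<dots> \<le> (\<integral>t. cmod (F t) \<partial>lebesgue)"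
    by (rule integral_mono[OF integrable_norm[OF i] integrable_norm[OF F]]) (simp add: indicator_def)
  finally show ?thesis .
qed

lemma exp_conv_0_ac_prim:
  assumes F: "integrable lebesgue F" and z: "(\<integral>t. F t \<partial>lebesgue) = 0"
  shows "ac_prim (exp_conv 0 F) F" "(exp_conv 0 F \<longlongrightarrow> 0) at_bot" "(exp_conv 0 F \<longlongrightarrow> 0) at_top"
proof -
  have e: "exp_conv 0 F = (\<lambda>s. \<integral>t. indicator {..s} t *\<^sub>R F t \<partial>lebesgue)"
    unfolding exp_conv_def by (simp add: scaleR_conv_of_real fun_eq_iff)
  show "ac_prim (exp_conv 0 F) F" unfolding e
    by (rule ac_prim_halfline) (rule integrable_mult_indicator[OF _ F], simp)
  show "(exp_conv 0 F \<longlongrightarrow> 0) at_bot" "(exp_conv 0 F \<longlongrightarrow> 0) at_top"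
    unfolding e using halfline_limits[OF F] z by auto
qed

section \<open>Linearity and symmetry of the graph\<close>

context confined_operator
begin

lemma fib_w_nonneg: assumes y: "good y" shows "AE s in lebesgue. 0 \<le> w (s, y)"
  by (rule eventually_mono[OF good_pos[OF y]]) (rule less_imp_le)

lemma integrable_wfib:
  fixes f :: "real \<Rightarrow> complex"
  assumes y: "good y" and f: "f \<in> borel_measurable lebesgue"
  shows "integrable (wfib w y) f \<longleftrightarrow> integrable lebesgue (\<lambda>s. of_real (w (s, y)) * f s)"
    and "integral\<^sup>L (wfib w y) f = (\<integral>s. of_real (w (s, y)) * f s \<partial>lebesgue)"
  unfolding wfib_def using integrable_density[OF f w_fib_measurable[OF good_Rperp[OF y]] fib_w_nonneg[OF y]]
    integral_density[OF f w_fib_measurable[OF good_Rperp[OF y]] fib_w_nonneg[OF y]]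
  by (simp_all add: scaleR_conv_of_real)

lemma L2_wfib_measurable: "f \<in> L2 (wfib w y) \<Longrightarrow> f \<in> borel_measurable lebesgue"
  using L2_measurable[of f "wfib w y"] by (simp add: measurable_wfib)

lemma L2_wfib_integrable:
  assumes y: "good y" and f: "f \<in> L2 (wfib w y)" and g: "g \<in> L2 (wfib w y)"
  shows "integrable lebesgue (\<lambda>s. of_real (w (s, y)) * (f s * cnj (g s)))"
    and "L2_inner (wfib w y) f g = (\<integral>s. of_real (w (s, y)) * (f s * cnj (g s)) \<partial>lebesgue)"
proof -
  have m: "(\<lambda>s. f s * cnj (g s)) \<in> borel_measurable lebesgue"
    by (intro borel_measurable_times borel_measurable_cnj L2_wfib_measurable[OF f] L2_wfib_measurable[OF g])
  show "integrable lebesgue (\<lambda>s. of_real (w (s, y)) * (f s * cnj (g s)))"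
    using integrable_L2_inner[OF f g] integrable_wfib(1)[OF y m] by blast
  show "L2_inner (wfib w y) f g = (\<integral>s. of_real (w (s, y)) * (f s * cnj (g s)) \<partial>lebesgue)"
    unfolding L2_inner_def by (rule integrable_wfib(2)[OF y m])
qed

lemma L2_inner_fib_measurable:
  assumes f: "f \<in> L2 N" and g: "g \<in> L2 N"
  shows "(\<lambda>y. L2_inner (wfib w y) (\<lambda>s. f (s, y)) (\<lambda>s. g (s, y))) \<in> borel_measurable X"
proof -
  have "(\<lambda>p. of_real (w p) * (f p * cnj (g p))) \<in> borel_measurable ZZ"
    by (intro borel_measurable_times borel_measurable_cnj L2_N_measurable f g measurable_compose[OF w_measurable borel_measurable_of_real])
  from measurable_fib_integral[OF this]
  have m: "(\<lambda>y. \<integral>s. of_real (w (s, y)) * (f (s, y) * cnj (g (s, y))) \<partial>lebesgue) \<in> borel_measurable X" .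
  have "AE y in X. (\<integral>s. of_real (w (s, y)) * (f (s, y) * cnj (g (s, y))) \<partial>lebesgue) = L2_inner (wfib w y) (\<lambda>s. f (s, y)) (\<lambda>s. g (s, y))"
    using AE_good L2_fib[OF f] L2_fib[OF g] by eventually_elim (rule L2_wfib_integrable(2)[symmetric])
  with m show ?thesis unfolding leb_perp_def by (rule borel_measurable_completion_cong_AE)
qed

lemma L2_inner_eqI_fib:
  assumes "f \<in> L2 N" "g \<in> L2 N" "f' \<in> L2 N" "g' \<in> L2 N"
    and "AE y in X. L2_inner (wfib w y) (\<lambda>s. f (s, y)) (\<lambda>s. g (s, y)) = L2_inner (wfib w y) (\<lambda>s. f' (s, y)) (\<lambda>s. g' (s, y))"
  shows "L2_inner N f g = L2_inner N f' g'"
  unfolding L2_inner_fib[OF assms(1,2)] L2_inner_fib[OF assms(3,4)]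
  by (rule integral_cong_AE[OF L2_inner_fib_measurable[OF assms(1,2)] L2_inner_fib_measurable[OF assms(3,4)] assms(5)])

lemma graph_L2: "graph f h \<Longrightarrow> f \<in> L2 N" "graph f h \<Longrightarrow> h \<in> L2 N"
  and graph_fib: "graph f h \<Longrightarrow> AE y in X. fib_rel y (\<lambda>s. f (s, y)) (\<lambda>s. h (s, y))"
  by (simp_all add: graph_def)

lemma fib_relI:
  assumes "AE s in lebesgue. g s = G s" "ac_prim G (\<lambda>s. \<i> * of_real (w (s, y) / \<psi> y) * k s)"
    "(G \<longlongrightarrow> c) at_top" "(G \<longlongrightarrow> c) at_bot"
  shows "fib_rel y g k"
  unfolding fib_rel_def using assms by (intro exI conjI)

lemma fib_rel_lin:
  assumes "fib_rel y f h" "fib_rel y g k"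
  shows "fib_rel y (\<lambda>s. a * f s + g s) (\<lambda>s. a * h s + k s)"
proof -
  from assms(1) obtain F c where F: "AE s in lebesgue. f s = F s" "ac_prim F (\<lambda>s. \<i> * of_real (w (s, y) / \<psi> y) * h s)"
    "(F \<longlongrightarrow> c) at_top" "(F \<longlongrightarrow> c) at_bot" by (auto simp: fib_rel_def)
  from assms(2) obtain G e where G: "AE s in lebesgue. g s = G s" "ac_prim G (\<lambda>s. \<i> * of_real (w (s, y) / \<psi> y) * k s)"
    "(G \<longlongrightarrow> e) at_top" "(G \<longlongrightarrow> e) at_bot" by (auto simp: fib_rel_def)
  have "ac_prim (\<lambda>s. a * F s + G s) (\<lambda>s. \<i> * of_real (w (s, y) / \<psi> y) * (a * h s + k s))"
    using ac_prim_lin[OF F(2) G(2), of a] by (simp only: distrib_left mult.left_commute)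
  moreover have "AE s in lebesgue. a * f s + g s = a * F s + G s" using F(1) G(1) by eventually_elim simp
  moreover have "((\<lambda>s. a * F s + G s) \<longlongrightarrow> a * c + e) at_top" "((\<lambda>s. a * F s + G s) \<longlongrightarrow> a * c + e) at_bot"
    by (intro tendsto_intros F G)+
  ultimately show ?thesis by (intro fib_relI)
qed

lemma fib_rel_cong:
  assumes r: "fib_rel y f h" and e: "AE s in lebesgue. f s = f' s" "AE s in lebesgue. h s = h' s"
  shows "fib_rel y f' h'"
proof -
  from r obtain F c where F: "AE s in lebesgue. f s = F s" "ac_prim F (\<lambda>s. \<i> * of_real (w (s, y) / \<psi> y) * h s)"
    "(F \<longlongrightarrow> c) at_top" "(F \<longlongrightarrow> c) at_bot" by (auto simp: fib_rel_def)
  have "AE s in lebesgue. \<i> * of_real (w (s, y) / \<psi> y) * h s = \<i> * of_real (w (s, y) / \<psi> y) * h' s"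
    using e(2) by eventually_elim simp
  from ac_prim_cong_AE[OF F(2) this] have "ac_prim F (\<lambda>s. \<i> * of_real (w (s, y) / \<psi> y) * h' s)" .
  moreover have "AE s in lebesgue. f' s = F s" using F(1) e(1) by eventually_elim simp
  ultimately show ?thesis using F(3,4) by (intro fib_relI)
qed

lemma graph_lin:
  assumes "graph f h" "graph g k" shows "graph (\<lambda>p. a * f p + g p) (\<lambda>p. a * h p + k p)"
  unfolding graph_def
proof (intro conjI L2_lin graph_L2[OF assms(1)] graph_L2[OF assms(2)])
  show "AE y in X. fib_rel y (\<lambda>s. a * f (s, y) + g (s, y)) (\<lambda>s. a * h (s, y) + k (s, y))"
    using graph_fib[OF assms(1)] graph_fib[OF assms(2)] by eventually_elim (rule fib_rel_lin)
qed

lemma graph_cong: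
  assumes g: "graph f h" and L: "f' \<in> L2 N" "h' \<in> L2 N" and e: "AE p in N. f p = f' p" "AE p in N. h p = h' p"
  shows "graph f' h'"
  unfolding graph_def
proof (intro conjI L)
  show "AE y in X. fib_rel y (\<lambda>s. f' (s, y)) (\<lambda>s. h' (s, y))"
    using graph_fib[OF g] AE_fib[OF e(1)[unfolded AE_N]] AE_fib[OF e(2)[unfolded AE_N]]
    by eventually_elim (rule fib_rel_cong)
qed

text \<open>The difference of the two inner products is, up to the factor i / psi, the integral of
  the derivative of F cnj G. The boundary terms cancel because F and G each have equal limits at
  both ends.\<close>

lemma fib_rel_symm:
  assumes y: "good y" and r: "fib_rel y f h" "fib_rel y g k"
    and L: "f \<in> L2 (wfib w y)" "h \<in> L2 (wfib w y)" "g \<in> L2 (wfib w y)" "k \<in> L2 (wfib w y)"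
  shows "L2_inner (wfib w y) h g = L2_inner (wfib w y) f k"
proof -
  from r(1) obtain F c where F: "AE s in lebesgue. f s = F s" "ac_prim F (\<lambda>s. \<i> * of_real (w (s, y) / \<psi> y) * h s)"
    "(F \<longlongrightarrow> c) at_top" "(F \<longlongrightarrow> c) at_bot" by (auto simp: fib_rel_def)
  from r(2) obtain G e where G: "AE s in lebesgue. g s = G s" "ac_prim G (\<lambda>s. \<i> * of_real (w (s, y) / \<psi> y) * k s)"
    "(G \<longlongrightarrow> e) at_top" "(G \<longlongrightarrow> e) at_bot" by (auto simp: fib_rel_def)
  let ?a = "\<lambda>s. of_real (w (s, y)) * (h s * cnj (g s))" and ?b = "\<lambda>s. of_real (w (s, y)) * (f s * cnj (k s))"
  have U: "ac_prim (\<lambda>s. F s * cnj (G s)) (\<lambda>s. \<i> * of_real (w (s, y) / \<psi> y) * h s * cnj (G s) + F s * cnj (\<i> * of_real (w (s, y) / \<psi> y) * k s))"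
    by (rule ac_prim_mult[OF F(2) ac_prim_cnj[OF G(2)]])
  have "AE s in lebesgue. \<i> * of_real (w (s, y) / \<psi> y) * h s * cnj (G s) + F s * cnj (\<i> * of_real (w (s, y) / \<psi> y) * k s)
      = \<i> / of_real (\<psi> y) * (?a s - ?b s)"
    using F(1) G(1)
  proof eventually_elim
    case (elim s)
    show ?case unfolding elim using psi_pos[OF good_Rperp[OF y]] by (simp add: field_simps)
  qed
  from ac_prim_cong_AE[OF U this] have U': "ac_prim (\<lambda>s. F s * cnj (G s)) (\<lambda>s. \<i> / of_real (\<psi> y) * (?a s - ?b s))" .
  have i: "integrable lebesgue ?a" "integrable lebesgue ?b"
    using L2_wfib_integrable(1)[OF y] L by blast+
  then have "integrable lebesgue (\<lambda>s. \<i> / of_real (\<psi> y) * (?a s - ?b s))" by (intro integrable_mult_right Bochner_Integration.integrable_diff)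
  from ac_prim_limits[OF U' this] obtain c1 d1 where
    cd: "((\<lambda>s. F s * cnj (G s)) \<longlongrightarrow> c1) at_bot" "((\<lambda>s. F s * cnj (G s)) \<longlongrightarrow> d1) at_top" "(\<integral>s. \<i> / of_real (\<psi> y) * (?a s - ?b s) \<partial>lebesgue) = d1 - c1" by blast
  have t1: "((\<lambda>s. F s * cnj (G s)) \<longlongrightarrow> c * cnj e) at_bot" by (intro tendsto_intros F G)
  have t2: "((\<lambda>s. F s * cnj (G s)) \<longlongrightarrow> c * cnj e) at_top" by (intro tendsto_intros F G)
  have "c1 = d1" using tendsto_unique[OF _ cd(1) t1] tendsto_unique[OF _ cd(2) t2] by simp
  with cd(3) have "\<i> / of_real (\<psi> y) * ((\<integral>s. ?a s \<partial>lebesgue) - (\<integral>s. ?b s \<partial>lebesgue)) = 0"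
    using i by (simp add: integral_mult_right_zero del: times_divide_eq_left mult_eq_0_iff)
  then have "(\<integral>s. ?a s \<partial>lebesgue) = (\<integral>s. ?b s \<partial>lebesgue)" using psi_pos[OF good_Rperp[OF y]] by simp
  then show ?thesis using L2_wfib_integrable(2)[OF y L(2,3)] L2_wfib_integrable(2)[OF y L(1,4)] by simp
qed

lemma graph_symm:
  assumes "graph f h" "graph g k" shows "L2_inner N h g = L2_inner N f k"
proof (rule L2_inner_eqI_fib[OF graph_L2(2)[OF assms(1)] graph_L2(1)[OF assms(2)] graph_L2(1)[OF assms(1)] graph_L2(2)[OF assms(2)]])
  show "AE y in X. L2_inner (wfib w y) (\<lambda>s. h (s, y)) (\<lambda>s. g (s, y)) = L2_inner (wfib w y) (\<lambda>s. f (s, y)) (\<lambda>s. k (s, y))"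
    using AE_good graph_fib[OF assms(1)] graph_fib[OF assms(2)] L2_fib[OF graph_L2(1)[OF assms(1)]] L2_fib[OF graph_L2(2)[OF assms(1)]]
      L2_fib[OF graph_L2(1)[OF assms(2)]] L2_fib[OF graph_L2(2)[OF assms(2)]]
    by eventually_elim (rule fib_rel_symm)
qed

text \<open>A bound with one constant on almost all fibres lifts to the whole space; this is how
  every fibre estimate below becomes an operator estimate.\<close>

lemma L2I_fib_bound:
  assumes u: "u \<in> borel_measurable ZZ" and f: "f \<in> L2 N" and K: "0 \<le> K"
    and b: "AE y in X. (\<lambda>s. u (s, y)) \<in> L2 (wfib w y) \<and> L2_norm (wfib w y) (\<lambda>s. u (s, y)) \<le> K * L2_norm (wfib w y) (\<lambda>s. f (s, y))"
  shows "u \<in> L2 N" "L2_norm N u \<le> K * L2_norm N f"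
proof -
  have le: "(\<integral>\<^sup>+y. ennreal ((L2_norm (wfib w y) (\<lambda>s. u (s, y)))\<^sup>2) \<partial>X) \<le> ennreal (K\<^sup>2) * ennreal ((L2_norm N f)\<^sup>2)"
  proof -
    have "AE y in X. ennreal ((L2_norm (wfib w y) (\<lambda>s. u (s, y)))\<^sup>2) \<le> ennreal (K\<^sup>2) * (\<integral>\<^sup>+s. ennreal ((cmod (f (s, y)))\<^sup>2) \<partial>wfib w y)"
      using b L2_fib[OF f]
    proof eventually_elim
      case (elim y)
      have "(L2_norm (wfib w y) (\<lambda>s. u (s, y)))\<^sup>2 \<le> (K * L2_norm (wfib w y) (\<lambda>s. f (s, y)))\<^sup>2"
        using elim(1) by (intro power_mono) (auto simp: L2_norm_nonneg)
      then show ?case unfolding L2_norm_sq_nn[OF elim(2), symmetric] power_mult_distrib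
        by (simp add: ennreal_leI flip: ennreal_mult)
    qed
    from nn_integral_mono_AE[OF this]
    have "(\<integral>\<^sup>+y. ennreal ((L2_norm (wfib w y) (\<lambda>s. u (s, y)))\<^sup>2) \<partial>X) \<le> (\<integral>\<^sup>+y. ennreal (K\<^sup>2) * (\<integral>\<^sup>+s. ennreal ((cmod (f (s, y)))\<^sup>2) \<partial>wfib w y) \<partial>X)" .
    also have "\<dots> = ennreal (K\<^sup>2) * (\<integral>\<^sup>+y. (\<integral>\<^sup>+s. ennreal ((cmod (f (s, y)))\<^sup>2) \<partial>wfib w y) \<partial>X)"
      by (rule nn_integral_cmult[OF nn_fib_measurable[OF L2_N_measurable[OF f]]])
    also have "(\<integral>\<^sup>+y. (\<integral>\<^sup>+s. ennreal ((cmod (f (s, y)))\<^sup>2) \<partial>wfib w y) \<partial>X) = ennreal ((L2_norm N f)\<^sup>2)"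
      unfolding L2_norm_sq_nn[OF f] by (rule nn_L2_fib[OF L2_N_measurable[OF f], symmetric])
    finally show ?thesis .
  qed
  also have "\<dots> < \<infinity>" by (simp add: ennreal_mult_less_top)
  finally have fin: "(\<integral>\<^sup>+y. ennreal ((L2_norm (wfib w y) (\<lambda>s. u (s, y)))\<^sup>2) \<partial>X) < \<infinity>" .
  have "AE y in X. (\<lambda>s. u (s, y)) \<in> L2 (wfib w y)" using b by (rule eventually_mono) simp
  then show uL: "u \<in> L2 N" by (rule L2I_fib[OF u _ fin])
  have "(L2_norm N u)\<^sup>2 \<le> (K * L2_norm N f)\<^sup>2"
    using le unfolding L2_norm_fib[OF uL, symmetric] power_mult_distrib by (simp flip: ennreal_mult)
  then show "L2_norm N u \<le> K * L2_norm N f" by (rule power2_le_imp_le) (simp add: K L2_norm_nonneg)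
qed

end

section \<open>Solving the equation with H and B on the fibres\<close>

context confined_operator
begin

definition wmass :: "perp \<Rightarrow> real" where "wmass y = (\<integral>s. w (s, y) \<partial>lebesgue)"

text \<open>The mean with respect to the weight. As a constant function it is the orthogonal
  projection onto the constants, which on a fibre over S belong to the weighted space.\<close>

definition favg :: "perp \<Rightarrow> (real \<Rightarrow> complex) \<Rightarrow> complex" where
  "favg y g = (\<integral>s. of_real (w (s, y)) * g s \<partial>lebesgue) / of_real (wmass y)"

lemma wmass_pos: assumes y: "good y" and S: "y \<in> S" shows "0 < wmass y"
proof -
  have "0 \<le> wmass y" unfolding wmass_def by (rule integral_nonneg_AE[OF fib_w_nonneg[OF y]])
  moreover have "wmass y \<noteq> 0"
  proof
    assume "wmass y = 0"
    then have "AE s in lebesgue. w (s, y) = 0"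
      unfolding wmass_def using integral_nonneg_eq_0_iff_AE[OF w_S(1)[OF S] fib_w_nonneg[OF y]] by simp
    then have "AE s in (lebesgue :: real measure). False" using good_pos[OF y] by eventually_elim simp
    then have "UNIV \<in> null_sets (lebesgue :: real measure)" by (simp add: AE_iff_null_sets)
    then show False by (simp add: null_sets_def)
  qed
  ultimately show ?thesis by simp
qed

lemma wmass_less: assumes y: "good y" and S: "y \<in> S" shows "wmass y < M"
proof -
  have "wmass y \<le> (\<integral>s. \<bar>w (s, y)\<bar> \<partial>lebesgue)"
    unfolding wmass_def by (rule integral_mono[OF w_S(1)[OF S] integrable_abs[OF w_S(1)[OF S]]]) simp
  then show ?thesis using w_S(2)[OF S] by simp
qed

lemma fib_const:
  assumes y: "good y" and S: "y \<in> S"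
  shows "(\<lambda>s. c) \<in> L2 (wfib w y)" "L2_norm (wfib w y) (\<lambda>s. c) = cmod c * sqrt (wmass y)"
proof -
  have nn: "(\<integral>\<^sup>+s. ennreal ((cmod c)\<^sup>2) \<partial>wfib w y) = ennreal ((cmod c)\<^sup>2 * wmass y)"
  proof -
    have "(\<integral>\<^sup>+s. ennreal ((cmod c)\<^sup>2) \<partial>wfib w y) = (\<integral>\<^sup>+s. ennreal (w (s, y)) * ennreal ((cmod c)\<^sup>2) \<partial>lebesgue)"
      by (rule nn_integral_wfib[OF good_Rperp[OF y]]) simp
    also have "\<dots> = (\<integral>\<^sup>+s. ennreal (w (s, y)) \<partial>lebesgue) * ennreal ((cmod c)\<^sup>2)"
      using w_fib_measurable[OF good_Rperp[OF y]] by (intro nn_integral_multc) simp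
    also have "(\<integral>\<^sup>+s. ennreal (w (s, y)) \<partial>lebesgue) = ennreal (wmass y)"
      unfolding wmass_def by (rule nn_integral_eq_integral[OF w_S(1)[OF S] fib_w_nonneg[OF y]])
    finally show ?thesis using wmass_pos[OF y S] by (simp add: ennreal_mult mult.commute)
  qed
  then show L: "(\<lambda>s. c) \<in> L2 (wfib w y)" unfolding L2_iff_nn_integral by simp
  have "(L2_norm (wfib w y) (\<lambda>s. c))\<^sup>2 = (cmod c * sqrt (wmass y))\<^sup>2"
    using L2_norm_sq_nn[OF L] wmass_pos[OF y S] unfolding nn by (simp add: power_mult_distrib)
  then show "L2_norm (wfib w y) (\<lambda>s. c) = cmod c * sqrt (wmass y)"
    using wmass_pos[OF y S] by (simp add: L2_norm_nonneg power2_eq_iff_nonneg)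
qed

lemma fib_integrable:
  assumes y: "good y" and S: "y \<in> S" and f: "f \<in> L2 (wfib w y)"
  shows "integrable lebesgue (\<lambda>s. of_real (w (s, y)) * f s)"
  using L2_wfib_integrable(1)[OF y f fib_const(1)[OF y S, of 1]] by simp

lemma fib_inner_const:
  assumes y: "good y" and S: "y \<in> S" and f: "f \<in> L2 (wfib w y)"
  shows "L2_inner (wfib w y) f (\<lambda>s. c) = of_real (wmass y) * favg y f * cnj c"
    and "L2_inner (wfib w y) (\<lambda>s. c) f = c * of_real (wmass y) * cnj (favg y f)"
proof -
  have "L2_inner (wfib w y) f (\<lambda>s. c) = (\<integral>s. of_real (w (s, y)) * f s * cnj c \<partial>lebesgue)"
    unfolding L2_wfib_integrable(2)[OF y f fib_const(1)[OF y S]] by (simp only: mult.assoc)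
  also have "\<dots> = of_real (wmass y) * favg y f * cnj c"
    using wmass_pos[OF y S] fib_integrable[OF y S f] by (simp add: favg_def)
  finally show *: "L2_inner (wfib w y) f (\<lambda>s. c) = of_real (wmass y) * favg y f * cnj c" .
  show "L2_inner (wfib w y) (\<lambda>s. c) f = c * of_real (wmass y) * cnj (favg y f)"
    unfolding L2_inner_commute[of "wfib w y" "\<lambda>s. c" f] * by simp
qed

lemma fib_L1_le:
  assumes y: "good y" and S: "y \<in> S" and f: "f \<in> L2 (wfib w y)"
  shows "(\<integral>s. cmod (of_real (w (s, y)) * f s) \<partial>lebesgue) \<le> sqrt (wmass y) * L2_norm (wfib w y) f"
proof -
  let ?g = "\<lambda>s. complex_of_real (cmod (f s))"
  note g = L2_norm_of_real_cmod[OF f]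
  have "L2_inner (wfib w y) ?g (\<lambda>s. 1) = (\<integral>s. of_real (w (s, y) * cmod (f s)) \<partial>lebesgue)"
    using L2_wfib_integrable(2)[OF y g(1) fib_const(1)[OF y S, of 1]] by simp
  also have "\<dots> = of_real (\<integral>s. w (s, y) * cmod (f s) \<partial>lebesgue)" by (rule integral_complex_of_real)
  also have "(\<integral>s. w (s, y) * cmod (f s) \<partial>lebesgue) = (\<integral>s. cmod (of_real (w (s, y)) * f s) \<partial>lebesgue)"
  proof (rule integral_cong_AE)
    show "AE s in lebesgue. w (s, y) * cmod (f s) = cmod (of_real (w (s, y)) * f s)"
      using fib_w_nonneg[OF y] by (rule eventually_mono) (simp add: norm_mult)
  qed (use w_fib_measurable[OF good_Rperp[OF y]] L2_wfib_measurable[OF f] in measurable)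
  finally have e: "L2_inner (wfib w y) ?g (\<lambda>s. 1) = of_real (\<integral>s. cmod (of_real (w (s, y)) * f s) \<partial>lebesgue)" .
  have "(\<integral>s. cmod (of_real (w (s, y)) * f s) \<partial>lebesgue) \<le> cmod (L2_inner (wfib w y) ?g (\<lambda>s. 1))"
    unfolding e by simp
  also have "\<dots> \<le> L2_norm (wfib w y) ?g * L2_norm (wfib w y) (\<lambda>s. 1)"
    by (rule L2_Cauchy_Schwarz[OF g(1) fib_const(1)[OF y S]])
  finally show ?thesis unfolding g(2) fib_const(2)[OF y S] by (simp add: mult.commute)
qed

lemma favg_le:
  assumes y: "good y" and S: "y \<in> S" and f: "f \<in> L2 (wfib w y)"
  shows "cmod (favg y f) * sqrt (wmass y) \<le> L2_norm (wfib w y) f"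
proof -
  have m: "0 < wmass y" by (rule wmass_pos[OF y S])
  have "cmod (L2_inner (wfib w y) f (\<lambda>s. 1)) \<le> L2_norm (wfib w y) f * L2_norm (wfib w y) (\<lambda>s. 1)"
    by (rule L2_Cauchy_Schwarz[OF f fib_const(1)[OF y S]])
  then have "wmass y * cmod (favg y f) \<le> L2_norm (wfib w y) f * sqrt (wmass y)"
    unfolding fib_inner_const[OF y S f] fib_const(2)[OF y S] using m by (simp add: norm_mult)
  moreover have "wmass y * cmod (favg y f) = (cmod (favg y f) * sqrt (wmass y)) * sqrt (wmass y)"
    using m by simp
  ultimately have "(cmod (favg y f) * sqrt (wmass y)) * sqrt (wmass y) \<le> L2_norm (wfib w y) f * sqrt (wmass y)" by simp
  then show ?thesis by (rule mult_right_le_imp_le) (use m in simp)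
qed

lemma favg_add_const:
  assumes y: "good y" and S: "y \<in> S" and f: "f \<in> L2 (wfib w y)"
  shows "favg y (\<lambda>s. f s + c) = favg y f + c"
proof -
  have i: "integrable lebesgue (\<lambda>s. of_real (w (s, y)) * c)" by (rule fib_integrable[OF y S fib_const(1)[OF y S]])
  have "(\<integral>s. complex_of_real (w (s, y)) * c \<partial>lebesgue) = (\<integral>s. complex_of_real (w (s, y)) \<partial>lebesgue) * c"
    using fib_integrable[OF y S fib_const(1)[OF y S, of 1]] by simp
  also have "(\<integral>s. complex_of_real (w (s, y)) \<partial>lebesgue) = of_real (wmass y)"
    unfolding wmass_def by (rule integral_complex_of_real)
  finally have c: "(\<integral>s. complex_of_real (w (s, y)) * c \<partial>lebesgue) = of_real (wmass y) * c" .
  have "(\<integral>s. of_real (w (s, y)) * (f s + c) \<partial>lebesgue) = (\<integral>s. of_real (w (s, y)) * f s \<partial>lebesgue) + of_real (wmass y) * c"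
    unfolding distrib_left c[symmetric] by (rule Bochner_Integration.integral_add[OF fib_integrable[OF y S f] i])
  then show ?thesis unfolding favg_def using wmass_pos[OF y S] by (simp add: add_divide_distrib)
qed

text \<open>The equation splits into its mean, e * mean(u) = mean(f), and the rest, where w (f -
  mean(f)) is integrated. Its total integral is 0, so the primitive \<open>u0\<close> has equal
  limits at both ends; the added constant adjusts the mean, with cnj e the inverse of e. A sup bound
  on \<open>u0\<close> costs the square root of the mass and so does passing to the norm, which is
  where M / l comes from.\<close>

lemma fib_surj_S:
  assumes y: "good y" and S: "y \<in> S" and f: "f \<in> L2 (wfib w y)" and e: "cmod e = 1"
    and u0_def: "u0 = (\<lambda>s. \<i> / of_real (\<psi> y) * exp_conv 0 (\<lambda>t. of_real (w (t, y)) * (f t - favg y f)) s)"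
    and u_def: "u = (\<lambda>s. u0 s + (cnj e * favg y f - favg y u0))"
  shows "u \<in> L2 (wfib w y)" "L2_norm (wfib w y) u \<le> (1 + 4 * M / l) * L2_norm (wfib w y) f"
    "e * favg y u = favg y f" "fib_rel y u (\<lambda>s. f s - favg y f)"
proof -
  note m = wmass_pos[OF y S] wmass_less[OF y S] psi_gt[OF good_Rperp[OF y]] l_pos
  let ?n = "L2_norm (wfib w y) f"
  let ?g = "\<lambda>t. f t - favg y f" and ?F = "\<lambda>t. of_real (w (t, y)) * (f t - favg y f)"
  have g: "?g \<in> L2 (wfib w y)" by (rule L2_diff[OF f fib_const(1)[OF y S]])
  have gn: "L2_norm (wfib w y) ?g \<le> 2 * ?n"
  proof -
    have "L2_norm (wfib w y) ?g \<le> ?n + L2_norm (wfib w y) (\<lambda>s. - favg y f)"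
      using L2_norm_triangle[OF f fib_const(1)[OF y S, of "- favg y f"]] by simp
    then show ?thesis using favg_le[OF y S f] by (simp add: fib_const(2)[OF y S])
  qed
  have Fi: "integrable lebesgue ?F" by (rule fib_integrable[OF y S g])
  have "favg y (\<lambda>t. f t + - favg y f) = 0" unfolding favg_add_const[OF y S f] by simp
  then have F0: "(\<integral>t. ?F t \<partial>lebesgue) = 0" using m(1) by (simp add: favg_def)
  note V = exp_conv_0_ac_prim[OF Fi F0]
  have u0p: "ac_prim u0 (\<lambda>s. \<i> / of_real (\<psi> y) * ?F s)" unfolding u0_def by (rule ac_prim_scale[OF V(1)])
  have u0b: "cmod (u0 s) \<le> sqrt (wmass y) * (2 * ?n) / \<psi> y" for s
  proof -
    have "cmod (exp_conv 0 ?F s) \<le> sqrt (wmass y) * L2_norm (wfib w y) ?g"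
      using norm_exp_conv_0_le[OF Fi, of s] fib_L1_le[OF y S g] by simp
    also have "\<dots> \<le> sqrt (wmass y) * (2 * ?n)" using gn m by (intro mult_left_mono) auto
    finally show ?thesis using m by (simp add: u0_def norm_mult norm_divide divide_right_mono)
  qed
  have u0m: "u0 \<in> borel_measurable lebesgue"
    by (rule ac_prim_fun_measurable[OF u0p])
  have u0L: "u0 \<in> L2 (wfib w y)" and u0n: "L2_norm (wfib w y) u0 \<le> 2 * M / l * ?n"
  proof -
    define K where "K = sqrt (wmass y) * (2 * ?n) / \<psi> y"
    have K: "0 \<le> K" unfolding K_def using m by (simp add: L2_norm_nonneg)
    have b: "AE s in wfib w y. cmod (u0 s) \<le> K" unfolding K_def using u0b by simp
    have m0: "u0 \<in> borel_measurable (wfib w y)" using u0m by (simp add: measurable_wfib)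
    from L2_mult_bounded[OF fib_const(1)[OF y S, of 1] m0 b] show "u0 \<in> L2 (wfib w y)" by simp
    from L2_norm_mult_bounded[OF fib_const(1)[OF y S, of 1] m0 b K]
    have "L2_norm (wfib w y) u0 \<le> K * sqrt (wmass y)" using K by (simp add: fib_const(2)[OF y S])
    also have "\<dots> = wmass y / \<psi> y * (2 * ?n)" unfolding K_def using m by simp
    also have "\<dots> \<le> M / l * (2 * ?n)" using m by (intro mult_right_mono frac_le) (auto simp: L2_norm_nonneg)
    finally show "L2_norm (wfib w y) u0 \<le> 2 * M / l * ?n" by (simp add: mult_ac)
  qed
  have c: "(\<lambda>s. cnj e * favg y f - favg y u0) \<in> L2 (wfib w y)" by (rule fib_const(1)[OF y S])
  show "u \<in> L2 (wfib w y)" unfolding u_def by (rule L2_add[OF u0L c])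
  have "cmod (cnj e * favg y f - favg y u0) * sqrt (wmass y) \<le> (cmod (favg y f) + cmod (favg y u0)) * sqrt (wmass y)"
    using norm_triangle_ineq4[of "cnj e * favg y f" "favg y u0"] e m by (intro mult_right_mono) (auto simp: norm_mult)
  also have "\<dots> \<le> ?n + L2_norm (wfib w y) u0" using favg_le[OF y S f] favg_le[OF y S u0L] by (simp add: distrib_right)
  finally have "L2_norm (wfib w y) (\<lambda>s. cnj e * favg y f - favg y u0) \<le> ?n + L2_norm (wfib w y) u0" by (simp add: fib_const(2)[OF y S])
  then have "L2_norm (wfib w y) u \<le> ?n + 2 * L2_norm (wfib w y) u0"
    unfolding u_def using L2_norm_triangle[OF u0L c] by simp
  also have "\<dots> \<le> ?n + 2 * (2 * M / l * ?n)" using u0n by simp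
  also have "\<dots> = (1 + 4 * M / l) * ?n" by (simp add: algebra_simps)
  finally show "L2_norm (wfib w y) u \<le> (1 + 4 * M / l) * ?n" .
  have "e * cnj e = 1" using e by (simp add: complex_norm_square[symmetric])
  then show "e * favg y u = favg y f" unfolding u_def favg_add_const[OF y S u0L] by (simp add: mult.assoc[symmetric])
  show "fib_rel y u ?g"
  proof (rule fib_relI)
    show "AE s in lebesgue. u s = u s" by simp
    have "ac_prim u (\<lambda>s. \<i> / of_real (\<psi> y) * ?F s)"
      using ac_prim_lin[OF u0p ac_prim_const, of 1] unfolding u_def by simp
    then show "ac_prim u (\<lambda>s. \<i> * of_real (w (s, y) / \<psi> y) * ?g s)" by (simp add: mult_ac)
    have "(u \<longlongrightarrow> \<i> / of_real (\<psi> y) * 0 + (cnj e * favg y f - favg y u0)) at_top"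
      "(u \<longlongrightarrow> \<i> / of_real (\<psi> y) * 0 + (cnj e * favg y f - favg y u0)) at_bot"
      unfolding u_def u0_def by (intro tendsto_intros V)+
    then show "(u \<longlongrightarrow> \<i> / of_real (\<psi> y) * 0 + (cnj e * favg y f - favg y u0)) at_top"
      "(u \<longlongrightarrow> \<i> / of_real (\<psi> y) * 0 + (cnj e * favg y f - favg y u0)) at_bot" .
  qed
qed

lemma wfib_outside: "y \<in> Rperp d - S \<Longrightarrow> wfib w y = lebesgue"
  unfolding wfib_def by (simp add: w_one density_1 one_ennreal_def[symmetric])

text \<open>Here the weight is 1 and the equation is -i psi u' = f + i c u. The convolution has rate
  1 / psi and norm at most psi, which cancels the prefactor 1 / psi, so the bound is uniform in the
  fibre.\<close>

lemma fib_surj_outside: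
  assumes y: "y \<in> Rperp d - S" and f: "f \<in> L2 (wfib w y)" and c: "c = 1 \<or> c = (-1::real)"
    and u_def: "u = (\<lambda>s. \<i> * of_real (c / \<psi> y) * exp_conv (1 / \<psi> y) (\<lambda>t. f (c * t)) (c * s))"
  shows "u \<in> L2 (wfib w y)" "L2_norm (wfib w y) u \<le> L2_norm (wfib w y) f"
    "fib_rel y u (\<lambda>s. f s + \<i> * of_real c * u s)"
proof -
  have psi: "0 < \<psi> y" using y psi_pos by blast
  then have a: "0 < 1 / \<psi> y" by simp
  have f': "f \<in> L2 lebesgue" using f wfib_outside[OF y] by simp
  note fc = L2_sign[OF c f']
  let ?v = "exp_conv (1 / \<psi> y) (\<lambda>t. f (c * t))"
  note v = exp_conv_L2[OF a fc(1)]
  note vc = L2_sign[OF c v(1)]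
  have "u \<in> L2 lebesgue" unfolding u_def by (rule L2_scale[OF vc(1)])
  then show "u \<in> L2 (wfib w y)" using wfib_outside[OF y] by simp
  have "L2_norm lebesgue u = 1 / \<psi> y * L2_norm lebesgue ?v"
    unfolding u_def L2_norm_scale vc(2) using c psi by (auto simp: norm_mult norm_divide)
  also have "\<dots> \<le> 1 / \<psi> y * (1 / (1 / \<psi> y) * L2_norm lebesgue f)"
    using v(2) psi unfolding fc(2) by (intro mult_left_mono) auto
  finally show "L2_norm (wfib w y) u \<le> L2_norm (wfib w y) f" using psi unfolding wfib_outside[OF y] by simp
  have "ac_prim (\<lambda>s. ?v (c * s)) (\<lambda>s. of_real c * (f (c * (c * s)) - of_real (1 / \<psi> y) * ?v (c * s)))"
    by (rule ac_prim_sign[OF c exp_conv_ac_prim[OF a fc(1)]])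
  from ac_prim_scale[OF this, of "\<i> * of_real (c / \<psi> y)"]
  have "ac_prim u (\<lambda>s. \<i> * of_real (c / \<psi> y) * (of_real c * (f (c * (c * s)) - of_real (1 / \<psi> y) * ?v (c * s))))"
    unfolding u_def .
  moreover have "\<i> * of_real (c / \<psi> y) * (of_real c * (f (c * (c * s)) - of_real (1 / \<psi> y) * ?v (c * s)))
     = \<i> * of_real (w (s, y) / \<psi> y) * (f s + \<i> * of_real c * u s)" for s
  proof -
    have cc: "c * (c * s) = s" using c by auto
    show ?thesis unfolding cc w_one[OF y] u_def using c psi by (auto simp: field_simps)
  qed
  ultimately have P: "ac_prim u (\<lambda>s. \<i> * of_real (w (s, y) / \<psi> y) * (f s + \<i> * of_real c * u s))" by (simp only:)
  note lim = tendsto_sign[OF c exp_conv_limits[OF a fc(1)]]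
  have "(u \<longlongrightarrow> \<i> * of_real (c / \<psi> y) * 0) at_top" "(u \<longlongrightarrow> \<i> * of_real (c / \<psi> y) * 0) at_bot"
    unfolding u_def by (intro tendsto_intros lim)+
  then show "fib_rel y u (\<lambda>s. f s + \<i> * of_real c * u s)" by (intro fib_relI[OF _ P]) auto
qed

text \<open>The fibrewise solutions must be glued to one measurable function. The integral is formed
  from a Borel representative of f; on almost every fibre this changes the integrand on a null set
  only, so equality holds for every s there.\<close>

lemma exp_conv_jointly_measurable:
  assumes f: "f \<in> borel_measurable ZZ" and a: "a \<in> borel_measurable (\<Pi>\<^sub>M i\<in>{2..d}. (lborel :: real measure))"
    and c: "c = 1 \<or> c = (-1::real)"
  obtains J where "J \<in> borel_measurable ZZ" "AE y in X. \<forall>s. J (s, y) = exp_conv (a y) (\<lambda>t. f (c * t, y)) (c * s)"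
proof -
  let ?Q = "\<Pi>\<^sub>M i\<in>{2..d}. (lborel :: real measure)"
  obtain g :: "point \<Rightarrow> complex" where g: "g \<in> borel_measurable ((lborel :: real measure) \<Otimes>\<^sub>M ?Q)" and "AE p in ZZ. f p = g p"
    and fg: "AE y in X. AE s in lebesgue. f (s, y) = g (s, y)"
    by (rule ex_borel_fib[OF f])
  define k where "k p t = complex_of_real (if t \<le> c * fst p then exp (- (a (snd p) * (c * fst p - t))) else 0) * g (c * t, snd p)" for p t
  have k_eq: "complex_of_real (indicator {..c * s} t * exp (- (a y * (c * s - t)))) * g (c * t, y) = k (s, y) t" for s t y
    by (simp add: k_def indicator_def)
  have km: "(\<lambda>(p, t). k p t) \<in> borel_measurable (((lborel :: real measure) \<Otimes>\<^sub>M ?Q) \<Otimes>\<^sub>M (lborel :: real measure))"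
  proof -
    have m1: "(\<lambda>q. (c * snd q, snd (fst q))) \<in> (((lborel :: real measure) \<Otimes>\<^sub>M ?Q) \<Otimes>\<^sub>M (lborel :: real measure)) \<rightarrow>\<^sub>M (lborel :: real measure) \<Otimes>\<^sub>M ?Q"
      by measurable
    have [measurable]: "(\<lambda>q. g (c * snd q, snd (fst q))) \<in> borel_measurable (((lborel :: real measure) \<Otimes>\<^sub>M ?Q) \<Otimes>\<^sub>M (lborel :: real measure))"
      by (rule measurable_compose[OF m1 g])
    have [measurable]: "(\<lambda>q. a (snd (fst q))) \<in> borel_measurable (((lborel :: real measure) \<Otimes>\<^sub>M ?Q) \<Otimes>\<^sub>M (lborel :: real measure))"
      by (rule measurable_compose[OF measurable_compose[OF measurable_fst measurable_snd] a])
    have "(\<lambda>q. complex_of_real (if snd q \<le> c * fst (fst q) then exp (- (a (snd (fst q)) * (c * fst (fst q) - snd q))) else 0) * g (c * snd q, snd (fst q)))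
      \<in> borel_measurable (((lborel :: real measure) \<Otimes>\<^sub>M ?Q) \<Otimes>\<^sub>M (lborel :: real measure))"
      by measurable
    then show ?thesis unfolding k_def case_prod_beta .
  qed
  define J where "J p = (\<integral>t. k p t \<partial>lborel)" for p
  have "J \<in> borel_measurable ((lborel :: real measure) \<Otimes>\<^sub>M ?Q)" unfolding J_def[abs_def]
    by (rule lborel.borel_measurable_lebesgue_integral[OF km])
  then have Jm: "J \<in> borel_measurable ZZ" unfolding leb_full_def by (rule measurable_completion)
  have "AE y in X. \<forall>s. J (s, y) = exp_conv (a y) (\<lambda>t. f (c * t, y)) (c * s)"
    using fg measurable_fib[OF f] AE_Rperp
  proof eventually_elim
    case (elim y)
    show ?case
    proof
      fix s
      have y: "y \<in> space ?Q" using elim(3) by (simp add: Rperp_def space_PiM)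
      have km1: "k (s, y) \<in> borel_measurable lborel"
        using measurable_compose[OF measurable_Pair1' km, of "(s, y)"] y by (simp add: space_pair_measure)
      have e: "AE t in lebesgue. k (s, y) t = complex_of_real (indicator {..c * s} t * exp (- (a y * (c * s - t)))) * f (c * t, y)"
        using AE_lebesgue_sign[OF c elim(1)] by (rule eventually_mono) (simp add: k_eq[symmetric])
      have m: "k (s, y) \<in> borel_measurable lebesgue" by (rule measurable_completion[OF km1])
      have m2: "(\<lambda>t. complex_of_real (indicator {..c * s} t * exp (- (a y * (c * s - t)))) * f (c * t, y)) \<in> borel_measurable lebesgue"
        using m e by (rule borel_measurable_completion_cong_AE)
      have "J (s, y) = (\<integral>t. k (s, y) t \<partial>lebesgue)" unfolding J_def using km1 by (simp add: integral_completion)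
      also have "\<dots> = exp_conv (a y) (\<lambda>t. f (c * t, y)) (c * s)"
        unfolding exp_conv_def by (rule integral_cong_AE[OF m m2 e])
      finally show "J (s, y) = exp_conv (a y) (\<lambda>t. f (c * t, y)) (c * s)" .
    qed
  qed
  with Jm show ?thesis by (rule that)
qed

definition Bop :: "(point \<Rightarrow> complex) \<Rightarrow> point \<Rightarrow> complex" where
  "Bop f p = (if snd p \<in> S then favg (snd p) (\<lambda>s. f (s, snd p)) else f p)"

lemma Bop_fib:
  "y \<in> S \<Longrightarrow> (\<lambda>s. Bop f (s, y)) = (\<lambda>s. favg y (\<lambda>s. f (s, y)))"
  "y \<notin> S \<Longrightarrow> (\<lambda>s. Bop f (s, y)) = (\<lambda>s. f (s, y))"
  by (simp_all add: Bop_def)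

lemma favg_measurable: assumes f: "f \<in> borel_measurable ZZ" shows "(\<lambda>y. favg y (\<lambda>s. f (s, y))) \<in> borel_measurable X"
proof -
  have wm: "(\<lambda>p. complex_of_real (w p)) \<in> borel_measurable ZZ" by (rule measurable_compose[OF w_measurable borel_measurable_of_real])
  have "(\<lambda>y. (\<integral>s. complex_of_real (w (s, y)) * f (s, y) \<partial>lebesgue) / (\<integral>s. complex_of_real (w (s, y)) \<partial>lebesgue)) \<in> borel_measurable X"
    by (intro borel_measurable_divide measurable_fib_integral borel_measurable_times wm f)
  then show ?thesis by (simp add: favg_def wmass_def)
qed

lemma measurable_if_S:
  fixes f g :: "point \<Rightarrow> complex"
  assumes "f \<in> borel_measurable ZZ" "g \<in> borel_measurable ZZ"
  shows "(\<lambda>p. if snd p \<in> S then f p else g p) \<in> borel_measurable ZZ"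
proof (rule measurable_If[OF assms])
  have "snd -` S \<inter> space ZZ \<in> sets ZZ" by (rule measurable_sets[OF measurable_snd_full S_sets])
  then show "{p \<in> space ZZ. snd p \<in> S} \<in> sets ZZ" by (simp add: vimage_def Int_def conj_commute)
qed

lemma Bop_L2: assumes f: "f \<in> L2 N" shows "Bop f \<in> L2 N"
proof (rule L2I_fib_bound(1)[OF _ f, of _ 1])
  show "Bop f \<in> borel_measurable ZZ" unfolding Bop_def[abs_def]
    by (intro measurable_if_S L2_N_measurable[OF f] measurable_compose[OF measurable_snd_full favg_measurable])
  show "AE y in X. (\<lambda>s. Bop f (s, y)) \<in> L2 (wfib w y) \<and> L2_norm (wfib w y) (\<lambda>s. Bop f (s, y)) \<le> 1 * L2_norm (wfib w y) (\<lambda>s. f (s, y))"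
    using AE_good L2_fib[OF f]
  proof eventually_elim
    case (elim y)
    show ?case
    proof (cases "y \<in> S")
      case True
      show ?thesis unfolding Bop_fib(1)[OF True] using fib_const[OF elim(1) True] favg_le[OF elim(1) True elim(2)] by simp
    next
      case False
      show ?thesis unfolding Bop_fib(2)[OF False] using elim by simp
    qed
  qed
qed simp

lemma Bop_symm:
  assumes f: "f \<in> L2 N" and g: "g \<in> L2 N"
  shows "L2_inner N (Bop f) g = L2_inner N f (Bop g)"
proof (rule L2_inner_eqI_fib[OF Bop_L2[OF f] g f Bop_L2[OF g]], use AE_good L2_fib[OF f] L2_fib[OF g] in eventually_elim)
    case (elim y)
    then show ?case by (cases "y \<in> S") (simp_all add: Bop_fib fib_inner_const mult_ac)
qed

lemma Bop_idem: assumes f: "f \<in> L2 N" shows "L2_inner N (Bop f) (Bop f) = L2_inner N (Bop f) f"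
  proof (rule L2_inner_eqI_fib[OF Bop_L2[OF f] Bop_L2[OF f] Bop_L2[OF f] f], use AE_good L2_fib[OF f] in eventually_elim)
    case (elim y)
    then show ?case
    proof (cases "y \<in> S")
      case True
      have "favg y (\<lambda>s. favg y (\<lambda>s. f (s, y))) = favg y (\<lambda>s. f (s, y))"
        using favg_add_const[OF elim(1) True fib_const(1)[OF elim(1) True, of 0], of "favg y (\<lambda>s. f (s, y))"] by (simp add: favg_def)
      then show ?thesis using True elim by (simp add: Bop_fib fib_inner_const fib_const)
    qed (simp add: Bop_fib)
qed

lemma graph_surj:
  assumes f: "f \<in> L2 N" and e: "e = \<i> \<or> e = - \<i>"
  shows "\<exists>u h. graph u h \<and> (AE p in N. h p + e * Bop u p = f p)"
proof -
  \<comment> \<open>The sign is fixed by e = -i c, so that off S the required h = f - e u is f + i c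
    u, the form treated by \<open>fib_surj_outside\<close>.\<close>
  define c :: real where "c = (if e = \<i> then -1 else 1)"
  have c: "c = 1 \<or> c = (-1::real)" by (simp add: c_def)
  have ec: "e = - \<i> * of_real c" using e by (auto simp: c_def complex_eq_iff)
  have e1: "cmod e = 1" using e by auto
  note fm = L2_N_measurable[OF f]
  define A where "A y = favg y (\<lambda>s. f (s, y))" for y
  have Am: "A \<in> borel_measurable X" unfolding A_def[abs_def] by (rule favg_measurable[OF fm])
  define F where "F p = of_real (w p) * (f p - A (snd p))" for p
  have Fm: "F \<in> borel_measurable ZZ" unfolding F_def[abs_def]
    by (intro borel_measurable_times borel_measurable_diff fm measurable_compose[OF measurable_snd_full Am] measurable_compose[OF w_measurable borel_measurable_of_real])
  have psi_m: "(\<lambda>p. complex_of_real (\<psi> (snd p))) \<in> borel_measurable ZZ" by (rule measurable_compose[OF psi_measurable_full borel_measurable_of_real])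
  obtain J1 where J1: "J1 \<in> borel_measurable ZZ" "AE y in X. \<forall>s. J1 (s, y) = exp_conv 0 (\<lambda>t. F (1 * t, y)) (1 * s)"
    by (rule exp_conv_jointly_measurable[OF Fm, of "\<lambda>_. 0" 1]) auto
  have am: "(\<lambda>y. 1 / \<psi> y) \<in> borel_measurable (\<Pi>\<^sub>M i\<in>{2..d}. (lborel :: real measure))"
    using psi_measurable_Q by (intro borel_measurable_divide) simp_all
  obtain J2 where J2: "J2 \<in> borel_measurable ZZ" "AE y in X. \<forall>s. J2 (s, y) = exp_conv (1 / \<psi> y) (\<lambda>t. f (c * t, y)) (c * s)"
    by (rule exp_conv_jointly_measurable[OF fm am c])
  define U0 where "U0 p = \<i> / of_real (\<psi> (snd p)) * J1 p" for p
  have U0m: "U0 \<in> borel_measurable ZZ" unfolding U0_def[abs_def]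
    by (intro borel_measurable_times borel_measurable_divide psi_m J1(1) borel_measurable_const)
  define A0 where "A0 y = favg y (\<lambda>s. U0 (s, y))" for y
  have A0m: "A0 \<in> borel_measurable X" unfolding A0_def[abs_def] by (rule favg_measurable[OF U0m])
  define u where "u p = (if snd p \<in> S then U0 p + (cnj e * A (snd p) - A0 (snd p)) else \<i> * of_real c / of_real (\<psi> (snd p)) * J2 p)" for p
  have um: "u \<in> borel_measurable ZZ" unfolding u_def[abs_def]
    by (intro measurable_if_S borel_measurable_add borel_measurable_diff borel_measurable_times borel_measurable_divide U0m psi_m J2(1)
        borel_measurable_const measurable_compose[OF measurable_snd_full Am] measurable_compose[OF measurable_snd_full A0m])
  define K where "K = 1 + 4 * M / l"
  have K: "1 \<le> K" using M_pos l_pos by (simp add: K_def)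
  have key: "AE y in X. (\<lambda>s. u (s, y)) \<in> L2 (wfib w y) \<and> L2_norm (wfib w y) (\<lambda>s. u (s, y)) \<le> K * L2_norm (wfib w y) (\<lambda>s. f (s, y))
      \<and> fib_rel y (\<lambda>s. u (s, y)) (\<lambda>s. f (s, y) - e * Bop u (s, y))"
    using AE_good L2_fib[OF f] J1(2) J2(2)
  proof eventually_elim
    case (elim y)
    show ?case
    proof (cases "y \<in> S")
      case True
      have U: "(\<lambda>s. U0 (s, y)) = (\<lambda>s. \<i> / of_real (\<psi> y) * exp_conv 0 (\<lambda>t. of_real (w (t, y)) * (f (t, y) - favg y (\<lambda>s. f (s, y)))) s)"
        using elim(3) by (simp add: U0_def F_def A_def)
      have u: "(\<lambda>s. u (s, y)) = (\<lambda>s. U0 (s, y) + (cnj e * favg y (\<lambda>s. f (s, y)) - favg y (\<lambda>s. U0 (s, y))))"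
        using True by (simp add: u_def A_def A0_def)
      note r = fib_surj_S[OF elim(1) True elim(2) e1 U u]
      have "(\<lambda>s. f (s, y) - e * Bop u (s, y)) = (\<lambda>s. f (s, y) - favg y (\<lambda>s. f (s, y)))"
        using True r(3) by (simp add: Bop_def)
      then show ?thesis using r by (simp add: K_def)
    next
      case False
      then have y: "y \<in> Rperp d - S" using good_Rperp[OF elim(1)] by simp
      have u: "(\<lambda>s. u (s, y)) = (\<lambda>s. \<i> * of_real (c / \<psi> y) * exp_conv (1 / \<psi> y) (\<lambda>t. f (c * t, y)) (c * s))"
        using False elim(4) by (simp add: u_def)
      note r = fib_surj_outside[OF y elim(2) c u]
      have "(\<lambda>s. f (s, y) - e * Bop u (s, y)) = (\<lambda>s. f (s, y) + \<i> * of_real c * u (s, y))"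
        using False by (simp add: Bop_def ec)
      moreover have "1 * L2_norm (wfib w y) (\<lambda>s. f (s, y)) \<le> K * L2_norm (wfib w y) (\<lambda>s. f (s, y))"
        by (rule mult_right_mono[OF K L2_norm_nonneg])
      ultimately show ?thesis using r by simp
    qed
  qed
  have "AE y in X. (\<lambda>s. u (s, y)) \<in> L2 (wfib w y) \<and> L2_norm (wfib w y) (\<lambda>s. u (s, y)) \<le> K * L2_norm (wfib w y) (\<lambda>s. f (s, y))"
    using key by (rule eventually_mono) simp
  from L2I_fib_bound(1)[OF um f _ this] have uL: "u \<in> L2 N" using K by simp
  have "graph u (\<lambda>p. f p - e * Bop u p)" unfolding graph_def
  proof (intro conjI uL L2_diff f L2_scale Bop_L2)
    show "AE y in X. fib_rel y (\<lambda>s. u (s, y)) (\<lambda>s. f (s, y) - e * Bop u (s, y))"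
      using key by (rule eventually_mono) simp
  qed
  moreover have "AE p in N. (f p - e * Bop u p) + e * Bop u p = f p" by simp
  ultimately show ?thesis by blast
qed

lemma self_adjoint_H: "self_adjoint N (D_symm d \<psi> w) (H_op d \<psi> w)"
proof (rule self_adjoint_criterion[where Gr=graph and B=Bop])
  fix f h assume "graph f h"
  then show "f \<in> L2 N \<and> h \<in> L2 N" by (simp add: graph_def)
next
  fix f e assume "f \<in> L2 N" "e \<in> {\<i>, - \<i>}"
  then show "\<exists>u h. graph u h \<and> (AE x in N. h x + e * Bop u x = f x)" by (intro graph_surj) auto
next
  fix f h assume "graph f h"
  from graph_imp_D_symm[OF this] show "f \<in> D_symm d \<psi> w \<and> (AE x in N. h x = H_op d \<psi> w f x)" ..
qed (fact graph_lin graph_cong graph_symm Bop_L2 Bop_symm Bop_idem D_symm_imp_graph)+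

end

section \<open>Resolvent estimates on the fibres\<close>

lemma L2_norm_mult_integral:
  assumes f: "f \<in> L2 N" and g: "g \<in> L2 N"
  shows "integrable N (\<lambda>x. cmod (f x) * cmod (g x))" "(\<integral>x. cmod (f x) * cmod (g x) \<partial>N) \<le> L2_norm N f * L2_norm N g"
proof -
  note f' = L2_norm_of_real_cmod[OF f] and g' = L2_norm_of_real_cmod[OF g]
  have "integrable N (\<lambda>x. complex_of_real (cmod (f x) * cmod (g x)))"
    using integrable_L2_inner[OF f'(1) g'(1)] by simp
  from integrable_Re[OF this] show "integrable N (\<lambda>x. cmod (f x) * cmod (g x))" by simp
  have "L2_inner N (\<lambda>x. complex_of_real (cmod (f x))) (\<lambda>x. complex_of_real (cmod (g x))) = (\<integral>x. complex_of_real (cmod (f x) * cmod (g x)) \<partial>N)"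
    unfolding L2_inner_def by simp
  also have "\<dots> = of_real (\<integral>x. cmod (f x) * cmod (g x) \<partial>N)" by (rule integral_complex_of_real)
  finally have "cmod (complex_of_real (\<integral>x. cmod (f x) * cmod (g x) \<partial>N)) \<le> L2_norm N f * L2_norm N g"
    using L2_Cauchy_Schwarz[OF f'(1) g'(1)] unfolding f'(2) g'(2) by simp
  then show "(\<integral>x. cmod (f x) * cmod (g x) \<partial>N) \<le> L2_norm N f * L2_norm N g" by simp
qed

lemma ac_prim_dist_limit_le:
  assumes G: "ac_prim G k" and k: "integrable lebesgue k" and lim: "(G \<longlongrightarrow> c) at_bot"
  shows "cmod (G s - c) \<le> (\<integral>s. cmod (k s) \<partial>lebesgue)"
proof -
  have le: "cmod (G s - G a) \<le> (\<integral>s. cmod (k s) \<partial>lebesgue)" if "a \<le> s" for a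
  proof -
    have i: "integrable lebesgue (\<lambda>t. indicator {a..s} t *\<^sub>R k t)" by (rule integrable_mult_indicator[OF _ k]) simp
    have "cmod (G s - G a) \<le> (\<integral>t. cmod (indicator {a..s} t *\<^sub>R k t) \<partial>lebesgue)"
      unfolding ac_prim_eq[OF G that] set_lebesgue_integral_def by (rule integral_norm_bound)
    also have "\<dots> \<le> (\<integral>t. cmod (k t) \<partial>lebesgue)"
      by (rule integral_mono[OF integrable_norm[OF i] integrable_norm[OF k]]) (simp add: indicator_def)
    finally show ?thesis .
  qed
  have "((\<lambda>a. cmod (G s - G a)) \<longlongrightarrow> cmod (G s - c)) at_bot" by (intro tendsto_intros lim)
  moreover have "\<forall>\<^sub>F a in at_bot. cmod (G s - G a) \<le> (\<integral>s. cmod (k s) \<partial>lebesgue)"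
    using eventually_le_at_bot[of s] by (rule eventually_mono) (rule le)
  ultimately show ?thesis by (rule tendsto_upperbound) simp
qed

text \<open>The factor relating the sup norm on a fibre to the norm with weight (1 +
  s^2)^(-sigma).\<close>

definition decay_const :: "real \<Rightarrow> real" where
  "decay_const \<sigma> = enn2real (\<integral>\<^sup>+s. ennreal ((1 + s\<^sup>2) powr (- \<sigma>)) \<partial>lebesgue)"

lemma decay_const: "\<sigma> > 1/2 \<Longrightarrow> ennreal (decay_const \<sigma>) = (\<integral>\<^sup>+s. ennreal ((1 + s\<^sup>2) powr (- \<sigma>)) \<partial>lebesgue)"
  and decay_const_nonneg: "0 \<le> decay_const \<sigma>"
  unfolding decay_const_def using nn_integral_one_plus_square_powr[of \<sigma>] by simp_all

section \<open>Fibre estimates over S and off S\<close>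

context confined_operator
begin

lemma favg_lin:
  assumes y: "good y" and S: "y \<in> S" and f: "f \<in> L2 (wfib w y)" and g: "g \<in> L2 (wfib w y)"
  shows "favg y (\<lambda>s. a * f s + g s) = a * favg y f + favg y g"
proof -
  have e: "of_real (w (s, y)) * (a * f s + g s) = a * (of_real (w (s, y)) * f s) + of_real (w (s, y)) * g s" for s
    by (simp add: algebra_simps)
  have "(\<integral>s. of_real (w (s, y)) * (a * f s + g s) \<partial>lebesgue) = a * (\<integral>s. of_real (w (s, y)) * f s \<partial>lebesgue) + (\<integral>s. of_real (w (s, y)) * g s \<partial>lebesgue)"
    unfolding e integral_mult_right_zero[symmetric]
    by (rule Bochner_Integration.integral_add[OF integrable_mult_right[OF fib_integrable[OF y S f]] fib_integrable[OF y S g]])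
  then show ?thesis by (simp add: favg_def add_divide_distrib)
qed

lemma favg_cong:
  assumes y: "good y" and f: "f \<in> L2 (wfib w y)" and g: "g \<in> L2 (wfib w y)" and e: "AE s in lebesgue. f s = g s"
  shows "favg y f = favg y g"
proof -
  have wm: "(\<lambda>s. complex_of_real (w (s, y))) \<in> borel_measurable lebesgue"
    by (rule measurable_compose[OF w_fib_measurable[OF good_Rperp[OF y]] borel_measurable_of_real])
  have "(\<integral>s. of_real (w (s, y)) * f s \<partial>lebesgue) = (\<integral>s. of_real (w (s, y)) * g s \<partial>lebesgue)"
  proof (rule integral_cong_AE)
    show "AE s in lebesgue. of_real (w (s, y)) * f s = of_real (w (s, y)) * g s" using e by eventually_elim simp
  qed (intro borel_measurable_times wm L2_wfib_measurable[OF f] L2_wfib_measurable[OF g])+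
  then show ?thesis by (simp add: favg_def)
qed

text \<open>Equal limits at both ends force h to have mean 0. Write v = V + c with c the common
  limit: V is bounded by (M / l) ||h||. The constant c is controlled by taking means in h = t v + q
  with q = h - t v, which expresses c through the means of V and of q / t.\<close>

lemma fib_resolvent_le_S:
  assumes y: "good y" and S: "y \<in> S" and t: "t \<noteq> 0" "4 * M * \<bar>t\<bar> \<le> l"
    and r: "fib_rel y v h" and v: "v \<in> L2 (wfib w y)" and h: "h \<in> L2 (wfib w y)"
  shows "L2_norm (wfib w y) v \<le> 3 / \<bar>t\<bar> * L2_norm (wfib w y) (\<lambda>s. h s - of_real t * v s)"
proof -
  let ?n = "L2_norm (wfib w y)"
  define q where "q s = h s - of_real t * v s" for s
  have q: "q \<in> L2 (wfib w y)" unfolding q_def[abs_def] by (intro L2_diff L2_scale v h)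
  note m = wmass_pos[OF y S] wmass_less[OF y S] psi_gt[OF good_Rperp[OF y]] l_pos
  from r obtain G c where G: "AE s in lebesgue. v s = G s" "ac_prim G (\<lambda>s. \<i> * of_real (w (s, y) / \<psi> y) * h s)"
    "(G \<longlongrightarrow> c) at_top" "(G \<longlongrightarrow> c) at_bot" by (auto simp: fib_rel_def)
  have ke: "(\<lambda>s. \<i> * of_real (w (s, y) / \<psi> y) * h s) = (\<lambda>s. \<i> / of_real (\<psi> y) * (of_real (w (s, y)) * h s))"
    by (simp add: fun_eq_iff)
  have P: "ac_prim G (\<lambda>s. \<i> / of_real (\<psi> y) * (of_real (w (s, y)) * h s))" using G(2) unfolding ke .
  have ki: "integrable lebesgue (\<lambda>s. \<i> / of_real (\<psi> y) * (of_real (w (s, y)) * h s))"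
    by (rule integrable_mult_right[OF fib_integrable[OF y S h]])
  obtain c1 d1 where cd: "(G \<longlongrightarrow> c1) at_bot" "(G \<longlongrightarrow> d1) at_top" "(\<integral>s. \<i> / of_real (\<psi> y) * (of_real (w (s, y)) * h s) \<partial>lebesgue) = d1 - c1"
    by (rule ac_prim_limits[OF P ki])
  have "c1 = c" "d1 = c" using tendsto_unique[OF _ cd(1) G(4)] tendsto_unique[OF _ cd(2) G(3)] by simp_all
  then have "\<i> / of_real (\<psi> y) * (\<integral>s. of_real (w (s, y)) * h s \<partial>lebesgue) = 0" using cd(3) unfolding integral_mult_right_zero by simp
  then have h0: "favg y h = 0" using m by (simp add: favg_def)
  define V where "V s = G s - c" for s
  define K where "K = sqrt (wmass y) * ?n h / \<psi> y"
  have K0: "0 \<le> K" unfolding K_def using m by (simp add: L2_norm_nonneg)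
  have VK: "cmod (V s) \<le> K" for s
  proof -
    have "cmod (V s) \<le> (\<integral>s. cmod (\<i> / of_real (\<psi> y) * (of_real (w (s, y)) * h s)) \<partial>lebesgue)"
      unfolding V_def by (rule ac_prim_dist_limit_le[OF P ki G(4)])
    also have "\<dots> = (\<integral>s. 1 / \<psi> y * cmod (of_real (w (s, y)) * h s) \<partial>lebesgue)"
      using m by (simp add: norm_mult norm_divide)
    also have "\<dots> = 1 / \<psi> y * (\<integral>s. cmod (of_real (w (s, y)) * h s) \<partial>lebesgue)" by (rule integral_mult_right_zero)
    also have "\<dots> \<le> 1 / \<psi> y * (sqrt (wmass y) * ?n h)" using fib_L1_le[OF y S h] m by (intro mult_left_mono) auto
    finally show ?thesis by (simp add: K_def)
  qed
  have Gm: "G \<in> borel_measurable lebesgue"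
    by (rule ac_prim_fun_measurable[OF P])
  have Vm: "V \<in> borel_measurable (wfib w y)" unfolding V_def[abs_def] using Gm by (simp add: measurable_wfib)
  have b: "AE s in wfib w y. cmod (V s) \<le> K" using VK by simp
  have VL: "V \<in> L2 (wfib w y)" using L2_mult_bounded[OF fib_const(1)[OF y S, of 1] Vm b] by simp
  have "?n V \<le> K * sqrt (wmass y)" using L2_norm_mult_bounded[OF fib_const(1)[OF y S, of 1] Vm b K0] by (simp add: fib_const(2)[OF y S])
  also have "\<dots> = wmass y / \<psi> y * ?n h" unfolding K_def using m by simp
  also have "\<dots> \<le> M / l * ?n h" using m by (intro mult_right_mono frac_le) (auto simp: L2_norm_nonneg)
  finally have Vn: "?n V \<le> M / l * ?n h" .
  have VcL: "(\<lambda>s. V s + c) \<in> L2 (wfib w y)" by (rule L2_add[OF VL fib_const(1)[OF y S]])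
  have ve: "AE s in lebesgue. v s = V s + c" using G(1) by (simp add: V_def)
  have "favg y v = favg y V + c" using favg_cong[OF y v VcL ve] favg_add_const[OF y S VL] by simp
  moreover have "favg y h = of_real t * favg y v + favg y q"
    using favg_lin[OF y S v q, of "of_real t"] by (simp add: q_def)
  ultimately have "c = - favg y V - favg y q / of_real t" using h0 t(1) by (simp add: field_simps eq_neg_iff_add_eq_0)
  then have "cmod c \<le> cmod (favg y V) + cmod (favg y q) / \<bar>t\<bar>"
    using norm_triangle_ineq4[of "- favg y V" "favg y q / of_real t"] by (simp add: norm_divide)
  then have "cmod c * sqrt (wmass y) \<le> (cmod (favg y V) + cmod (favg y q) / \<bar>t\<bar>) * sqrt (wmass y)"
    using m by (intro mult_right_mono) auto
  also have "\<dots> = cmod (favg y V) * sqrt (wmass y) + cmod (favg y q) * sqrt (wmass y) / \<bar>t\<bar>" by (simp add: distrib_right)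
  also have "\<dots> \<le> ?n V + ?n q / \<bar>t\<bar>" by (intro add_mono divide_right_mono favg_le[OF y S] VL q) simp
  finally have cn: "cmod c * sqrt (wmass y) \<le> ?n V + ?n q / \<bar>t\<bar>" .
  have "?n v = ?n (\<lambda>s. V s + c)"
    by (rule L2_norm_cong_AE[OF v VcL]) (use ve in \<open>simp add: AE_wfib[OF y]\<close>)
  also have "\<dots> \<le> ?n V + cmod c * sqrt (wmass y)" using L2_norm_triangle[OF VL fib_const(1)[OF y S, of c]] by (simp add: fib_const(2)[OF y S])
  finally have vn: "?n v \<le> 2 * (M / l * ?n h) + ?n q / \<bar>t\<bar>" using cn Vn by simp
  have hn: "?n h \<le> ?n q + \<bar>t\<bar> * ?n v"
  proof -
    have "?n (\<lambda>s. q s + of_real t * v s) \<le> ?n q + ?n (\<lambda>s. of_real t * v s)" by (rule L2_norm_triangle[OF q L2_scale[OF v]])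
    then show ?thesis by (simp add: q_def L2_norm_scale)
  qed
  \<comment> \<open>With this bound the term containing v on the right is half of the left-hand side
    and can be absorbed; what remains is (3/2) ||q|| / |t|, doubled.\<close>
  have Ml: "M / l \<le> 1 / (4 * \<bar>t\<bar>)" using t m by (simp add: field_simps)
  have "?n v \<le> 2 * (1 / (4 * \<bar>t\<bar>) * (?n q + \<bar>t\<bar> * ?n v)) + ?n q / \<bar>t\<bar>"
  proof -
    have "M / l * ?n h \<le> 1 / (4 * \<bar>t\<bar>) * (?n q + \<bar>t\<bar> * ?n v)" by (intro mult_mono Ml hn) (auto simp: L2_norm_nonneg)
    with vn show ?thesis by linarith
  qed
  also have "\<dots> = 3 / 2 * (?n q / \<bar>t\<bar>) + ?n v / 2" using t(1) by (simp add: field_simps)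
  finally show ?thesis unfolding q_def by simp
qed

text \<open>The derivative of |v|^2 is i / psi times (h cnj v - v cnj h). Because t is real, h may
  be replaced by h - t v without changing it. Integration starts at minus infinity, where the square
  integrable G tends to 0.\<close>

lemma fib_sup_le_outside:
  assumes y: "y \<in> Rperp d - S" and r: "fib_rel y v h" and v: "v \<in> L2 (wfib w y)" and h: "h \<in> L2 (wfib w y)"
  shows "AE s in lebesgue. (cmod (v s))\<^sup>2 \<le> 2 / l * (\<integral>s. cmod (h s - of_real t * v s) * cmod (v s) \<partial>lebesgue)"
proof -
  define q where "q s = h s - of_real t * v s" for s
  have vL: "v \<in> L2 lebesgue" and hL: "h \<in> L2 lebesgue" using v h wfib_outside[OF y] by simp_all
  have qL: "q \<in> L2 lebesgue" unfolding q_def[abs_def] by (intro L2_diff L2_scale vL hL)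
  have psi: "l \<le> \<psi> y" "0 < \<psi> y" using y psi_ge psi_pos by blast+
  from r obtain G c where G: "AE s in lebesgue. v s = G s" "ac_prim G (\<lambda>s. \<i> * of_real (w (s, y) / \<psi> y) * h s)"
    by (auto simp: fib_rel_def)
  have P: "ac_prim G (\<lambda>s. \<i> / of_real (\<psi> y) * h s)" using G(2) by (simp add: w_one[OF y])
  have Gm: "G \<in> borel_measurable lebesgue"
    by (rule ac_prim_fun_measurable[OF P])
  have GL: "G \<in> L2 lebesgue" by (rule L2_cong_AE[OF vL Gm G(1)])
  have kL: "(\<lambda>s. \<i> / of_real (\<psi> y) * h s) \<in> L2 lebesgue" by (rule L2_scale[OF hL])
  note lim = ac_prim_L2_limits(2)[OF P GL integrable_L2_deriv_sum[OF GL kL]]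
  let ?k = "\<lambda>s. \<i> / of_real (\<psi> y) * (q s * cnj (v s)) - \<i> / of_real (\<psi> y) * (v s * cnj (q s))"
  have U: "ac_prim (\<lambda>s. G s * cnj (G s)) (\<lambda>s. \<i> / of_real (\<psi> y) * h s * cnj (G s) + G s * cnj (\<i> / of_real (\<psi> y) * h s))"
    by (rule ac_prim_mult[OF P ac_prim_cnj[OF P]])
  have "AE s in lebesgue. \<i> / of_real (\<psi> y) * h s * cnj (G s) + G s * cnj (\<i> / of_real (\<psi> y) * h s) = ?k s"
    using G(1)
  proof eventually_elim
    case (elim s)
    have "h s = q s + of_real t * v s" by (simp add: q_def)
    then show ?case unfolding elim[symmetric] using psi by (simp add: field_simps)
  qed
  from ac_prim_cong_AE[OF U this] have U': "ac_prim (\<lambda>s. G s * cnj (G s)) ?k" .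
  have ki: "integrable lebesgue ?k"
    by (intro Bochner_Integration.integrable_diff integrable_mult_right integrable_L2_inner qL vL)
  have lim0: "((\<lambda>s. G s * cnj (G s)) \<longlongrightarrow> 0 * cnj 0) at_bot" by (intro tendsto_intros lim)
  note i = L2_norm_mult_integral(1)[OF qL vL]
  have "(cmod (G s))\<^sup>2 \<le> 2 / l * (\<integral>s. cmod (q s) * cmod (v s) \<partial>lebesgue)" for s
  proof -
    have "(cmod (G s))\<^sup>2 = cmod (G s * cnj (G s) - 0 * cnj 0)" by (simp add: norm_mult power2_eq_square)
    also have "\<dots> \<le> (\<integral>s. cmod (?k s) \<partial>lebesgue)" by (rule ac_prim_dist_limit_le[OF U' ki lim0])
    also have "\<dots> \<le> (\<integral>s. 2 / l * (cmod (q s) * cmod (v s)) \<partial>lebesgue)"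
    proof (rule integral_mono[OF integrable_norm[OF ki] integrable_mult_right[OF i]])
      fix s
      have "cmod (?k s) \<le> cmod (\<i> / of_real (\<psi> y) * (q s * cnj (v s))) + cmod (\<i> / of_real (\<psi> y) * (v s * cnj (q s)))" by (rule norm_triangle_ineq4)
      also have "\<dots> = 2 / \<psi> y * (cmod (q s) * cmod (v s))" using psi by (simp add: norm_mult norm_divide)
      also have "\<dots> \<le> 2 / l * (cmod (q s) * cmod (v s))" using psi l_pos by (intro mult_right_mono frac_le) auto
      finally show "cmod (?k s) \<le> 2 / l * (cmod (q s) * cmod (v s))" .
    qed
    also have "\<dots> = 2 / l * (\<integral>s. cmod (q s) * cmod (v s) \<partial>lebesgue)" by (rule integral_mult_right_zero)
    finally show ?thesis .
  qed
  note le = this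
  show ?thesis unfolding q_def[symmetric] by (rule eventually_mono[OF G(1)]) (simp only: le)
qed

text \<open>For an eigenvector the difference h - t v vanishes, so the resolvent estimate over S and
  the sup estimate off S both give 0.\<close>

lemma no_eigenvalue:
  assumes t: "t \<noteq> 0" "4 * M * \<bar>t\<bar> \<le> l"
  shows "\<not> eigenvalue N (D_symm d \<psi> w) (H_op d \<psi> w) (of_real t)"
proof
  assume "eigenvalue N (D_symm d \<psi> w) (H_op d \<psi> w) (of_real t)"
  then obtain f where f: "f \<in> D_symm d \<psi> w" and nz: "\<not> (AE p in N. f p = 0)" and e: "AE p in N. H_op d \<psi> w f p = of_real t * f p"
    unfolding eigenvalue_def by blast
  note g = D_symm_imp_graph[OF f]
  have fL: "f \<in> L2 N" by (rule graph_L2(1)[OF g])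
  have g': "graph f (\<lambda>p. of_real t * f p)" by (rule graph_cong[OF g fL L2_scale[OF fL] _ e]) simp
  have "AE y in X. AE s in lebesgue. f (s, y) = 0"
    using AE_good graph_fib[OF g'] L2_fib[OF fL]
  proof eventually_elim
    case (elim y)
    show ?case
    proof (cases "y \<in> S")
      case True
      from fib_resolvent_le_S[OF elim(1) True t elim(2,3) L2_scale[OF elim(3)]]
      have "L2_norm (wfib w y) (\<lambda>s. f (s, y)) \<le> 0" by simp
      then have "L2_norm (wfib w y) (\<lambda>s. f (s, y)) = 0" using L2_norm_nonneg[of "wfib w y" "\<lambda>s. f (s, y)"] by linarith
      then show ?thesis unfolding L2_norm_eq_0_iff[OF elim(3)] AE_wfib[OF elim(1)] .
    next
      case False
      then have "y \<in> Rperp d - S" using good_Rperp[OF elim(1)] by simp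
      from fib_sup_le_outside[OF this elim(2,3) L2_scale[OF elim(3)], of t] show ?thesis by simp
    qed
  qed
  from AE_eq_if_fib[OF L2_N_measurable[OF fL] borel_measurable_const this] show False using nz by (simp add: AE_N)
qed

definition cut :: "(point \<Rightarrow> complex) \<Rightarrow> point \<Rightarrow> complex" where
  "cut v p = (if snd p \<in> S then v p else 0)"

lemma cut_fib: "y \<in> S \<Longrightarrow> (\<lambda>s. cut v (s, y)) = (\<lambda>s. v (s, y))" "y \<notin> S \<Longrightarrow> (\<lambda>s. cut v (s, y)) = (\<lambda>s. 0)"
  by (simp_all add: cut_def)

lemma cut_measurable: "v \<in> borel_measurable ZZ \<Longrightarrow> cut v \<in> borel_measurable ZZ"
  unfolding cut_def[abs_def] by (rule measurable_if_S) simp_all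

lemma cut_L2: assumes v: "v \<in> L2 N" shows "cut v \<in> L2 N" "L2_norm N (cut v) \<le> L2_norm N v"
proof -
  have "AE y in X. (\<lambda>s. cut v (s, y)) \<in> L2 (wfib w y) \<and> L2_norm (wfib w y) (\<lambda>s. cut v (s, y)) \<le> 1 * L2_norm (wfib w y) (\<lambda>s. v (s, y))"
    using L2_fib[OF v]
  proof eventually_elim
    case (elim y)
    then show ?case by (cases "y \<in> S") (simp_all add: cut_fib L2_zero L2_norm_nonneg)
  qed
  note * = L2I_fib_bound[OF cut_measurable[OF L2_N_measurable[OF v]] v _ this]
  show "cut v \<in> L2 N" "L2_norm N (cut v) \<le> L2_norm N v" using * by simp_all
qed

lemma cut_resolvent_le:
  assumes g: "graph v h" and t: "t \<noteq> 0" "4 * M * \<bar>t\<bar> \<le> l"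
  shows "L2_norm N (cut v) \<le> 3 / \<bar>t\<bar> * L2_norm N (cut (\<lambda>p. h p - of_real t * v p))"
proof -
  have q: "(\<lambda>p. h p - of_real t * v p) \<in> L2 N" by (intro L2_diff L2_scale graph_L2[OF g])
  note vL = graph_L2(1)[OF g]
  have "AE y in X. (\<lambda>s. cut v (s, y)) \<in> L2 (wfib w y) \<and>
      L2_norm (wfib w y) (\<lambda>s. cut v (s, y)) \<le> 3 / \<bar>t\<bar> * L2_norm (wfib w y) (\<lambda>s. cut (\<lambda>p. h p - of_real t * v p) (s, y))"
    using AE_good graph_fib[OF g] L2_fib[OF vL] L2_fib[OF graph_L2(2)[OF g]]
  proof eventually_elim
    case (elim y)
    show ?case
    proof (cases "y \<in> S")
      case True
      show ?thesis unfolding cut_fib(1)[OF True] using fib_resolvent_le_S[OF elim(1) True t elim(2,3,4)] elim(3) by blast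
    next
      case False
      show ?thesis unfolding cut_fib(2)[OF False] by (simp add: L2_zero)
    qed
  qed
  from L2I_fib_bound(2)[OF cut_measurable[OF L2_N_measurable[OF vL]] cut_L2(1)[OF q] _ this] show ?thesis by simp
qed

text \<open>The exponent is halved because the factor multiplies the function, whose modulus is
  squared in the norm.\<close>

definition yweight :: "real \<Rightarrow> point \<Rightarrow> complex" where
  "yweight \<tau> p = (if snd p \<in> S then 0 else of_real ((1 + (fst p)\<^sup>2) powr (\<tau> / 2)))"

lemma yweight_measurable: "yweight \<tau> \<in> borel_measurable ZZ"
proof -
  have "(\<lambda>p. complex_of_real ((1 + (fst p)\<^sup>2) powr (\<tau> / 2))) \<in> borel_measurable ZZ"
    by (rule measurable_compose[OF measurable_fst_full]) measurable
  then show ?thesis unfolding yweight_def[abs_def] by (intro measurable_if_S) simp_all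
qed

lemma yweight_decay_L2: assumes v: "v \<in> L2 N" and \<tau>: "\<tau> \<le> 0" shows "(\<lambda>p. yweight \<tau> p * v p) \<in> L2 N"
proof (rule L2_mult_bounded[OF v])
  show "yweight \<tau> \<in> borel_measurable N" unfolding measurable_N by (rule yweight_measurable)
  have "(1 + (fst p)\<^sup>2) powr (\<tau> / 2) \<le> 1" for p :: point
  proof -
    have "1 + (fst p)\<^sup>2 \<noteq> 0" using zero_le_power2[of "fst p"] by linarith
    then show ?thesis using powr_mono[of "\<tau> / 2" 0 "1 + (fst p)\<^sup>2"] \<tau> by simp
  qed
  then show "AE p in N. cmod (yweight \<tau> p) \<le> 1" by (simp add: yweight_def)
qed

text \<open>The sup bound on each fibre off S is integrated against (1 + s^2)^(-sigma). The
  resulting integrals of |h - t v| |v| are summed over the fibres before Cauchy-Schwarz is applied,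
  once and globally.\<close>

lemma decay_norm_le:
  assumes g: "graph v h" and \<sigma>: "\<sigma> > 1/2"
  shows "(L2_norm N (\<lambda>p. yweight (- \<sigma>) p * v p))\<^sup>2
    \<le> decay_const \<sigma> * (2 / l) * (L2_norm N (\<lambda>p. h p - of_real t * v p) * L2_norm N v)"
proof -
  note vL = graph_L2(1)[OF g] and hL = graph_L2(2)[OF g]
  define q where "q p = h p - of_real t * v p" for p
  have qL: "q \<in> L2 N" unfolding q_def[abs_def] by (intro L2_diff L2_scale vL hL)
  \<comment> \<open>A square root of |q| |v|: it turns the product into the squared modulus of one
    function, to which the fibre decomposition of norms applies.\<close>
  define Q where "Q p = complex_of_real (sqrt (cmod (q p) * cmod (v p)))" for p
  have Qsq: "(cmod (Q p))\<^sup>2 = cmod (q p) * cmod (v p)" for p by (simp add: Q_def)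
  have Qm: "Q \<in> borel_measurable ZZ" unfolding Q_def[abs_def] using L2_N_measurable[OF qL] L2_N_measurable[OF vL] by measurable
  have aL: "(\<lambda>p. yweight (- \<sigma>) p * v p) \<in> L2 N" using \<sigma> by (intro yweight_decay_L2 vL) simp
  define C where "C = decay_const \<sigma> * (2 / l)"
  have C0: "0 \<le> C" using decay_const_nonneg l_pos by (simp add: C_def)
  have "AE y in X. (\<integral>\<^sup>+s. ennreal ((cmod (yweight (- \<sigma>) (s, y) * v (s, y)))\<^sup>2) \<partial>wfib w y)
      \<le> ennreal C * (\<integral>\<^sup>+s. ennreal ((cmod (Q (s, y)))\<^sup>2) \<partial>wfib w y)"
    using AE_good graph_fib[OF g] L2_fib[OF vL] L2_fib[OF hL]
  proof eventually_elim
    case (elim y)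
    show ?case
    proof (cases "y \<in> S")
      case True
      then show ?thesis by (simp add: yweight_def)
    next
      case False
      then have y: "y \<in> Rperp d - S" using good_Rperp[OF elim(1)] by simp
      have vy: "(\<lambda>s. v (s, y)) \<in> L2 lebesgue" and hy: "(\<lambda>s. h (s, y)) \<in> L2 lebesgue" using elim(3,4) wfib_outside[OF y] by simp_all
      have qy: "(\<lambda>s. q (s, y)) \<in> L2 lebesgue" unfolding q_def by (intro L2_diff L2_scale vy hy)
      define I where "I = (\<integral>s. cmod (q (s, y)) * cmod (v (s, y)) \<partial>lebesgue)"
      have I0: "0 \<le> I" unfolding I_def by (rule Bochner_Integration.integral_nonneg) simp
      have I: "(\<integral>\<^sup>+s. ennreal ((cmod (Q (s, y)))\<^sup>2) \<partial>lebesgue) = ennreal I"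
        unfolding Qsq I_def by (rule nn_integral_eq_integral[OF L2_norm_mult_integral(1)[OF qy vy]]) simp
      have "(\<integral>\<^sup>+s. ennreal ((cmod (yweight (- \<sigma>) (s, y) * v (s, y)))\<^sup>2) \<partial>lebesgue)
          \<le> (\<integral>\<^sup>+s. ennreal ((1 + s\<^sup>2) powr (- \<sigma>)) * ennreal (2 / l * I) \<partial>lebesgue)"
      proof (rule nn_integral_mono_AE, use fib_sup_le_outside[OF y elim(2,3,4), of t] in eventually_elim)
        case (elim s)
        have "((1 + s\<^sup>2) powr (- \<sigma> / 2))\<^sup>2 = (1 + s\<^sup>2) powr (- \<sigma>)"
          by (simp add: power2_eq_square powr_add[symmetric])
        then have "(cmod (yweight (- \<sigma>) (s, y) * v (s, y)))\<^sup>2 = (1 + s\<^sup>2) powr (- \<sigma>) * (cmod (v (s, y)))\<^sup>2"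
          using False by (simp add: yweight_def norm_mult power_mult_distrib)
        also have "\<dots> \<le> (1 + s\<^sup>2) powr (- \<sigma>) * (2 / l * I)"
          using elim unfolding I_def q_def by (intro mult_left_mono) auto
        finally show ?case using I0 l_pos by (simp add: ennreal_leI flip: ennreal_mult)
      qed
      also have "\<dots> = (\<integral>\<^sup>+s. ennreal ((1 + s\<^sup>2) powr (- \<sigma>)) \<partial>lebesgue) * ennreal (2 / l * I)"
        by (rule nn_integral_multc) (rule measurable_completion, measurable)
      also have "\<dots> = ennreal C * ennreal I"
        unfolding decay_const[OF \<sigma>, symmetric] C_def using I0 l_pos decay_const_nonneg by (simp add: mult.assoc flip: ennreal_mult)
      finally show ?thesis unfolding wfib_outside[OF y] I .
    qed
  qed
  from nn_integral_mono_AE[OF this]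
  have "ennreal ((L2_norm N (\<lambda>p. yweight (- \<sigma>) p * v p))\<^sup>2) \<le> (\<integral>\<^sup>+y. ennreal C * (\<integral>\<^sup>+s. ennreal ((cmod (Q (s, y)))\<^sup>2) \<partial>wfib w y) \<partial>X)"
    unfolding L2_norm_sq_nn[OF aL] nn_L2_fib[OF L2_N_measurable[OF aL]] .
  also have "\<dots> = ennreal C * (\<integral>\<^sup>+y. (\<integral>\<^sup>+s. ennreal ((cmod (Q (s, y)))\<^sup>2) \<partial>wfib w y) \<partial>X)"
    by (rule nn_integral_cmult[OF nn_fib_measurable[OF Qm]])
  also have "(\<integral>\<^sup>+y. (\<integral>\<^sup>+s. ennreal ((cmod (Q (s, y)))\<^sup>2) \<partial>wfib w y) \<partial>X) = (\<integral>\<^sup>+p. ennreal ((cmod (Q p))\<^sup>2) \<partial>N)"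
    by (rule nn_L2_fib[OF Qm, symmetric])
  also have "\<dots> = ennreal (\<integral>p. cmod (q p) * cmod (v p) \<partial>N)"
    unfolding Qsq by (rule nn_integral_eq_integral[OF L2_norm_mult_integral(1)[OF qL vL]]) simp
  also have "ennreal C * \<dots> \<le> ennreal C * ennreal (L2_norm N q * L2_norm N v)"
    by (intro mult_left_mono ennreal_leI L2_norm_mult_integral(2)[OF qL vL]) simp
  also have "\<dots> = ennreal (C * (L2_norm N q * L2_norm N v))" using C0 by (simp add: ennreal_mult L2_norm_nonneg)
  finally have le: "ennreal ((L2_norm N (\<lambda>p. yweight (- \<sigma>) p * v p))\<^sup>2) \<le> ennreal (C * (L2_norm N q * L2_norm N v))" .
  have "0 \<le> C * (L2_norm N q * L2_norm N v)" by (intro mult_nonneg_nonneg C0 L2_norm_nonneg)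
  from le[unfolded ennreal_le_iff[OF this]] show ?thesis unfolding q_def C_def .
qed

end

section \<open>Vectors in short spectral intervals\<close>

locale confined_resolution = confined_operator +
  fixes E :: "real \<Rightarrow> (point \<Rightarrow> complex) \<Rightarrow> (point \<Rightarrow> complex)"
  assumes resolution: "spectral_family (wmeas d w) (D_symm d \<psi> w) (H_op d \<psi> w) E"
begin

sublocale spectral_resolution "wmeas d w" "D_symm d \<psi> w" "H_op d \<psi> w" E
  by unfold_locales (rule self_adjoint_H, rule resolution)

abbreviation "HH \<equiv> H_op d \<psi> w"

lemma inran_graph: "a \<le> b \<Longrightarrow> inran a b v \<Longrightarrow> graph v (HH v)"
  by (rule D_symm_imp_graph[OF inran_D])

text \<open>
  With t the midpoint and r the radius of the interval, the conditions say $4M|t| \le l$ and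
  $3r/|t| < 1$.
\<close>

definition ok :: "real \<Rightarrow> real \<Rightarrow> bool" where
  "ok a b \<longleftrightarrow> a < b \<and> 2 * M * \<bar>a + b\<bar> \<le> l \<and> 3 * (b - a) < \<bar>a + b\<bar>"

lemma inran_shift_le:
  assumes ab: "a < b" and v: "inran a b v"
  shows "nrm (\<lambda>p. HH v p - of_real ((a + b) / 2) * v p) \<le> (b - a) / 2 * nrm v"
proof (rule inran_norm_le)
  have "(a + b) / 2 - (b - a) / 2 = a" "(a + b) / 2 + (b - a) / 2 = b" by (simp_all add: field_simps)
  then show "inran ((a + b) / 2 - (b - a) / 2) ((a + b) / 2 + (b - a) / 2) v" using v by simp
qed (use ab in simp)

text \<open>Each use of the resolvent estimate costs 3/|t|, while H - t shrinks the norm by the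
  half-length (b - a)/2 on the spectral subspace and keeps the vector there. The product
  \<open>\<theta>\<close> of the two factors is less than 1, so n steps give
  \<open>\<theta>\<close>^n ||v|| for the part of v over S.\<close>

lemma cut_eq_0:
  assumes ok: "ok a b" and v: "inran a b v" shows "AE p in N. cut v p = 0"
proof -
  define t where "t = (a + b) / 2"
  have ab: "a < b" and t: "t \<noteq> 0" "4 * M * \<bar>t\<bar> \<le> l" and q: "3 * (b - a) < \<bar>a + b\<bar>" using ok by (auto simp: ok_def t_def)
  define \<theta> where "\<theta> = 3 / \<bar>t\<bar> * ((b - a) / 2)"
  have \<theta>: "0 \<le> \<theta>" "\<theta> < 1" using ab q t by (auto simp: \<theta>_def t_def field_simps)
  have "nrm (cut v) \<le> \<theta> ^ n * nrm v" if "inran a b v" for n v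
    using that
  proof (induction n arbitrary: v)
    case 0
    then show ?case using cut_L2(2)[OF inran_L2] by simp
  next
    case (Suc n)
    let ?q = "\<lambda>p. HH v p - of_real t * v p"
    have "nrm (cut v) \<le> 3 / \<bar>t\<bar> * nrm (cut ?q)"
      using ab by (intro cut_resolvent_le inran_graph[OF _ Suc.prems] t) simp
    also have "\<dots> \<le> 3 / \<bar>t\<bar> * (\<theta> ^ n * nrm ?q)"
      using ab by (intro mult_left_mono Suc.IH inran_shift Suc.prems) simp_all
    also have "\<dots> \<le> 3 / \<bar>t\<bar> * (\<theta> ^ n * ((b - a) / 2 * nrm v))"
      using inran_shift_le[OF ab Suc.prems] \<theta>(1) unfolding t_def[symmetric] by (intro mult_left_mono) simp_all
    also have "\<dots> = 3 / \<bar>t\<bar> * ((b - a) / 2) * \<theta> ^ n * nrm v" by (simp only: mult_ac)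
    finally show ?case by (simp only: \<theta>_def[symmetric] power_Suc)
  qed
  note b = this[OF v]
  have "(\<lambda>n. \<theta> ^ n * nrm v) \<longlonglongrightarrow> 0 * nrm v" by (intro tendsto_intros LIMSEQ_power_zero) (use \<theta> in simp)
  then have "nrm (cut v) \<le> 0 * nrm v" by (rule LIMSEQ_le_const) (use b in blast)
  then have "nrm (cut v) = 0" using L2_norm_nonneg[of N "cut v"] by simp
  then show ?thesis using L2_norm_eq_0_iff[OF cut_L2(1)[OF inran_L2[OF v]]] by simp
qed

text \<open>A duality argument. With v the projection of f, ||v||^2 = (v, f), and the weights of
  exponents sigma and -sigma may be inserted since v vanishes over S. The decaying side is at most
  the square root of K times ||v||, with K = decay_const * (b - a) / l; the factor 2 / l there meets
  the norm (b - a)/2 of H - t.\<close>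

lemma P_norm_le_weighted:
  assumes ok: "ok a b" and \<sigma>: "\<sigma> > 1/2" and f: "f \<in> L2 N" and y: "(\<lambda>p. yweight \<sigma> p * f p) \<in> L2 N"
  shows "nrm (P a b f) \<le> sqrt (decay_const \<sigma> * (b - a) / l) * nrm (\<lambda>p. yweight \<sigma> p * f p)"
proof -
  have ab: "a < b" "a \<le> b" using ok by (auto simp: ok_def)
  define v where "v = P a b f"
  have v: "inran a b v" unfolding v_def by (rule inran_P[OF ab(2) f])
  note vL = inran_L2[OF v]
  define K where "K = decay_const \<sigma> * (b - a) / l"
  have K0: "0 \<le> K" using decay_const_nonneg l_pos ab by (simp add: K_def)
  let ?yv = "\<lambda>p. yweight (- \<sigma>) p * v p" and ?yf = "\<lambda>p. yweight \<sigma> p * f p"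
  have yvL: "?yv \<in> L2 N" using \<sigma> by (intro yweight_decay_L2 vL) simp
  have "(nrm ?yv)\<^sup>2 \<le> decay_const \<sigma> * (2 / l) * (nrm (\<lambda>p. HH v p - of_real ((a + b) / 2) * v p) * nrm v)"
    by (rule decay_norm_le[OF inran_graph[OF ab(2) v] \<sigma>])
  also have "\<dots> \<le> decay_const \<sigma> * (2 / l) * ((b - a) / 2 * nrm v * nrm v)"
    using decay_const_nonneg l_pos by (intro mult_left_mono mult_right_mono inran_shift_le[OF ab(1) v]) (auto simp: L2_norm_nonneg)
  also have "\<dots> = (sqrt K * nrm v)\<^sup>2" unfolding power_mult_distrib real_sqrt_pow2[OF K0]
    by (simp add: K_def power2_eq_square)
  finally have yv: "nrm ?yv \<le> sqrt K * nrm v" by (rule power2_le_imp_le) (simp add: K0 L2_norm_nonneg)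
  have e: "ip v f = ip ?yv ?yf" unfolding L2_inner_def
  proof (rule integral_cong_AE)
    show "AE p in N. v p * cnj (f p) = ?yv p * cnj (?yf p)"
      using cut_eq_0[OF ok v]
    proof eventually_elim
      case (elim p)
      show ?case
      proof (cases "snd p \<in> S")
        case False
        have "1 + (fst p)\<^sup>2 \<noteq> 0" using zero_le_power2[of "fst p"] by linarith
        then have "(1 + (fst p)\<^sup>2) powr (- \<sigma> / 2) * (1 + (fst p)\<^sup>2) powr (\<sigma> / 2) = 1" by (simp add: powr_add[symmetric])
        then have "complex_of_real ((1 + (fst p)\<^sup>2) powr (- \<sigma> / 2)) * complex_of_real ((1 + (fst p)\<^sup>2) powr (\<sigma> / 2)) = 1"
          by (simp only: of_real_mult[symmetric] of_real_1)
        then show ?thesis using False by (simp add: yweight_def mult_ac)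
      qed (use elim in \<open>simp add: cut_def yweight_def\<close>)
    qed
  qed (intro borel_measurable_times borel_measurable_cnj L2_measurable[OF vL] L2_measurable[OF f] L2_measurable[OF yvL] L2_measurable[OF y])+
  have "nrm v * nrm v = cmod (ip v f)"
    using P_norm_sq_inner[OF ab(2) f] unfolding v_def[symmetric] by (metis norm_of_real abs_of_nonneg zero_le_power2 power2_eq_square)
  also have "\<dots> \<le> nrm ?yv * nrm ?yf" unfolding e by (rule L2_Cauchy_Schwarz[OF yvL y])
  also have "\<dots> \<le> sqrt K * nrm v * nrm ?yf" by (intro mult_right_mono yv L2_norm_nonneg)
  finally have "nrm v * nrm v \<le> (sqrt K * nrm ?yf) * nrm v" by (simp add: mult_ac)
  then have "nrm v \<le> sqrt K * nrm ?yf"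
    by (cases "nrm v = 0") (use L2_norm_nonneg[of N v] L2_norm_nonneg[of N ?yf] K0 in \<open>auto simp: mult_le_cancel_right\<close>)
  then show ?thesis unfolding v_def K_def .
qed

end

section \<open>Translation of the spectral parameter\<close>

lemma L2_norm_dominated_tendsto_0:
  assumes g: "g \<in> L2 N" and c: "\<And>n. c n \<in> borel_measurable N" and K: "\<And>n x. cmod (c n x) \<le> K"
    and lim: "\<And>x. (\<lambda>n. c n x) \<longlonglongrightarrow> 0"
  shows "(\<lambda>n. L2_norm N (\<lambda>x. c n x * g x)) \<longlonglongrightarrow> 0"
proof -
  note gm = L2_measurable[OF g]
  have "(\<lambda>n. \<integral>x. (cmod (c n x * g x))\<^sup>2 \<partial>N) \<longlonglongrightarrow> (\<integral>x. 0 \<partial>N)"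
  proof (rule integral_dominated_convergence[where w="\<lambda>x. K\<^sup>2 * (cmod (g x))\<^sup>2"])
    show "integrable N (\<lambda>x. K\<^sup>2 * (cmod (g x))\<^sup>2)" by (rule integrable_mult_right[OF L2_integrable[OF g]])
    show "AE x in N. (\<lambda>n. (cmod (c n x * g x))\<^sup>2) \<longlonglongrightarrow> 0"
    proof (rule AE_I2)
      fix x
      have "(\<lambda>n. (cmod (c n x * g x))\<^sup>2) \<longlonglongrightarrow> (cmod (0 * g x))\<^sup>2" by (intro tendsto_intros lim)
      then show "(\<lambda>n. (cmod (c n x * g x))\<^sup>2) \<longlonglongrightarrow> 0" by simp
    qed
    show "AE x in N. norm ((cmod (c n x * g x))\<^sup>2) \<le> K\<^sup>2 * (cmod (g x))\<^sup>2" for n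
      by (rule AE_I2) (simp add: norm_mult power_mult_distrib mult_right_mono power_mono[OF K])
  qed (use c gm in measurable)
  then have "(\<lambda>n. sqrt (\<integral>x. (cmod (c n x * g x))\<^sup>2 \<partial>N)) \<longlonglongrightarrow> sqrt (\<integral>x. 0 \<partial>N)" by (rule tendsto_real_sqrt)
  then show ?thesis by (simp add: L2_norm_def)
qed

lemma isCont_if_lipschitz:
  fixes G :: "real \<Rightarrow> real"
  assumes lip: "\<And>a b. x < a \<Longrightarrow> a \<le> b \<Longrightarrow> b < y \<Longrightarrow> \<bar>G b - G a\<bar> \<le> K * (b - a)" and t: "x < t" "t < y"
  shows "isCont G t"
proof -
  have le: "norm (G s - G t) \<le> K * \<bar>s - t\<bar>" if "x < s" "s < y" for s
    using lip[of s t] lip[of t s] that t by (cases "s \<le> t") (auto simp: abs_minus_commute)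
  have "((\<lambda>s. K * \<bar>s - t\<bar>) \<longlongrightarrow> K * \<bar>t - t\<bar>) (at t)" by (intro tendsto_intros)
  then have z: "((\<lambda>s. K * \<bar>s - t\<bar>) \<longlongrightarrow> 0) (at t)" by simp
  have "\<forall>\<^sub>F s in at t. s \<in> {x<..<y}" by (rule eventually_at_in_open') (use t in auto)
  then have "\<forall>\<^sub>F s in at t. norm (G s - G t) \<le> K * \<bar>s - t\<bar>" by (rule eventually_mono) (use le in simp)
  from Lim_null_comparison[OF this z] show ?thesis unfolding isCont_def by (rule LIM_zero_cancel)
qed

lemma ac_prim_cis: "ac_prim (\<lambda>s. cis (c * s)) (\<lambda>s. \<i> * of_real c * cis (c * s))"
proof (rule ac_prim_smooth)
  fix x
  have "((\<lambda>z. exp (\<i> * of_real c * z)) has_field_derivative \<i> * of_real c * exp (\<i> * of_real c * of_real x)) (at (of_real x))"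
    by (auto intro!: derivative_eq_intros)
  from has_vector_derivative_real_field[OF this]
  show "((\<lambda>s. cis (c * s)) has_vector_derivative \<i> * of_real c * cis (c * x)) (at x)"
    by (simp add: cis_conv_exp mult_ac)
qed (intro continuous_intros)

section \<open>Multiplication by a phase\<close>

context confined_operator
begin

text \<open>Set to 0 over S, so the multiplication is a contraction that also discards the fibres
  over S, rather than a unitary map.\<close>

definition phase :: "real \<Rightarrow> point \<Rightarrow> complex" where
  "phase h p = (if snd p \<in> S then 0 else cis (h / \<psi> (snd p) * fst p))"

lemma cis_measurable: "(\<lambda>p. cis (h / \<psi> (snd p) * fst p)) \<in> borel_measurable ZZ"
proof -
  have "cis \<in> borel_measurable borel" by (intro borel_measurable_continuous_onI continuous_intros)
  moreover have "(\<lambda>p. h / \<psi> (snd p) * fst p) \<in> borel_measurable ZZ"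
    by (intro borel_measurable_times borel_measurable_divide psi_measurable_full measurable_fst_full borel_measurable_const)
  ultimately show ?thesis by (rule measurable_compose[rotated])
qed

lemma phase_measurable: "phase h \<in> borel_measurable ZZ"
  unfolding phase_def[abs_def] by (intro measurable_if_S cis_measurable borel_measurable_const)

lemma phase_mult_L2:
  assumes v: "v \<in> L2 N" shows "(\<lambda>p. phase h p * v p) \<in> L2 N" "L2_norm N (\<lambda>p. phase h p * v p) \<le> L2_norm N v"
proof -
  have m: "phase h \<in> borel_measurable N" unfolding measurable_N by (rule phase_measurable)
  have b: "AE p in N. cmod (phase h p) \<le> 1" by (rule AE_I2) (simp add: phase_def)
  show "(\<lambda>p. phase h p * v p) \<in> L2 N" by (rule L2_mult_bounded[OF v m b])
  show "L2_norm N (\<lambda>p. phase h p * v p) \<le> L2_norm N v" using L2_norm_mult_bounded[OF v m b] by simp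
qed

lemma phase_adjoint: "L2_inner N v (\<lambda>p. phase (- h) p * f p) = L2_inner N (\<lambda>p. phase h p * v p) f"
proof -
  have "v p * cnj (phase (- h) p * f p) = phase h p * v p * cnj (f p)" for p
    by (simp add: phase_def cis_cnj)
  then show ?thesis unfolding L2_inner_def by (simp only:)
qed

text \<open>
  Off S, multiplication by $e^{ihx_1/\psi}$ translates the spectral parameter by h.
\<close>

lemma graph_phase:
  assumes g: "graph v k"
  shows "graph (\<lambda>p. phase h p * v p) (\<lambda>p. phase h p * (k p + of_real h * v p))"
  unfolding graph_def
proof (intro conjI phase_mult_L2 L2_add L2_scale graph_L2[OF g])
  show "AE y in X. fib_rel y (\<lambda>s. phase h (s, y) * v (s, y)) (\<lambda>s. phase h (s, y) * (k (s, y) + of_real h * v (s, y)))"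
    using AE_good graph_fib[OF g] L2_fib[OF graph_L2(1)[OF g]] L2_fib[OF graph_L2(2)[OF g]]
  proof eventually_elim
    case (elim y)
    show ?case
    proof (cases "y \<in> S")
      case True
      have "fib_rel y (\<lambda>s. 0) (\<lambda>s. 0)"
        by (rule fib_relI[of _ "\<lambda>s. 0" _ _ 0]) (simp_all add: ac_prim_const)
      then show ?thesis using True by (simp add: phase_def)
    next
      case False
      then have y: "y \<in> Rperp d - S" using good_Rperp[OF elim(1)] by simp
      have vy: "(\<lambda>s. v (s, y)) \<in> L2 lebesgue" and ky: "(\<lambda>s. k (s, y)) \<in> L2 lebesgue" using elim(3,4) wfib_outside[OF y] by simp_all
      from elim(2) obtain G c where G: "AE s in lebesgue. v (s, y) = G s" "ac_prim G (\<lambda>s. \<i> * of_real (w (s, y) / \<psi> y) * k (s, y))"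
        by (auto simp: fib_rel_def)
      have P: "ac_prim G (\<lambda>s. \<i> / of_real (\<psi> y) * k (s, y))" using G(2) by (simp add: w_one[OF y])
      have Gm: "G \<in> borel_measurable lebesgue"
        by (rule ac_prim_fun_measurable[OF P])
      have GL: "G \<in> L2 lebesgue" by (rule L2_cong_AE[OF vy Gm G(1)])
      have kL: "(\<lambda>s. \<i> / of_real (\<psi> y) * k (s, y)) \<in> L2 lebesgue" by (rule L2_scale[OF ky])
      note lim = ac_prim_L2_limits[OF P GL integrable_L2_deriv_sum[OF GL kL]]
      let ?e = "\<lambda>s. cis (h / \<psi> y * s)"
      \<comment> \<open>The phase has no limit at infinity. The boundary condition is preserved
        because G itself tends to 0 at both ends, being square integrable on an unweighted
        fibre.\<close>
      have n: "cmod (?e s * G s) = cmod (G s)" for s by (simp add: norm_mult)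
      have l: "((\<lambda>s. ?e s * G s) \<longlongrightarrow> 0) at_top" "((\<lambda>s. ?e s * G s) \<longlongrightarrow> 0) at_bot"
        by (rule tendsto_norm_zero_cancel, unfold n, rule tendsto_norm_zero[OF lim(1)])
          (rule tendsto_norm_zero_cancel, unfold n, rule tendsto_norm_zero[OF lim(2)])
      have "AE s in lebesgue. \<i> * of_real (h / \<psi> y) * ?e s * G s + ?e s * (\<i> / of_real (\<psi> y) * k (s, y))
          = \<i> * of_real (w (s, y) / \<psi> y) * (phase h (s, y) * (k (s, y) + of_real h * v (s, y)))"
        using G(1)
      proof eventually_elim
        case (elim s)
        show ?case unfolding elim w_one[OF y] using False by (simp add: phase_def algebra_simps add_divide_distrib)
      qed
      from ac_prim_cong_AE[OF ac_prim_mult[OF ac_prim_cis P] this] show ?thesis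
      proof (rule fib_relI[rotated])
        show "AE s in lebesgue. phase h (s, y) * v (s, y) = ?e s * G s"
          using G(1) by eventually_elim (use False in \<open>simp add: phase_def\<close>)
      qed (use l in simp_all)
    qed
  qed
qed

end

section \<open>Translated increments and differentiability\<close>

context confined_resolution
begin

lemma graph_imp_Gr: "graph f h \<Longrightarrow> Gr f h"
  unfolding Gr_def using graph_imp_D_symm graph_L2(2) by blast

text \<open>The iterates of H - (m + h) on phase * v are the phase times the iterates of H - m on v,
  hence bounded by ((b - a)/2)^n up to a constant. The growth criterion asks for a strictly larger
  radius, which is the origin of \<open>\<eta>\<close>.\<close>

lemma inran_phase:
  assumes ab: "a < b" and \<eta>: "\<eta> > 0" and v: "inran a b v"
  shows "inran (a + h - \<eta>) (b + h + \<eta>) (\<lambda>p. phase h p * v p)"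
proof -
  define m where "m = (a + b) / 2"
  define vv where "vv n = ((\<lambda>u p. HH u p - of_real m * u p) ^^ n) v" for n
  have vS: "vv (Suc n) = (\<lambda>p. HH (vv n) p - of_real m * vv n p)" for n by (simp add: vv_def)
  have vr: "inran a b (vv n)" for n
  proof (induction n)
    case 0 then show ?case using v by (simp add: vv_def)
  next
    case (Suc n) then show ?case unfolding vS using ab by (intro inran_shift) simp_all
  qed
  have vn: "nrm (vv n) \<le> nrm v * ((b - a) / 2) ^ n" for n
  proof (induction n)
    case 0 then show ?case by (simp add: vv_def)
  next
    case (Suc n)
    have "nrm (vv (Suc n)) \<le> (b - a) / 2 * nrm (vv n)" unfolding vS m_def by (rule inran_shift_le[OF ab vr])
    also have "\<dots> \<le> (b - a) / 2 * (nrm v * ((b - a) / 2) ^ n)" using ab by (intro mult_left_mono Suc) simp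
    finally show ?case by (simp add: mult_ac)
  qed
  have "inran ((m + h) - ((b - a) / 2 + \<eta>)) ((m + h) + ((b - a) / 2 + \<eta>)) (\<lambda>p. phase h p * vv 0 p)"
  proof (rule inran_if_powers_bounded[where \<rho>="(b - a) / 2" and C="nrm v" and w="\<lambda>n p. phase h p * vv n p"])
    fix n
    have "graph (\<lambda>p. phase h p * vv n p) (\<lambda>p. phase h p * (HH (vv n) p + of_real h * vv n p))"
      using ab by (intro graph_phase inran_graph[OF _ vr]) simp
    moreover have "phase h p * (HH (vv n) p + of_real h * vv n p) = phase h p * vv (Suc n) p + of_real (m + h) * (phase h p * vv n p)" for p
      unfolding vS by (simp add: algebra_simps)
    ultimately show "Gr (\<lambda>p. phase h p * vv n p) (\<lambda>p. phase h p * vv (Suc n) p + of_real (m + h) * (phase h p * vv n p))"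
      using graph_imp_Gr by simp
    show "nrm (\<lambda>p. phase h p * vv n p) \<le> nrm v * ((b - a) / 2) ^ n"
      using phase_mult_L2(2)[OF inran_L2[OF vr[of n]], of h] vn[of n] by simp
  qed (use ab \<eta> in simp_all)
  moreover have "(m + h) - ((b - a) / 2 + \<eta>) = a + h - \<eta>" "(m + h) + ((b - a) / 2 + \<eta>) = b + h + \<eta>" "vv 0 = v"
    by (simp_all add: m_def vv_def field_simps)
  ultimately show ?thesis by simp
qed

text \<open>With v the projection of the multiplied vector, ||v||^2 = (phase * v, f). Since phase *
  v lies over the shifted interval, f may be replaced by its projection to that interval.\<close>

lemma P_phase_le:
  assumes ab: "a < b" and \<eta>: "\<eta> > 0" and f: "f \<in> L2 N"
  shows "nrm (P a b (\<lambda>p. phase (- h) p * f p)) \<le> nrm (P (a + h - \<eta>) (b + h + \<eta>) f)"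
proof -
  note fh = phase_mult_L2(1)[OF f, of "- h"]
  define v where "v = P a b (\<lambda>p. phase (- h) p * f p)"
  have v: "inran a b v" unfolding v_def using ab by (intro inran_P fh) simp
  note vL = inran_L2[OF v]
  note i = inran_phase[OF ab \<eta> v, of h]
  have "nrm v * nrm v = cmod (ip v (\<lambda>p. phase (- h) p * f p))"
    using P_norm_sq_inner[OF _ fh, of a b] ab unfolding v_def[symmetric]
    by (metis norm_of_real abs_of_nonneg zero_le_power2 power2_eq_square less_imp_le)
  also have "ip v (\<lambda>p. phase (- h) p * f p) = ip (\<lambda>p. phase h p * v p) (P (a + h - \<eta>) (b + h + \<eta>) f)"
    unfolding phase_adjoint by (rule inran_inner_P[OF i f, symmetric])
  also have "cmod \<dots> \<le> nrm (\<lambda>p. phase h p * v p) * nrm (P (a + h - \<eta>) (b + h + \<eta>) f)"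
    by (rule L2_Cauchy_Schwarz[OF inran_L2[OF i] P_L2[OF f]])
  also have "\<dots> \<le> nrm v * nrm (P (a + h - \<eta>) (b + h + \<eta>) f)"
    by (intro mult_right_mono phase_mult_L2(2)[OF vL] L2_norm_nonneg)
  finally have "nrm v * nrm v \<le> nrm (P (a + h - \<eta>) (b + h + \<eta>) f) * nrm v" by (simp add: mult.commute)
  then show ?thesis unfolding v_def[symmetric]
    by (cases "nrm v = 0") (use L2_norm_nonneg[of N v] L2_norm_nonneg[of N "P (a + h - \<eta>) (b + h + \<eta>) f"] in \<open>auto simp: mult_le_cancel_right\<close>)
qed

text \<open>The margin \<open>\<eta>\<close> is sent to 0. At the lower endpoint this takes
  continuity from the left, which a spectral family does not have in general and which the local
  Lipschitz bound will provide.\<close>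

lemma P_phase_le':
  assumes ab: "a < b" and f: "f \<in> L2 N" and c: "isCont (F f) (a + h)" "isCont (F f) (b + h)"
  shows "nrm (P a b (\<lambda>p. phase (- h) p * f p)) \<le> nrm (P (a + h) (b + h) f)"
proof (rule power2_le_imp_le[OF _ L2_norm_nonneg])
  let ?n = "nrm (P a b (\<lambda>p. phase (- h) p * f p))"
  have l1: "((\<lambda>\<eta>. F f (b + h + \<eta>)) \<longlongrightarrow> F f (b + h)) (at_right 0)"
    using c(2)[unfolded isCont_iff] by (rule filterlim_mono[OF _ order_refl]) (simp add: at_within_le_at)
  have "((\<lambda>\<eta>. F f (a + h + - \<eta>)) \<longlongrightarrow> F f (a + h)) (at_right 0)"
  proof (rule isCont_tendsto_compose[OF c(1)])
    have "((\<lambda>\<eta>. a + h + - \<eta>) \<longlongrightarrow> a + h + - 0) (at_right 0)" by (intro tendsto_intros)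
    then show "((\<lambda>\<eta>. a + h + - \<eta>) \<longlongrightarrow> a + h) (at_right 0)" by simp
  qed
  with l1 have "((\<lambda>\<eta>. F f (b + h + \<eta>) - F f (a + h + - \<eta>)) \<longlongrightarrow> F f (b + h) - F f (a + h)) (at_right 0)"
    by (rule tendsto_diff)
  moreover have "\<forall>\<^sub>F \<eta> in at_right 0. ?n\<^sup>2 \<le> F f (b + h + \<eta>) - F f (a + h + - \<eta>)"
    using eventually_at_right_less[of "0::real"]
  proof (rule eventually_mono)
    fix \<eta> :: real assume \<eta>: "0 < \<eta>"
    have "?n\<^sup>2 \<le> (nrm (P (a + h - \<eta>) (b + h + \<eta>) f))\<^sup>2"
      by (rule power_mono[OF P_phase_le[OF ab \<eta> f] L2_norm_nonneg])
    also have "\<dots> = F f (b + h + \<eta>) - F f (a + h - \<eta>)" using ab \<eta> by (intro P_norm_sq f) simp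
    finally show "?n\<^sup>2 \<le> F f (b + h + \<eta>) - F f (a + h + - \<eta>)" by simp
  qed
  ultimately have "?n\<^sup>2 \<le> F f (b + h) - F f (a + h)" by (rule tendsto_lowerbound) simp
  then show "?n\<^sup>2 \<le> (nrm (P (a + h) (b + h) f))\<^sup>2" using ab P_norm_sq[OF _ f, of "a + h" "b + h"] by simp
qed

lemma ok_near:
  assumes t: "t0 \<noteq> 0" "\<bar>t0\<bar> < l / (4 * M)"
  shows "\<exists>\<rho>>0. \<forall>a b. t0 - \<rho> < a \<longrightarrow> a < b \<longrightarrow> b < t0 + \<rho> \<longrightarrow> ok a b"
proof -
  \<comment> \<open>The first bound gives 3 (b - a) < (3/4) |t0| against |a + b| > (7/4) |t0|; the
    second keeps the midpoint within l/(4M).\<close>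
  define \<rho> where "\<rho> = min (\<bar>t0\<bar> / 8) (l / (4 * M) - \<bar>t0\<bar>)"
  have "\<rho> > 0" using t by (simp add: \<rho>_def)
  moreover have "ok a b" if a: "t0 - \<rho> < a" "a < b" "b < t0 + \<rho>" for a b
  proof -
    have r: "\<rho> \<le> \<bar>t0\<bar> / 8" unfolding \<rho>_def by (rule min.cobounded1)
    have r': "\<rho> \<le> l / (4 * M) - \<bar>t0\<bar>" unfolding \<rho>_def by (rule min.cobounded2)
    have "\<bar>a + b\<bar> \<le> 2 * (l / (4 * M))" using r' a by (auto simp: abs_if split: if_splits)
    then have "2 * M * \<bar>a + b\<bar> \<le> 2 * M * (2 * (l / (4 * M)))" using M_pos by (intro mult_left_mono) simp_all
    moreover have "3 * (b - a) < \<bar>a + b\<bar>" using r a by (auto simp: abs_if split: if_splits)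
    ultimately show ?thesis unfolding ok_def using a M_pos by simp
  qed
  ultimately show ?thesis by blast
qed

text \<open>
  The weight vanishes on S: vectors of small nonzero energy vanish there, so that the values of f on
  S do not enter the estimates.
\<close>

definition Yc :: "real \<Rightarrow> (point \<Rightarrow> complex) set" where
  "Yc \<sigma> = {f \<in> L2 N. (\<lambda>p. yweight \<sigma> p * f p) \<in> L2 N}"

abbreviation ynrm :: "real \<Rightarrow> (point \<Rightarrow> complex) \<Rightarrow> real" where
  "ynrm \<sigma> f \<equiv> nrm (\<lambda>p. yweight \<sigma> p * f p)"

lemma Yc_L2: "f \<in> Yc \<sigma> \<Longrightarrow> f \<in> L2 N" and Yc_weight: "f \<in> Yc \<sigma> \<Longrightarrow> (\<lambda>p. yweight \<sigma> p * f p) \<in> L2 N"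
  by (simp_all add: Yc_def)

lemma Yc_lin: assumes f: "f \<in> Yc \<sigma>" and g: "g \<in> Yc \<sigma>" shows "(\<lambda>p. f p + a * g p) \<in> Yc \<sigma>"
proof -
  have "(\<lambda>p. yweight \<sigma> p * (f p + a * g p)) = (\<lambda>p. yweight \<sigma> p * f p + a * (yweight \<sigma> p * g p))"
    by (simp add: algebra_simps)
  then show ?thesis unfolding Yc_def using L2_add[OF Yc_L2[OF f] L2_scale[OF Yc_L2[OF g]]]
      L2_add[OF Yc_weight[OF f] L2_scale[OF Yc_weight[OF g]]] by simp
qed

lemma P_norm_le_Yc:
  assumes "ok a b" "\<sigma> > 1/2" "f \<in> Yc \<sigma>"
  shows "nrm (P a b f) \<le> sqrt (decay_const \<sigma> / l * (b - a)) * ynrm \<sigma> f"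
  using P_norm_le_weighted[OF assms(1,2) Yc_L2[OF assms(3)] Yc_weight[OF assms(3)]] by simp

lemma F_lipschitz:
  assumes ok: "ok a b" and \<sigma>: "\<sigma> > 1/2" and f: "f \<in> Yc \<sigma>"
  shows "\<bar>F f b - F f a\<bar> \<le> decay_const \<sigma> / l * (ynrm \<sigma> f)\<^sup>2 * (b - a)"
proof -
  have ab: "a \<le> b" using ok by (simp add: ok_def)
  have K0: "0 \<le> decay_const \<sigma> / l * (b - a)" using decay_const_nonneg l_pos ab by simp
  have "\<bar>F f b - F f a\<bar> = (nrm (P a b f))\<^sup>2" using P_norm_sq[OF ab Yc_L2[OF f]] F_mono[OF Yc_L2[OF f] ab] by simp
  also have "\<dots> \<le> (sqrt (decay_const \<sigma> / l * (b - a)) * ynrm \<sigma> f)\<^sup>2"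
    by (rule power_mono[OF P_norm_le_Yc[OF ok \<sigma> f] L2_norm_nonneg])
  finally show ?thesis unfolding power_mult_distrib real_sqrt_pow2[OF K0] by (simp add: mult_ac)
qed

text \<open>Dominated convergence: 1 - cis is bounded by 2 and tends to 0 at each point, though not
  uniformly in the first coordinate.\<close>

lemma phase_increment_tendsto_0:
  assumes f: "f \<in> Yc \<sigma>"
  shows "((\<lambda>h. ynrm \<sigma> (\<lambda>p. f p - phase h p * f p)) \<longlongrightarrow> 0) (at 0)"
proof -
  define c where "c h p = (if snd p \<in> S then 0 else 1 - cis (h / \<psi> (snd p) * fst p))" for h p
  have cm: "c h \<in> borel_measurable N" for h unfolding measurable_N c_def[abs_def]
    by (intro measurable_if_S borel_measurable_diff cis_measurable borel_measurable_const)
  have c2: "cmod (c h p) \<le> 2" for h p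
    using norm_triangle_ineq4[of 1 "cis (h / \<psi> (snd p) * fst p)"] by (simp add: c_def)
  have e: "yweight \<sigma> p * (f p - phase h p * f p) = c h p * (yweight \<sigma> p * f p)" for h p
    by (simp add: c_def phase_def yweight_def algebra_simps)
  show ?thesis unfolding e tendsto_at_iff_sequentially comp_def
  proof (intro allI impI)
    fix h :: "nat \<Rightarrow> real" assume h: "h \<longlonglongrightarrow> 0"
    show "(\<lambda>n. nrm (\<lambda>p. c (h n) p * (yweight \<sigma> p * f p))) \<longlonglongrightarrow> 0"
    proof (rule L2_norm_dominated_tendsto_0[OF Yc_weight[OF f] cm c2])
      fix p
      have "(\<lambda>n. 1 - cis (h n / \<psi> (snd p) * fst p)) \<longlonglongrightarrow> 1 - cis (0 / \<psi> (snd p) * fst p)"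
        unfolding divide_inverse by (intro tendsto_intros h)
      then show "(\<lambda>n. c (h n) p) \<longlonglongrightarrow> 0" by (cases "snd p \<in> S") (simp_all add: c_def)
    qed
  qed
qed

text \<open>Split f into phase * f and the difference. The increment of the first is controlled by
  the translated increment of f, that of the second by the weighted bound, in which the difference
  is small when h is small.\<close>

lemma P_norm_le_translate:
  assumes ok: "ok a b" and \<sigma>: "\<sigma> > 1/2" and f: "f \<in> Yc \<sigma>" and c: "isCont (F f) (a + h)" "isCont (F f) (b + h)"
  shows "nrm (P a b f) \<le> nrm (P (a + h) (b + h) f) + sqrt (decay_const \<sigma> / l * (b - a)) * ynrm \<sigma> (\<lambda>p. f p - phase (- h) p * f p)"
proof -
  have ab: "a < b" using ok by (simp add: ok_def)
  define g where "g p = phase (- h) p * f p" for p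
  note fL = Yc_L2[OF f]
  have gL: "g \<in> L2 N" unfolding g_def[abs_def] by (rule phase_mult_L2(1)[OF fL])
  have dL: "(\<lambda>p. f p - g p) \<in> L2 N" by (rule L2_diff[OF fL gL])
  have "yweight \<sigma> p * (f p - g p) = yweight \<sigma> p * f p - phase (- h) p * (yweight \<sigma> p * f p)" for p
    by (simp add: g_def algebra_simps)
  then have dY: "(\<lambda>p. f p - g p) \<in> Yc \<sigma>"
    unfolding Yc_def using dL L2_diff[OF Yc_weight[OF f] phase_mult_L2(1)[OF Yc_weight[OF f], of "- h"]] by simp
  have "AE p in N. P a b f p = P a b (\<lambda>p. f p - g p) p + P a b g p"
    using P_lin[OF dL gL, of a b 1] by simp
  from L2_norm_cong_AE[OF P_L2[OF fL] L2_add[OF P_L2[OF dL] P_L2[OF gL]] this]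
  have "nrm (P a b f) \<le> nrm (P a b (\<lambda>p. f p - g p)) + nrm (P a b g)"
    using L2_norm_triangle[OF P_L2[OF dL] P_L2[OF gL], of a b a b] by simp
  also have "nrm (P a b g) \<le> nrm (P (a + h) (b + h) f)"
    unfolding g_def[abs_def] by (rule P_phase_le'[OF ab fL c])
  also have "nrm (P a b (\<lambda>p. f p - g p)) \<le> sqrt (decay_const \<sigma> / l * (b - a)) * ynrm \<sigma> (\<lambda>p. f p - g p)"
    by (rule P_norm_le_Yc[OF ok \<sigma> dY])
  finally show ?thesis unfolding g_def by simp
qed

text \<open>The translation bound used with h and with -h compares the norms x and y of an increment
  and its translate from both sides, and the differentiability criterion takes over.\<close>

lemma F_differentiable:
  assumes t: "t0 \<noteq> 0" "\<bar>t0\<bar> < l / (4 * M)" and \<sigma>: "\<sigma> > 1/2" and f: "f \<in> Yc \<sigma>"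
  shows "\<exists>D. (F f has_real_derivative D) (at t0)"
proof -
  from ok_near[OF t] obtain \<rho> where \<rho>: "\<rho> > 0" and ok: "\<And>a b. t0 - \<rho> < a \<Longrightarrow> a < b \<Longrightarrow> b < t0 + \<rho> \<Longrightarrow> ok a b"
    by blast
  define K where "K = decay_const \<sigma> / l"
  have K0: "0 \<le> K" using decay_const_nonneg l_pos by (simp add: K_def)
  define Y where "Y = ynrm \<sigma> f"
  have Y0: "0 \<le> Y" unfolding Y_def by (rule L2_norm_nonneg)
  have lip: "\<bar>F f b - F f a\<bar> \<le> K * Y\<^sup>2 * (b - a)" if "t0 - \<rho> < a" "a \<le> b" "b < t0 + \<rho>" for a b
    using F_lipschitz[OF ok \<sigma> f, of a b] that unfolding K_def Y_def by (cases "a = b") auto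
  have c: "isCont (F f) s" if "t0 - \<rho> < s" "s < t0 + \<rho>" for s
    by (rule isCont_if_lipschitz[OF lip that])
  define om where "om h = ynrm \<sigma> (\<lambda>p. f p - phase h p * f p)" for h
  have bound: "\<bar>(F f (b + h) - F f (a + h)) - (F f b - F f a)\<bar> \<le> 2 * K * Y * max (om h) (om (- h)) * (b - a)"
    if a: "t0 - \<rho> < a" "a < b" "b < t0 + \<rho>" and h: "t0 - \<rho> < a + h" "b + h < t0 + \<rho>" for a b h
  proof -
    define s where "s = sqrt (K * (b - a))"
    have s: "0 \<le> s" "s * s = K * (b - a)" using K0 a by (simp_all add: s_def)
    define x where "x = nrm (P a b f)"
    define y where "y = nrm (P (a + h) (b + h) f)"
    define m where "m = max (om h) (om (- h))"
    have m: "om h \<le> m" "om (- h) \<le> m" by (simp_all add: m_def)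
    have o1: "ok a b" and o2: "ok (a + h) (b + h)" using ok a h by auto
    have "x \<le> y + s * om (- h)" unfolding x_def y_def s_def om_def K_def
      using a h by (intro P_norm_le_translate[OF o1 \<sigma> f] c) auto
    moreover have "y \<le> x + s * om h"
      using P_norm_le_translate[OF o2 \<sigma> f, of "- h"] c[of a] c[of b] a
      unfolding x_def y_def s_def om_def K_def by simp
    moreover have "s * om (- h) \<le> s * m" "s * om h \<le> s * m" using m s(1) by (auto intro: mult_left_mono)
    ultimately have d: "\<bar>y - x\<bar> \<le> s * m" by linarith
    have xy: "x \<le> s * Y" "y \<le> s * Y"
      using P_norm_le_Yc[OF o1 \<sigma> f] P_norm_le_Yc[OF o2 \<sigma> f] unfolding x_def y_def s_def K_def Y_def by simp_all
    have xy0: "0 \<le> x" "0 \<le> y" unfolding x_def y_def by (rule L2_norm_nonneg)+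
    \<comment> \<open>In (y - x)(y + x) each factor carries the square root of b - a, so the error
      is linear in b - a as the criterion demands, and the first factor also carries the small
      modulus m.\<close>
    have "(F f (b + h) - F f (a + h)) - (F f b - F f a) = y\<^sup>2 - x\<^sup>2"
      unfolding x_def y_def using P_norm_sq[OF _ Yc_L2[OF f], of a b] P_norm_sq[OF _ Yc_L2[OF f], of "a + h" "b + h"] a by simp
    also have "\<bar>y\<^sup>2 - x\<^sup>2\<bar> = \<bar>y - x\<bar> * (y + x)" using xy0 by (simp add: power2_eq_square square_diff_square_factored abs_mult)
    also have "\<dots> \<le> (s * m) * (s * Y + s * Y)"
      by (intro mult_mono d add_mono xy) (use d xy0 in linarith)+
    also have "\<dots> = 2 * (s * s) * Y * m" by (simp add: algebra_simps)
    also have "\<dots> = 2 * K * Y * m * (b - a)" unfolding s(2) by (simp only: mult_ac)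
    finally show ?thesis unfolding m_def .
  qed
  show ?thesis
  proof (rule differentiable_if_increments_almost_translation_invariant[OF \<rho> lip])
    fix e :: real assume e: "e > 0"
    \<comment> \<open>The 1 keeps the denominator positive when K or Y is 0.\<close>
    define \<epsilon> where "\<epsilon> = e / (2 * K * Y + 1)"
    have KY: "0 < 2 * K * Y + 1" using K0 Y0 by (simp add: add_nonneg_pos)
    have \<epsilon>: "\<epsilon> > 0" using e KY by (simp add: \<epsilon>_def)
    have "(om \<longlongrightarrow> 0) (at 0)" unfolding om_def[abs_def] by (rule phase_increment_tendsto_0[OF f])
    from tendstoD[OF this \<epsilon>] obtain h0 where h0: "h0 > 0" "\<And>h. h \<noteq> 0 \<Longrightarrow> \<bar>h\<bar> < h0 \<Longrightarrow> \<bar>om h\<bar> < \<epsilon>"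
      unfolding eventually_at by (auto simp: dist_real_def)
    have "\<bar>(F f (b + h) - F f (a + h)) - (F f b - F f a)\<bar> \<le> e * (b - a)"
      if h: "\<bar>h\<bar> < h0" and a: "t0 - \<rho> < a" "a \<le> b" "b < t0 + \<rho>" "t0 - \<rho> < a + h" "b + h < t0 + \<rho>" for h a b
    proof (cases "h = 0 \<or> a = b")
      case True
      then show ?thesis using e a by auto
    next
      case False
      have "max (om h) (om (- h)) \<le> \<epsilon>" using h0(2)[of h] h0(2)[of "- h"] False h by auto
      then have "2 * K * Y * max (om h) (om (- h)) * (b - a) \<le> 2 * K * Y * \<epsilon> * (b - a)"
        using K0 Y0 a by (intro mult_right_mono mult_left_mono) auto
      also have "\<dots> \<le> (2 * K * Y + 1) * \<epsilon> * (b - a)" using \<epsilon> a by (intro mult_right_mono) auto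
      also have "(2 * K * Y + 1) * \<epsilon> = e" using KY by (simp add: \<epsilon>_def)
      finally have le: "2 * K * Y * max (om h) (om (- h)) * (b - a) \<le> e * (b - a)" .
      have "\<bar>(F f (b + h) - F f (a + h)) - (F f b - F f a)\<bar> \<le> 2 * K * Y * max (om h) (om (- h)) * (b - a)"
        using a False by (intro bound) simp_all
      from this le show ?thesis by (rule order_trans)
    qed
    then show "\<exists>h0>0. \<forall>h a b. \<bar>h\<bar> < h0 \<longrightarrow> t0 - \<rho> < a \<longrightarrow> a \<le> b \<longrightarrow> b < t0 + \<rho> \<longrightarrow> t0 - \<rho> < a + h \<longrightarrow> b + h < t0 + \<rho> \<longrightarrow>
        \<bar>(F f (b + h) - F f (a + h)) - (F f b - F f a)\<bar> \<le> e * (b - a)"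
      using h0(1) by (intro exI[of _ h0]) simp
  qed
qed

end

section \<open>Absolute continuity and the density of states\<close>

text \<open>Domination on intervals is turned into domination on Borel sets by exhibiting the
  difference as a measure: \<open>\<Psi>\<close> is nondecreasing by hypothesis, and its Stieltjes
  measure added to the restricted \<open>\<nu>\<close> gives K times Lebesgue measure on the
  interval.\<close>

lemma emeasure_null_if_Ioc_le:
  fixes \<nu> :: "real measure"
  assumes fin: "finite_measure \<nu>" and sets: "sets \<nu> = sets borel" and K: "0 \<le> K" and ab0: "a0 \<le> b0"
    and le: "\<And>a b. a0 \<le> a \<Longrightarrow> a \<le> b \<Longrightarrow> b \<le> b0 \<Longrightarrow> measure \<nu> {a<..b} \<le> K * (b - a)"
    and B: "B \<in> null_sets lborel" and BI: "B \<subseteq> {a0<..b0}"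
  shows "emeasure \<nu> B = 0"
proof -
  interpret finite_measure \<nu> by (rule fin)
  note [simp] = sets
  have Bs: "B \<in> sets borel" using null_setsD2[OF B] by simp
  \<comment> \<open>Clamping to [a0, b0] extends the distribution functions to the whole line,
    constant outside the interval.\<close>
  define c where "c t = max a0 (min b0 t)" for t
  have c: "a0 \<le> c t" "c t \<le> b0" for t using ab0 by (auto simp: c_def)
  have cm: "c s \<le> c t" "c t - c s \<le> t - s" if "s \<le> t" for s t using that by (auto simp: c_def max_def min_def)
  define \<Phi> where "\<Phi> t = measure \<nu> {a0<..c t}" for t
  have \<Phi>d: "\<Phi> t - \<Phi> s = measure \<nu> {c s<..c t}" if "s \<le> t" for s t
  proof -
    have "{a0<..c t} = {a0<..c s} \<union> {c s<..c t}" using c(1)[of s] cm(1)[OF that] by auto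
    then show ?thesis unfolding \<Phi>_def by (simp add: finite_measure_Union)
  qed
  define \<Psi> where "\<Psi> t = K * (c t - a0) - \<Phi> t" for t
  have \<Psi>d: "\<Psi> t - \<Psi> s = K * (c t - c s) - measure \<nu> {c s<..c t}" if "s \<le> t" for s t
    using \<Phi>d[OF that] by (simp add: \<Psi>_def algebra_simps)
  have \<Psi>m: "\<Psi> s \<le> \<Psi> t" if "s \<le> t" for s t
    using \<Psi>d[OF that] le[OF c(1) cm(1)[OF that] c(2)] by simp
  have lip: "\<bar>\<Psi> t - \<Psi> s\<bar> \<le> K * (t - s)" if "s \<le> t" for s t
  proof -
    have "\<bar>\<Psi> t - \<Psi> s\<bar> \<le> K * (c t - c s)" using \<Psi>d[OF that] \<Psi>m[OF that] by simp
    also have "\<dots> \<le> K * (t - s)" by (rule mult_left_mono[OF cm(2)[OF that] K])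
    finally show ?thesis .
  qed
  have \<Psi>c: "continuous (at_right t) \<Psi>" for t
  proof -
    have "isCont \<Psi> t" by (rule isCont_if_lipschitz[of "t - 1" "t + 1" \<Psi> K]) (use lip in auto)
    then show ?thesis by (rule continuous_within_subset) simp
  qed
  let ?M2 = "interval_measure \<Psi>"
  have M2: "emeasure ?M2 {a<..b} = ennreal (\<Psi> b - \<Psi> a)" if "a \<le> b" for a b
    by (rule emeasure_interval_measure_Ioc[OF that \<Psi>m \<Psi>c])
  have f2: "finite_measure ?M2"
  proof
    have "(\<Union>n. {- real n<..real n}) = (UNIV :: real set)"
    proof (intro equalityI subsetI)
      fix x :: real
      obtain n :: nat where "\<bar>x\<bar> < real n" using reals_Archimedean2 by blast
      then show "x \<in> (\<Union>n. {- real n<..real n})" by (intro UN_I[of n]) auto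
    qed simp
    moreover have "(SUP n. emeasure ?M2 {- real n<..real n}) = emeasure ?M2 (\<Union>n. {- real n<..real n})"
      by (rule SUP_emeasure_incseq) (auto simp: incseq_def)
    moreover have "(SUP n. emeasure ?M2 {- real n<..real n}) \<le> ennreal (K * (b0 - a0))"
    proof (rule SUP_least)
      fix n :: nat
      have "\<Psi> (real n) - \<Psi> (- real n) \<le> K * (c (real n) - c (- real n))"
        using \<Psi>d[of "- real n" "real n"] by simp
      also have "\<dots> \<le> K * (b0 - a0)" using K c[of "real n"] c[of "- real n"] by (intro mult_left_mono) auto
      finally show "emeasure ?M2 {- real n<..real n} \<le> ennreal (K * (b0 - a0))" by (simp add: M2 ennreal_leI)
    qed
    ultimately have "emeasure ?M2 UNIV \<le> ennreal (K * (b0 - a0))" by simp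
    then show "emeasure ?M2 (space ?M2) \<noteq> \<infinity>" by (auto simp: top_unique)
  qed
  let ?I = "{a0<..b0}"
  have Ic: "?I \<inter> {a<..b} = {c a<..c b}" if "a \<le> b" for a b
    using that ab0 by (auto simp: c_def)
  let ?M1 = "density \<nu> (indicator ?I)"
  have M1: "emeasure ?M1 A = emeasure \<nu> (?I \<inter> A)" if "A \<in> sets borel" for A
    using that by (intro emeasure_restricted) simp_all
  have f1: "finite_measure ?M1"
  proof
    have "emeasure ?M1 (space ?M1) = emeasure \<nu> (?I \<inter> UNIV)" using M1[of UNIV] sets_eq_imp_space_eq[OF sets] by simp
    then show "emeasure ?M1 (space ?M1) \<noteq> \<infinity>" using emeasure_finite by simp
  qed
  let ?M3 = "density lborel (\<lambda>x. ennreal K * indicator ?I x)"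
  have M3: "emeasure ?M3 A = ennreal K * emeasure lborel (?I \<inter> A)" if "A \<in> sets borel" for A
  proof -
    have "emeasure ?M3 A = (\<integral>\<^sup>+x. ennreal K * indicator ?I x * indicator A x \<partial>lborel)"
      using that by (intro emeasure_density) simp_all
    also have "\<dots> = (\<integral>\<^sup>+x. ennreal K * indicator (?I \<inter> A) x \<partial>lborel)"
      by (rule nn_integral_cong) (simp add: indicator_def)
    finally show ?thesis using that by (simp add: nn_integral_cmult_indicator)
  qed
  have f3: "finite_measure ?M3"
  proof
    show "emeasure ?M3 (space ?M3) \<noteq> \<infinity>" using M3[of UNIV] ab0 by (simp add: ennreal_mult_eq_top_iff)
  qed
  have f4: "finite_measure (null_measure (borel :: real measure))" by (intro finite_measureI) simp
  have "emeasure ?M1 B + emeasure ?M2 B = emeasure ?M3 B + emeasure (null_measure borel) B"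
  proof (rule emeasure_add_eqI_Ioc[OF f1 f2 f3 f4])
    fix a b :: real assume ab: "a \<le> b"
    have "emeasure ?M1 {a<..b} = emeasure \<nu> {c a<..c b}" using M1[of "{a<..b}"] unfolding Ic[OF ab] by simp
    then have "measure ?M1 {a<..b} = measure \<nu> {c a<..c b}" by (simp only: measure_def)
    moreover have "measure ?M2 {a<..b} = \<Psi> b - \<Psi> a" unfolding measure_def M2[OF ab] using \<Psi>m[OF ab] by simp
    moreover have "measure ?M3 {a<..b} = K * (c b - c a)" unfolding measure_def
      using M3[of "{a<..b}"] cm(1)[OF ab] K unfolding Ic[OF ab] by (simp add: enn2real_mult)
    ultimately show "measure ?M1 {a<..b} + measure ?M2 {a<..b} = measure ?M3 {a<..b} + measure (null_measure borel) {a<..b}"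
      using \<Psi>d[OF ab] by simp
  qed (use B in auto)
  moreover have "emeasure ?M3 B = 0"
  proof -
    have "?I \<inter> B \<in> null_sets lborel" using B by (intro null_set_Int1) simp_all
    then show ?thesis using M3[OF Bs] by (simp add: null_setsD1)
  qed
  ultimately have "emeasure ?M1 B = 0" by simp
  moreover have "?I \<inter> B = B" using BI by blast
  ultimately show ?thesis using M1[OF Bs] by simp
qed

section \<open>Absolute continuity and the derivative of the spectral family\<close>

context confined_resolution
begin

text \<open>The Lipschitz bound is available only on short intervals away from 0. By Lindelof
  countably many of them cover B, and on each the piece of B is null.\<close>

lemma mu_null_if_Yc:
  assumes \<sigma>: "\<sigma> > 1/2" and f: "f \<in> Yc \<sigma>" and B: "B \<in> null_sets lborel" and BU: "\<And>t. t \<in> B \<Longrightarrow> t \<noteq> 0 \<and> \<bar>t\<bar> < l / (4 * M)"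
  shows "B \<in> null_sets (mu f)"
proof -
  note fL = Yc_L2[OF f]
  \<comment> \<open>Open intervals all of whose subintervals, endpoints included, satisfy
    \<open>ok\<close>; so the Lipschitz bound with one constant holds up to the closed
    interval.\<close>
  define \<F> where "\<F> = {{x<..<y} |x y. x < y \<and> (\<forall>a b. x \<le> a \<longrightarrow> a < b \<longrightarrow> b \<le> y \<longrightarrow> ok a b)}"
  have "open I" if "I \<in> \<F>" for I using that by (auto simp: \<F>_def)
  then obtain \<G> where \<G>: "\<G> \<subseteq> \<F>" "countable \<G>" "\<Union>\<G> = \<Union>\<F>" by (rule Lindelof)
  have cover: "B \<subseteq> \<Union>\<F>"
  proof
    fix t assume "t \<in> B"
    then have t: "t \<noteq> 0" "\<bar>t\<bar> < l / (4 * M)" using BU by auto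
    from ok_near[OF t] obtain \<rho> where \<rho>: "\<rho> > 0" and ok: "\<And>a b. t - \<rho> < a \<Longrightarrow> a < b \<Longrightarrow> b < t + \<rho> \<Longrightarrow> ok a b" by blast
    have "{t - \<rho> / 2<..<t + \<rho> / 2} \<in> \<F>" unfolding \<F>_def
    proof (rule CollectI, rule exI[of _ "t - \<rho> / 2"], rule exI[of _ "t + \<rho> / 2"], intro conjI allI impI refl)
      fix a b assume "t - \<rho> / 2 \<le> a" "a < b" "b \<le> t + \<rho> / 2"
      then show "ok a b" using \<rho> by (intro ok) linarith+
    qed (use \<rho> in simp)
    moreover have "t \<in> {t - \<rho> / 2<..<t + \<rho> / 2}" using \<rho> by simp
    ultimately show "t \<in> \<Union>\<F>" by (rule UnionI)
  qed
  have "B \<inter> I \<in> null_sets (mu f)" if I: "I \<in> \<G>" for I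
  proof -
    from I \<G>(1) obtain x y where xy: "I = {x<..<y}" "x < y" and ok: "\<And>a b. x \<le> a \<Longrightarrow> a < b \<Longrightarrow> b \<le> y \<Longrightarrow> ok a b"
      by (auto simp: \<F>_def)
    have BI: "B \<inter> I \<in> null_sets lborel" using B by (intro null_set_Int2) (simp_all add: xy)
    have "emeasure (mu f) (B \<inter> I) = 0"
    proof (rule emeasure_null_if_Ioc_le[OF finite_mu[OF fL] sets_mu _ less_imp_le[OF xy(2)] _ BI])
      show "0 \<le> decay_const \<sigma> / l * (ynrm \<sigma> f)\<^sup>2" using decay_const_nonneg l_pos by simp
      fix a b assume a: "x \<le> a" "a \<le> b" "b \<le> y"
      show "measure (mu f) {a<..b} \<le> decay_const \<sigma> / l * (ynrm \<sigma> f)\<^sup>2 * (b - a)"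
        unfolding mu_Ioc[OF fL a(2)] using F_lipschitz[OF ok \<sigma> f, of a b] a by (cases "a = b") auto
    qed (auto simp: xy)
    then show ?thesis using BI by (intro null_setsI) auto
  qed
  then have "(\<Union>I\<in>\<G>. B \<inter> I) \<in> null_sets (mu f)" by (intro null_sets_UN' \<G>(2))
  moreover have "(\<Union>I\<in>\<G>. B \<inter> I) = B" using cover \<G>(3) by blast
  ultimately show ?thesis by simp
qed

text \<open>Truncating f to |x_1| \<le> n off S makes the weighted norm finite, so that part gives B
  no mass. The remainder tends to 0 in norm, and the parallelogram bound limits the mass of f to
  twice the squared norm of the remainder.\<close>

lemma mu_null:
  assumes f: "f \<in> L2 N" and B: "B \<in> null_sets lborel" and BU: "\<And>t. t \<in> B \<Longrightarrow> t \<noteq> 0 \<and> \<bar>t\<bar> < l / (4 * M)"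
  shows "measure (mu f) B = 0"
proof -
  define c where "c n p = (if snd p \<in> S then 1 else if \<bar>fst p\<bar> \<le> real n then 1 else (0::complex))" for n :: nat and p :: point
  have cm: "c n \<in> borel_measurable ZZ" for n
  proof -
    have "(\<lambda>s::real. if \<bar>s\<bar> \<le> real n then 1 else (0::complex)) \<in> borel_measurable borel" by measurable
    from measurable_compose[OF measurable_fst_full this]
    show ?thesis unfolding c_def[abs_def] by (intro measurable_if_S) simp_all
  qed
  have cm': "c n \<in> borel_measurable N" for n unfolding measurable_N by (rule cm)
  have cm2: "(\<lambda>p. 1 - c n p) \<in> borel_measurable N" for n by (intro borel_measurable_diff borel_measurable_const cm')
  have c1: "cmod (1 - c n p) \<le> 1" for n p by (simp add: c_def)
  define f1 where "f1 n p = c n p * f p" for n p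
  define f2 where "f2 n p = (1 - c n p) * f p" for n p
  have f1L: "f1 n \<in> L2 N" for n unfolding f1_def[abs_def] by (rule L2_mult_bounded[OF f cm', where K=1]) (simp add: c_def)
  have f2L: "f2 n \<in> L2 N" for n unfolding f2_def[abs_def]
    by (rule L2_mult_bounded[OF f cm2 AE_I2[OF c1]])
  \<comment> \<open>Absolute continuity does not mention sigma, so an exponent above 1/2 is chosen
    freely; after truncation the weight is bounded.\<close>
  have f1Y: "f1 n \<in> Yc 1" for n
  proof -
    have "(\<lambda>p. (yweight 1 p * c n p) * f p) \<in> L2 N"
    proof (rule L2_mult_bounded[OF f])
      show "(\<lambda>p. yweight 1 p * c n p) \<in> borel_measurable N" unfolding measurable_N by (intro borel_measurable_times yweight_measurable cm)
      have "cmod (yweight 1 p * c n p) \<le> (1 + (real n)\<^sup>2) powr (1 / 2)" for p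
      proof (cases "snd p \<notin> S \<and> \<bar>fst p\<bar> \<le> real n")
        case True
        then have "(fst p)\<^sup>2 \<le> (real n)\<^sup>2" by (simp add: abs_le_square_iff[symmetric])
        then have "(1 + (fst p)\<^sup>2) powr (1 / 2) \<le> (1 + (real n)\<^sup>2) powr (1 / 2)" by (intro powr_mono2) simp_all
        then show ?thesis using True by (simp add: yweight_def c_def)
      qed (auto simp: yweight_def c_def)
      then show "AE p in N. cmod (yweight 1 p * c n p) \<le> (1 + (real n)\<^sup>2) powr (1 / 2)" by simp
    qed
    then show ?thesis unfolding Yc_def using f1L[of n] by (simp add: f1_def mult.assoc)
  qed
  let ?r = "complex_of_real (sqrt 2)"
  have bound: "measure (mu f) B \<le> 2 * (nrm (f2 n))\<^sup>2" for n
  proof -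
    have Bb: "B \<in> sets borel" using B by auto
    have "(\<lambda>p. f1 n p + (?r - 1) * f1 n p) = (\<lambda>p. ?r * f1 n p)" by (simp add: algebra_simps)
    then have "(\<lambda>p. ?r * f1 n p) \<in> Yc 1" using Yc_lin[OF f1Y f1Y, of n "?r - 1" n] by simp
    then have "B \<in> null_sets (mu (\<lambda>p. ?r * f1 n p))" by (rule mu_null_if_Yc[OF _ _ B BU, rotated]) simp_all
    then have z: "emeasure (mu (\<lambda>p. ?r * f1 n p)) B = 0" by (rule null_setsD1)
    have e: "(\<lambda>p. f1 n p + f2 n p) = f" by (simp add: f1_def f2_def algebra_simps)
    have "emeasure (mu f) B \<le> emeasure (mu (\<lambda>p. ?r * f2 n p)) B"
      using mu_parallelogram[OF f1L f2L Bb, of n n] unfolding e z by simp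
    then have "measure (mu f) B \<le> measure (mu (\<lambda>p. ?r * f2 n p)) B"
      using finite_mu[OF f] finite_mu[OF L2_scale[OF f2L, of ?r n]]
      by (simp add: finite_measure.emeasure_eq_measure)
    also have "\<dots> \<le> (nrm (\<lambda>p. ?r * f2 n p))\<^sup>2" by (rule measure_mu_le[OF L2_scale[OF f2L]])
    finally show ?thesis by (simp add: L2_norm_scale power_mult_distrib)
  qed
  have "(\<lambda>n. nrm (f2 n)) \<longlonglongrightarrow> 0" unfolding f2_def[abs_def]
  proof (rule L2_norm_dominated_tendsto_0[OF f cm2 c1])
    fix p :: point
    obtain n0 :: nat where n0: "\<bar>fst p\<bar> < real n0" using reals_Archimedean2 by blast
    have "\<forall>\<^sub>F n in sequentially. 1 - c n p = 0"
      using eventually_ge_at_top[of n0] by (rule eventually_mono) (use n0 in \<open>auto simp: c_def\<close>)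
    then show "(\<lambda>n. 1 - c n p) \<longlonglongrightarrow> 0" by (rule tendsto_eventually)
  qed
  then have "(\<lambda>n. 2 * (nrm (f2 n))\<^sup>2) \<longlonglongrightarrow> 2 * 0\<^sup>2" by (intro tendsto_intros)
  then have "measure (mu f) B \<le> 2 * 0\<^sup>2" by (rule LIMSEQ_le_const) (use bound in blast)
  then show ?thesis using measure_nonneg[of "mu f" B] by simp
qed

lemma ac_spectrum: "ac_spectrum_in N E ({- (l / (4 * M))<..<l / (4 * M)} - {0})"
  unfolding ac_spectrum_in_def
proof (intro ballI impI)
  fix f g B assume f: "f \<in> L2 N" and g: "g \<in> L2 N" and B: "B \<in> null_sets (lborel :: real measure)"
    and BU: "B \<subseteq> {- (l / (4 * M))<..<l / (4 * M)} - {0}"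
  have "t \<noteq> 0 \<and> \<bar>t\<bar> < l / (4 * M)" if "t \<in> B" for t using that BU by (auto simp: abs_less_iff)
  then have "measure (mu (\<lambda>x. f x + \<i> ^ k * g x)) B = 0" for k
    by (intro mu_null B L2_add f L2_scale g)
  then show "spectral_cmeasure N E f g B = 0" by (simp add: spectral_cmeasure_def)
qed

lemma inner_polarization:
  assumes f: "f \<in> L2 N" and g: "g \<in> L2 N"
  shows "ip (E t f) g = of_real ((F (\<lambda>p. f p + 1 * g p) t - F f t - F g t) / 2) + \<i> * of_real ((F (\<lambda>p. f p + \<i> * g p) t - F f t - F g t) / 2)"
proof -
  have "F (\<lambda>p. f p + 1 * g p) t = F f t + F g t + 2 * Re (ip (E t f) g)" using F_add[OF f g] by simp
  moreover have "F (\<lambda>p. f p + \<i> * g p) t = F f t + F g t + 2 * Im (ip (E t f) g)"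
    using F_add[OF f L2_scale[OF g, of \<i>]] F_scale[OF g, of \<i>] by (simp add: L2_inner_scale_right)
  ultimately show ?thesis by (simp add: complex_eq_iff)
qed

text \<open>Existence of the derivative follows from the diagonal case by polarization, but a bound
  obtained that way would not have the product form. It comes instead from Cauchy-Schwarz for the
  increments of f and g, each of order sqrt h, so that their product divided by h stays
  bounded.\<close>

lemma density_of_states:
  assumes t: "t0 \<noteq> 0" "\<bar>t0\<bar> < l / (4 * M)" and \<sigma>: "\<sigma> > 1/2" and f: "f \<in> Yc \<sigma>" and g: "g \<in> Yc \<sigma>"
  shows "\<exists>D. ((\<lambda>t. ip (E t f) g) has_vector_derivative D) (at t0) \<and> cmod D \<le> decay_const \<sigma> / l * ynrm \<sigma> f * ynrm \<sigma> g"
proof -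
  note fL = Yc_L2[OF f] and gL = Yc_L2[OF g]
  define r where "r a t = (F (\<lambda>p. f p + a * g p) t - F f t - F g t) / 2" for a t
  have G: "ip (E t f) g = of_real (r 1 t) + \<i> * of_real (r \<i> t)" for t
    unfolding r_def by (rule inner_polarization[OF fL gL])
  have "\<exists>D. (r a has_real_derivative D) (at t0)" for a
  proof -
    obtain D1 where D1: "(F f has_real_derivative D1) (at t0)" using F_differentiable[OF t \<sigma> f] by blast
    obtain D2 where D2: "(F g has_real_derivative D2) (at t0)" using F_differentiable[OF t \<sigma> g] by blast
    obtain D3 where D3: "(F (\<lambda>p. f p + a * g p) has_real_derivative D3) (at t0)" using F_differentiable[OF t \<sigma> Yc_lin[OF f g]] by blast
    have "(r a has_real_derivative (D3 - D1 - D2) / 2) (at t0)" unfolding r_def[abs_def]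
      by (intro DERIV_cdivide DERIV_diff D1 D2 D3)
    then show ?thesis ..
  qed
  then obtain D1 D2 where D1: "(r 1 has_real_derivative D1) (at t0)" and D2: "(r \<i> has_real_derivative D2) (at t0)" by blast
  define D where "D = of_real D1 + \<i> * of_real D2"
  have v1: "((\<lambda>t. complex_of_real (r 1 t)) has_vector_derivative of_real D1) (at t0)"
    using D1 unfolding has_real_derivative_iff_has_vector_derivative by (rule bounded_linear.has_vector_derivative[OF bounded_linear_of_real])
  have v2: "((\<lambda>t. complex_of_real (r \<i> t)) has_vector_derivative of_real D2) (at t0)"
    using D2 unfolding has_real_derivative_iff_has_vector_derivative by (rule bounded_linear.has_vector_derivative[OF bounded_linear_of_real])
  have v: "((\<lambda>t. ip (E t f) g) has_vector_derivative D) (at t0)"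
    unfolding G D_def by (intro has_vector_derivative_add v1 bounded_linear.has_vector_derivative[OF bounded_linear_mult_right v2])
  define q where "q h = of_real ((r 1 (t0 + h) - r 1 t0) / h) + \<i> * of_real ((r \<i> (t0 + h) - r \<i> t0) / h)" for h
  have "(q \<longlongrightarrow> D) (at 0)" unfolding q_def[abs_def] D_def
    using D1 D2 unfolding DERIV_def by (intro tendsto_intros)
  then have "(q \<longlongrightarrow> D) (at_right 0)" by (rule tendsto_mono[rotated]) (simp add: at_within_le_at)
  then have lim: "((\<lambda>h. cmod (q h)) \<longlongrightarrow> cmod D) (at_right 0)" by (rule tendsto_norm)
  from ok_near[OF t] obtain \<rho> where \<rho>: "\<rho> > 0" and ok: "\<And>a b. t0 - \<rho> < a \<Longrightarrow> a < b \<Longrightarrow> b < t0 + \<rho> \<Longrightarrow> ok a b" by blast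
  have "cmod (q h) \<le> decay_const \<sigma> / l * ynrm \<sigma> f * ynrm \<sigma> g" if h: "0 < h" "h < \<rho>" for h
  proof -
    have o: "ok t0 (t0 + h)" using ok[of t0 "t0 + h"] h \<rho> by simp
    define s where "s = sqrt (decay_const \<sigma> / l * h)"
    have s: "s * s = decay_const \<sigma> / l * h" "0 \<le> s" using decay_const_nonneg l_pos h by (simp_all add: s_def)
    have "of_real h * q h = ip (P t0 (t0 + h) f) g"
      unfolding P_inner[OF fL gL] G q_def using h by (simp add: field_simps)
    also have "\<dots> = ip (P t0 (t0 + h) f) (P t0 (t0 + h) g)" using h by (intro P_idem_inner[symmetric] fL gL) simp
    finally have "h * cmod (q h) \<le> nrm (P t0 (t0 + h) f) * nrm (P t0 (t0 + h) g)"
      using L2_Cauchy_Schwarz[OF P_L2[OF fL] P_L2[OF gL], of t0 "t0 + h" t0 "t0 + h"] h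
      by (metis norm_mult norm_of_real abs_of_pos)
    also have "\<dots> \<le> (s * ynrm \<sigma> f) * (s * ynrm \<sigma> g)"
      using P_norm_le_Yc[OF o \<sigma> f] P_norm_le_Yc[OF o \<sigma> g] s(2) unfolding s_def
      by (intro mult_mono) (simp_all add: L2_norm_nonneg)
    also have "\<dots> = (s * s) * (ynrm \<sigma> f * ynrm \<sigma> g)" by (simp only: mult_ac)
    also have "\<dots> = h * (decay_const \<sigma> / l * ynrm \<sigma> f * ynrm \<sigma> g)" unfolding s(1) by (simp only: mult_ac)
    finally show ?thesis using h(1) by (simp only: mult_le_cancel_left_pos)
  qed
  then have "\<forall>\<^sub>F h in at_right 0. cmod (q h) \<le> decay_const \<sigma> / l * ynrm \<sigma> f * ynrm \<sigma> g"
    using \<rho> unfolding eventually_at_right_field by blast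
  from tendsto_upperbound[OF lim this] v show ?thesis by auto
qed

text \<open>Off S the weight is at least 1, so the first norm controls the plain norm as well; over
  S the two unweighted norms coincide and the weight contributes 0.\<close>

lemma Y_space_Yc:
  assumes f: "f \<in> Y_space d S w \<sigma>" and \<sigma>: "\<sigma> > 1/2"
  shows "f \<in> Yc \<sigma>" "ynrm \<sigma> f \<le> Y_norm d S w \<sigma> f"
proof -
  have fm: "f \<in> borel_measurable ZZ"
    and fib: "AE y in X. (\<lambda>s. f (s, y)) \<in> (if y \<in> S then L2 (wfib w y) else L2 (sfib \<sigma>))"
    and fin: "Y_sqnorm d S w \<sigma> f < \<infinity>" using f by (auto simp: Y_space_def)
  define a where "a y = ennreal ((L2_norm (wfib w y) (\<lambda>s. f (s, y)))\<^sup>2) * indicator S y" for y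
  define b where "b y = ennreal ((L2_norm (sfib \<sigma>) (\<lambda>s. f (s, y)))\<^sup>2) * indicator (Rperp d - S) y" for y
  have Y: "Y_sqnorm d S w \<sigma> f = (\<integral>\<^sup>+y. a y \<partial>X) + (\<integral>\<^sup>+y. b y \<partial>X)" by (simp add: Y_sqnorm_def a_def b_def)
  define h where "h y = (\<integral>\<^sup>+s. ennreal ((cmod (f (s, y)))\<^sup>2) \<partial>wfib w y)" for y
  define k where "k y = (\<integral>\<^sup>+s. ennreal ((cmod (yweight \<sigma> (s, y) * f (s, y)))\<^sup>2) \<partial>wfib w y)" for y
  have out: "b y = (\<integral>\<^sup>+s. ennreal ((1 + s\<^sup>2) powr \<sigma>) * ennreal ((cmod (f (s, y)))\<^sup>2) \<partial>lebesgue)"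
    if y: "y \<in> Rperp d - S" and L: "(\<lambda>s. f (s, y)) \<in> L2 (sfib \<sigma>)" for y
  proof -
    have "(\<lambda>s. f (s, y)) \<in> borel_measurable lebesgue" using L2_measurable[OF L] by (simp add: sfib_def)
    then have m: "(\<lambda>s. ennreal ((cmod (f (s, y)))\<^sup>2)) \<in> borel_measurable lebesgue" by measurable
    have wm: "(\<lambda>s. ennreal ((1 + s\<^sup>2) powr \<sigma>)) \<in> borel_measurable lebesgue" by (rule measurable_completion) measurable
    have "b y = (\<integral>\<^sup>+s. ennreal ((cmod (f (s, y)))\<^sup>2) \<partial>sfib \<sigma>)" using y L2_norm_sq_nn[OF L] by (simp add: b_def)
    then show ?thesis unfolding sfib_def using nn_integral_density[OF wm m] by simp
  qed
  have k_le: "AE y in X. k y \<le> b y"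
    using AE_Rperp fib
  proof eventually_elim
    case (elim y)
    show ?case
    proof (cases "y \<in> S")
      case True
      then show ?thesis by (simp add: k_def yweight_def)
    next
      case False
      then have y: "y \<in> Rperp d - S" and L: "(\<lambda>s. f (s, y)) \<in> L2 (sfib \<sigma>)" using elim by auto
      have "((1 + s\<^sup>2) powr (\<sigma> / 2))\<^sup>2 = (1 + s\<^sup>2) powr \<sigma>" for s :: real
        by (simp add: power2_eq_square powr_add[symmetric])
      then have "k y = b y" unfolding k_def wfib_outside[OF y] out[OF y L] using False
        by (intro nn_integral_cong) (simp add: yweight_def norm_mult power_mult_distrib ennreal_mult)
      then show ?thesis by simp
    qed
  qed
  have h_in: "AE y in X. h y * indicator S y \<le> a y"
    using fib
  proof eventually_elim
    case (elim y)
    then show ?case by (cases "y \<in> S") (simp_all add: h_def a_def L2_norm_sq_nn)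
  qed
  have h_out: "AE y in X. h y * indicator (Rperp d - S) y \<le> b y"
    using AE_Rperp fib
  proof eventually_elim
    case (elim y)
    show ?case
    proof (cases "y \<in> S")
      case False
      then have y: "y \<in> Rperp d - S" and L: "(\<lambda>s. f (s, y)) \<in> L2 (sfib \<sigma>)" using elim by auto
      have "h y \<le> b y" unfolding h_def wfib_outside[OF y] out[OF y L]
      proof (rule nn_integral_mono)
        fix s :: real
        have "1 \<le> (1 + s\<^sup>2) powr \<sigma>" using \<sigma> by (intro ge_one_powr_ge_zero) simp_all
        then have "(cmod (f (s, y)))\<^sup>2 \<le> (1 + s\<^sup>2) powr \<sigma> * (cmod (f (s, y)))\<^sup>2"
          using mult_right_mono[of 1 "(1 + s\<^sup>2) powr \<sigma>" "(cmod (f (s, y)))\<^sup>2"] by simp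
        then show "ennreal ((cmod (f (s, y)))\<^sup>2) \<le> ennreal ((1 + s\<^sup>2) powr \<sigma>) * ennreal ((cmod (f (s, y)))\<^sup>2)"
          by (simp add: ennreal_leI flip: ennreal_mult)
      qed
      then show ?thesis using y by simp
    qed simp
  qed
  have hm: "h \<in> borel_measurable X" unfolding h_def[abs_def] by (rule nn_fib_measurable[OF fm])
  have Sc: "Rperp d - S \<in> sets X" using sets.compl_sets[OF S_sets] by (simp add: space_X)
  have "(\<integral>\<^sup>+y. h y \<partial>X) = (\<integral>\<^sup>+y. h y * indicator S y + h y * indicator (Rperp d - S) y \<partial>X)"
    by (rule nn_integral_cong_AE, use AE_Rperp in eventually_elim) (simp add: indicator_def)
  also have "\<dots> = (\<integral>\<^sup>+y. h y * indicator S y \<partial>X) + (\<integral>\<^sup>+y. h y * indicator (Rperp d - S) y \<partial>X)"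
    by (intro nn_integral_add borel_measurable_times_ennreal borel_measurable_indicator hm S_sets Sc)
  also have "\<dots> \<le> Y_sqnorm d S w \<sigma> f" unfolding Y by (intro add_mono nn_integral_mono_AE h_in h_out)
  finally have hfin: "(\<integral>\<^sup>+y. h y \<partial>X) < \<infinity>" using fin by (rule le_less_trans)
  have fL: "f \<in> L2 N" unfolding L2_iff_nn_integral
    using hfin nn_L2_fib[OF fm] fm by (simp add: measurable_N h_def)
  have wfm: "(\<lambda>p. yweight \<sigma> p * f p) \<in> borel_measurable ZZ" by (intro borel_measurable_times yweight_measurable fm)
  have "(\<integral>\<^sup>+y. k y \<partial>X) \<le> (\<integral>\<^sup>+y. b y \<partial>X)" by (rule nn_integral_mono_AE[OF k_le])
  also have "\<dots> \<le> Y_sqnorm d S w \<sigma> f" unfolding Y by (rule add_increasing) simp_all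
  finally have kY: "(\<integral>\<^sup>+y. k y \<partial>X) \<le> Y_sqnorm d S w \<sigma> f" .
  then have wL: "(\<lambda>p. yweight \<sigma> p * f p) \<in> L2 N" unfolding L2_iff_nn_integral
    using nn_L2_fib[OF wfm] wfm fin by (simp add: measurable_N k_def le_less_trans)
  with fL show "f \<in> Yc \<sigma>" by (simp add: Yc_def)
  have "ennreal ((ynrm \<sigma> f)\<^sup>2) \<le> Y_sqnorm d S w \<sigma> f"
    unfolding L2_norm_sq_nn[OF wL] nn_L2_fib[OF wfm] using kY by (simp add: k_def)
  then have "(ynrm \<sigma> f)\<^sup>2 \<le> enn2real (Y_sqnorm d S w \<sigma> f)"
    using fin enn2real_mono[of "ennreal ((ynrm \<sigma> f)\<^sup>2)" "Y_sqnorm d S w \<sigma> f"] by simp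
  then show "ynrm \<sigma> f \<le> Y_norm d S w \<sigma> f" unfolding Y_norm_def by (rule real_le_rsqrt)
qed

end

theorem theorem4p6:
  shows "\<exists>C :: real \<Rightarrow> real \<Rightarrow> real \<Rightarrow> real \<Rightarrow> real.
    \<forall>(d :: nat) (\<psi> :: perp \<Rightarrow> real) (l :: real) (L :: real) (M :: real) (S :: perp set)
      (w :: point \<Rightarrow> real) (\<sigma> :: real).
      2 \<le> d \<longrightarrow>
      0 < l \<longrightarrow>
      (\<forall>x\<in>Rperp d. l < \<psi> x) \<longrightarrow>
      (\<forall>x\<in>Rperp d. \<forall>y\<in>Rperp d. \<bar>\<psi> x - \<psi> y\<bar> \<le> L * dist_perp d x y) \<longrightarrow>
      confined_weight d M S w \<longrightarrow>
      1 / 2 < \<sigma> \<longrightarrow>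
      0 < emeasure (leb_perp d) (Rperp d - S) \<longrightarrow>
      self_adjoint (wmeas d w) (D_symm d \<psi> w) (H_op d \<psi> w) \<and>
      (\<exists>\<delta>>0.
        (\<forall>\<mu>\<in>{-\<delta><..<\<delta>} - {0}. \<not> eigenvalue (wmeas d w) (D_symm d \<psi> w) (H_op d \<psi> w) (of_real \<mu>)) \<and>
        (\<forall>E. spectral_family (wmeas d w) (D_symm d \<psi> w) (H_op d \<psi> w) E \<longrightarrow>
          ac_spectrum_in (wmeas d w) E ({-\<delta><..<\<delta>} - {0}) \<and>
          (\<forall>f\<in>Y_space d S w \<sigma>. \<forall>g\<in>Y_space d S w \<sigma>. \<forall>t0. 0 < \<bar>t0\<bar> \<and> \<bar>t0\<bar> < \<delta> \<longrightarrow>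
            (\<lambda>t. L2_inner (wmeas d w) (E t f) g) differentiable (at t0) \<and>
            cmod (vector_derivative (\<lambda>t. L2_inner (wmeas d w) (E t f) g) (at t0))
              \<le> C \<sigma> l L t0 * Y_norm d S w \<sigma> f * Y_norm d S w \<sigma> g)))"
proof (rule exI[of _ "\<lambda>\<sigma> l L t0. decay_const \<sigma> / l"], intro allI impI)
  \<comment> \<open>The witness \<open>decay_const \<sigma> / l\<close> is fixed before the
    dimension, \<open>\<psi>\<close>, M, S and the weight.\<close>
  fix d :: nat and \<psi> :: "perp \<Rightarrow> real" and l L M :: real and S :: "perp set" and w :: "point \<Rightarrow> real" and \<sigma> :: real
  assume l: "0 < l" and psi: "\<forall>x\<in>Rperp d. l < \<psi> x"
    and lip: "\<forall>x\<in>Rperp d. \<forall>y\<in>Rperp d. \<bar>\<psi> x - \<psi> y\<bar> \<le> L * dist_perp d x y"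
    and conf: "confined_weight d M S w" and \<sigma>: "1 / 2 < \<sigma>" and out: "0 < emeasure (leb_perp d) (Rperp d - S)"
  interpret confined_operator d \<psi> l L M S w
    by unfold_locales (use l psi lip conf out in blast)+
  \<comment> \<open>Exactly the range in which 4 M |t| < l, the condition for absorbing v in the
    resolvent estimate over S.\<close>
  let ?\<delta> = "l / (4 * M)"
  have \<delta>: "0 < ?\<delta>" using l M_pos by simp
  have eig: "\<not> eigenvalue (wmeas d w) (D_symm d \<psi> w) (H_op d \<psi> w) (of_real \<mu>)" if "\<mu> \<in> {- ?\<delta><..<?\<delta>} - {0}" for \<mu>
  proof (rule no_eigenvalue)
    have "\<bar>\<mu>\<bar> < ?\<delta>" using that by (simp add: abs_less_iff)
    then show "4 * M * \<bar>\<mu>\<bar> \<le> l" using M_pos by (simp add: field_simps)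
  qed (use that in simp)
  have ac: "ac_spectrum_in (wmeas d w) E ({- ?\<delta><..<?\<delta>} - {0})"
    if "spectral_family (wmeas d w) (D_symm d \<psi> w) (H_op d \<psi> w) E" for E
  proof -
    interpret confined_resolution d \<psi> l L M S w E by unfold_locales (rule that)
    show ?thesis by (rule ac_spectrum)
  qed
  have dos: "(\<lambda>t. L2_inner (wmeas d w) (E t f) g) differentiable (at t0) \<and>
      cmod (vector_derivative (\<lambda>t. L2_inner (wmeas d w) (E t f) g) (at t0)) \<le> decay_const \<sigma> / l * Y_norm d S w \<sigma> f * Y_norm d S w \<sigma> g"
    if E: "spectral_family (wmeas d w) (D_symm d \<psi> w) (H_op d \<psi> w) E" and f: "f \<in> Y_space d S w \<sigma>" and g: "g \<in> Y_space d S w \<sigma>"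
      and t: "0 < \<bar>t0\<bar> \<and> \<bar>t0\<bar> < ?\<delta>" for E f g t0
  proof -
    interpret confined_resolution d \<psi> l L M S w E by unfold_locales (rule E)
    note fY = Y_space_Yc[OF f \<sigma>] and gY = Y_space_Yc[OF g \<sigma>]
    have "t0 \<noteq> 0" "\<bar>t0\<bar> < ?\<delta>" using t by auto
    from density_of_states[OF this \<sigma> fY(1) gY(1)] obtain D
      where D: "((\<lambda>t. ip (E t f) g) has_vector_derivative D) (at t0)" and b: "cmod D \<le> decay_const \<sigma> / l * ynrm \<sigma> f * ynrm \<sigma> g"
      by blast
    have "decay_const \<sigma> / l * ynrm \<sigma> f * ynrm \<sigma> g \<le> decay_const \<sigma> / l * Y_norm d S w \<sigma> f * Y_norm d S w \<sigma> g"
      using decay_const_nonneg[of \<sigma>] l fY(2) gY(2) L2_norm_nonneg[of N "\<lambda>p. yweight \<sigma> p * f p"]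
      by (intro mult_mono mult_nonneg_nonneg) (auto simp: L2_norm_nonneg Y_norm_def)
    with b show ?thesis using differentiableI_vector[OF D] vector_derivative_at[OF D] by simp
  qed
  show "self_adjoint (wmeas d w) (D_symm d \<psi> w) (H_op d \<psi> w) \<and>
      (\<exists>\<delta>>0.
        (\<forall>\<mu>\<in>{-\<delta><..<\<delta>} - {0}. \<not> eigenvalue (wmeas d w) (D_symm d \<psi> w) (H_op d \<psi> w) (of_real \<mu>)) \<and>
        (\<forall>E. spectral_family (wmeas d w) (D_symm d \<psi> w) (H_op d \<psi> w) E \<longrightarrow>
          ac_spectrum_in (wmeas d w) E ({-\<delta><..<\<delta>} - {0}) \<and>
          (\<forall>f\<in>Y_space d S w \<sigma>. \<forall>g\<in>Y_space d S w \<sigma>. \<forall>t0. 0 < \<bar>t0\<bar> \<and> \<bar>t0\<bar> < \<delta> \<longrightarrow>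
            (\<lambda>t. L2_inner (wmeas d w) (E t f) g) differentiable (at t0) \<and>
            cmod (vector_derivative (\<lambda>t. L2_inner (wmeas d w) (E t f) g) (at t0))
              \<le> decay_const \<sigma> / l * Y_norm d S w \<sigma> f * Y_norm d S w \<sigma> g)))"
  proof (intro conjI self_adjoint_H exI[of _ ?\<delta>])
    show "0 < ?\<delta>" by (rule \<delta>)
    show "\<forall>\<mu>\<in>{- ?\<delta><..<?\<delta>} - {0}. \<not> eigenvalue (wmeas d w) (D_symm d \<psi> w) (H_op d \<psi> w) (of_real \<mu>)"
      by (intro ballI eig)
  qed (intro allI impI conjI[OF ac] ballI dos; assumption)
qed

end
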